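(* Let $M$ be a real-analytic generic submanifold of codimension $d$ in $\mathbb{C}^N$ with $0\in M$, of finite type at $0$. Then, for every $\lambda\in\mathbb{C}$ with $0<|\lambda|<1$, there exist $2d+1$ germs at $0$ of holomorphic functions $$g^\lambda_1,\ldots,g^\lambda_{d},\ h^\lambda_1,\ldots,h^\lambda_{d+1}\colon(\mathbb{C}^N,0)\to\mathbb{C}^N,$$ depending holomorphically on $\lambda$, such that $g_j^{\lambda}(0)\to 0$ and $h_j^\lambda(0)\to 0$ as $\lambda\to 0$, and such that the following holds. Let $M'\subset\mathbb{C}^{N'}$ be a real-analytic generic submanifold of codimension $d'$ through $0$, let $\Sigma'_0$ be the Segre variety of $M'$ at $0$, and let $\tilde z\colon(\mathbb{C}^{N'},0)\to(\Sigma'_0,0)$ be a germ at $0$ of a holomorphic submersion such that $\tilde z^{-1}(0)$ is transversal to $\Sigma'_0$ at $0$. Then there exists a germ at $0$ of a holomorphic mapping $$\Phi\colon\big((\overline{\Sigma'_0}\times\Sigma'_0)^{d+1},0\big)\to(\mathbb{C}^{N'},0)$$ such that, whenever $H\colon(\mathbb{C}^N,0)\to(\mathbb{C}^{N'},0)$ is a germ at $0$ of a holomorphic mapping with $H(M)\subset M'$, one has $$H=\Phi\circ\big(\overline{\tilde z\circ H}\circ h^\lambda_1,\ \tilde z\circ H\circ g^\lambda_1,\ \ldots,\ \overline{\tilde z\circ H}\circ h^\lambda_{d},\ \tilde z\circ H\circ g^\lambda_d,\ \overline{\tilde z\circ H}\circ h^\lambda_{d+1},\ \tilde z\circ H\big)$$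 (as germs at $0\in\mathbb{C}^N$) for all sufficiently small $\lambda$ (with $\lambda\neq 0$).
   Context: A real-analytic generic submanifold $M\subset\mathbb{C}^N$ of (real) codimension $d$ through $0$ is given near $0$ by $\rho_1(Z,\bar Z)=\dots=\rho_d(Z,\bar Z)=0$, where $\rho(Z,\zeta)=(\rho_1,\ldots,\rho_d)(Z,\zeta)$ is a $\mathbb{C}^d$-valued holomorphic function near $0\in\mathbb{C}^N\times\mathbb{C}^N$ with $\rho(Z,\zeta)=\overline{\rho(\bar\zeta,\bar Z)}$ and $\partial_Z\rho_1\wedge\cdots\wedge\partial_Z\rho_d\neq0$ near $0$. $M$ is of finite type at $p\in M$ (in the sense of Kohn and Bloom–Graham) if the complex Lie algebra $\mathfrak g_M$ generated by all smooth $(1,0)$ and $(0,1)$ vector fields tangent to $M$ satisfies $\mathfrak g_M(p)=\mathbb{C}T_pM$, the complexified tangent space of $M$ at $p$. For a sufficiently small neighborhood $U$ of $0$ and $p$ close to $0$, the Segre variety of $M$ at $p$ is $\Sigma_p:=\{Z\in U:\rho(Z,\bar p)=0\}$, a complex submanifold of dimension $N-d$. $\Sigma'_p$ denotes the Segre variety of $M'$. Near $0$ only germs matter. Conjugation: for a holomorphic mapping $f$, $\bar f$ denotes the holomorphic mapping $\bar f(Z):=\overline{f(\bar Z)}$. Also $\overline{\Sigma'_0}:=\{\bar Z: Z\in\Sigma'_0\}$; thus $\overline{\tilde z\circ H}$ takes values in $\overline{\Sigma'_0}$. The inclusion $H(M)\subset M'$ is understood in the sense of germs at $0$. *)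

theory Defs
  imports "HOL-Complex_Analysis.Complex_Analysis" "HOL-Library.Function_Algebras"
begin

section \<open>Complex coordinate spaces and holomorphic germs\<close>

text \<open>
  All dimensions have to be quantified inside formulas, so the coordinate space with finite index
  set \<open>I\<close> is the set of functions vanishing off \<open>I\<close>, with the (product) topology of the function
  type; for finite \<open>I\<close> this is the usual topology. Products of spaces are formed by taking sums or
  products of index sets. Functions are total, and a germ at \<open>a\<close> is represented by any function
  with the given behaviour on \<open>cspace I\<close> near \<open>a\<close>; its values elsewhere are irrelevant.
\<close>

type_synonym 'i cpoint = "'i \<Rightarrow> complex"

definition cspace :: "'i set \<Rightarrow> 'i cpoint set" where
  "cspace I = {z. \<forall>i. i \<notin> I \<longrightarrow> z i = 0}"

abbreviation Cn :: "nat \<Rightarrow> nat cpoint set" where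
  "Cn n \<equiv> cspace {..<n}"

definition complex_differentiable :: "'i set \<Rightarrow> ('i cpoint \<Rightarrow> complex) \<Rightarrow> 'i cpoint \<Rightarrow> bool" where
  "complex_differentiable I f z \<longleftrightarrow>
     (\<exists>c. ((\<lambda>w. cmod (f w - f z - (\<Sum>i\<in>I. c i * (w i - z i))) / L2_set (\<lambda>i. cmod (w i - z i)) I)
            \<longlongrightarrow> 0) (at z within cspace I))"

definition holomorphic_germ ::
  "'i set \<Rightarrow> 'j set \<Rightarrow> ('i cpoint \<Rightarrow> 'j cpoint) \<Rightarrow> 'i cpoint \<Rightarrow> bool" where
  "holomorphic_germ I J F a \<longleftrightarrow>
     (\<forall>\<^sub>F z in nhds a. z \<in> cspace I \<longrightarrow>
        F z \<in> cspace J \<and> (\<forall>j\<in>J. complex_differentiable I (\<lambda>w. F w j) z))"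

definition partial_deriv :: "'i \<Rightarrow> ('i cpoint \<Rightarrow> complex) \<Rightarrow> 'i cpoint \<Rightarrow> complex" where
  "partial_deriv i f z = deriv (\<lambda>t. f (z(i := t))) (z i)"

definition differential ::
  "'i set \<Rightarrow> ('i cpoint \<Rightarrow> 'j cpoint) \<Rightarrow> 'i cpoint \<Rightarrow> 'i cpoint \<Rightarrow> 'j cpoint" where
  "differential I F a v = (\<lambda>j. \<Sum>i\<in>I. partial_deriv i (\<lambda>z. F z j) a * v i)"

text \<open>Tangent space at \<open>a\<close> of the level set of \<open>F\<close> through \<open>a\<close>; only used where \<open>F\<close> has constant
  rank near \<open>a\<close>, so that this level set is a complex submanifold.\<close>

definition level_tangent_space ::
  "'i set \<Rightarrow> ('i cpoint \<Rightarrow> 'j cpoint) \<Rightarrow> 'i cpoint \<Rightarrow> 'i cpoint set" where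
  "level_tangent_space I F a = {v \<in> cspace I. differential I F a v = 0}"

text \<open>Germ at \<open>a\<close> of a holomorphic map on a complex submanifold \<open>S\<close> of \<open>cspace I\<close>: one that is
  the restriction of an ambient holomorphic germ.\<close>

definition holomorphic_germ_along ::
  "'i set \<Rightarrow> 'i cpoint set \<Rightarrow> 'j set \<Rightarrow> ('i cpoint \<Rightarrow> 'j cpoint) \<Rightarrow> 'i cpoint \<Rightarrow> bool" where
  "holomorphic_germ_along I S J \<Phi> a \<longleftrightarrow>
     (\<exists>F. holomorphic_germ I J F a \<and> (\<forall>\<^sub>F w in nhds a. w \<in> S \<longrightarrow> \<Phi> w = F w))"

definition cconj :: "'i cpoint \<Rightarrow> 'i cpoint" where
  "cconj z = (\<lambda>i. cnj (z i))"

definition conj_map :: "('i cpoint \<Rightarrow> 'j cpoint) \<Rightarrow> 'i cpoint \<Rightarrow> 'j cpoint" where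
  "conj_map f = (\<lambda>z. cconj (f (cconj z)))"

text \<open>A family \<open>g \<lambda>\<close>, \<open>0 < \<bar>\<lambda>\<bar> < 1\<close>, of germs at \<open>0\<close> of holomorphic maps from \<open>Cn N\<close> to itself that
  depends holomorphically on \<open>\<lambda>\<close>: \<open>(\<lambda>, Z) \<mapsto> g \<lambda> Z\<close> is holomorphic near every point \<open>(\<lambda>, 0)\<close>. The
  coordinate \<open>\<lambda>\<close> has index \<open>None\<close>.\<close>

definition holomorphic_family :: "nat \<Rightarrow> (complex \<Rightarrow> nat cpoint \<Rightarrow> nat cpoint) \<Rightarrow> bool" where
  "holomorphic_family N g \<longleftrightarrow>
     (\<forall>lam. 0 < cmod lam \<and> cmod lam < 1 \<longrightarrow>
        holomorphic_germ (insert None (Some ` {..<N})) {..<N}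
          (\<lambda>w. g (w None) (w \<circ> Some)) (case_option lam 0))"


section \<open>Generic submanifolds and Segre varieties\<close>

definition wedge :: "nat \<Rightarrow> (nat \<Rightarrow> 'v \<Rightarrow> complex) \<Rightarrow> (nat \<Rightarrow> 'v) \<Rightarrow> complex" where
  "wedge d \<omega> v = (\<Sum>\<sigma> | \<sigma> permutes {..<d}. of_int (sign \<sigma>) * (\<Prod>k<d. \<omega> k (v (\<sigma> k))))"

text \<open>\<open>\<rho>\<close> exhibits the germ of \<open>M\<close> at \<open>0\<close> as a real-analytic generic submanifold of \<open>Cn N\<close> of
  codimension \<open>d\<close> through \<open>0\<close>.\<close>

definition generic_submanifold ::
  "nat \<Rightarrow> nat \<Rightarrow> nat cpoint set \<Rightarrow> (nat cpoint \<Rightarrow> nat cpoint \<Rightarrow> nat cpoint) \<Rightarrow> bool" where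
  "generic_submanifold N d M \<rho> \<longleftrightarrow>
     M \<subseteq> Cn N \<and> 0 \<in> M \<and>
     holomorphic_germ ({..<N} <+> {..<N}) {..<d} (\<lambda>w. \<rho> (w \<circ> Inl) (w \<circ> Inr)) 0 \<and>
     (\<forall>\<^sub>F (Z, \<zeta>) in nhds (0, 0). Z \<in> Cn N \<and> \<zeta> \<in> Cn N \<longrightarrow>
        \<rho> Z \<zeta> = cconj (\<rho> (cconj \<zeta>) (cconj Z)) \<and>
        (\<exists>v. (\<forall>l<d. v l \<in> Cn N) \<and>
             wedge d (\<lambda>k u. differential {..<N} (\<lambda>Y. \<rho> Y \<zeta>) Z u k) v \<noteq> 0)) \<and>
     (\<forall>\<^sub>F Z in nhds 0. Z \<in> Cn N \<longrightarrow> (Z \<in> M \<longleftrightarrow> \<rho> Z (cconj Z) = 0))"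

text \<open>Only the germ at \<open>0\<close> of this set is used, so the small neighbourhood in which Segre varieties
  are usually taken is omitted.\<close>

definition segre_variety ::
  "nat \<Rightarrow> (nat cpoint \<Rightarrow> nat cpoint \<Rightarrow> nat cpoint) \<Rightarrow> nat cpoint \<Rightarrow> nat cpoint set" where
  "segre_variety N \<rho> p = {Z \<in> Cn N. \<rho> Z (cconj p) = 0}"

text \<open>\<open>zt\<close> is a germ at \<open>0\<close> of a holomorphic submersion onto the Segre variety of \<open>\<rho>\<close> at \<open>0\<close> whose
  zero fibre is transversal to that variety at \<open>0\<close>.\<close>

definition transversal_submersion ::
  "nat \<Rightarrow> (nat cpoint \<Rightarrow> nat cpoint \<Rightarrow> nat cpoint) \<Rightarrow> (nat cpoint \<Rightarrow> nat cpoint) \<Rightarrow> bool" where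
  "transversal_submersion N \<rho> zt \<longleftrightarrow>
     (let TS = level_tangent_space {..<N} (\<lambda>Z. \<rho> Z (cconj 0)) 0;
          TF = level_tangent_space {..<N} zt 0
      in holomorphic_germ {..<N} {..<N} zt 0 \<and> zt 0 = 0 \<and>
         (\<forall>\<^sub>F Z in nhds 0. Z \<in> Cn N \<longrightarrow> zt Z \<in> segre_variety N \<rho> 0) \<and>
         differential {..<N} zt 0 ` Cn N = TS \<and>
         {u + v | u v. u \<in> TF \<and> v \<in> TS} = Cn N)"

text \<open>\<open>(cconj ` S \<times> S)\<^sup>m\<close> as a subset of a coordinate space: the coordinates \<open>(l, Inl j)\<close> and
  \<open>(l, Inr j)\<close> are the \<open>j\<close>-th coordinates in the \<open>l\<close>-th copy of \<open>cconj ` S\<close> and of \<open>S\<close>.\<close>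

definition tuple_index :: "nat \<Rightarrow> nat \<Rightarrow> (nat \<times> (nat + nat)) set" where
  "tuple_index m N = {1..m} \<times> ({..<N} <+> {..<N})"

definition mk_tuple ::
  "nat \<Rightarrow> (nat \<Rightarrow> nat cpoint) \<Rightarrow> (nat \<Rightarrow> nat cpoint) \<Rightarrow> (nat \<times> (nat + nat)) cpoint" where
  "mk_tuple m x y = (\<lambda>(l, s). if l \<in> {1..m} then case_sum (x l) (y l) s else 0)"

definition conj_power :: "nat \<Rightarrow> nat cpoint set \<Rightarrow> (nat \<times> (nat + nat)) cpoint set" where
  "conj_power m S = {mk_tuple m x y | x y. \<forall>l\<in>{1..m}. x l \<in> cconj ` S \<and> y l \<in> S}"


section \<open>Vector fields and finite type\<close>

text \<open>Real partial derivative in the direction \<open>e \<in> {1, \<i>}\<close> of the \<open>j\<close>-th complex coordinate.\<close>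

definition real_partial :: "nat \<Rightarrow> complex \<Rightarrow> (nat cpoint \<Rightarrow> complex) \<Rightarrow> nat cpoint \<Rightarrow> complex" where
  "real_partial j e f Z = vector_derivative (\<lambda>t. f (Z(j := Z j + of_real t * e))) (at 0)"

fun iterated_partial ::
  "(nat \<times> complex) list \<Rightarrow> (nat cpoint \<Rightarrow> complex) \<Rightarrow> nat cpoint \<Rightarrow> complex" where
  "iterated_partial [] f = f"
| "iterated_partial ((j, e) # ds) f = real_partial j e (iterated_partial ds f)"

definition smooth_germ :: "nat \<Rightarrow> (nat cpoint \<Rightarrow> complex) \<Rightarrow> nat cpoint \<Rightarrow> bool" where
  "smooth_germ N f p \<longleftrightarrow>
     (\<exists>U. open U \<and> p \<in> U \<and>
        (\<forall>ds. set ds \<subseteq> {..<N} \<times> {1, \<i>} \<longrightarrow>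
           continuous_on (U \<inter> Cn N) (iterated_partial ds f) \<and>
           (\<forall>Z\<in>U \<inter> Cn N. \<forall>j<N. \<forall>e\<in>{1, \<i>}.
              (\<lambda>t. iterated_partial ds f (Z(j := Z j + of_real t * e))) differentiable at (0::real))))"

text \<open>A complexified tangent vector of \<open>Cn N\<close> is an element \<open>v\<close> of \<open>cspace ({..<N} <+> {..<N})\<close>,
  standing for \<open>\<Sum>j<N. v (Inl j) \<partial>/\<partial>Z\<^sub>j + v (Inr j) \<partial>/\<partial>\<bar>Z\<bar>\<^sub>j\<close>. Its action on functions is given by
  the Wirtinger derivatives \<open>\<partial>/\<partial>Z = (\<partial>/\<partial>x - \<i> \<partial>/\<partial>y) / 2\<close> and
  \<open>\<partial>/\<partial>\<bar>Z\<bar> = (\<partial>/\<partial>x + \<i> \<partial>/\<partial>y) / 2\<close>.\<close>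

definition tangent_apply ::
  "nat \<Rightarrow> (nat + nat) cpoint \<Rightarrow> (nat cpoint \<Rightarrow> complex) \<Rightarrow> nat cpoint \<Rightarrow> complex" where
  "tangent_apply N v f Z =
     (\<Sum>j<N. v (Inl j) * ((real_partial j 1 f Z - \<i> * real_partial j \<i> f Z) / 2) +
             v (Inr j) * ((real_partial j 1 f Z + \<i> * real_partial j \<i> f Z) / 2))"

type_synonym vfield = "nat cpoint \<Rightarrow> (nat + nat) cpoint"

definition bracket :: "nat \<Rightarrow> vfield \<Rightarrow> vfield \<Rightarrow> vfield" where
  "bracket N X Y = (\<lambda>Z s. tangent_apply N (X Z) (\<lambda>W. Y W s) Z - tangent_apply N (Y Z) (\<lambda>W. X W s) Z)"

definition complex_tangent_space ::
  "nat \<Rightarrow> nat \<Rightarrow> (nat cpoint \<Rightarrow> nat cpoint \<Rightarrow> nat cpoint) \<Rightarrow> nat cpoint \<Rightarrow> (nat + nat) cpoint set" where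
  "complex_tangent_space N d \<rho> p =
     {v \<in> cspace ({..<N} <+> {..<N}). \<forall>k<d. tangent_apply N v (\<lambda>Z. \<rho> Z (cconj Z) k) p = 0}"

text \<open>Vector fields on \<open>M\<close> near \<open>p\<close> are represented by smooth extensions to a neighbourhood of \<open>p\<close> in
  \<open>Cn N\<close>. Such extensions exist, preserving the type, and along \<open>M\<close> the bracket of fields tangent
  to \<open>M\<close> does not depend on them.\<close>

definition smooth_tangent_field ::
  "nat \<Rightarrow> nat \<Rightarrow> nat cpoint set \<Rightarrow> (nat cpoint \<Rightarrow> nat cpoint \<Rightarrow> nat cpoint) \<Rightarrow>
   nat cpoint \<Rightarrow> vfield \<Rightarrow> bool" where
  "smooth_tangent_field N d M \<rho> p X \<longleftrightarrow>
     (\<forall>Z. X Z \<in> cspace ({..<N} <+> {..<N})) \<and>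
     (\<forall>s. smooth_germ N (\<lambda>Z. X Z s) p) \<and>
     (\<forall>\<^sub>F Z in nhds p. Z \<in> M \<longrightarrow> X Z \<in> complex_tangent_space N d \<rho> Z)"

inductive_set CR_lie_algebra ::
  "nat \<Rightarrow> nat \<Rightarrow> nat cpoint set \<Rightarrow> (nat cpoint \<Rightarrow> nat cpoint \<Rightarrow> nat cpoint) \<Rightarrow>
   nat cpoint \<Rightarrow> vfield set"
  for N d M \<rho> p where
  type10: "smooth_tangent_field N d M \<rho> p X \<Longrightarrow> (\<And>Z j. X Z (Inr j) = 0) \<Longrightarrow>
             X \<in> CR_lie_algebra N d M \<rho> p"
| type01: "smooth_tangent_field N d M \<rho> p X \<Longrightarrow> (\<And>Z j. X Z (Inl j) = 0) \<Longrightarrow>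
             X \<in> CR_lie_algebra N d M \<rho> p"
| add: "X \<in> CR_lie_algebra N d M \<rho> p \<Longrightarrow> Y \<in> CR_lie_algebra N d M \<rho> p \<Longrightarrow>
          (\<lambda>Z s. X Z s + Y Z s) \<in> CR_lie_algebra N d M \<rho> p"
| scale: "X \<in> CR_lie_algebra N d M \<rho> p \<Longrightarrow> (\<lambda>Z s. c * X Z s) \<in> CR_lie_algebra N d M \<rho> p"
| bracket: "X \<in> CR_lie_algebra N d M \<rho> p \<Longrightarrow> Y \<in> CR_lie_algebra N d M \<rho> p \<Longrightarrow>
          bracket N X Y \<in> CR_lie_algebra N d M \<rho> p"

definition finite_type ::
  "nat \<Rightarrow> nat \<Rightarrow> nat cpoint set \<Rightarrow> (nat cpoint \<Rightarrow> nat cpoint \<Rightarrow> nat cpoint) \<Rightarrow> nat cpoint \<Rightarrow> bool" where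
  "finite_type N d M \<rho> p \<longleftrightarrow> (\<lambda>X. X p) ` CR_lie_algebra N d M \<rho> p = complex_tangent_space N d \<rho> p"

end

theory Submission
 imports Defs "Jordan_Normal_Form.Determinant"
begin

text \<open>
Write \<open>x = (Z, \<zeta>)\<close> for points of \<open>\<complex>\<^sup>N \<times> \<complex>\<^sup>N\<close>. The complexification of \<open>M\<close> is the level set
\<open>\<rho> Z \<zeta> = 0\<close>, and \<open>M\<close> sits in it as the points \<open>cc Z\<close> with \<open>\<zeta> = cconj Z\<close>. Two facts drive the proof.

The first concerns the target. If \<open>H\<close> maps \<open>M\<close> into \<open>M'\<close>, then \<open>\<rho>' (H Z) (conj_map H \<zeta>)\<close> vanishes on \<open>M\<close>,
and hence on the complexification: \<open>M\<close> is a set of uniqueness there, because every derivative of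
a function vanishing on \<open>M\<close> along the complexification vanishes on \<open>M\<close> again
(\<open>vanishing_on_complexification\<close>, \<open>complexified_inclusion\<close>). Transversality says that a point \<open>Z'\<close> near \<open>0\<close> with
\<open>\<rho>' Z' \<zeta>' = 0\<close> is determined by \<open>zt Z'\<close> and \<open>\<zeta>'\<close>, through a holomorphic function \<open>Y\<close>
(\<open>target_recovery\<close>); by the reality of \<open>\<rho>'\<close>, likewise \<open>\<zeta>'\<close> is determined by its projection and
\<open>Z'\<close>. Consequently, if \<open>p\<^sub>0 = 0, p\<^sub>1, \<dots>, p\<^sub>2\<^sub>d\<^sub>+\<^sub>2\<close> are points of the complexification of \<open>M\<close> such that
\<open>p\<^sub>2\<^sub>j\<^sub>+\<^sub>1\<close> has the \<open>Z\<close>-part of \<open>p\<^sub>2\<^sub>j\<close> and \<open>p\<^sub>2\<^sub>j\<^sub>+\<^sub>2\<close> has the \<open>\<zeta>\<close>-part of \<open>p\<^sub>2\<^sub>j\<^sub>+\<^sub>1\<close>, then the values of \<open>H\<close> and of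
its conjugate can be recovered one after the other from the projections (\<open>segre_rec\<close>), starting from
\<open>H 0 = 0\<close>. This recursion is \<open>\<Phi>\<close>, and it does not mention \<open>H\<close>.

The second concerns the source: such chains, ending at a point with prescribed \<open>Z\<close>-part, must
exist and depend holomorphically on \<open>(\<lambda>, Z)\<close> (\<open>segre_chains\<close>). The steps of a chain are given by
the Segre flows \<open>mvE\<close> and \<open>mvO\<close>, each an action of the additive group. Their velocities \<open>LE i\<close> and \<open>LO i\<close> are
holomorphic, and on \<open>M\<close> they span the \<open>(1,0)\<close> and the \<open>(0,1)\<close> tangent vectors. A smooth module argument
shows that the holomorphic Lie algebra \<open>LL\<close> which they generate spans, at \<open>0\<close>, the same space as the
smooth CR fields, that is, the whole complex tangent space (\<open>finite_type_span\<close>). If the maximal rank of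
the end point map does not increase from one step to the next, then at points of maximal rank the
image of its derivative contains all of \<open>LL\<close> (\<open>rank_growth\<close>, resting on \<open>bracket_in_dimage\<close>). Two steps already have corank at
most \<open>d\<close>, so after \<open>d + 2\<close> steps the rank is full near \<open>0\<close>, at some parameter \<open>t\<close>.

Running the chain with parameter \<open>t\<close> forward and back again returns to \<open>0\<close>, and the end point map of the closed chain of
\<open>2d + 3\<close> steps still has full rank (\<open>closing_rank\<close>); its last step does not move \<open>Z\<close>, so \<open>2d + 2\<close>
steps suffice. Scaling \<open>t\<close> by a complex number \<open>\<mu>\<close> keeps the chain closed. The determinant
controlling solvability is holomorphic in \<open>\<mu>\<close> and equals \<open>1\<close> at \<open>\<mu> = 1\<close>, so it has no zeros in a punctured disc about
\<open>0\<close>. There the implicit function theorem gives chains ending over \<open>Z\<close>, and as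
\<open>\<mu> \<rightarrow> 0\<close> the chains over \<open>Z = 0\<close> shrink to the constant chain.
\<close>

abbreviation (input) pd :: "'i => ('i cpoint => complex) => 'i cpoint => complex" where
 "pd == partial_deriv"

section \<open>Polydiscs\<close>

definition pbox :: "'i set => 'i cpoint => real => 'i cpoint set" where
 "pbox I a r = {z. \<forall>i\<in>I. cmod (z i - a i) < r}"

definition pdisc :: "'i set => 'i cpoint => real => 'i cpoint set" where
 "pdisc I a r = pbox I a r \<inter> cspace I"

definition n1 :: "'i set => 'i cpoint => real" where
 "n1 I h = (\<Sum>i\<in>I. cmod (h i))"

lemma pdisc_iff: "z \<in> pdisc I a r \<longleftrightarrow> z \<in> cspace I & (\<forall>i\<in>I. cmod (z i - a i) < r)"
 by (auto simp: pdisc_def pbox_def)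

lemma open_pbox: assumes "finite I" shows "open (pbox I a r)"
proof -
 have "pbox I a r = (\<Inter>i\<in>I. (%z. z i) -` ball (a i) r)"
  by (auto simp: pbox_def dist_norm norm_minus_commute)
 moreover have "open ((%z::'a cpoint. z i) -` ball (a i) r)" for i
  by (intro open_vimage open_ball continuous_on_product_coordinates)
 ultimately show ?thesis using assms by (auto intro!: open_INT)
qed

lemma pdisc_mono: "r \<le> s ==> pdisc I a r \<subseteq> pdisc I a s"
 by (force simp: pdisc_iff)

lemma pbox_self[simp]: "0 < r ==> a \<in> pbox I a r" by (simp add: pbox_def)

lemma cspace_0[simp]: "0 \<in> cspace I" by (simp add: cspace_def)

lemma cspace_upd: "z \<in> cspace I ==> i \<in> I ==> z(i:=t) \<in> cspace I"
 by (auto simp: cspace_def)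

lemma open_pdisc_subset:
 assumes "finite I" "open V" "a \<in> V" "a \<in> cspace I"
 shows "\<exists>r>0. pdisc I a r \<subseteq> V"
proof -
 obtain X where X: "a \<in> PiE UNIV X" "\<forall>i. open (X i)" "PiE UNIV X \<subseteq> V"
  using product_topology_open_contains_basis[of "%_. euclidean" UNIV V a] assms
  unfolding open_fun_def by auto
 have "\<exists>r>0. ball (a i) r \<subseteq> X i" for i
  using X(1,2) by (meson PiE_E UNIV_I open_contains_ball)
 then obtain r where r: "\<And>i. r i > 0" "\<And>i. ball (a i) (r i) \<subseteq> X i" by metis
 define s where "s = Min (insert 1 (r ` I))"
 have s: "s > 0" "\<And>i. i \<in> I ==> s \<le> r i" using assms(1) r(1) by (auto simp: s_def)
 have "pdisc I a s \<subseteq> V"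
 proof
  fix z assume z: "z \<in> pdisc I a s"
  have "z i \<in> X i" for i
  proof (cases "i \<in> I")
   case True
   then have "z i \<in> ball (a i) (r i)" using z s(2)[OF True]
    by (force simp: pdisc_iff dist_norm norm_minus_commute)
   then show ?thesis using r by blast
  next
   case False
   then have "z i = a i" using z assms(4) by (simp add: pdisc_iff cspace_def)
   then show ?thesis using X(1) by auto
  qed
  then show "z \<in> V" using X(3) by auto
 qed
 then show ?thesis using s by blast
qed

lemma eventually_nhds_pdisc:
 assumes "finite I" "a \<in> cspace I"
 shows "(\<forall>\<^sub>F z in nhds a. z \<in> cspace I --> P z) \<longleftrightarrow> (\<exists>r>0. \<forall>z\<in>pdisc I a r. P z)"
proof
 assume "\<forall>\<^sub>F z in nhds a. z \<in> cspace I --> P z"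
 then obtain V where "open V" "a \<in> V" "\<forall>z\<in>V. z \<in> cspace I --> P z" by (auto simp: eventually_nhds)
 with open_pdisc_subset[OF assms(1) _ _ assms(2)] show "\<exists>r>0. \<forall>z\<in>pdisc I a r. P z"
  by (metis Int_iff pdisc_def subsetD)
next
 assume "\<exists>r>0. \<forall>z\<in>pdisc I a r. P z"
 then obtain r where r: "r>0" "\<forall>z\<in>pdisc I a r. P z" by blast
 then show "\<forall>\<^sub>F z in nhds a. z \<in> cspace I --> P z"
  unfolding eventually_nhds
  by (intro exI[of _ "pbox I a r"]) (auto simp: open_pbox assms(1) pdisc_def)
qed

section \<open>Bounded separately holomorphic functions\<close>

text \<open>
Separate holomorphy together with a bound on a polydisc is all that is needed for Cauchy
estimates in one variable at a time; the several-variable facts below are obtained by changing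
coordinates one after the other.
\<close>

definition sepb :: "'i set => 'i cpoint => real => ('i cpoint => complex) => real => bool" where
 "sepb I a r f M \<longleftrightarrow> (\<forall>z\<in>pdisc I a r. cmod (f z) \<le> M &
   (\<forall>i\<in>I. (%t. f (z(i:=t))) field_differentiable at (z i)))"

lemma cauchy_estimates:
 assumes f: "\<And>t. t \<in> ball a r ==> f field_differentiable at t"
  and M: "\<And>t. t \<in> ball a r ==> cmod (f t) \<le> M" and t: "t \<in> ball a (r/2)"
 shows "cmod (deriv f t) \<le> 4*M/r" "cmod (deriv (deriv f) t) \<le> 32*M/r^2"
proof -
 have r: "r > 0" using t by (metis ball_eq_empty empty_iff half_gt_zero_iff not_less)
 have sub: "cball t (r/4) \<subseteq> ball a r" using t r by (auto simp: subset_iff dist_norm)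
   (smt (verit) dist_norm dist_triangle field_sum_of_halves)
 have hol: "f holomorphic_on ball a r"
  using f by (meson field_differentiable_at_within holomorphic_on_def)
 have h: "f holomorphic_on ball t (r/4)" "continuous_on (cball t (r/4)) f"
  using hol sub ball_subset_cball holomorphic_on_subset holomorphic_on_imp_continuous_on
  by (blast, metis hol holomorphic_on_subset holomorphic_on_imp_continuous_on sub)
 have b: "cmod (f x) \<le> M" if "norm (t - x) = r/4" for x
  using sub that M by (auto simp: subset_iff dist_norm)
 have "cmod ((deriv ^^ n) f t) \<le> fact n * M / (r/4)^n" for n
  using Cauchy_inequality[OF h _ b] r by auto
 from this[of 1] this[of 2] show "cmod (deriv f t) \<le> 4*M/r" "cmod (deriv (deriv f) t) \<le> 32*M/r^2"
  by (auto simp: numeral_2_eq_2 field_simps)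
qed

lemma one_var_estimates:
 assumes f: "\<And>t. t \<in> ball a r ==> f field_differentiable at t"
  and M: "\<And>t. t \<in> ball a r ==> cmod (f t) \<le> M" and t: "t \<in> ball a (r/2)" "s \<in> ball a (r/2)"
 shows "cmod (f s - f t) \<le> 4*M/r * cmod (s - t)"
  "cmod (f s - f t - deriv f t * (s - t)) \<le> 32*M/r^2 * (cmod (s - t))^2"
proof -
 have r: "r > 0" using t by (metis ball_eq_empty empty_iff half_gt_zero_iff not_less)
 have sub: "ball a (r/2) \<subseteq> ball a r" using r by auto
 have hol: "f holomorphic_on ball a r"
  using f by (meson field_differentiable_at_within holomorphic_on_def)
 have d0: "(f has_field_derivative deriv f x) (at x within ball a (r/2))" if "x \<in> ball a (r/2)" for x
  using f sub that DERIV_deriv_iff_field_differentiable has_field_derivative_at_within by blast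
 have d1: "(deriv f has_field_derivative deriv (deriv f) x) (at x within ball a (r/2))" if "x \<in> ball a (r/2)" for x
  using holomorphic_derivI[OF holomorphic_deriv[OF hol open_ball] open_ball] sub that by blast
 show "cmod (f s - f t) \<le> 4*M/r * cmod (s - t)"
  by (rule field_differentiable_bound[OF convex_ball d0 _ t(2,1)])
    (use cauchy_estimates(1)[OF f M] in auto)
 have "cmod ((%n. (deriv^^n) f) 0 s - (\<Sum>i\<le>1. (%n. (deriv^^n) f) i t * (s-t)^i / fact i)) 
   \<le> 32*M/r^2 * cmod (s-t)^(Suc 1) / fact 1"
  apply (rule complex_Taylor[OF convex_ball _ _ t(1,2)])
  subgoal for i x using d0[of x] d1[of x] by (cases i) auto
  subgoal for x using cauchy_estimates(2)[of a r f M x] f M by auto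
  done
 then show "cmod (f s - f t - deriv f t * (s - t)) \<le> 32*M/r^2 * (cmod (s - t))^2"
  by (simp add: power2_eq_square algebra_simps)
qed

lemma sepb_line:
 assumes "sepb I a r f M" "z \<in> pdisc I a r" "i \<in> I" "t \<in> ball (a i) r"
 shows "(%t. f (z(i:=t))) field_differentiable at t" "cmod (f (z(i:=t))) \<le> M"
proof -
 have "z(i:=t) \<in> pdisc I a r" using assms by (auto simp: pdisc_iff cspace_upd dist_norm norm_minus_commute)
 then show "(%t. f (z(i:=t))) field_differentiable at t" "cmod (f (z(i:=t))) \<le> M"
  using assms unfolding sepb_def by force+
qed

lemma pdisc_ball: "z \<in> pdisc I a r ==> i \<in> I ==> z i \<in> ball (a i) r"
 by (simp add: pdisc_iff dist_norm norm_minus_commute)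

lemma half_pdisc: assumes "z \<in> pdisc I a (r/2)" "i\<in>I" shows "z \<in> pdisc I a r" "r > 0"
proof -
 show "r > 0" using assms by (auto simp: pdisc_iff) (smt (verit) norm_ge_zero half_gt_zero_iff)
 then show "z \<in> pdisc I a r" using pdisc_mono[of "r/2" r I a] assms by auto
qed

lemma sepb_step:
 assumes "sepb I a r f M" "z \<in> pdisc I a (r/2)" "i \<in> I" "t \<in> ball (a i) (r/2)"
 shows "cmod (f (z(i:=t)) - f z) \<le> 4*M/r * cmod (t - z i)"
  "cmod (f (z(i:=t)) - f z - pd i f z * (t - z i)) \<le> 32*M/r^2 * (cmod (t - z i))^2"
  "cmod (pd i f z) \<le> 4*M/r"
proof -
 have z: "z \<in> pdisc I a r" "r > 0" using half_pdisc[OF assms(2,3)] by auto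
 have zi: "z i \<in> ball (a i) (r/2)" using pdisc_ball assms by metis
 note o = one_var_estimates[OF sepb_line[OF assms(1) z(1) assms(3)] zi assms(4), simplified]
 show "cmod (f (z(i:=t)) - f z) \<le> 4*M/r * cmod (t - z i)"
  "cmod (f (z(i:=t)) - f z - pd i f z * (t - z i)) \<le> 32*M/r^2 * (cmod (t - z i))^2"
  using o by (auto simp: partial_deriv_def)
 show "cmod (pd i f z) \<le> 4*M/r"
  using cauchy_estimates(1)[OF sepb_line[OF assms(1) z(1) assms(3)] zi]
  by (simp add: partial_deriv_def)
qed

lemma sepb_nonneg: "sepb I a r f M ==> z \<in> pdisc I a r ==> 0 \<le> M"
 unfolding sepb_def by (meson norm_ge_zero order_trans)

lemma sepb_lipschitz_aux:
 assumes s: "sepb I a r f M" and I: "finite I" and S: "finite S" "S \<subseteq> I"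
  and zw: "z \<in> pdisc I a (r/2)" "w \<in> pdisc I a (r/2)" "\<forall>i. i \<notin> S --> w i = z i"
 shows "cmod (f w - f z) \<le> 4*M/r * n1 S (w - z)"
 using S zw(2,3)
proof (induction S arbitrary: w rule: finite_induct)
 case empty
 then have "w = z" by auto
 then show ?case by (simp add: n1_def)
next
 case (insert i S)
 have i: "i \<in> I" using insert by auto
 let ?w = "w(i := z i)"
 have w: "?w \<in> pdisc I a (r/2)" using insert.prems zw(1) i by (auto simp: pdisc_iff cspace_upd)
 have eq: "n1 S (?w - z) = n1 S (w - z)" unfolding n1_def using insert.hyps by (intro sum.cong) auto
 have wz: "\<forall>j. j \<notin> S --> ?w j = z j" using insert.prems by auto
 have 1: "cmod (f ?w - f z) \<le> 4*M/r * n1 S (w - z)"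
  using insert.IH[OF _ w wz] insert.prems unfolding eq by blast
 have 2: "cmod (f w - f ?w) \<le> 4*M/r * cmod (w i - z i)"
  using sepb_step(1)[OF s w i, of "w i"] pdisc_ball[OF insert.prems(2) i] by simp
 have "cmod (f w - f z) \<le> 4*M/r * n1 S (w - z) + 4*M/r * cmod (w i - z i)"
  using 1 2 norm_triangle_ineq[of "f w - f ?w" "f ?w - f z"] by simp
 then show ?case using insert.hyps by (simp add: n1_def algebra_simps)
qed

lemma sepb_lipschitz:
 assumes "sepb I a r f M" "finite I" "z \<in> pdisc I a (r/2)" "w \<in> pdisc I a (r/2)"
 shows "cmod (f w - f z) \<le> 4*M/r * n1 I (w - z)"
 by (rule sepb_lipschitz_aux[OF assms(1,2,2) subset_refl assms(3,4)])
   (use assms in \<open>auto simp: pdisc_iff cspace_def\<close>)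

text \<open>
Difference quotients in the direction \<open>i\<close> converge locally uniformly, with an error controlled by the
bound, so by the Weierstrass theorem in the variable \<open>k\<close> the limit is holomorphic in that variable and its derivative is
the limit of the derivatives.
\<close>

lemma sepb_partial_ex:
 assumes s: "sepb I a r f M" and i: "i \<in> I" and k: "k \<in> I" "k \<noteq> i" and z: "z \<in> pdisc I a (r/2)"
 shows "\<exists>D. ((%t. pd i f (z(k:=t))) has_field_derivative D) (at (z k)) &
   ((%n. (pd k f (z(i := z i + of_real (inverse (real (Suc n))))) - pd k f z) / of_real (inverse (real (Suc n)))) \<longlonglongrightarrow> D)"
proof -
 have zr: "z \<in> pdisc I a r" "r > 0" using half_pdisc[OF z i] by auto
 define h where "h n = inverse (real (Suc n))" for n
 have hpos: "h n > 0" for n by (simp add: h_def)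
 have hlim: "h \<longlonglongrightarrow> 0" unfolding h_def by (rule LIMSEQ_inverse_real_of_nat)
 obtain e where e: "e > 0" "cball (z k) e \<subseteq> ball (a k) (r/2)"
  using pdisc_ball[OF z k(1)] by (metis open_ball open_contains_cball)
 obtain e' where e': "e' > 0" "ball (z i) e' \<subseteq> ball (a i) (r/2)"
  using pdisc_ball[OF z i] by (metis open_ball open_contains_ball)
 define g where "g n t = (f (z(k:=t, i := z i + of_real (h n))) - f (z(k:=t))) / of_real (h n)" for n t
 define g' where "g' n t = (pd k f (z(k:=t, i := z i + of_real (h n))) - pd k f (z(k:=t))) / of_real (h n)" for n t
 have small: "\<forall>\<^sub>F n in sequentially. h n < e'" using order_tendstoD(2)[OF hlim e'(1)] .
 have in1: "z(k:=t) \<in> pdisc I a (r/2)" if "t \<in> cball (z k) e" for t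
  using z that e k by (auto simp: pdisc_iff cspace_upd dist_norm norm_minus_commute subset_iff)
 have hin: "z i + of_real (h n) \<in> ball (a i) (r/2)" if "h n < e'" for n
  using e' that hpos[of n] by (auto simp: subset_iff dist_norm)
 have in2: "z(k:=t, i := z i + of_real (h n)) \<in> pdisc I a (r/2)" if "t \<in> cball (z k) e" "h n < e'" for n t
  using in1[OF that(1)] hin[OF that(2)] i by (auto simp: pdisc_iff cspace_upd dist_norm norm_minus_commute)
 have der: "((%t. f (y(k:=t))) has_field_derivative pd k f (y(k:=t))) (at t)"
  if "y(k:=t) \<in> pdisc I a (r/2)" for y t
 proof -
  have "(%t. f ((y(k:=t))(k:=t))) field_differentiable at t"
   using sepb_line(1)[OF s half_pdisc(1)[OF that k(1)] k(1), of t] pdisc_ball[OF half_pdisc(1)[OF that k(1)] k(1)] by auto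
  then show ?thesis by (simp add: partial_deriv_def DERIV_deriv_iff_field_differentiable)
 qed
 have dg: "(g n has_field_derivative g' n t) (at t)" if "t \<in> cball (z k) e" "h n < e'" for n t
 proof -
  have c: "z(k := t, i := u) = z(i := u, k := t)" for t u using k by (simp add: fun_upd_twist)
  show ?thesis unfolding g_def g'_def c
   by (rule derivative_eq_intros der refl | use in1[OF that(1)] in2[OF that] hpos[of n] in \<open>force simp: c\<close>)+
 qed
 have "\<forall>\<^sub>F n in sequentially. continuous_on (cball (z k) e) (g n) & (\<forall>w \<in> ball (z k) e. (g n has_field_derivative g' n w) (at w))"
  using small
 proof eventually_elim
  case (elim n)
  have "continuous_on (cball (z k) e) (g n)"
   by (rule DERIV_continuous_on[of _ _ "g' n"]) (use dg elim has_field_derivative_at_within in blast)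
  with dg elim show ?case by auto
 qed
 moreover have "uniform_limit (cball (z k) e) g (%t. pd i f (z(k:=t))) sequentially"
 proof (rule uniform_limitI)
  fix ep :: real assume "ep > 0"
  have "(%n. 32*M/r^2 * h n) \<longlonglongrightarrow> 0" using tendsto_mult_right_zero[OF hlim] .
  from order_tendstoD(2)[OF this \<open>ep > 0\<close>] small
  show "\<forall>\<^sub>F n in sequentially. \<forall>t\<in>cball (z k) e. dist (g n t) (pd i f (z(k:=t))) < ep"
  proof eventually_elim
   case (elim n)
   show ?case
   proof
    fix t assume t: "t \<in> cball (z k) e"
    let ?y = "z(k:=t)" and ?h = "complex_of_real (h n)"
    have y: "?y i = z i" using k by simp
    have "cmod (f (?y(i:=z i + ?h)) - f ?y - pd i f ?y * ?h) \<le> 32*M/r^2 * (h n)^2"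
     using sepb_step(2)[OF s in1[OF t] i, of "z i + ?h"] hin[OF elim(2)] k by simp
    then have b: "cmod (f (?y(i:=z i + ?h)) - f ?y - pd i f ?y * ?h) / h n \<le> 32*M/r^2 * (h n)^2 / h n"
     by (rule divide_right_mono) (use hpos[of n] in simp)
    have "g n t - pd i f ?y = (f (?y(i:=z i + ?h)) - f ?y - pd i f ?y * ?h) / ?h"
     using hpos[of n] by (simp add: g_def field_simps)
    then have "dist (g n t) (pd i f ?y) = cmod (f (?y(i:=z i + ?h)) - f ?y - pd i f ?y * ?h) / h n"
     using hpos[of n] by (simp only: dist_norm norm_divide) simp
    with b have "dist (g n t) (pd i f ?y) \<le> 32*M/r^2 * (h n)^2 / h n" by simp
    then show "dist (g n t) (pd i f ?y) < ep" using elim(1) hpos[of n]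
     by (simp add: power2_eq_square)
   qed
  qed
 qed
 ultimately obtain G where "\<And>w. w \<in> ball (z k) e ==>
   ((%t. pd i f (z(k:=t))) has_field_derivative G w) (at w) & (%n. g' n w) \<longlonglongrightarrow> G w"
  using has_complex_derivative_uniform_limit[of "z k" e g g' sequentially "%t. pd i f (z(k:=t))"]
   e(1) by force
 from this[of "z k"] show ?thesis using e(1) by (auto simp: g'_def h_def)
qed

lemma sepb_partial:
 assumes s: "sepb I a r f M" and i: "i \<in> I"
 shows "sepb I a (r/2) (pd i f) (4*M/r)"
 unfolding sepb_def
proof (intro ballI conjI)
 fix z assume z: "z \<in> pdisc I a (r/2)"
 then show "cmod (pd i f z) \<le> 4*M/r" using sepb_step(3)[OF s z i pdisc_ball[OF z i]] by simp
 fix k assume k: "k \<in> I"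
 show "(%t. pd i f (z(k:=t))) field_differentiable at (z k)"
 proof (cases "k = i")
  case True
  have zr: "z \<in> pdisc I a r" "r > 0" using half_pdisc[OF z i] by auto
  have "(%t. f (z(i:=t))) holomorphic_on ball (a i) r"
   using sepb_line(1)[OF s zr(1) i] by (meson field_differentiable_at_within holomorphic_on_def)
  then have "deriv (%t. f (z(i:=t))) holomorphic_on ball (a i) r" by (simp add: holomorphic_deriv)
  then have "deriv (%t. f (z(i:=t))) field_differentiable at (z i)"
   using holomorphic_on_imp_differentiable_at[OF _ open_ball pdisc_ball[OF zr(1) i]] by blast
  moreover have "(%t. pd i f (z(i:=t))) = deriv (%t. f (z(i:=t)))"
   by (simp add: partial_deriv_def fun_eq_iff)
  ultimately show ?thesis using True by simp
 next
  case False
  then show ?thesis using sepb_partial_ex[OF s i k False z] unfolding field_differentiable_def by blast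
 qed
qed

lemma sepb_partial_commute:
 assumes s: "sepb I a r f M" and i: "i \<in> I" and k: "k \<in> I" and z: "z \<in> pdisc I a (r/2)"
 shows "pd k (pd i f) z = pd i (pd k f) z"
proof (cases "k = i")
 case False
 obtain D where D: "((%t. pd i f (z(k:=t))) has_field_derivative D) (at (z k))"
   "(%n. (pd k f (z(i := z i + of_real (inverse (real (Suc n))))) - pd k f z) / of_real (inverse (real (Suc n)))) \<longlonglongrightarrow> D"
  using sepb_partial_ex[OF s i k False z] by blast
 have "(%t. pd k f (z(i:=t))) field_differentiable at (z i)"
  using sepb_partial[OF s k] z i unfolding sepb_def by blast
 then have "((%t. pd k f (z(i:=t))) has_field_derivative pd i (pd k f) z) (at (z i))"
  by (simp add: partial_deriv_def DERIV_deriv_iff_field_differentiable)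
 then have "(%h. (pd k f (z(i:=z i + h)) - pd k f z) / h) \<midarrow>0\<rightarrow> pd i (pd k f) z"
  by (simp add: DERIV_def)
 moreover have "filterlim (%n. complex_of_real (inverse (real (Suc n)))) (at 0) sequentially"
  unfolding filterlim_at using tendsto_of_real[OF LIMSEQ_inverse_real_of_nat, where 'a=complex]
  by (simp del: of_nat_Suc of_real_inverse)
 ultimately have "(%n. (pd k f (z(i := z i + of_real (inverse (real (Suc n))))) - pd k f z) / of_real (inverse (real (Suc n)))) \<longlonglongrightarrow> pd i (pd k f) z"
  by (rule filterlim_compose)
 then have "D = pd i (pd k f) z" using D(2) LIMSEQ_unique by blast
 then show ?thesis using D(1) by (simp add: partial_deriv_def[of k] DERIV_imp_deriv)
qed simp

lemma sepb_expansion_aux: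
 assumes s: "sepb I a r f M" and I: "finite I" and S: "finite S" "S \<subseteq> I"
  and zw: "z \<in> pdisc I a (r/4)" "w \<in> pdisc I a (r/4)" "\<forall>i. i \<notin> S --> w i = z i"
 shows "cmod (f w - f z - (\<Sum>i\<in>S. pd i f z * (w i - z i))) \<le> 32*M/r^2 * (n1 S (w - z))^2"
 using S zw(2,3)
proof (induction S arbitrary: w rule: finite_induct)
 case empty
 then have "w = z" by auto
 then show ?case by (simp add: n1_def)
next
 case (insert i S)
 have i: "i \<in> I" using insert by auto
 let ?w = "w(i := z i)" and ?x = "cmod (w i - z i)" and ?n = "n1 S (w - z)"
 have r: "r > 0" using half_pdisc[of z I a "r/2" i] zw(1) i by simp
 have quar: "x \<in> pdisc I a (r/4) ==> x \<in> pdisc I a (r/2)" for x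
  using pdisc_mono[of "r/4" "r/2" I a] r by auto
 have w: "?w \<in> pdisc I a (r/4)" using insert.prems zw(1) i by (auto simp: pdisc_iff cspace_upd)
 have M0: "0 \<le> M" using sepb_nonneg[OF s half_pdisc(1)[OF quar[OF zw(1)] i]] .
 have eq: "n1 S (?w - z) = ?n" unfolding n1_def using insert.hyps by (intro sum.cong) auto
 have eq1: "n1 I (?w - z) = ?n"
  unfolding n1_def using insert by (intro sum.mono_neutral_cong_right I) auto
 have eq2: "(\<Sum>k\<in>S. pd k f z * (?w k - z k)) = (\<Sum>k\<in>S. pd k f z * (w k - z k))"
  using insert.hyps by (intro sum.cong) auto
 have wz: "\<forall>j. j \<notin> S --> ?w j = z j" using insert.prems by auto
 have 1: "cmod (f ?w - f z - (\<Sum>k\<in>S. pd k f z * (w k - z k))) \<le> 32*M/r^2 * ?n^2"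
  using insert.IH[OF _ w wz] insert.prems unfolding eq eq2 by blast
 have 2: "cmod (f w - f ?w - pd i f ?w * (w i - z i)) \<le> 32*M/r^2 * ?x^2"
  using sepb_step(2)[OF s quar[OF w] i, of "w i"] pdisc_ball[OF quar[OF insert.prems(2)] i] by simp
 have "cmod (pd i f ?w - pd i f z) \<le> 4*(4*M/r)/(r/2) * ?n"
  using sepb_lipschitz[OF sepb_partial[OF s i] I, of z ?w] zw(1) w eq1 by simp
 also have "\<dots> = 32*M/r^2 * ?n" by (simp add: power2_eq_square)
 finally have 3: "cmod (pd i f ?w * (w i - z i) - pd i f z * (w i - z i)) \<le> 32*M/r^2 * ?n * ?x"
  by (metis left_diff_distrib mult_right_mono norm_ge_zero norm_mult)
 have "f w - f z - (\<Sum>k\<in>insert i S. pd k f z * (w k - z k)) =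
   (f ?w - f z - (\<Sum>k\<in>S. pd k f z * (w k - z k))) +
   (f w - f ?w - pd i f ?w * (w i - z i)) +
   (pd i f ?w * (w i - z i) - pd i f z * (w i - z i))"
  using insert.hyps by simp
 then have "cmod (f w - f z - (\<Sum>k\<in>insert i S. pd k f z * (w k - z k))) 
   \<le> 32*M/r^2 * ?n^2 + 32*M/r^2 * ?x^2 + 32*M/r^2 * ?n * ?x"
  using 1 2 3 by (smt (verit) norm_triangle_ineq)
 also have "\<dots> = 32*M/r^2 * (?n^2 + ?x^2 + ?n*?x)" by (simp add: algebra_simps)
 also have "\<dots> \<le> 32*M/r^2 * (?x + ?n)^2"
  using M0 by (intro mult_left_mono) (auto simp: power2_sum n1_def sum_nonneg)
 also have "?x + ?n = n1 (insert i S) (w - z)" using insert.hyps by (simp add: n1_def)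
 finally show ?case .
qed

lemma sepb_expansion:
 assumes "sepb I a r f M" "finite I" "z \<in> pdisc I a (r/4)" "w \<in> pdisc I a (r/4)"
 shows "cmod (f w - f z - (\<Sum>i\<in>I. pd i f z * (w i - z i))) \<le> 32*M/r^2 * (n1 I (w - z))^2"
 by (rule sepb_expansion_aux[OF assms(1,2,2) subset_refl assms(3,4)])
   (use assms in \<open>auto simp: pdisc_iff cspace_def\<close>)

section \<open>Holomorphic functions of several variables\<close>

text \<open>
Holomorphy in the sense of Osgood: continuity and holomorphy in each variable. This form makes composition with
limits easy, and \<open>complex_differentiable_imp_holo\<close> relates it to differentiability in the sense of Frechet.
\<close>

definition holo :: "'i set => 'i cpoint set => ('i cpoint => complex) => bool" where
 "holo I V f \<longleftrightarrow> continuous_on (V \<inter> cspace I) f &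
   (\<forall>z\<in>V \<inter> cspace I. \<forall>i\<in>I. (%t. f (z(i:=t))) field_differentiable at (z i))"

lemma continuous_upd: "continuous_on UNIV (%t. (z::'i cpoint)(i:=t))"
proof (rule continuous_on_coordinatewise_then_product)
 fix j show "continuous_on UNIV (%t. (z(i:=t)) j)" by (cases "j = i") (auto intro!: continuous_intros)
qed

lemma eventually_upd:
 assumes "open V" "(z::'i cpoint) \<in> V" shows "\<forall>\<^sub>F t in nhds (z i). z(i:=t) \<in> V"
proof -
 have "open ((%t. z(i:=t)) -` V)" by (rule open_vimage[OF assms(1) continuous_upd])
 moreover have "z i \<in> (%t. z(i:=t)) -` V" using assms by simp
 ultimately have "\<forall>\<^sub>F t in nhds (z i). t \<in> (%t. z(i:=t)) -` V" by (rule eventually_nhds_in_open)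
 then show ?thesis by simp
qed

lemma holo_cong:
 assumes V: "open V" and eq: "\<And>z. z \<in> V ==> z \<in> cspace I ==> f z = g z" and f: "holo I V f"
 shows "holo I V g"
 unfolding holo_def
proof (intro conjI ballI)
 show "continuous_on (V \<inter> cspace I) g"
  using f eq continuous_on_cong[of "V \<inter> cspace I" "V \<inter> cspace I" f g] by (auto simp: holo_def)
 fix z i assume z: "z \<in> V \<inter> cspace I" and i: "i \<in> I"
 have "\<forall>\<^sub>F t in nhds (z i). f (z(i:=t)) = g (z(i:=t))"
  using eventually_upd[OF V, of z i] z by (auto elim!: eventually_mono intro!: eq cspace_upd i)
 then have "(%t. f (z(i:=t))) field_differentiable at (z i) \<longleftrightarrow> (%t. g (z(i:=t))) field_differentiable at (z i)"
  unfolding field_differentiable_def by (intro ex_cong1 DERIV_cong_ev) auto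
 then show "(%t. g (z(i:=t))) field_differentiable at (z i)" using f z i by (auto simp: holo_def)
qed

lemma holo_subset: "holo I V f ==> W \<subseteq> V ==> holo I W f"
 unfolding holo_def using continuous_on_subset[of "V \<inter> cspace I" f "W \<inter> cspace I"] by blast

lemma holo_union: assumes "\<And>a. a \<in> V ==> a \<in> cspace I ==> \<exists>W. open W & a \<in> W & holo I W f"
 shows "holo I V f"
 unfolding holo_def
proof (intro conjI ballI)
 show "continuous_on (V \<inter> cspace I) f"
  unfolding continuous_on_def
 proof
  fix z assume z: "z \<in> V \<inter> cspace I"
  with assms obtain W where W: "open W" "z \<in> W" "holo I W f" by blast
  then have "(f \<longlongrightarrow> f z) (at z within W \<inter> cspace I)" using z by (auto simp: holo_def continuous_on_def)
  moreover have "at z within W \<inter> cspace I = at z within cspace I"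
   by (rule at_within_nhd[of z W]) (use W in auto)
  ultimately have "(f \<longlongrightarrow> f z) (at z within cspace I)" by simp
  then show "(f \<longlongrightarrow> f z) (at z within V \<inter> cspace I)"
   by (rule tendsto_within_subset) simp
 qed
next
 fix z i assume z: "z \<in> V \<inter> cspace I" and i: "i \<in> I"
 with assms obtain W where "z \<in> W" "holo I W f" by blast
 then show "(%t. f (z(i:=t))) field_differentiable at (z i)" using z i unfolding holo_def by blast
qed

lemma holo_sepb:
 assumes I: "finite I" and V: "open V" and f: "holo I V f" and a: "a \<in> V" "a \<in> cspace I"
 shows "\<exists>r>0. \<exists>M. pdisc I a r \<subseteq> V & sepb I a r f M"
proof -
 have "(f \<longlongrightarrow> f a) (at a within (V \<inter> cspace I))" using f a by (auto simp: holo_def continuous_on_def)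
 then have "\<forall>\<^sub>F z in at a within (V \<inter> cspace I). dist (f z) (f a) < 1" by (rule tendstoD) simp
 then obtain W where W: "open W" "a \<in> W" "\<forall>z\<in>W. z \<noteq> a --> z \<in> V \<inter> cspace I --> dist (f z) (f a) < 1"
  unfolding eventually_at_topological by auto
 obtain r where r: "r > 0" "pdisc I a r \<subseteq> V \<inter> W"
  using open_pdisc_subset[OF I, of "V \<inter> W" a] V W a by auto
 have "cmod (f z) \<le> cmod (f a) + 1" if "z \<in> pdisc I a r" for z
 proof -
  have "z \<in> W" "z \<in> V \<inter> cspace I" using that r(2) by (auto simp: pdisc_def)
  then have "dist (f z) (f a) \<le> 1" using W(3) by (cases "z = a") (auto simp: less_imp_le)
  then show ?thesis unfolding dist_norm by (smt (verit) norm_triangle_sub)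
 qed
 then have "sepb I a r f (cmod (f a) + 1)" using f r(2) unfolding sepb_def holo_def pdisc_def by blast
 with r show ?thesis by blast
qed

lemma sepb_imp_holo:
 assumes I: "finite I" and s: "sepb I a r f M"
 shows "holo I (pbox I a (r/2)) f"
 unfolding holo_def
proof (intro conjI ballI)
 have eq: "pbox I a (r/2) \<inter> cspace I = pdisc I a (r/2)" by (simp add: pdisc_def)
 show "continuous_on (pbox I a (r/2) \<inter> cspace I) f" unfolding eq continuous_on_def
 proof
  fix z assume z: "z \<in> pdisc I a (r/2)"
  have "((%w. 4*M/r * n1 I (w - z)) \<longlongrightarrow> 4*M/r * n1 I (z - z)) (at z within pdisc I a (r/2))"
  proof -
   have "continuous_on UNIV (%w. 4*M/r * n1 I (w - z))"
    unfolding n1_def fun_diff_def by (intro continuous_intros continuous_on_product_coordinates)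
   then have "((%w. 4*M/r * n1 I (w - z)) \<longlongrightarrow> 4*M/r * n1 I (z - z)) (at z)"
    unfolding continuous_on_def by blast
   then show ?thesis by (rule tendsto_within_subset) simp
  qed
  then have "((%w. 4*M/r * n1 I (w - z)) \<longlongrightarrow> 0) (at z within pdisc I a (r/2))" by (simp add: n1_def)
  moreover have "\<forall>\<^sub>F w in at z within pdisc I a (r/2). norm (f w - f z) \<le> 4*M/r * n1 I (w - z)"
   unfolding eventually_at_filter by (rule always_eventually) (use sepb_lipschitz[OF s I z] in blast)
  ultimately have "((%w. f w - f z) \<longlongrightarrow> 0) (at z within pdisc I a (r/2))" by (rule Lim_null_comparison[rotated])
  then show "(f \<longlongrightarrow> f z) (at z within pdisc I a (r/2))" by (simp add: LIM_zero_cancel)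
 qed
 fix z i assume "z \<in> pbox I a (r/2) \<inter> cspace I" "i \<in> I"
 then have "z \<in> pdisc I a r" "i \<in> I" using half_pdisc(1)[of z I a r i] unfolding eq by auto
 then show "(%t. f (z(i:=t))) field_differentiable at (z i)" using s by (auto simp: sepb_def)
qed

lemma holo_partial:
 assumes I: "finite I" and V: "open V" and f: "holo I V f" and i: "i \<in> I"
 shows "holo I V (pd i f)"
proof (rule holo_union)
 fix a assume a: "a \<in> V" "a \<in> cspace I"
 obtain r M where r: "r > 0" "sepb I a r f M" using holo_sepb[OF I V f a] by blast
 have "holo I (pbox I a (r/2/2)) (pd i f)" by (rule sepb_imp_holo[OF I sepb_partial[OF r(2) i]])
 then show "\<exists>W. open W & a \<in> W & holo I W (pd i f)"
  using r(1) by (intro exI[of _ "pbox I a (r/2/2)"]) (auto simp: open_pbox[OF I])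
qed

lemma holo_partial_commute:
 assumes I: "finite I" and V: "open V" and f: "holo I V f" and i: "i \<in> I" "k \<in> I" and a: "a \<in> V" "a \<in> cspace I"
 shows "pd k (pd i f) a = pd i (pd k f) a"
proof -
 obtain r M where r: "r > 0" "sepb I a r f M" using holo_sepb[OF I V f a] by blast
 show ?thesis by (rule sepb_partial_commute[OF r(2) i]) (use r a in \<open>auto simp: pdisc_iff\<close>)
qed

lemma holo_partial_DERIV:
 assumes f: "holo I V f" and i: "i \<in> I" and a: "a \<in> V" "a \<in> cspace I"
 shows "((%t. f (a(i:=t))) has_field_derivative pd i f a) (at (a i))"
 using assms unfolding holo_def partial_deriv_def DERIV_deriv_iff_field_differentiable by auto

lemma holo_expansion:
 assumes I: "finite I" and V: "open V" and f: "holo I V f" and a: "a \<in> V" "a \<in> cspace I"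
 shows "\<exists>dl>0. \<exists>C\<ge>0. pdisc I a dl \<subseteq> V & (\<forall>z\<in>pdisc I a dl. \<forall>w\<in>pdisc I a dl.
   cmod (f w - f z - (\<Sum>i\<in>I. pd i f z * (w i - z i))) \<le> C * (n1 I (w - z))^2)"
proof -
 obtain r M where r: "r > 0" "pdisc I a r \<subseteq> V" "sepb I a r f M" using holo_sepb[OF I V f a] by blast
 have "0 \<le> M" using sepb_nonneg[OF r(3), of a] r a by (auto simp: pdisc_iff)
 then show ?thesis using sepb_expansion[OF r(3) I] r(1,2) pdisc_mono[of "r/4" r I a]
  by (intro exI[of _ "r/4"] exI[of _ "32*M/r^2"] conjI) auto
qed

lemma has_derivative_zero_quadratic:
 fixes R :: "'a::real_normed_vector => complex" and u :: "'j => 'a => complex"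
 assumes J: "finite J" and u: "\<And>j. j \<in> J ==> (u j has_derivative g j) (at x within S)" "\<And>j. j \<in> J ==> u j x = 0"
  and R: "\<forall>\<^sub>F y in at x within S. cmod (R y) \<le> C * (\<Sum>j\<in>J. cmod (u j y))^2" "R x = 0" "C \<ge> 0"
 shows "(R has_derivative (%h. 0)) (at x within S)"
proof -
 let ?n = "%y. \<Sum>j\<in>J. cmod (u j y)"
 have "\<exists>K. \<forall>\<^sub>F y in at x within S. cmod (u j y) \<le> K * norm (y - x)" if j: "j \<in> J" for j
 proof -
  obtain B where B: "\<And>h. norm (g j h) \<le> norm h * B"
   using bounded_linear.bounded[OF has_derivative_bounded_linear[OF u(1)[OF j]]] by blast
  have "((%y. (u j y - u j x - g j (y - x)) /\<^sub>R norm (y - x)) \<longlongrightarrow> 0) (at x within S)"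
   using u(1)[OF j] by (simp add: has_derivative_within divide_inverse_commute)
     (simp add: scaleR_conv_of_real divide_inverse_commute algebra_simps)
  then have "\<forall>\<^sub>F y in at x within S. norm ((u j y - u j x - g j (y - x)) /\<^sub>R norm (y - x)) < 1"
   by (auto dest: tendstoD[of _ _ _ 1] simp: dist_norm)
  moreover have "\<forall>\<^sub>F y in at x within S. y \<noteq> x" by (simp add: eventually_at_filter)
  ultimately have "\<forall>\<^sub>F y in at x within S. cmod (u j y) \<le> (1 + B) * norm (y - x)"
  proof eventually_elim
   case (elim y)
   then have "norm (u j y - g j (y - x)) \<le> norm (y - x)" using u(2)[OF j]
    by (simp add: divide_simps split: if_splits)
   with B[of "y - x"] show ?case
    by (smt (verit) norm_triangle_sub distrib_right mult.commute mult_cancel_right1)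
  qed
  then show ?thesis by blast
 qed
 then obtain K where K: "\<And>j. j \<in> J ==> \<forall>\<^sub>F y in at x within S. cmod (u j y) \<le> K j * norm (y - x)" by metis
 have n: "\<forall>\<^sub>F y in at x within S. ?n y \<le> (\<Sum>j\<in>J. K j) * norm (y - x)"
 proof -
  have "\<forall>\<^sub>F y in at x within S. \<forall>j\<in>J. cmod (u j y) \<le> K j * norm (y - x)"
   using K J by (simp add: eventually_ball_finite)
  then show ?thesis by eventually_elim (simp add: sum_distrib_right sum_mono)
 qed
 have "((%y. C * (sum K J)^2 * norm (y - x)) \<longlongrightarrow> C * (sum K J)^2 * norm (x - x)) (at x within S)"
  by (intro tendsto_intros)
 then have lim: "((%y. C * (sum K J)^2 * norm (y - x)) \<longlongrightarrow> 0) (at x within S)" by simp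
 have "\<forall>\<^sub>F y in at x within S. norm (norm (R y) / norm (y - x)) \<le> C * (sum K J)^2 * norm (y - x)"
  using R(1) n
 proof eventually_elim
  case (elim y)
  have "0 \<le> ?n y" by (simp add: sum_nonneg)
  have "cmod (R y) \<le> C * ((sum K J) * norm (y - x))^2"
   using elim \<open>0 \<le> ?n y\<close> R(3) by (meson mult_left_mono order_trans power_mono)
  then show ?case by (simp add: divide_simps power2_eq_square algebra_simps)
 qed
 then have "((%y. norm (R y) / norm (y - x)) \<longlongrightarrow> 0) (at x within S)" by (rule Lim_null_comparison[OF _ lim])
 then show ?thesis unfolding has_derivative_iff_norm using R(2) by simp
qed

text \<open>
A chain rule for arbitrary differentiable arguments. It is used for complex lines and for real curves
alike, which is why the derivative of the inner function is a general linear map.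
\<close>

lemma holo_chain:
 fixes gm :: "'a::real_normed_vector => 'j cpoint"
 assumes J: "finite J" and W: "open W" and F: "holo J W F"
  and gm: "\<And>x. x \<in> S ==> gm x \<in> cspace J" "gm x0 \<in> cspace J" "gm x0 \<in> W"
  and d: "\<And>j. j \<in> J ==> ((%x. gm x j) has_derivative g j) (at x0 within S)"
 shows "((%x. F (gm x)) has_derivative (%h. \<Sum>j\<in>J. pd j F (gm x0) * g j h)) (at x0 within S)"
proof -
 obtain dl C where dC: "dl > 0" "C \<ge> 0" and e: "\<And>z w. z \<in> pdisc J (gm x0) dl ==> w \<in> pdisc J (gm x0) dl ==>
   cmod (F w - F z - (\<Sum>i\<in>J. pd i F z * (w i - z i))) \<le> C * (n1 J (w - z))^2"
  using holo_expansion[OF J W F gm(3,2)] by blast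
 let ?p = "%j. pd j F (gm x0)"
 define R where "R x = F (gm x) - F (gm x0) - (\<Sum>j\<in>J. ?p j * (gm x j - gm x0 j))" for x
 have "\<forall>\<^sub>F x in at x0 within S. \<forall>j\<in>J. cmod (gm x j - gm x0 j) < dl"
 proof (rule eventually_ball_finite[OF J], rule)
  fix j assume "j \<in> J"
  then have "((%x. gm x j) \<longlongrightarrow> gm x0 j) (at x0 within S)"
   using has_derivative_continuous[OF d] by (auto simp: continuous_within)
  from tendstoD[OF this dC(1)] show "\<forall>\<^sub>F x in at x0 within S. cmod (gm x j - gm x0 j) < dl" by (simp add: dist_norm)
 qed
 moreover have "\<forall>\<^sub>F x in at x0 within S. x \<in> S" by (auto simp: eventually_at_filter)
 ultimately have ev: "\<forall>\<^sub>F x in at x0 within S. cmod (R x) \<le> C * (\<Sum>j\<in>J. cmod (gm x j - gm x0 j))^2"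
 proof eventually_elim
  case (elim x)
  then have "gm x \<in> pdisc J (gm x0) dl" "gm x0 \<in> pdisc J (gm x0) dl" using gm dC by (auto simp: pdisc_iff)
  from e[OF this(2,1)] show ?case by (simp add: R_def n1_def)
 qed
 have "(R has_derivative (%h. 0)) (at x0 within S)"
  by (rule has_derivative_zero_quadratic[OF J _ _ ev _ dC(2), where g=g])
    (auto simp: R_def intro!: derivative_eq_intros d)
 moreover have "((%x. \<Sum>j\<in>J. ?p j * (gm x j - gm x0 j)) has_derivative (%h. \<Sum>j\<in>J. ?p j * g j h)) (at x0 within S)"
  by (auto intro!: derivative_eq_intros d)
 ultimately have "((%x. F (gm x0) + R x + (\<Sum>j\<in>J. ?p j * (gm x j - gm x0 j))) has_derivative (%h. 0 + 0 + (\<Sum>j\<in>J. ?p j * g j h))) (at x0 within S)"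
  by (intro has_derivative_add has_derivative_const)
 then show ?thesis by (simp add: R_def)
qed

lemma holo_chain_DERIV:
 assumes J: "finite J" and W: "open W" and F: "holo J W F"
  and gm: "\<And>x. gm x \<in> cspace J" "gm x0 \<in> W"
  and d: "\<And>j. j \<in> J ==> ((%x. gm x j) has_field_derivative g j) (at x0)"
 shows "((%x. F (gm x)) has_field_derivative (\<Sum>j\<in>J. pd j F (gm x0) * g j)) (at x0)"
proof -
 have "((%x. F (gm x)) has_derivative (%h. \<Sum>j\<in>J. pd j F (gm x0) * (g j * h))) (at x0)"
  by (rule holo_chain[OF J W F]) (use gm d in \<open>auto simp: has_field_derivative_def\<close>)
 then show ?thesis unfolding has_field_derivative_def
  by (rule has_derivative_eq_rhs) (simp add: fun_eq_iff sum_distrib_right mult.assoc)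
qed

definition holom :: "'i set => 'j set => 'i cpoint set => ('i cpoint => 'j cpoint) => bool" where
 "holom I J V G \<longleftrightarrow> (\<forall>z\<in>V \<inter> cspace I. G z \<in> cspace J) & (\<forall>j\<in>J. holo I V (%z. G z j))"

lemma holom_continuous: assumes "holom I J V G" shows "continuous_on (V \<inter> cspace I) G"
proof (rule continuous_on_coordinatewise_then_product)
 fix j show "continuous_on (V \<inter> cspace I) (%z. G z j)"
 proof (cases "j \<in> J")
  case True then show ?thesis using assms by (auto simp: holom_def holo_def)
 next
  case False
  then have "continuous_on (V \<inter> cspace I) (%z. G z j) \<longleftrightarrow> continuous_on (V \<inter> cspace I) (%z. 0::complex)"
   using assms by (intro continuous_on_cong) (auto simp: holom_def cspace_def)
  then show ?thesis by simp
 qed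
qed

lemma holo_chain_upd:
 assumes J: "finite J" and V: "open V" and W: "open W" and F: "holo J W F" and G: "holom I J V G"
  and z: "z \<in> V" "z \<in> cspace I" "G z \<in> W" and i: "i \<in> I"
 shows "((%t. F (G (z(i:=t)))) has_field_derivative
   (\<Sum>j\<in>J. pd j F (G z) * pd i (%z. G z j) z)) (at (z i))"
proof -
 obtain S where S: "open S" "z i \<in> S" "\<And>t. t \<in> S ==> z(i:=t) \<in> V"
  using eventually_upd[OF V z(1), of i] unfolding eventually_nhds by blast
 have d: "((%t. G (z(i:=t)) j) has_field_derivative pd i (%z. G z j) z) (at (z i) within S)" if "j \<in> J" for j
  using G that z i by (auto simp: holom_def intro!: has_field_derivative_at_within[OF holo_partial_DERIV])
 have "((%x. F (G (z(i:=x)))) has_derivative (%h. \<Sum>j\<in>J. pd j F (G (z(i:=z i))) * (pd i (%z. G z j) z * h))) (at (z i) within S)"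
  by (rule holo_chain[OF J W F])
    (use d G S z i in \<open>auto simp: has_field_derivative_def holom_def cspace_upd\<close>)
 then have "((%t. F (G (z(i:=t)))) has_field_derivative
   (\<Sum>j\<in>J. pd j F (G z) * pd i (%z. G z j) z)) (at (z i) within S)"
  unfolding has_field_derivative_def
  by (rule has_derivative_eq_rhs) (simp add: fun_eq_iff sum_distrib_right mult.assoc)
 then show ?thesis using at_within_open[OF S(2,1)] by simp
qed

lemma holo_compose:
 assumes J: "finite J" and V: "open V" and W: "open W" and F: "holo J W F" and G: "holom I J V G"
  and GW: "\<And>z. z \<in> V ==> z \<in> cspace I ==> G z \<in> W"
 shows "holo I V (%z. F (G z))"
 unfolding holo_def
proof (intro conjI ballI)
 have "continuous_on (V \<inter> cspace I) (F o G)"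
  by (rule continuous_on_compose[OF holom_continuous[OF G]], rule continuous_on_subset[of "W \<inter> cspace J"])
    (use F G GW in \<open>auto simp: holo_def holom_def\<close>)
 then show "continuous_on (V \<inter> cspace I) (%z. F (G z))" by (simp add: comp_def)
 fix z i assume "z \<in> V \<inter> cspace I" "i \<in> I"
 then show "(%t. F (G (z(i := t)))) field_differentiable at (z i)"
  using holo_chain_upd[OF J V W F G, of z i] GW unfolding field_differentiable_def by blast
qed

lemma partial_deriv_compose:
 assumes J: "finite J" and V: "open V" and W: "open W" and F: "holo J W F" and G: "holom I J V G"
  and z: "z \<in> V" "z \<in> cspace I" "G z \<in> W" and i: "i \<in> I"
 shows "pd i (%z. F (G z)) z = (\<Sum>j\<in>J. pd j F (G z) * pd i (%z. G z j) z)"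
 unfolding partial_deriv_def[of i "%z. F (G z)"] by (rule DERIV_imp_deriv[OF holo_chain_upd[OF assms]])

lemma partial_deriv_cong:
 assumes V: "open V" "z \<in> V" "z \<in> cspace I" "i \<in> I" and eq: "\<And>w. w \<in> V ==> w \<in> cspace I ==> f w = g w"
 shows "pd i f z = pd i g z"
 unfolding partial_deriv_def
 using eventually_upd[OF V(1,2), of i] V
 by (intro deriv_cong_ev refl) (auto elim!: eventually_mono intro!: eq cspace_upd)

lemma holo_const[simp]: "holo I V (%z. c)" by (simp add: holo_def)

lemma holo_coord[simp]: "holo I V (%z. z i)"
proof -
 have "continuous_on (V \<inter> cspace I) (%z. z i)" by (rule continuous_on_subset[OF continuous_on_product_coordinates]) simp
 moreover have "(%t. (z(k:=t)) i) field_differentiable at (z k)" for z :: "'a cpoint" and k by (cases "k = i") auto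
 ultimately show ?thesis by (simp add: holo_def del: fun_upd_apply)
qed

lemma holo_add: "holo I V f ==> holo I V g ==> holo I V (%z. f z + g z)"
 by (auto simp: holo_def intro!: continuous_intros field_differentiable_add)

lemma holo_minus: "holo I V f ==> holo I V (%z. - f z)"
 by (auto simp: holo_def intro!: continuous_intros field_differentiable_minus)

lemma holo_diff: "holo I V f ==> holo I V g ==> holo I V (%z. f z - g z)"
 by (auto simp: holo_def intro!: continuous_intros field_differentiable_diff)

lemma holo_mult: "holo I V f ==> holo I V g ==> holo I V (%z. f z * g z)"
 by (auto simp: holo_def intro!: continuous_intros field_differentiable_mult)

lemma holo_divide: "holo I V f ==> holo I V g ==> (\<And>z. z \<in> V ==> z \<in> cspace I ==> g z \<noteq> 0) ==> holo I V (%z. f z / g z)"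
 by (auto simp: holo_def intro!: continuous_intros field_differentiable_divide)

lemma holo_sum: "(\<And>a. a \<in> A ==> holo I V (f a)) ==> holo I V (%z. \<Sum>a\<in>A. f a z)"
 by (induction A rule: infinite_finite_induct) (auto intro: holo_add)

lemma holo_prod: "(\<And>a. a \<in> A ==> holo I V (f a)) ==> holo I V (%z. \<Prod>a\<in>A. f a z)"
 by (induction A rule: infinite_finite_induct) (auto intro: holo_mult)

lemmas holo_intros = holo_const holo_coord holo_add holo_minus holo_diff holo_mult holo_sum holo_prod

lemma holo_uniform_limit:
 assumes V: "open V" and f: "\<And>n. holo I V (f n)" and u: "uniform_limit (V \<inter> cspace I) f g sequentially"
 shows "holo I V g"
 unfolding holo_def
proof (intro conjI ballI)
 show "continuous_on (V \<inter> cspace I) g"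
  by (rule uniform_limit_theorem[OF _ u]) (use f in \<open>auto simp: holo_def\<close>)
 fix z i assume z: "z \<in> V \<inter> cspace I" and i: "i \<in> I"
 obtain r where r: "r > 0" "cball (z i) r \<subseteq> {t. z(i:=t) \<in> V}"
 proof -
  have "open ((%t. z(i:=t)) -` V)" by (rule open_vimage[OF V continuous_upd])
  moreover have "z i \<in> (%t. z(i:=t)) -` V" using z by simp
  ultimately obtain r where "r > 0" "cball (z i) r \<subseteq> (%t. z(i:=t)) -` V" using open_contains_cball by blast
  then show ?thesis using that[of r] by (simp add: vimage_def)
 qed
 have inV: "z(i:=t) \<in> V \<inter> cspace I" if "t \<in> cball (z i) r" for t
  using r(2) that cspace_upd[of z I i t] z i by blast
 have "(%t. f n (z(i:=t))) field_differentiable at t" if "t \<in> cball (z i) r" for n t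
 proof -
  have "(%u. f n ((z(i:=t))(i:=u))) field_differentiable at ((z(i:=t)) i)"
   using f[of n] inV[OF that] i unfolding holo_def by blast
  then show ?thesis by simp
 qed
 then have hol: "(%t. f n (z(i:=t))) holomorphic_on cball (z i) r" for n
  unfolding holomorphic_on_def using field_differentiable_at_within by blast
 have "continuous_on (cball (z i) r) (%t. f n (z(i:=t))) & (%t. f n (z(i:=t))) holomorphic_on ball (z i) r" for n
  using holomorphic_on_imp_continuous_on[OF hol] holomorphic_on_subset[OF hol ball_subset_cball] by blast
 moreover have "uniform_limit (cball (z i) r) (%n t. f n (z(i:=t))) (%t. g (z(i:=t))) sequentially"
  using u inV unfolding uniform_limit_iff by (auto elim!: eventually_mono)
 ultimately have "(%t. g (z(i:=t))) holomorphic_on ball (z i) r"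
  using holomorphic_uniform_limit[of "z i" r "%n t. f n (z(i:=t))" sequentially "%t. g (z(i:=t))"] by auto
 then show "(%t. g (z(i:=t))) field_differentiable at (z i)"
  using r(1) by (simp add: holomorphic_on_imp_differentiable_at)
qed

lemma cconj_simps[simp]: "cconj z i = cnj (z i)" "cconj (cconj z) = z" "cconj 0 = 0"
 by (auto simp: cconj_def)

lemma cconj_cspace[simp]: "cconj z \<in> cspace I \<longleftrightarrow> z \<in> cspace I"
 by (auto simp: cspace_def)

lemma continuous_cconj: "continuous_on S cconj"
 unfolding cconj_def by (intro continuous_on_coordinatewise_then_product continuous_intros
   continuous_on_subset[OF continuous_on_product_coordinates]) simp

lemma holo_cnj:
 assumes f: "holo I V f" and V: "open V"
 shows "holo I (cconj -` V) (%z. cnj (f (cconj z)))"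
  and "z \<in> cconj -` V ==> z \<in> cspace I ==> i \<in> I ==> pd i (%z. cnj (f (cconj z))) z = cnj (pd i f (cconj z))"
proof -
 have d: "((%t. cnj (f (cconj (z(i:=t))))) has_field_derivative cnj (pd i f (cconj z))) (at (z i))"
  if "z \<in> cconj -` V" "z \<in> cspace I" "i \<in> I" for z i
 proof -
  have "((%t. f ((cconj z)(i:=t))) has_field_derivative pd i f (cconj z)) (at (cconj z i))"
   using holo_partial_DERIV[OF f that(3), of "cconj z"] that by simp
  then have "((cnj o (%t. f ((cconj z)(i:=t))) o cnj) has_field_derivative cnj (pd i f (cconj z))) (at (z i))"
   by (intro has_field_derivative_cnj_cnj) simp
  moreover have "(cconj z)(i:=cnj t) = cconj (z(i:=t))" for t by (auto simp: fun_eq_iff)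
  ultimately show ?thesis by (simp add: comp_def)
 qed
 show "holo I (cconj -` V) (%z. cnj (f (cconj z)))" unfolding holo_def
 proof (intro conjI ballI)
  have "continuous_on (cconj -` V \<inter> cspace I) (f o cconj)"
   by (rule continuous_on_compose[OF continuous_cconj], rule continuous_on_subset[of "V \<inter> cspace I"])
     (use f in \<open>auto simp: holo_def\<close>)
  then show "continuous_on (cconj -` V \<inter> cspace I) (%z. cnj (f (cconj z)))" by (intro continuous_intros) (simp add: comp_def)
 qed (use d field_differentiable_def in blast)
 assume "z \<in> cconj -` V" "z \<in> cspace I" "i \<in> I"
 then show "pd i (%z. cnj (f (cconj z))) z = cnj (pd i f (cconj z))"
  unfolding partial_deriv_def[of i "%z. cnj (f (cconj z))" z] by (intro DERIV_imp_deriv d)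
qed

lemma open_vimage_cconj: "open V ==> open (cconj -` V)"
 by (rule open_vimage[OF _ continuous_cconj])

section \<open>Comparison with complex differentiability\<close>

lemma n1_le_L2: "n1 I h \<le> card I * L2_set (%i. cmod (h i)) I"
proof (cases "finite I")
 case True
 have "n1 I h \<le> (\<Sum>i\<in>I. L2_set (%i. cmod (h i)) I)" unfolding n1_def
  by (intro sum_mono member_le_L2_set True)
 then show ?thesis by simp
qed (simp add: n1_def)

lemma n1_nonneg[simp]: "0 \<le> n1 I h" by (simp add: n1_def sum_nonneg)

lemma continuous_on_UNIV_tendsto:
 assumes "continuous_on UNIV f" shows "(f \<longlongrightarrow> f x) (at x within S)"
proof -
 have "(f \<longlongrightarrow> f x) (at x within UNIV)" using assms continuous_on_def[of UNIV f] by simp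
 then show ?thesis by (rule tendsto_within_subset) simp
qed

lemma n1_tendsto_0: "((%w. n1 I (w - z)) \<longlongrightarrow> 0) (at z within S)"
proof -
 have "continuous_on UNIV (%w. n1 I (w - z))"
  unfolding n1_def fun_diff_def by (intro continuous_intros continuous_on_product_coordinates)
 from continuous_on_UNIV_tendsto[OF this, of z S] show ?thesis by (simp add: n1_def)
qed

lemma holo_imp_complex_differentiable:
 assumes I: "finite I" and V: "open V" and f: "holo I V f" and z: "z \<in> V" "z \<in> cspace I"
 shows "complex_differentiable I f z"
proof -
 obtain dl C where d: "dl > 0" "C \<ge> 0" and e: "\<And>w. w \<in> pdisc I z dl ==>
   cmod (f w - f z - (\<Sum>i\<in>I. pd i f z * (w i - z i))) \<le> C * (n1 I (w - z))^2"
  using holo_expansion[OF I V f z] z by (auto simp: pdisc_iff)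
 let ?N = "%w. cmod (f w - f z - (\<Sum>i\<in>I. pd i f z * (w i - z i)))"
 let ?L = "%w. L2_set (%i. cmod (w i - z i)) I"
 have "\<forall>\<^sub>F w in at z within cspace I. norm (?N w / ?L w) \<le> C * card I * n1 I (w - z)"
  unfolding eventually_at_topological
 proof (intro exI conjI ballI impI)
  show "open (pbox I z dl)" "z \<in> pbox I z dl" using d by (auto simp: open_pbox I)
  fix w assume "w \<in> pbox I z dl" "w \<noteq> z" "w \<in> cspace I"
  then have "?N w \<le> C * (n1 I (w - z))^2" using e by (simp add: pdisc_def)
  also have "\<dots> \<le> C * ((card I * ?L w) * n1 I (w - z))"
   unfolding power2_eq_square using n1_le_L2[of I "w - z"] d(2)
   by (intro mult_left_mono mult_right_mono) auto
  finally have b: "?N w \<le> C * card I * n1 I (w - z) * ?L w" by (simp add: mult_ac)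
  have L: "?L w \<ge> 0" by (rule L2_set_nonneg)
  have "?N w / ?L w \<le> C * card I * n1 I (w - z)"
  proof (cases "?L w = 0")
   case False
   then have "?L w > 0" using L by linarith
   then show ?thesis by (rule mult_imp_div_pos_le) (rule b)
  qed (use d in simp)
  then show "norm (?N w / ?L w) \<le> C * card I * n1 I (w - z)" using L by simp
 qed
 moreover have "((%w. C * card I * n1 I (w - z)) \<longlongrightarrow> 0) (at z within cspace I)"
  by (rule tendsto_mult_right_zero[OF n1_tendsto_0])
 ultimately have "((%w. ?N w / ?L w) \<longlongrightarrow> 0) (at z within cspace I)" by (rule Lim_null_comparison)
 then show ?thesis unfolding complex_differentiable_def by (intro exI[of _ "%i. pd i f z"])
qed

lemma complex_differentiable_imp_holo:
 assumes I: "finite I" and V: "open V" and f: "\<And>z. z \<in> V ==> z \<in> cspace I ==> complex_differentiable I f z"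
 shows "holo I V f"
 unfolding holo_def
proof (intro conjI ballI)
 show "continuous_on (V \<inter> cspace I) f" unfolding continuous_on_def
 proof
  fix z assume z: "z \<in> V \<inter> cspace I"
  let ?L = "%w. L2_set (%i. cmod (w i - z i)) I"
  obtain c where c: "((%w. cmod (f w - f z - (\<Sum>i\<in>I. c i * (w i - z i))) / ?L w) \<longlongrightarrow> 0) (at z within cspace I)"
   using f z unfolding complex_differentiable_def by blast
  have L: "(?L \<longlongrightarrow> 0) (at z within cspace I)"
   by (rule Lim_null_comparison[OF _ n1_tendsto_0[of I]])
     (auto simp: n1_def L2_set_nonneg intro!: always_eventually L2_set_le_sum)
  have pos: "?L w \<noteq> 0" if "w \<in> cspace I" "w \<noteq> z" for w
  proof
   assume "?L w = 0"
   then have "\<forall>i. w i = z i" using that z I by (auto simp: L2_set_eq_0_iff cspace_def)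
   with that show False by auto
  qed
  have "((%w. cmod (f w - f z - (\<Sum>i\<in>I. c i * (w i - z i))) / ?L w * ?L w) \<longlongrightarrow> 0 * 0) (at z within cspace I)"
   by (rule tendsto_mult[OF c L])
  moreover have "\<forall>\<^sub>F w in at z within cspace I. cmod (f w - f z - (\<Sum>i\<in>I. c i * (w i - z i))) / ?L w * ?L w = cmod (f w - f z - (\<Sum>i\<in>I. c i * (w i - z i)))"
   unfolding eventually_at_filter by (rule always_eventually) (use pos in auto)
  ultimately have "((%w. cmod (f w - f z - (\<Sum>i\<in>I. c i * (w i - z i)))) \<longlongrightarrow> 0) (at z within cspace I)"
   using tendsto_cong by fastforce
  then have 1: "((%w. f w - f z - (\<Sum>i\<in>I. c i * (w i - z i))) \<longlongrightarrow> 0) (at z within cspace I)"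
   by (simp add: tendsto_norm_zero_iff)
  have coord: "((%w. w i) \<longlongrightarrow> z i) (at z within cspace I)" for i
   by (rule continuous_on_UNIV_tendsto[OF continuous_on_product_coordinates])
  have 2: "((%w. \<Sum>i\<in>I. c i * (w i - z i)) \<longlongrightarrow> (\<Sum>i\<in>I. c i * (z i - z i))) (at z within cspace I)"
   by (intro tendsto_intros coord)
  have "((%w. (f w - f z - (\<Sum>i\<in>I. c i * (w i - z i))) + (\<Sum>i\<in>I. c i * (w i - z i)) + f z) \<longlongrightarrow> 0 + (\<Sum>i\<in>I. c i * (z i - z i)) + f z) (at z within cspace I)"
   by (intro tendsto_add 1 2 tendsto_const)
  then have "(f \<longlongrightarrow> f z) (at z within cspace I)" by simp
  then show "(f \<longlongrightarrow> f z) (at z within V \<inter> cspace I)" by (rule tendsto_within_subset) simp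
 qed
 fix z i assume z: "z \<in> V \<inter> cspace I" and i: "i \<in> I"
 let ?L = "%w. L2_set (%i. cmod (w i - z i)) I"
 obtain c where c: "((%w. cmod (f w - f z - (\<Sum>i\<in>I. c i * (w i - z i))) / ?L w) \<longlongrightarrow> 0) (at z within cspace I)"
  using f z unfolding complex_differentiable_def by blast
 have u: "filterlim (%t. z(i:=t)) (at z within cspace I) (at (z i))"
  unfolding filterlim_at
 proof
  have ne: "z(i:=t) \<noteq> z" if "t \<noteq> z i" for t using that by (metis fun_upd_same)
  show "\<forall>\<^sub>F t in at (z i). z(i:=t) \<in> cspace I & z(i:=t) \<noteq> z"
   unfolding eventually_at_filter using ne by (intro always_eventually) (use z i in \<open>auto intro: cspace_upd simp del: fun_upd_apply\<close>)
  have "((%t. z(i:=t)) \<longlongrightarrow> z(i:=z i)) (at (z i))"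
   by (rule continuous_on_UNIV_tendsto[OF continuous_upd])
  then show "((%t. z(i:=t)) \<longlongrightarrow> z) (at (z i))" by simp
 qed
 have "(\<Sum>k\<in>I. c k * ((z(i:=t)) k - z k)) = c i * (t - z i)" for t
 proof -
  have "(\<Sum>k\<in>I. c k * ((z(i:=t)) k - z k)) = (\<Sum>k\<in>I. if k = i then c i * (t - z i) else 0)"
   by (rule sum.cong) auto
  then show ?thesis using I i by simp
 qed
 moreover have "?L (z(i:=t)) = cmod (t - z i)" for t
 proof -
  have "(\<Sum>k\<in>I. (cmod ((z(i:=t)) k - z k))^2) = (\<Sum>k\<in>I. if k = i then (cmod (t - z i))^2 else 0)"
   by (rule sum.cong) auto
  then show ?thesis unfolding L2_set_def using I i by simp
 qed
 ultimately have "((%t. cmod (f (z(i:=t)) - f z - c i * (t - z i)) / cmod (t - z i)) \<longlongrightarrow> 0) (at (z i))"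
  using filterlim_compose[OF c u] by (simp del: fun_upd_apply)
 then have "((%t. f (z(i:=t))) has_field_derivative c i) (at (z i))"
  unfolding has_field_derivative_def has_derivative_iff_norm by (simp add: bounded_linear_mult_right)
 then show "(%t. f (z(i:=t))) field_differentiable at (z i)" unfolding field_differentiable_def by blast
qed

definition hgerm :: "'i set => ('i cpoint => complex) => 'i cpoint => bool" where
 "hgerm I f a \<longleftrightarrow> (\<exists>V. open V & a \<in> V & holo I V f)"

definition hmgerm :: "'i set => 'j set => ('i cpoint => 'j cpoint) => 'i cpoint => bool" where
 "hmgerm I J G a \<longleftrightarrow> (\<exists>V. open V & a \<in> V & holom I J V G)"

lemma holom_subset: "holom I J V G ==> W \<subseteq> V ==> holom I J W G"
 unfolding holom_def by (meson IntD1 IntD2 IntI holo_subset subsetD)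

lemma holomorphic_germ_iff:
 assumes I: "finite I" and J: "finite J"
 shows "holomorphic_germ I J F a \<longleftrightarrow> hmgerm I J F a"
proof
 assume "holomorphic_germ I J F a"
 then obtain V where V: "open V" "a \<in> V"
  "\<And>z. z \<in> V ==> z \<in> cspace I ==> F z \<in> cspace J & (\<forall>j\<in>J. complex_differentiable I (%w. F w j) z)"
  unfolding holomorphic_germ_def eventually_nhds by blast
 then have "holom I J V F" unfolding holom_def
  using complex_differentiable_imp_holo[OF I V(1)] by auto
 then show "hmgerm I J F a" using V unfolding hmgerm_def by blast
next
 assume "hmgerm I J F a"
 then obtain V where V: "open V" "a \<in> V" "holom I J V F" unfolding hmgerm_def by blast
 then have "F z \<in> cspace J & (\<forall>j\<in>J. complex_differentiable I (%w. F w j) z)" if "z \<in> V" "z \<in> cspace I" for z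
  using holo_imp_complex_differentiable[OF I V(1) _ that] that by (auto simp: holom_def)
 then show "holomorphic_germ I J F a" unfolding holomorphic_germ_def eventually_nhds using V by blast
qed

lemma open_vimage_germ:
 assumes G: "holom I J V G" and V: "open V" and W: "open W" and a: "a \<in> V" "a \<in> cspace I" "G a \<in> W"
 shows "\<exists>U. open U & a \<in> U & U \<subseteq> V & (\<forall>z\<in>U \<inter> cspace I. G z \<in> W)"
proof -
 obtain U where U: "open U" "U \<inter> (V \<inter> cspace I) = G -` W \<inter> (V \<inter> cspace I)"
  using holom_continuous[OF G] W unfolding continuous_on_open_invariant by blast
 then show ?thesis using V a by (intro exI[of _ "U \<inter> V"]) auto
qed

lemma hgerm_compose:
 assumes J: "finite J" and F: "hgerm J F (G a)" and G: "hmgerm I J G a" and a: "a \<in> cspace I"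
 shows "hgerm I (%z. F (G z)) a"
proof -
 obtain W where W: "open W" "G a \<in> W" "holo J W F" using F unfolding hgerm_def by blast
 obtain V where V: "open V" "a \<in> V" "holom I J V G" using G unfolding hmgerm_def by blast
 obtain U where U: "open U" "a \<in> U" "U \<subseteq> V" "\<forall>z\<in>U \<inter> cspace I. G z \<in> W"
  using open_vimage_germ[OF V(3,1) W(1) V(2) a W(2)] by blast
 have "holo I U (%z. F (G z))"
  by (rule holo_compose[OF J U(1) W(1,3) holom_subset[OF V(3) U(3)]]) (use U in auto)
 then show ?thesis using U unfolding hgerm_def by blast
qed

lemma hmgermD: "hmgerm I J G a ==> j \<in> J ==> hgerm I (%z. G z j) a"
 unfolding hmgerm_def hgerm_def holom_def by blast

lemma hmgermI:
 assumes J: "finite J" and 1: "\<forall>\<^sub>F z in nhds a. z \<in> cspace I --> G z \<in> cspace J"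
  and 2: "\<And>j. j \<in> J ==> hgerm I (%z. G z j) a"
 shows "hmgerm I J G a"
proof -
 obtain V where V: "open V" "a \<in> V" "\<And>z. z \<in> V ==> z \<in> cspace I ==> G z \<in> cspace J"
  using 1 unfolding eventually_nhds by blast
 obtain W where W: "\<And>j. j \<in> J ==> open (W j) & a \<in> W j & holo I (W j) (%z. G z j)"
  using 2 unfolding hgerm_def by metis
 have "holom I J (V \<inter> (\<Inter>j\<in>J. W j)) G" unfolding holom_def
  using V W by (auto intro: holo_subset[of I "W _"])
 moreover have "open (V \<inter> (\<Inter>j\<in>J. W j))" using V W J by auto
 ultimately show ?thesis unfolding hmgerm_def using V W by blast
qed

lemma hmgerm_compose:
 assumes J: "finite J" and K: "finite K" and F: "hmgerm J K F (G a)" and G: "hmgerm I J G a" and a: "a \<in> cspace I"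
 shows "hmgerm I K (%z. F (G z)) a"
proof -
 obtain W where W: "open W" "G a \<in> W" "holom J K W F" using F unfolding hmgerm_def by blast
 obtain V where V: "open V" "a \<in> V" "holom I J V G" using G unfolding hmgerm_def by blast
 obtain U where U: "open U" "a \<in> U" "U \<subseteq> V" "\<forall>z\<in>U \<inter> cspace I. G z \<in> W"
  using open_vimage_germ[OF V(3,1) W(1) V(2) a W(2)] by blast
 show ?thesis
 proof (rule hmgermI[OF K])
  show "\<forall>\<^sub>F z in nhds a. z \<in> cspace I --> F (G z) \<in> cspace K"
   unfolding eventually_nhds using U V W by (intro exI[of _ U]) (auto simp: holom_def)
  fix k assume "k \<in> K"
  then show "hgerm I (%z. F (G z) k) a" by (intro hgerm_compose[OF J hmgermD[OF F] G a])
 qed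
qed

lemma hgerm_const[simp]: "hgerm I (%z. c) a" unfolding hgerm_def by (intro exI[of _ UNIV]) auto
lemma hgerm_coord[simp]: "hgerm I (%z. z i) a" unfolding hgerm_def by (intro exI[of _ UNIV]) auto

lemma hgerm_combine:
 assumes "hgerm I f a" "hgerm I g a" "\<And>V. open V ==> holo I V f ==> holo I V g ==> holo I V h"
 shows "hgerm I h a"
proof -
 obtain V W where "open V" "a \<in> V" "holo I V f" "open W" "a \<in> W" "holo I W g"
  using assms unfolding hgerm_def by blast
 then show ?thesis unfolding hgerm_def
  by (intro exI[of _ "V \<inter> W"]) (auto intro!: assms(3) intro: holo_subset[of I V] holo_subset[of I W])
qed

lemma hgerm_add: "hgerm I f a ==> hgerm I g a ==> hgerm I (%z. f z + g z) a"
 and hgerm_diff: "hgerm I f a ==> hgerm I g a ==> hgerm I (%z. f z - g z) a"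
 and hgerm_mult: "hgerm I f a ==> hgerm I g a ==> hgerm I (%z. f z * g z) a"
 by (erule (1) hgerm_combine, simp add: holo_add holo_diff holo_mult)+

lemma hgerm_sum: "(\<And>k. k \<in> A ==> hgerm I (f k) a) ==> hgerm I (%z. \<Sum>k\<in>A. f k z) a"
 by (induction A rule: infinite_finite_induct) (auto intro: hgerm_add)

section \<open>Sums of index sets\<close>

lemma plus_mem[simp]: "Inl i \<in> I <+> J \<longleftrightarrow> i \<in> I" "Inr j \<in> I <+> J \<longleftrightarrow> j \<in> J"
 by auto

lemma cspace_case_sum[simp]: "case_sum x y \<in> cspace (I <+> J) \<longleftrightarrow> x \<in> cspace I & y \<in> cspace J"
 unfolding cspace_def by (force simp: split_sum_all split: sum.splits)

lemma cspace_comp_sum: "z \<in> cspace (I <+> J) ==> z o Inl \<in> cspace I" "z \<in> cspace (I <+> J) ==> z o Inr \<in> cspace J"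
 unfolding cspace_def by auto

lemma case_sum_comp[simp]: "case_sum x y o Inl = x" "case_sum x y o Inr = y" "case_sum (z o Inl) (z o Inr) = z"
 by (auto simp: fun_eq_iff split: sum.splits)

lemma case_sum_0[simp]: "case_sum 0 0 = (0 :: ('i + 'j) cpoint)"
 by (auto simp: fun_eq_iff split: sum.splits)

lemma ball_Plus: "(\<forall>k\<in>I <+> J. P k) \<longleftrightarrow> (\<forall>i\<in>I. P (Inl i)) & (\<forall>j\<in>J. P (Inr j))"
 by auto

lemma pdisc_case_sum[simp]: "case_sum x y \<in> pdisc (I <+> J) (case_sum a b) r \<longleftrightarrow> x \<in> pdisc I a r & y \<in> pdisc J b r"
 unfolding pdisc_iff cspace_case_sum ball_Plus by auto

section \<open>Implicit functions as limits of iterations\<close>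

text \<open>
The limit of the iterates of \<open>T x\<close> started at \<open>0\<close>. The definition makes no reference to a
base point or a neighbourhood, so the solutions found near different points \<open>a\<close> are
values of one function.
\<close>

definition fixsol :: "('i cpoint => 'j cpoint => 'j cpoint) => 'i cpoint => 'j cpoint" where
 "fixsol T x = (%j. lim (%n. ((T x) ^^ n) 0 j))"

lemma n1_triangle: "n1 J (a - c) \<le> n1 J (a - b) + n1 J (b - c)"
 unfolding n1_def sum.distrib[symmetric]
 by (rule sum_mono) (simp, metis diff_add_cancel add_diff_eq norm_triangle_ineq)

lemma n1_comp: "finite J ==> j \<in> J ==> cmod (y j) \<le> n1 J y"
 unfolding n1_def by (rule member_le_sum) auto

lemma n1_zero: "finite J ==> x \<in> cspace J ==> y \<in> cspace J ==> n1 J (x - y) \<le> 0 ==> x = y"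
proof -
 assume a: "finite J" "x \<in> cspace J" "y \<in> cspace J" "n1 J (x - y) \<le> 0"
 have "x j = y j" for j
 proof (cases "j \<in> J")
  case True
  have "cmod ((x - y) j) \<le> 0" using n1_comp[OF a(1) True, of "x - y"] a(4) by linarith
  then show ?thesis by simp
 qed (use a in \<open>auto simp: cspace_def\<close>)
 then show "x = y" by auto
qed

lemma n1_pdisc: "finite J ==> y \<in> cspace J ==> n1 J y < dl ==> y \<in> pdisc J 0 dl"
 unfolding pdisc_iff using n1_comp[of J _ y] by (auto intro: le_less_trans)

text \<open>
Since \<open>T\<close> has derivative zero in the unknown at the base point, it contracts in the unknown nearby; the iterates
are holomorphic in \<open>x\<close> and converge uniformly.
\<close>

lemma implicit_function:
 fixes T :: "'i cpoint => 'j cpoint => 'j cpoint"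
 assumes I: "finite I" and J: "finite J" and a: "a \<in> cspace I"
  and hT: "hmgerm (I <+> J) J (%w. T (w o Inl) (w o Inr)) (case_sum a 0)"
  and T0: "T a 0 = 0"
  and dT: "\<And>j k. j \<in> J ==> k \<in> J ==> pd (Inr k) (%w. T (w o Inl) (w o Inr) j) (case_sum a 0) = 0"
 shows "\<exists>U ep. open U & a \<in> U & ep > 0 & holom I J U (fixsol T) & fixsol T a = 0 &
  (\<forall>x\<in>U \<inter> cspace I. T x (fixsol T x) = fixsol T x & (\<forall>y\<in>pdisc J 0 ep. T x y = y --> y = fixsol T x))"
proof -
 let ?K = "I <+> J" and ?T = "%j w. T (w o Inl) (w o Inr) j" and ?a = "case_sum a (0::'j cpoint)"
 define \<eta> :: real where "\<eta> = 1 / (2 * (card J + 1))"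
 have \<eta>: "\<eta> > 0" "card J * \<eta> \<le> 1/2" by (auto simp: \<eta>_def field_simps)
 have K: "finite ?K" using I J by simp
 have aK: "?a \<in> cspace ?K" using a by simp
 obtain V where V: "open V" "?a \<in> V" and hV: "holom ?K J V (%w. T (w o Inl) (w o Inr))"
  using hT unfolding hmgerm_def by blast
 have hj: "holo ?K V (?T j)" if "j \<in> J" for j using hV that by (auto simp: holom_def)
 have "\<exists>W. open W & ?a \<in> W & (\<forall>w\<in>W \<inter> V \<inter> cspace ?K. \<forall>j\<in>J. \<forall>k\<in>J. cmod (pd (Inr k) (?T j) w) < \<eta>)"
 proof -
  have "\<forall>\<^sub>F w in at ?a within (V \<inter> cspace ?K). \<forall>j\<in>J. \<forall>k\<in>J. cmod (pd (Inr k) (?T j) w) < \<eta>"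
  proof (rule eventually_ball_finite[OF J], rule, rule eventually_ball_finite[OF J], rule)
   fix j k assume jk: "j \<in> J" "k \<in> J"
   have "holo ?K V (pd (Inr k) (?T j))" by (rule holo_partial[OF K V(1) hj]) (use jk in auto)
   then have "(pd (Inr k) (?T j) \<longlongrightarrow> pd (Inr k) (?T j) ?a) (at ?a within (V \<inter> cspace ?K))"
    unfolding holo_def continuous_on_def using V aK by blast
   then have "((%w. cmod (pd (Inr k) (?T j) w)) \<longlongrightarrow> 0) (at ?a within (V \<inter> cspace ?K))"
    using dT[OF jk] tendsto_norm_zero by fastforce
   then show "\<forall>\<^sub>F w in at ?a within (V \<inter> cspace ?K). cmod (pd (Inr k) (?T j) w) < \<eta>"
    using order_tendstoD(2) \<eta>(1) by blast
  qed
  then obtain W where W: "open W" "?a \<in> W" "\<forall>w\<in>W. w \<noteq> ?a --> w \<in> V \<inter> cspace ?K --> (\<forall>j\<in>J. \<forall>k\<in>J. cmod (pd (Inr k) (?T j) w) < \<eta>)"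
   unfolding eventually_at_topological by blast
  show ?thesis
  proof (intro exI[of _ W] conjI ballI)
   fix w j k assume "w \<in> W \<inter> V \<inter> cspace ?K" "j \<in> J" "k \<in> J"
   then show "cmod (pd (Inr k) (?T j) w) < \<eta>" using W(3) dT \<eta>(1) by (cases "w = ?a") auto
  qed (use W in auto)
 qed
 then obtain W where W: "open W" "?a \<in> W" "\<And>w j k. w \<in> W ==> w \<in> V ==> w \<in> cspace ?K ==> j \<in> J ==> k \<in> J ==> cmod (pd (Inr k) (?T j) w) < \<eta>"
  by blast
 obtain dl where dl: "dl > 0" "pdisc ?K ?a dl \<subseteq> V \<inter> W"
  using open_pdisc_subset[OF K, of "V \<inter> W" ?a] V W aK by auto
 have inV: "case_sum x y \<in> V" if "x \<in> pdisc I a dl" "y \<in> pdisc J 0 dl" for x y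
  using dl(2) that by (auto simp: subset_iff)
 have TJ: "T x y \<in> cspace J" if "x \<in> pdisc I a dl" "y \<in> pdisc J 0 dl" for x y
 proof -
  have "case_sum x y \<in> V \<inter> cspace ?K" using inV[OF that] that by (auto simp: pdisc_iff)
  then have "T (case_sum x y o Inl) (case_sum x y o Inr) \<in> cspace J" using hV unfolding holom_def by blast
  then show ?thesis by simp
 qed
 have contr1: "cmod (T x y j - T x y' j) \<le> \<eta> * n1 J (y - y')"
  if x: "x \<in> pdisc I a dl" and y: "y \<in> pdisc J 0 dl" "y' \<in> pdisc J 0 dl" and j: "j \<in> J" for x y y' j
 proof -
  define gm where "gm s = case_sum x (%k. y' k + s * (y k - y' k))" for s :: complex
  let ?S = "closed_segment 0 (1::complex)"
  have gmS: "(%k. y' k + s * (y k - y' k)) \<in> pdisc J 0 dl" if s: "s \<in> ?S" for s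
  proof -
   obtain u :: real where u: "s = of_real u" "0 \<le> u" "u \<le> 1" using s by (auto simp: in_segment scaleR_conv_of_real)
   have "cmod (y' k + s * (y k - y' k)) < dl" if k: "k \<in> J" for k
   proof -
    have b: "y k \<in> ball 0 dl" "y' k \<in> ball 0 dl" using y k by (auto simp: pdisc_iff)
    have "(1 - u) *\<^sub>R y' k + u *\<^sub>R y k \<in> ball 0 dl"
     by (rule convexD[OF convex_ball]) (use b u in auto)
    moreover have "y' k + s * (y k - y' k) = (1 - u) *\<^sub>R y' k + u *\<^sub>R y k"
     by (simp add: u(1) scaleR_conv_of_real algebra_simps)
    ultimately show ?thesis by simp
   qed
   then show ?thesis using y by (auto simp: pdisc_iff cspace_def)
  qed
  define g :: "('i + 'j) => complex" where "g = case_sum (%_. 0) (y - y')"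
  have d: "((%s. ?T j (gm s)) has_field_derivative (\<Sum>m\<in>?K. pd m (?T j) (gm s) * g m)) (at s)" if s: "s \<in> ?S" for s
  proof (rule holo_chain_DERIV[OF K V(1) hj[OF j]])
   show "gm s \<in> V" using inV x gmS[OF s] by (simp add: gm_def)
   show "gm t \<in> cspace ?K" for t using x y by (auto simp: gm_def pdisc_iff) (auto simp: cspace_def)
   show "((%t. gm t m) has_field_derivative g m) (at s)" for m
    by (cases m) (auto simp: gm_def g_def intro!: derivative_eq_intros)
  qed
  have "cmod (?T j (gm 1) - ?T j (gm 0)) \<le> \<eta> * n1 J (y - y') * cmod (1 - 0)"
  proof (rule field_differentiable_bound[OF convex_closed_segment, of 0 1 _ "%s. (\<Sum>m\<in>?K. pd m (?T j) (gm s) * g m)"])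
   fix s :: complex assume s: "s \<in> ?S"
   have "gm s \<in> pdisc ?K ?a dl" unfolding gm_def pdisc_case_sum using x gmS[OF s] by simp
   then have g: "gm s \<in> W" "gm s \<in> V" "gm s \<in> cspace ?K"
    using dl(2) by (auto simp: pdisc_iff)
   have "(\<Sum>m\<in>?K. pd m (?T j) (gm s) * g m) = (\<Sum>k\<in>J. pd (Inr k) (?T j) (gm s) * (y - y') k)"
    using I J by (simp add: sum.Plus g_def)
   also have "cmod \<dots> \<le> (\<Sum>k\<in>J. \<eta> * cmod ((y - y') k))"
    by (rule sum_norm_le) (auto simp: norm_mult intro!: mult_right_mono less_imp_le[OF W(3)] g j)
   finally show "cmod (\<Sum>m\<in>?K. pd m (?T j) (gm s) * g m) \<le> \<eta> * n1 J (y - y')"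
    by (simp add: n1_def sum_distrib_left)
  qed (rule has_field_derivative_at_within[OF d], simp_all)
  then show ?thesis by (simp add: gm_def)
 qed
 have contr: "n1 J (T x y - T x y') \<le> 1/2 * n1 J (y - y')"
  if x: "x \<in> pdisc I a dl" and y: "y \<in> pdisc J 0 dl" "y' \<in> pdisc J 0 dl" for x y y'
 proof -
  have "n1 J (T x y - T x y') \<le> (\<Sum>j\<in>J. \<eta> * n1 J (y - y'))"
   unfolding n1_def[of J "T x y - T x y'"] by (rule sum_mono) (use contr1[OF x y] in auto)
  also have "\<dots> = (card J * \<eta>) * n1 J (y - y')" by simp
  also have "\<dots> \<le> 1/2 * n1 J (y - y')" by (intro mult_right_mono \<eta>) auto
  finally show ?thesis .
 qed
 have G0: "holom I ?K UNIV (%x. case_sum x (0::'j cpoint))"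
  unfolding holom_def ball_Plus by simp
 obtain U1 where U1: "open U1" "a \<in> U1" "\<And>x. x \<in> U1 ==> x \<in> cspace I ==> n1 J (T x 0) < dl/4"
 proof -
  obtain U2 where U2: "open U2" "a \<in> U2" "\<forall>x\<in>U2 \<inter> cspace I. case_sum x (0::'j cpoint) \<in> V"
   using open_vimage_germ[OF G0 open_UNIV V(1) UNIV_I a V(2)] by blast
  have "holom I J U2 (%x. T x 0)" unfolding holom_def
  proof (intro conjI ballI)
   fix j assume "j \<in> J"
   then show "holo I U2 (%x. T x 0 j)"
    using holo_compose[OF K U2(1) V(1) hj[of j] holom_subset[OF G0, of U2]] U2 by simp
  next
   fix z assume "z \<in> U2 \<inter> cspace I"
   then have "case_sum z (0::'j cpoint) \<in> V \<inter> cspace ?K" using U2 by simp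
   with hV have "T (case_sum z (0::'j cpoint) o Inl) (case_sum z (0::'j cpoint) o Inr) \<in> cspace J" unfolding holom_def by blast
   then show "T z 0 \<in> cspace J" by simp
  qed
  moreover have "open (n1 J -` {..<dl/4})"
   by (rule open_vimage) (auto simp: n1_def intro!: continuous_intros continuous_on_product_coordinates)
  moreover have "T a 0 \<in> n1 J -` {..<dl/4}" using T0 dl by (simp add: n1_def)
  ultimately show ?thesis using open_vimage_germ[of I J U2 "%x. T x 0" "n1 J -` {..<dl/4}" a] U2 a that by auto
 qed
 define U where "U = U1 \<inter> pbox I a dl"
 have U: "open U" "a \<in> U" using U1 dl open_pbox[OF I] by (auto simp: U_def)
 have Ux: "x \<in> pdisc I a dl" "n1 J (T x 0) \<le> dl/4" if "x \<in> U" "x \<in> cspace I" for x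
  using that U1(3)[of x] by (auto simp: U_def pdisc_def)
 define Y where "Y n x = ((T x) ^^ n) 0" for n :: nat and x :: "'i cpoint"
 have Y0: "Y 0 x = 0" and YS: "Y (Suc n) x = T x (Y n x)" for n :: nat and x :: "'i cpoint" by (auto simp: Y_def)
 have step: "Y n x \<in> cspace J & n1 J (Y n x) \<le> (1 - (1/2)^n) * (dl/2) & Y (Suc n) x \<in> cspace J & n1 J (Y (Suc n) x - Y n x) \<le> (1/2)^n * (dl/4)"
  if x: "x \<in> U" "x \<in> cspace I" for n :: nat and x :: "'i cpoint"
 proof (induction n)
  case 0
  have 1: "T x 0 \<in> cspace J" using TJ[OF Ux(1)[OF x]] dl by (auto simp: pdisc_iff)
  have 2: "T x 0 - 0 = T x 0" by (auto simp: fun_eq_iff)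
  have 3: "n1 J (0::'j cpoint) = 0" by (simp add: n1_def)
  have 4: "n1 J (Y 0 x) \<le> (1 - (1/2)^0) * (dl/2)" unfolding Y0 3 by simp
  have 5: "n1 J (Y (Suc 0) x - Y 0 x) \<le> (1/2)^0 * (dl/4)" unfolding YS Y0 2 using Ux(2)[OF x] by simp
  have 6: "Y 0 x \<in> cspace J" "Y (Suc 0) x \<in> cspace J" unfolding YS Y0 using 1 by auto
  show ?case using 4 5 6 by blast
 next
  case (Suc n)
  have zz: "y - 0 = y" for y :: "'j cpoint" by (auto simp: fun_eq_iff)
  have hy: "Y n x \<in> cspace J" "n1 J (Y n x) \<le> (1 - (1/2)^n) * (dl/2)" "Y (Suc n) x \<in> cspace J"
   "n1 J (Y (Suc n) x - Y n x) \<le> (1/2)^n * (dl/4)" using Suc by blast+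
  have "n1 J (Y (Suc n) x) \<le> n1 J (Y (Suc n) x - Y n x) + n1 J (Y n x)"
   using n1_triangle[of J "Y (Suc n) x" 0 "Y n x"] unfolding zz .
  moreover have "(1 - (1/2)^n) * (dl/2) + (1/2)^n * (dl/4) = (1 - (1/2)^Suc n) * (dl/2)" by (simp add: field_simps)
  ultimately have b: "n1 J (Y (Suc n) x) \<le> (1 - (1/2)^Suc n) * (dl/2)" using hy by linarith
  have lt: "(1 - (1/2)^k) * (dl/2) < dl" for k :: nat
  proof -
   have "(1/2::real)^k \<ge> 0" by simp
   then have "1 - (1/2::real)^k \<le> 1" by linarith
   then have "(1 - (1/2)^k) * (dl/2) \<le> 1 * (dl/2)" by (rule mult_right_mono) (use dl(1) in simp)
   then show ?thesis using dl(1) by linarith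
  qed
  have p: "Y n x \<in> pdisc J 0 dl" "Y (Suc n) x \<in> pdisc J 0 dl"
   using hy b lt[of n] lt[of "Suc n"] by (auto intro!: n1_pdisc[OF J] intro: le_less_trans simp del: power_Suc)
  have "n1 J (T x (Y (Suc n) x) - T x (Y n x)) \<le> 1/2 * n1 J (Y (Suc n) x - Y n x)"
   by (rule contr[OF Ux(1)[OF x] p(2,1)])
  then have "n1 J (Y (Suc (Suc n)) x - Y (Suc n) x) \<le> 1/2 * n1 J (Y (Suc n) x - Y n x)"
   by (simp only: YS)
  also have "\<dots> \<le> (1/2)^Suc n * (dl/4)" using hy(4) by simp
  finally have 4: "n1 J (Y (Suc (Suc n)) x - Y (Suc n) x) \<le> (1/2)^Suc n * (dl/4)" .
  have "Y (Suc (Suc n)) x \<in> cspace J" using TJ[OF Ux(1)[OF x] p(2)] by (simp only: YS)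
  then show ?case using hy(3) b 4 by blast
 qed
 have Yb: "n1 J (Y n x) \<le> dl/2" "Y n x \<in> pdisc J 0 dl" "Y n x \<in> cspace J" if x: "x \<in> U" "x \<in> cspace I" for n x
 proof -
  have "(1/2::real)^n \<ge> 0" by simp
  then have "1 - (1/2::real)^n \<le> 1" by linarith
  then have "(1 - (1/2)^n) * (dl/2) \<le> 1 * (dl/2)" by (rule mult_right_mono) (use dl(1) in simp)
  then show 1: "n1 J (Y n x) \<le> dl/2" using step[OF x, of n] by linarith
  show "Y n x \<in> pdisc J 0 dl" using step[OF x, of n] 1 dl(1) by (intro n1_pdisc[OF J]) auto
  show "Y n x \<in> cspace J" using step[OF x, of n] by simp
 qed
 have Yhol: "holom I J U (Y n)" for n
 proof (induction n)
  case 0 then show ?case unfolding holom_def Y0 by simp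
 next
  case (Suc n)
  have G: "holom I ?K U (%x. case_sum x (Y n x))" using Suc by (auto simp: holom_def)
  show ?case unfolding holom_def
  proof (intro conjI ballI)
   fix j assume j: "j \<in> J"
   show "holo I U (%x. Y (Suc n) x j)" unfolding YS
    using holo_compose[OF K U(1) V(1) hj[OF j] G] inV Ux Yb by simp
  qed (use step in blast)
 qed
 have ul: "uniform_limit (U \<inter> cspace I) (%n x. Y n x j) (%x. fixsol T x j) sequentially" for j
 proof -
  have b: "norm (Y (Suc n) x j - Y n x j) \<le> (1/2)^n * (dl/4)" if x: "x \<in> U \<inter> cspace I" for n x
  proof (cases "j \<in> J")
   case True
   then show ?thesis using n1_comp[OF J True, of "Y (Suc n) x - Y n x"] step[of x n] x by auto
  next
   case False
   then have "Y (Suc n) x j = 0" "Y n x j = 0" using step[of x n] x by (auto simp: cspace_def)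
   then show ?thesis using dl by simp
  qed
  have sm: "summable (%n. (1/2)^n * (dl/4))" by (intro summable_mult2 summable_geometric) auto
  have u: "uniform_limit (U \<inter> cspace I) (%n x. \<Sum>k<n. Y (Suc k) x j - Y k x j) (%x. \<Sum>k. Y (Suc k) x j - Y k x j) sequentially"
   by (rule Weierstrass_m_test[where M="%n. (1/2)^n * (dl/4)"]) (rule b, assumption, rule sm)
  have eq: "(\<Sum>k<n. Y (Suc k) x j - Y k x j) = Y n x j" for n x
   using sum_lessThan_telescope[of "%n. Y n x j" n] by (simp add: Y0)
  have fs: "(\<Sum>k. Y (Suc k) x j - Y k x j) = fixsol T x j" if x: "x \<in> U \<inter> cspace I" for x
  proof -
   have "(%n. Y n x j) \<longlonglongrightarrow> (\<Sum>k. Y (Suc k) x j - Y k x j)"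
    using tendsto_uniform_limitI[OF u x] unfolding eq .
   then show ?thesis by (simp add: fixsol_def limI Y_def)
  qed
  have "uniform_limit (U \<inter> cspace I) (%n x. \<Sum>k<n. Y (Suc k) x j - Y k x j) (%x. \<Sum>k. Y (Suc k) x j - Y k x j) sequentially
   \<longleftrightarrow> uniform_limit (U \<inter> cspace I) (%n x. Y n x j) (%x. fixsol T x j) sequentially"
   by (rule uniform_limit_cong') (rule eq, erule fs)
  with u show ?thesis by simp
 qed
 have lim: "(%n. Y n x j) \<longlonglongrightarrow> fixsol T x j" if "x \<in> U" "x \<in> cspace I" for x j
  by (rule tendsto_uniform_limitI[OF ul]) (use that in simp)
 have Fc: "fixsol T x \<in> cspace J" if x: "x \<in> U" "x \<in> cspace I" for x
 proof -
  have "fixsol T x j = 0" if "j \<notin> J" for j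
  proof -
   have "Y n x j = 0" for n using Yb(3)[OF x] that by (auto simp: cspace_def)
   then show ?thesis using lim[OF x, of j] by (simp add: LIMSEQ_const_iff)
  qed
  then show ?thesis by (simp add: cspace_def)
 qed
 have nlim: "(%n. n1 J (fixsol T x - Y n x)) \<longlonglongrightarrow> 0" if x: "x \<in> U" "x \<in> cspace I" for x
 proof -
  have "(%n. \<Sum>j\<in>J. cmod (fixsol T x j - Y n x j)) \<longlonglongrightarrow> (\<Sum>j\<in>J. cmod (fixsol T x j - fixsol T x j))"
   by (intro tendsto_intros lim x)
  then show ?thesis by (simp add: n1_def)
 qed
 have Fd: "fixsol T x \<in> pdisc J 0 dl" if x: "x \<in> U" "x \<in> cspace I" for x
 proof -
  have "(%n. \<Sum>j\<in>J. cmod (Y n x j)) \<longlonglongrightarrow> (\<Sum>j\<in>J. cmod (fixsol T x j))"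
   by (intro tendsto_intros lim x)
  then have "n1 J (fixsol T x) \<le> dl/2" unfolding n1_def
   by (rule LIMSEQ_le_const2) (use Yb(1)[OF x] in \<open>auto simp: n1_def\<close>)
  then show ?thesis using dl by (intro n1_pdisc[OF J Fc[OF x]]) auto
 qed
 have fixp: "T x (fixsol T x) = fixsol T x" if x: "x \<in> U" "x \<in> cspace I" for x
 proof
  fix j show "T x (fixsol T x) j = fixsol T x j"
  proof (cases "j \<in> J")
   case True
   have "cmod (T x (fixsol T x) j - Y (Suc n) x j) \<le> n1 J (fixsol T x - Y n x)" for n
    using n1_comp[OF J True, of "T x (fixsol T x) - T x (Y n x)"] contr[OF Ux(1)[OF x] Fd[OF x] Yb(2)[OF x, of n]]
     n1_nonneg[of J "fixsol T x - Y n x"] unfolding YS fun_diff_def by linarith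
   then have "(%n. T x (fixsol T x) j - Y (Suc n) x j) \<longlonglongrightarrow> 0"
    by (intro Lim_null_comparison[OF _ nlim[OF x]] always_eventually) auto
   then have "(%n. T x (fixsol T x) j - (T x (fixsol T x) j - Y (Suc n) x j)) \<longlonglongrightarrow> T x (fixsol T x) j - 0"
    by (intro tendsto_intros)
   then have "(%n. Y (Suc n) x j) \<longlonglongrightarrow> T x (fixsol T x) j" by simp
   then show ?thesis using LIMSEQ_unique LIMSEQ_Suc[OF lim[OF x, of j]] by blast
  next
   case False
   then show ?thesis using TJ[OF Ux(1)[OF x] Fd[OF x]] Fc[OF x] by (auto simp: cspace_def)
  qed
 qed
 have uniq: "y = fixsol T x" if x: "x \<in> U" "x \<in> cspace I" and y: "y \<in> pdisc J 0 dl" "T x y = y" for x y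
 proof (rule n1_zero[OF J])
  have "n1 J (y - fixsol T x) \<le> 1/2 * n1 J (y - fixsol T x)"
   using contr[OF Ux(1)[OF x] y(1) Fd[OF x]] y(2) fixp[OF x] by simp
  then show "n1 J (y - fixsol T x) \<le> 0" by simp
 qed (use y Fc[OF x] in \<open>auto simp: pdisc_iff\<close>)
 have "holom I J U (fixsol T)" unfolding holom_def
  using Fc holo_uniform_limit[OF U(1) _ ul] Yhol by (auto simp: holom_def)
 moreover have "fixsol T a = 0" using uniq[OF U(2) a, of 0] T0 dl(1) by (auto simp: pdisc_iff)
 ultimately show ?thesis using U dl(1) fixp uniq by (intro exI[of _ U] exI[of _ dl]) auto
qed

section \<open>Linear algebra in coordinate spaces\<close>

definition smul :: "complex => 'i cpoint => 'i cpoint" where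
 "smul c f = (%i. c * f i)"

interpretation fvs: vector_space "smul :: complex => 'i cpoint => 'i cpoint"
 by unfold_locales (auto simp: smul_def fun_eq_iff algebra_simps)

interpretation cvs: vector_space "(*) :: complex => complex => complex"
 by unfold_locales (auto simp: algebra_simps)

interpretation fcp: vector_space_pair "smul :: complex => 'i cpoint => 'i cpoint" "(*) :: complex => complex => complex"
 by unfold_locales

interpretation ffp: vector_space_pair "smul :: complex => 'i cpoint => 'i cpoint" "smul :: complex => 'j cpoint => 'j cpoint"
 by unfold_locales

lemma sum_fun_apply: "(\<Sum>a\<in>A. f a) x = (\<Sum>a\<in>A. f a x)"
 by (induction A rule: infinite_finite_induct) auto

lemma subspace_cspace: "fvs.subspace (cspace A)"
 by (auto simp: fvs.subspace_def cspace_def smul_def)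

definition unit_at :: "'i => 'i cpoint" where "unit_at a = (%i. if i = a then 1 else 0)"

lemma cspace_expand:
 assumes "finite A" "v \<in> cspace A"
 shows "v = (\<Sum>a\<in>A. smul (v a) (unit_at a))"
proof
 fix i
 have "(\<Sum>a\<in>A. v a * (if i = a then 1 else 0)) = (if i \<in> A then v i else 0)"
  using assms(1) by (simp add: if_distrib[of "(*) _"] cong: if_cong)
 then show "v i = (\<Sum>a\<in>A. smul (v a) (unit_at a)) i" using assms(2)
  by (auto simp: sum_fun_apply smul_def unit_at_def cspace_def)
qed

lemma cspace_span: "finite A ==> cspace A \<subseteq> fvs.span (unit_at ` A)"
proof
 fix v assume A: "finite A" and v: "v \<in> cspace A"
 have "(\<Sum>a\<in>A. smul (v a) (unit_at a)) \<in> fvs.span (unit_at ` A)"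
  by (rule fvs.span_sum, rule fvs.span_scale, rule fvs.span_base) simp
 then show "v \<in> fvs.span (unit_at ` A)" using cspace_expand[OF A v] by simp
qed

lemma indep_cspace_finite: "finite A ==> S \<subseteq> cspace A ==> fvs.independent S ==> finite S"
 using fvs.independent_span_bound[of "unit_at ` A" S] cspace_span by blast

lemma indep_card_le_dim:
 assumes "finite A" "V \<subseteq> cspace A" "S \<subseteq> V" "fvs.independent S"
 shows "card S \<le> fvs.dim V"
proof -
 obtain B where B: "B \<subseteq> V" "fvs.independent B" "V \<subseteq> fvs.span B" "card B = fvs.dim V" by (rule fvs.basis_exists)
 have "finite B" using indep_cspace_finite[OF assms(1) _ B(2)] B(1) assms(2) by blast
 then show ?thesis using fvs.independent_span_bound[OF _ assms(4), of B] B assms(3) by auto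
qed

lemma dim_subset_cspace:
 assumes "finite A" "W \<subseteq> cspace A" "V \<subseteq> W" shows "fvs.dim V \<le> fvs.dim W"
proof -
 obtain B where B: "B \<subseteq> V" "fvs.independent B" "card B = fvs.dim V" by (metis fvs.basis_exists)
 then show ?thesis using indep_card_le_dim[OF assms(1,2), of B] assms by auto
qed

lemma span_if_dim_le:
 assumes "finite A" "V \<subseteq> cspace A" "S \<subseteq> V" "fvs.independent S" "fvs.dim V \<le> card S"
 shows "V \<subseteq> fvs.span S"
proof
 fix x assume x: "x \<in> V"
 have fS: "finite S" using indep_cspace_finite[OF assms(1)] assms by blast
 show "x \<in> fvs.span S"
 proof (rule ccontr)
  assume n: "x \<notin> fvs.span S"
  then have "fvs.independent (insert x S)" by (rule fvs.independent_insertI[OF _ assms(4)])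
  moreover have "x \<notin> S" using n fvs.span_base[of x S] by blast
  ultimately show False using indep_card_le_dim[OF assms(1,2), of "insert x S"] x assms fS by auto
 qed
qed

lemma dim_le_dim_cspace: "finite A ==> V \<subseteq> cspace A ==> fvs.dim V \<le> card A"
 using fvs.dim_le_card[of V "unit_at ` A"] cspace_span[of A] card_image_le[of A unit_at] by fastforce

text \<open>
Linear functionals taking the values of a dual basis, written as coefficient vectors so that they can be applied to
perturbed families.
\<close>

lemma dual_family:
 assumes A: "finite A" and S: "fvs.independent S" "S \<subseteq> cspace A"
 shows "\<exists>\<phi>. \<forall>u\<in>S. \<forall>v\<in>S. (\<Sum>a\<in>A. \<phi> u a * v a) = (if u = v then 1 else (0::complex))"
proof -
 have "\<exists>g. Vector_Spaces.linear smul (*) g & (\<forall>x\<in>S. g x = (if u = x then 1 else 0))" for u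
  using fcp.linear_independent_extend[OF S(1), of "%x. if u = x then 1 else 0"] by blast
 then obtain g where g: "\<And>u. Vector_Spaces.linear smul (*) (g u)" "\<And>u x. x \<in> S ==> g u x = (if u = x then 1 else (0::complex))"
  by metis
 have "(\<Sum>a\<in>A. g u (unit_at a) * v a) = g u v" if v: "v \<in> S" for u v
 proof -
  interpret Vector_Spaces.linear smul "(*)" "g u" by (rule g)
  have "g u v = g u (\<Sum>a\<in>A. smul (v a) (unit_at a))" using cspace_expand[OF A] v S(2) by force
  then show ?thesis by (simp add: sum scale mult.commute)
 qed
 then show ?thesis using g(2) by (intro exI[of _ "%u a. g u (unit_at a)"]) simp
qed

lemma near_identity_bound:
 fixes M :: "'s => 's => complex" and \<eta> :: real
 assumes S: "finite S" and M: "\<And>u v. u \<in> S ==> v \<in> S ==> cmod (M u v - (if u = v then 1 else 0)) \<le> \<eta>" and \<eta>: "card S * \<eta> \<le> 1/2"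
 shows "(\<Sum>u\<in>S. cmod (gm u)) \<le> 2 * (\<Sum>u\<in>S. cmod (\<Sum>v\<in>S. M u v * gm v))"
  and "u \<in> S ==> cmod (gm u - (\<Sum>v\<in>S. M u v * gm v)) \<le> \<eta> * (\<Sum>u\<in>S. cmod (gm u))"
proof -
 show 1: "cmod (gm u - (\<Sum>v\<in>S. M u v * gm v)) \<le> \<eta> * (\<Sum>u\<in>S. cmod (gm u))" if u: "u \<in> S" for u
 proof -
  have "gm u = (\<Sum>v\<in>S. (if u = v then 1 else 0) * gm v)" using S u by (simp add: if_distrib[of "%x. x * _"] cong: if_cong)
  then have "cmod (gm u - (\<Sum>v\<in>S. M u v * gm v)) = cmod (\<Sum>v\<in>S. (M u v - (if u = v then 1 else 0)) * gm v)"
   by (subst norm_minus_commute) (simp add: sum_subtractf[symmetric] algebra_simps)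
  also have "\<dots> \<le> (\<Sum>v\<in>S. \<eta> * cmod (gm v))"
  proof (rule sum_norm_le)
   fix v assume "v \<in> S"
   show "cmod ((M u v - (if u = v then 1 else 0)) * gm v) \<le> \<eta> * cmod (gm v)"
    unfolding norm_mult by (rule mult_right_mono[OF M[OF u \<open>v \<in> S\<close>]]) simp
  qed
  finally show ?thesis by (simp add: sum_distrib_left)
 qed
 have "(\<Sum>u\<in>S. cmod (gm u)) \<le> (\<Sum>u\<in>S. cmod (\<Sum>v\<in>S. M u v * gm v) + \<eta> * (\<Sum>u\<in>S. cmod (gm u)))"
 proof (rule sum_mono)
  fix u assume "u \<in> S"
  show "cmod (gm u) \<le> cmod (\<Sum>v\<in>S. M u v * gm v) + \<eta> * (\<Sum>u\<in>S. cmod (gm u))"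
   using 1[OF \<open>u \<in> S\<close>] norm_triangle_sub[of "gm u" "\<Sum>v\<in>S. M u v * gm v"] by linarith
 qed
 also have "\<dots> = (\<Sum>u\<in>S. cmod (\<Sum>v\<in>S. M u v * gm v)) + (card S * \<eta>) * (\<Sum>u\<in>S. cmod (gm u))"
  by (simp add: sum.distrib)
 also have "\<dots> \<le> (\<Sum>u\<in>S. cmod (\<Sum>v\<in>S. M u v * gm v)) + 1/2 * (\<Sum>u\<in>S. cmod (gm u))"
  using \<eta> by (intro add_left_mono mult_right_mono) (auto simp: sum_nonneg)
 finally show "(\<Sum>u\<in>S. cmod (gm u)) \<le> 2 * (\<Sum>u\<in>S. cmod (\<Sum>v\<in>S. M u v * gm v))" by simp
qed

lemma family_independent:
 assumes S: "finite S" and e: "\<And>gm. (\<Sum>v\<in>S. smul (gm v) (e v)) = 0 ==> \<forall>v\<in>S. gm v = 0"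
 shows "inj_on e S" "fvs.independent (e ` S)"
proof -
 show inj: "inj_on e S"
 proof (rule inj_onI, rule ccontr)
  fix u v assume uv: "u \<in> S" "v \<in> S" "e u = e v" "u \<noteq> v"
  let ?gm = "%x. if x = u then 1 else if x = v then -1 else (0::complex)"
  have "(\<Sum>x\<in>S. smul (?gm x) (e x)) = (\<Sum>x\<in>{u,v}. smul (?gm x) (e x))"
   by (rule sum.mono_neutral_right) (use S uv in \<open>auto simp: smul_def fun_eq_iff\<close>)
  also have "\<dots> = 0" using uv by (auto simp: smul_def fun_eq_iff)
  finally show False using e[of ?gm] uv by auto
 qed
 show "fvs.independent (e ` S)"
 proof (rule fvs.independent_if_scalars_zero)
  fix f x assume *: "(\<Sum>x\<in>e ` S. smul (f x) x) = 0" "x \<in> e ` S"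
  then have "(\<Sum>v\<in>S. smul (f (e v)) (e v)) = 0" by (simp add: sum.reindex[OF inj] comp_def)
  from e[OF this] * show "f x = 0" by auto
 qed (use S in auto)
qed

text \<open>
The matrix of the dual functionals on the perturbed vectors is close to the identity, hence
diagonally dominant; the last clause is the resulting bound on coefficients.
\<close>

lemma independent_perturb:
 assumes A: "finite A" and S: "fvs.independent S" "S \<subseteq> cspace A"
 shows "\<exists>\<kappa>>0. \<exists>\<phi>. (\<forall>u\<in>S. \<forall>v\<in>S. (\<Sum>a\<in>A. \<phi> u a * v a) = (if u = v then 1 else (0::complex))) &
  (\<forall>e. (\<forall>v\<in>S. \<forall>a\<in>A. cmod (e v a - v a) < \<kappa>) -->
   inj_on e S & fvs.independent (e ` S) &
   (\<forall>gm. (\<Sum>u\<in>S. cmod (gm u)) \<le> 2 * (\<Sum>u\<in>S. cmod (\<Sum>v\<in>S. (\<Sum>a\<in>A. \<phi> u a * e v a) * gm v))))"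
proof -
 have fS: "finite S" using indep_cspace_finite[OF A S(2,1)] .
 obtain \<phi> where \<phi>: "\<And>u v. u \<in> S ==> v \<in> S ==> (\<Sum>a\<in>A. \<phi> u a * v a) = (if u = v then 1 else (0::complex))"
  using dual_family[OF A S] by blast
 define C where "C = (\<Sum>u\<in>S. \<Sum>a\<in>A. cmod (\<phi> u a))"
 have C: "C \<ge> 0" by (simp add: C_def sum_nonneg)
 define \<eta> :: real where "\<eta> = 1 / (2 * (card S + 1))"
 have \<eta>: "\<eta> > 0" "card S * \<eta> \<le> 1/2" by (auto simp: \<eta>_def field_simps)
 define \<kappa> where "\<kappa> = \<eta> / (C + 1)"
 have \<kappa>: "\<kappa> > 0" "C * \<kappa> \<le> \<eta>" using C \<eta> by (auto simp: \<kappa>_def field_simps)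
 have bound: "(\<Sum>u\<in>S. cmod (gm u)) \<le> 2 * (\<Sum>u\<in>S. cmod (\<Sum>v\<in>S. (\<Sum>a\<in>A. \<phi> u a * e v a) * gm v))"
  if e: "\<forall>v\<in>S. \<forall>a\<in>A. cmod (e v a - v a) < \<kappa>" for e and gm :: "'a cpoint => complex"
 proof (rule near_identity_bound[OF fS _ \<eta>(2)])
  fix u v assume uv: "u \<in> S" "v \<in> S"
  have "(\<Sum>a\<in>A. \<phi> u a * e v a) - (if u = v then 1 else 0) = (\<Sum>a\<in>A. \<phi> u a * (e v a - v a))"
   by (simp add: \<phi>[OF uv, symmetric] sum_subtractf[symmetric] algebra_simps)
  also have "cmod \<dots> \<le> (\<Sum>a\<in>A. cmod (\<phi> u a) * \<kappa>)"
  proof (rule sum_norm_le)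
   fix a assume "a \<in> A"
   then have "cmod (e v a - v a) \<le> \<kappa>" using e uv by (simp add: less_imp_le)
   then show "cmod (\<phi> u a * (e v a - v a)) \<le> cmod (\<phi> u a) * \<kappa>"
    unfolding norm_mult by (rule mult_left_mono) simp
  qed
  also have "\<dots> = (\<Sum>a\<in>A. cmod (\<phi> u a)) * \<kappa>" by (simp add: sum_distrib_right)
  also have "\<dots> \<le> C * \<kappa>" unfolding C_def using \<kappa>(1) uv fS
   by (intro mult_right_mono member_le_sum) (auto simp: sum_nonneg)
  finally show "cmod ((\<Sum>a\<in>A. \<phi> u a * e v a) - (if u = v then 1 else 0)) \<le> \<eta>" using \<kappa>(2) by simp
 qed
 have "inj_on e S & fvs.independent (e ` S)" if e: "\<forall>v\<in>S. \<forall>a\<in>A. cmod (e v a - v a) < \<kappa>" for e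
 proof -
  have "\<forall>v\<in>S. gm v = 0" if z: "(\<Sum>v\<in>S. smul (gm v) (e v)) = 0" for gm
  proof -
   have "(\<Sum>v\<in>S. (\<Sum>a\<in>A. \<phi> u a * e v a) * gm v) = (\<Sum>a\<in>A. \<phi> u a * (\<Sum>v\<in>S. smul (gm v) (e v)) a)" for u
    unfolding sum_fun_apply smul_def sum_distrib_left sum_distrib_right
    by (subst sum.swap) (simp add: algebra_simps)
   then have "(\<Sum>u\<in>S. cmod (gm u)) \<le> 0" using bound[OF e, of gm] z by simp
   then have "(\<Sum>u\<in>S. cmod (gm u)) = 0" by (simp add: sum_nonneg eq_iff)
   then show ?thesis using fS by (simp add: sum_nonneg_eq_0_iff)
  qed
  then show ?thesis using family_independent[OF fS, of e] by blast
 qed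
 then show ?thesis using \<kappa>(1) \<phi> bound by (intro exI[of _ \<kappa>] conjI exI[of _ \<phi>]) auto
qed

text \<open>
By the coefficient bound of \<open>independent_perturb\<close> the coefficients of \<open>w x\<close> differ by little from
the values of the dual functionals on \<open>w x\<close>, which converge.
\<close>

lemma span_closed_perturb:
 fixes e :: "'x => 'a cpoint => 'a cpoint"
 assumes A: "finite A" and S: "fvs.independent S" "S \<subseteq> cspace A" and F: "F \<noteq> bot"
  and e: "\<And>v a. v \<in> S ==> a \<in> A ==> ((%x. e x v a) \<longlongrightarrow> v a) F"
  and w: "\<forall>\<^sub>F x in F. w x \<in> fvs.span (e x ` S)"
  and wl: "\<And>a. a \<in> A ==> ((%x. w x a) \<longlongrightarrow> w0 a) F" and w0: "w0 \<in> cspace A"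
 shows "w0 \<in> fvs.span S"
proof -
 have fS: "finite S" using indep_cspace_finite[OF A S(2,1)] .
 obtain \<kappa> \<phi> where \<kappa>: "\<kappa> > 0" and \<phi>: "\<And>u v. u \<in> S ==> v \<in> S ==> (\<Sum>a\<in>A. \<phi> u a * v a) = (if u = v then 1 else (0::complex))"
  and b: "\<And>e gm. (\<forall>v\<in>S. \<forall>a\<in>A. cmod (e v a - v a) < \<kappa>) ==>
    inj_on e S & (\<Sum>u\<in>S. cmod (gm u)) \<le> 2 * (\<Sum>u\<in>S. cmod (\<Sum>v\<in>S. (\<Sum>a\<in>A. \<phi> u a * e v a) * gm v))"
  using independent_perturb[OF A S] by blast
 have near: "\<forall>\<^sub>F x in F. \<forall>v\<in>S. \<forall>a\<in>A. cmod (e x v a - v a) < \<kappa>"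
  using tendstoD[OF e \<kappa>] by (intro eventually_ball_finite fS A ballI) (auto simp: dist_norm)
 obtain gm where gm: "\<And>x. (\<forall>v\<in>S. \<forall>a\<in>A. cmod (e x v a - v a) < \<kappa>) ==> w x \<in> fvs.span (e x ` S) ==> w x = (\<Sum>v\<in>S. smul (gm x v) (e x v))"
 proof -
  have "\<exists>gm. w x = (\<Sum>v\<in>S. smul (gm v) (e x v))" if n: "\<forall>v\<in>S. \<forall>a\<in>A. cmod (e x v a - v a) < \<kappa>" and s: "w x \<in> fvs.span (e x ` S)" for x
  proof -
   obtain c where "w x = (\<Sum>y\<in>e x ` S. smul (c y) y)"
    using s fvs.span_finite[OF finite_imageI[OF fS]] by auto
   then have "w x = (\<Sum>v\<in>S. smul (c (e x v)) (e x v))" using b[OF n] by (simp add: sum.reindex comp_def)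
   then show ?thesis by (intro exI[of _ "%v. c (e x v)"])
  qed
  then show ?thesis using that by metis
 qed
 define W where "W u x = (\<Sum>a\<in>A. \<phi> u a * w x a)" for u x
 define W0 where "W0 u = (\<Sum>a\<in>A. \<phi> u a * w0 a)" for u
 have Wl: "(W u \<longlongrightarrow> W0 u) F" for u unfolding W_def W0_def by (intro tendsto_intros wl)
 define M where "M u v x = (\<Sum>a\<in>A. \<phi> u a * e x v a)" for u v x
 have Ml: "(M u v \<longlongrightarrow> (if u = v then 1 else 0)) F" if "u \<in> S" "v \<in> S" for u v
  unfolding M_def \<phi>[OF that, symmetric] by (intro tendsto_intros e that)
 have ev: "\<forall>\<^sub>F x in F. w x = (\<Sum>v\<in>S. smul (gm x v) (e x v)) & (\<forall>u. (\<Sum>v\<in>S. M u v x * gm x v) = W u x) &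
   (\<Sum>u\<in>S. cmod (gm x u)) \<le> 2 * (\<Sum>u\<in>S. cmod (W u x))"
  using near w
 proof eventually_elim
  case (elim x)
  have 1: "w x = (\<Sum>v\<in>S. smul (gm x v) (e x v))" by (rule gm[OF elim])
  have 2: "(\<Sum>v\<in>S. M u v x * gm x v) = W u x" for u
   unfolding W_def M_def by (subst 1, unfold sum_fun_apply smul_def sum_distrib_left sum_distrib_right)
    (subst sum.swap, simp add: algebra_simps)
  from 1 2 show ?case using b[OF elim(1), of "gm x"] unfolding M_def[symmetric] by simp
 qed
 have Bf: "((%x. 2 * (\<Sum>u\<in>S. cmod (W u x))) \<longlongrightarrow> 2 * (\<Sum>u\<in>S. cmod (W0 u))) F" by (intro tendsto_intros Wl)
 have gml: "((%x. gm x u) \<longlongrightarrow> W0 u) F" if u: "u \<in> S" for u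
 proof -
  have "((%x. (\<Sum>v\<in>S. cmod (M u v x - (if u = v then 1 else 0))) * (2 * (\<Sum>u\<in>S. cmod (W u x)))) \<longlongrightarrow>
    (\<Sum>v\<in>S. cmod ((if u = v then 1 else 0) - (if u = v then 1 else 0))) * (2 * (\<Sum>u\<in>S. cmod (W0 u)))) F"
   by (intro tendsto_mult Bf tendsto_sum tendsto_norm tendsto_diff Ml tendsto_const u)
  then have z: "((%x. (\<Sum>v\<in>S. cmod (M u v x - (if u = v then 1 else 0))) * (2 * (\<Sum>u\<in>S. cmod (W u x)))) \<longlongrightarrow> 0) F" by simp
  have "\<forall>\<^sub>F x in F. norm (W u x - gm x u) \<le> (\<Sum>v\<in>S. cmod (M u v x - (if u = v then 1 else 0))) * (2 * (\<Sum>u\<in>S. cmod (W u x)))"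
   using ev
  proof eventually_elim
   case (elim x)
   have "gm x u = (\<Sum>v\<in>S. (if u = v then 1 else 0) * gm x v)" using fS u by (simp add: if_distrib[of "%x. x * _"] cong: if_cong)
   moreover have "W u x = (\<Sum>v\<in>S. M u v x * gm x v)" using elim by simp
   ultimately have "W u x - gm x u = (\<Sum>v\<in>S. (M u v x - (if u = v then 1 else 0)) * gm x v)"
    by (simp add: sum_subtractf[symmetric] algebra_simps)
   also have "cmod \<dots> \<le> (\<Sum>v\<in>S. cmod (M u v x - (if u = v then 1 else 0)) * (\<Sum>u\<in>S. cmod (gm x u)))"
    by (rule sum_norm_le) (use fS in \<open>auto simp: norm_mult intro!: mult_left_mono member_le_sum\<close>)
   also have "\<dots> = (\<Sum>v\<in>S. cmod (M u v x - (if u = v then 1 else 0))) * (\<Sum>u\<in>S. cmod (gm x u))" by (simp add: sum_distrib_right)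
   also have "\<dots> \<le> (\<Sum>v\<in>S. cmod (M u v x - (if u = v then 1 else 0))) * (2 * (\<Sum>u\<in>S. cmod (W u x)))"
    using elim by (intro mult_left_mono) (auto simp: sum_nonneg)
   finally show ?case .
  qed
  then have "((%x. W u x - gm x u) \<longlongrightarrow> 0) F" by (rule Lim_null_comparison[OF _ z])
  then have "((%x. W u x - (W u x - gm x u)) \<longlongrightarrow> W0 u - 0) F" by (intro tendsto_diff Wl)
  then show ?thesis by simp
 qed
 have "w0 = (\<Sum>v\<in>S. smul (W0 v) v)"
 proof
  fix a show "w0 a = (\<Sum>v\<in>S. smul (W0 v) v) a"
  proof (cases "a \<in> A")
   case True
   have "((%x. \<Sum>v\<in>S. gm x v * e x v a) \<longlongrightarrow> (\<Sum>v\<in>S. W0 v * v a)) F"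
    by (intro tendsto_intros gml e True)
   moreover have "\<forall>\<^sub>F x in F. (\<Sum>v\<in>S. gm x v * e x v a) = w x a"
    using ev
   proof eventually_elim
    case (elim x)
    then have "w x a = (\<Sum>v\<in>S. smul (gm x v) (e x v)) a" by simp
    then show ?case by (simp add: sum_fun_apply smul_def)
   qed
   ultimately have "((%x. w x a) \<longlongrightarrow> (\<Sum>v\<in>S. W0 v * v a)) F" using tendsto_cong by fastforce
   then show ?thesis using tendsto_unique[OF F wl[OF True]] by (simp add: sum_fun_apply smul_def)
  next
   case False
   then have "v a = 0" if "v \<in> S" for v using S(2) that by (auto simp: cspace_def)
   then have "(\<Sum>v\<in>S. W0 v * v a) = 0" by (intro sum.neutral) simp
   then show ?thesis using w0 False by (simp add: sum_fun_apply smul_def cspace_def)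
  qed
 qed
 moreover have "(\<Sum>v\<in>S. smul (W0 v) v) \<in> fvs.span S"
  by (rule fvs.span_sum, rule fvs.span_scale, erule fvs.span_base)
 ultimately show ?thesis by simp
qed

section \<open>Tangent spaces of images and Lie brackets\<close>

definition dimage :: "'k set => ('k cpoint => 'a cpoint) => 'k cpoint => 'a cpoint set" where
 "dimage K \<Psi> t = differential K \<Psi> t ` cspace K"

lemma differential_add: "differential K \<Psi> t (a + b) = differential K \<Psi> t a + differential K \<Psi> t b"
 by (simp add: differential_def fun_eq_iff sum.distrib algebra_simps)

lemma differential_smul: "differential K \<Psi> t (smul c a) = smul c (differential K \<Psi> t a)"
 by (simp add: differential_def smul_def fun_eq_iff sum_distrib_left algebra_simps)

lemma subspace_dimage: "fvs.subspace (dimage K \<Psi> t)"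
proof -
 have "0 = differential K \<Psi> t 0" by (auto simp: differential_def fun_eq_iff)
 then show ?thesis unfolding fvs.subspace_def dimage_def
  using differential_add[of K \<Psi> t] differential_smul[of K \<Psi> t] subspace_cspace[of K]
  by (auto simp: fvs.subspace_def) (metis image_eqI)+
qed

lemma differential_cspace:
 assumes V: "open V" and \<Psi>: "holom K A V \<Psi>" and t: "t \<in> V" "t \<in> cspace K"
 shows "differential K \<Psi> t c \<in> cspace A"
 unfolding cspace_def
proof (safe)
 fix a assume a: "a \<notin> A"
 have "pd k (%z. \<Psi> z a) t = pd k (%z. 0) t" if "k \<in> K" for k
  by (rule partial_deriv_cong[OF V t that]) (use \<Psi> a in \<open>auto simp: holom_def cspace_def\<close>)
 then show "differential K \<Psi> t c a = 0" by (simp add: differential_def partial_deriv_def)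
qed

text \<open>
The Lie bracket of the vector fields with component functions \<open>P\<close> and \<open>Q\<close>.
\<close>

definition hbr :: "'a set => ('a cpoint => 'a cpoint) => ('a cpoint => 'a cpoint) => 'a cpoint => 'a cpoint" where
 "hbr A P Q x = differential A Q x (P x) - differential A P x (Q x)"

lemma holo_line_DERIV:
 assumes K: "finite K" and V: "open V" and F: "holo K V F" and t: "t \<in> V" "t \<in> cspace K" and a: "a \<in> cspace K"
 shows "((%s. F (t + smul s a)) has_field_derivative (\<Sum>k\<in>K. pd k F t * a k)) (at 0)"
proof -
 have "((%s. F (t + smul s a)) has_field_derivative (\<Sum>k\<in>K. pd k F (t + smul 0 a) * a k)) (at 0)"
  by (rule holo_chain_DERIV[OF K V F])
    (use t a in \<open>auto simp: smul_def cspace_def fun_eq_iff intro!: derivative_eq_intros\<close>,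
    simp add: plus_fun_def)
 then show ?thesis by (simp add: smul_def plus_fun_def)
qed

lemma continuous_line: "continuous_on UNIV (%s. t + smul s a)"
 by (rule continuous_on_coordinatewise_then_product) (auto simp: smul_def intro!: continuous_intros)

lemma eventually_line:
 assumes "open V" "t \<in> V" shows "\<forall>\<^sub>F s in at 0. t + smul s a \<in> V"
proof -
 have "open ((%s. t + smul s a) -` V)" by (rule open_vimage[OF assms(1) continuous_line])
 moreover have "t + smul 0 a = t" by (auto simp: smul_def fun_eq_iff)
 ultimately have "\<forall>\<^sub>F s in nhds 0. s \<in> (%s. t + smul s a) -` V" using assms(2) by (intro eventually_nhds_in_open) auto
 then show ?thesis by (auto simp: eventually_at_filter elim: eventually_mono)
qed

text \<open>
Along a line through \<open>t\<close> the rank stays maximal near \<open>t\<close>, so \<open>Q\<close> stays in the image of the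
differential there. Differentiating this relation, the part of the derivative in which the
coefficients vary is a limit of vectors in the moving images, hence lies in the image at \<open>t\<close>; the
other part is the second derivative of \<open>\<Psi>\<close>, which is subtracted.
\<close>

lemma bracket_half:
 assumes K: "finite K" and A: "finite A" and U: "open U" and \<Psi>: "holom K A U \<Psi>"
  and W: "open W" and Q: "holom A A W Q" and \<Psi>W: "\<And>t. t \<in> U ==> t \<in> cspace K ==> \<Psi> t \<in> W"
  and R: "\<And>t. t \<in> U ==> t \<in> cspace K ==> fvs.dim (dimage K \<Psi> t) \<le> R"
  and QT: "\<And>t. t \<in> U ==> t \<in> cspace K ==> fvs.dim (dimage K \<Psi> t) = R ==> Q (\<Psi> t) \<in> dimage K \<Psi> t"
  and t: "t \<in> U" "t \<in> cspace K" "fvs.dim (dimage K \<Psi> t) = R"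
  and a: "a \<in> cspace K" and b: "b \<in> cspace K" "Q (\<Psi> t) = differential K \<Psi> t b"
 shows "differential A Q (\<Psi> t) (differential K \<Psi> t a) -
   (%s. \<Sum>k\<in>K. \<Sum>l\<in>K. pd l (pd k (%z. \<Psi> z s)) t * b k * a l) \<in> dimage K \<Psi> t"
proof -
 let ?T = "%t. dimage K \<Psi> t"
 have TA: "?T t' \<subseteq> cspace A" if "t' \<in> U" "t' \<in> cspace K" for t'
  using differential_cspace[OF U \<Psi> that] by (auto simp: dimage_def)
 have h\<Psi>: "holo K U (%z. \<Psi> z s)" for s
 proof (cases "s \<in> A")
  case False
  then show ?thesis using \<Psi> by (intro holo_cong[OF U _ holo_const[of K U 0]]) (auto simp: holom_def cspace_def)
 qed (use \<Psi> in \<open>auto simp: holom_def\<close>)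
 obtain S where S: "S \<subseteq> ?T t" "fvs.independent S" "?T t \<subseteq> fvs.span S" "card S = fvs.dim (?T t)" by (rule fvs.basis_exists)
 have SA: "S \<subseteq> cspace A" using S(1) TA t by blast
 have fS: "finite S" by (rule indep_cspace_finite[OF A SA S(2)])
 obtain c where c: "\<And>v. v \<in> S ==> c v \<in> cspace K & v = differential K \<Psi> t (c v)"
 proof -
  have "\<exists>c. c \<in> cspace K & v = differential K \<Psi> t c" if "v \<in> S" for v
   using S(1) that unfolding dimage_def by blast
  then have "\<forall>v. \<exists>c. v \<in> S --> c \<in> cspace K & v = differential K \<Psi> t c" by blast
  then obtain c where "\<forall>v. v \<in> S --> c v \<in> cspace K & v = differential K \<Psi> t (c v)"
   using choice[of "%v c. v \<in> S --> c \<in> cspace K & v = differential K \<Psi> t c"] by blast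
  then show ?thesis by (intro that[of c]) simp
 qed
 define gm where "gm s = t + smul s a" for s
 have gm0: "gm 0 = t" by (auto simp: gm_def smul_def fun_eq_iff)
 have gmK: "gm s \<in> cspace K" for s using t a by (auto simp: gm_def smul_def cspace_def)
 have gmU: "\<forall>\<^sub>F s in at 0. gm s \<in> U" unfolding gm_def by (rule eventually_line[OF U t(1)])
 define e where "e s v = differential K \<Psi> (gm s) (c v)" for s v
 have hp: "holo K U (pd k (%z. \<Psi> z s))" if "k \<in> K" for k s
  by (rule holo_partial[OF K U h\<Psi> that])
 have el: "((%s. e s v i) \<longlongrightarrow> v i) (at 0)" if v: "v \<in> S" for v i
 proof -
  have "((%s. pd k (%z. \<Psi> z i) (gm s)) \<longlongrightarrow> pd k (%z. \<Psi> z i) t) (at 0)" if "k \<in> K" for k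
   using DERIV_isCont[OF holo_line_DERIV[OF K U hp[OF that] t(1,2) a]] gm0
   unfolding gm_def isCont_def by (simp add: smul_def plus_fun_def)
  then have "((%s. e s v i) \<longlongrightarrow> (\<Sum>k\<in>K. pd k (%z. \<Psi> z i) t * c v k)) (at 0)"
   unfolding e_def differential_def by (intro tendsto_intros) auto
  moreover have "v i = differential K \<Psi> t (c v) i" using c[OF v] by simp
  ultimately show ?thesis by (simp add: differential_def)
 qed
 obtain \<kappa> where \<kappa>: "\<kappa> > 0" "\<And>e. (\<forall>v\<in>S. \<forall>a\<in>A. cmod (e v a - v a) < \<kappa>) ==> inj_on e S & fvs.independent (e ` S)"
  using independent_perturb[OF A S(2) SA] by metis
 have near: "\<forall>\<^sub>F s in at 0. \<forall>v\<in>S. \<forall>i\<in>A. cmod (e s v i - v i) < \<kappa>"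
  using tendstoD[OF el \<kappa>(1)] by (intro eventually_ball_finite fS A ballI) (auto simp: dist_norm)
 have Tspan: "\<forall>\<^sub>F s in at 0. gm s \<in> U & fvs.dim (?T (gm s)) = R & ?T (gm s) \<subseteq> fvs.span (e s ` S)"
  using near gmU
 proof eventually_elim
  case (elim s)
  have i: "inj_on (e s) S" "fvs.independent (e s ` S)" using \<kappa>(2)[OF elim(1)] by auto
  have sub: "e s ` S \<subseteq> ?T (gm s)" using c by (auto simp: e_def dimage_def)
  have card: "card (e s ` S) = R" using card_image[OF i(1)] S(4) t(3) by simp
  have "R \<le> fvs.dim (?T (gm s))" using indep_card_le_dim[OF A TA[OF elim(2) gmK] sub i(2)] card by simp
  then have "fvs.dim (?T (gm s)) = R" using R[OF elim(2) gmK] by simp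
  moreover have "?T (gm s) \<subseteq> fvs.span (e s ` S)"
   by (rule span_if_dim_le[OF A TA[OF elim(2) gmK] sub i(2)]) (use R[OF elim(2) gmK] card in simp)
  ultimately show ?case using elim by simp
 qed
 define u where "u s = smul (inverse s) (Q (\<Psi> (gm s)) - differential K \<Psi> (gm s) b)" for s
 define u0 where "u0 = differential A Q (\<Psi> t) (differential K \<Psi> t a) -
   (%s. \<Sum>k\<in>K. \<Sum>l\<in>K. pd l (pd k (%z. \<Psi> z s)) t * b k * a l)"
 have "\<forall>\<^sub>F s in at 0. u s \<in> fvs.span (e s ` S)"
  using Tspan
 proof eventually_elim
  case (elim s)
  have "Q (\<Psi> (gm s)) \<in> ?T (gm s)" using QT elim gmK by blast
  moreover have "differential K \<Psi> (gm s) b \<in> ?T (gm s)" using b by (auto simp: dimage_def)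
  ultimately have "u s \<in> ?T (gm s)" unfolding u_def
   by (intro fvs.subspace_scale fvs.subspace_diff subspace_dimage)
  then show ?case using elim by blast
 qed
 moreover have "((%s. u s i) \<longlongrightarrow> u0 i) (at 0)" if i: "i \<in> A" for i
 proof -
  have hQ: "holo A W (%x. Q x i)" using Q i by (auto simp: holom_def)
  have hQ\<Psi>: "holo K U (%z. Q (\<Psi> z) i)" by (rule holo_compose[OF A U W hQ \<Psi> \<Psi>W])
  have 1: "((%s. Q (\<Psi> (gm s)) i) has_field_derivative (\<Sum>k\<in>K. pd k (%z. Q (\<Psi> z) i) t * a k)) (at 0)"
   unfolding gm_def by (rule holo_line_DERIV[OF K U hQ\<Psi> t(1,2) a])
  have "pd k (%z. Q (\<Psi> z) i) t = (\<Sum>j\<in>A. pd j (%x. Q x i) (\<Psi> t) * pd k (%z. \<Psi> z j) t)" if "k \<in> K" for k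
   by (rule partial_deriv_compose[OF A U W hQ \<Psi> t(1,2) \<Psi>W[OF t(1,2)] that])
  then have 2: "(\<Sum>k\<in>K. pd k (%z. Q (\<Psi> z) i) t * a k) = differential A Q (\<Psi> t) (differential K \<Psi> t a) i"
   unfolding differential_def by (simp add: sum_distrib_left sum_distrib_right algebra_simps) (subst sum.swap, simp)
  have 3: "((%s. differential K \<Psi> (gm s) b i) has_field_derivative (\<Sum>k\<in>K. (\<Sum>l\<in>K. pd l (pd k (%z. \<Psi> z i)) t * a l) * b k)) (at 0)"
   unfolding differential_def gm_def by (intro DERIV_sum DERIV_cmult_right holo_line_DERIV[OF K U hp t(1,2) a])
  have "((%s. Q (\<Psi> (gm s)) i - differential K \<Psi> (gm s) b i) has_field_derivative u0 i) (at 0)"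
   by (rule DERIV_cong[OF DERIV_diff[OF 1 3]])
     (unfold u0_def fun_diff_def 2[symmetric], simp add: sum_distrib_left sum_distrib_right mult_ac)
  then have "((%s. ((Q (\<Psi> (gm s)) i - differential K \<Psi> (gm s) b i) - (Q (\<Psi> (gm 0)) i - differential K \<Psi> (gm 0) b i)) / s) \<longlongrightarrow> u0 i) (at 0)"
   by (simp add: DERIV_def)
  moreover have "Q (\<Psi> (gm 0)) i - differential K \<Psi> (gm 0) b i = 0" using b(2) by (simp add: gm0)
  ultimately show ?thesis by (simp add: u_def smul_def divide_inverse mult.commute)
 qed
 moreover have "u0 \<in> cspace A"
 proof -
  have "differential A Q (\<Psi> t) (differential K \<Psi> t a) \<in> cspace A"
   by (rule differential_cspace[OF W Q \<Psi>W[OF t(1,2)]]) (use \<Psi> t in \<open>auto simp: holom_def\<close>)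
  moreover have "pd l (pd k (%z. \<Psi> z i)) t = 0" if "i \<notin> A" "k \<in> K" "l \<in> K" for i k l
  proof -
   have z: "pd k (%z. \<Psi> z i) z = 0" if z: "z \<in> U" "z \<in> cspace K" for z
   proof -
    have "pd k (%z. \<Psi> z i) z = pd k (%z. 0) z"
     by (rule partial_deriv_cong[OF U z \<open>k \<in> K\<close>]) (use \<Psi> \<open>i \<notin> A\<close> in \<open>auto simp: holom_def cspace_def\<close>)
    then show ?thesis by (simp add: partial_deriv_def)
   qed
   have "pd l (pd k (%z. \<Psi> z i)) t = pd l (%z. 0) t"
    by (rule partial_deriv_cong[OF U t(1,2) \<open>l \<in> K\<close>]) (use z in auto)
   then show ?thesis by (simp add: partial_deriv_def)
  qed
  ultimately show ?thesis by (auto simp: u0_def cspace_def)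
 qed
 ultimately have "u0 \<in> fvs.span S"
  by (intro span_closed_perturb[OF A S(2) SA, where F="at 0" and e=e and w=u]) (auto intro: el)
 then have "u0 \<in> ?T t" using fvs.span_minimal[OF S(1) subspace_dimage] by blast
 then show ?thesis unfolding u0_def .
qed

text \<open>
The second derivative terms of the two halves of the bracket agree, because mixed partial
derivatives commute, and cancel.
\<close>

lemma bracket_in_dimage:
 assumes K: "finite K" and A: "finite A" and U: "open U" and \<Psi>: "holom K A U \<Psi>"
  and W: "open W" and P: "holom A A W P" and Q: "holom A A W Q" and \<Psi>W: "\<And>t. t \<in> U ==> t \<in> cspace K ==> \<Psi> t \<in> W"
  and R: "\<And>t. t \<in> U ==> t \<in> cspace K ==> fvs.dim (dimage K \<Psi> t) \<le> R"
  and PT: "\<And>t. t \<in> U ==> t \<in> cspace K ==> fvs.dim (dimage K \<Psi> t) = R ==> P (\<Psi> t) \<in> dimage K \<Psi> t"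
  and QT: "\<And>t. t \<in> U ==> t \<in> cspace K ==> fvs.dim (dimage K \<Psi> t) = R ==> Q (\<Psi> t) \<in> dimage K \<Psi> t"
  and t: "t \<in> U" "t \<in> cspace K" "fvs.dim (dimage K \<Psi> t) = R"
 shows "hbr A P Q (\<Psi> t) \<in> dimage K \<Psi> t"
proof -
 obtain a b where ab: "a \<in> cspace K" "P (\<Psi> t) = differential K \<Psi> t a" "b \<in> cspace K" "Q (\<Psi> t) = differential K \<Psi> t b"
  using PT[OF t] QT[OF t] by (auto simp: dimage_def)
 let ?H = "%a b s. \<Sum>k\<in>K. \<Sum>l\<in>K. pd l (pd k (%z. \<Psi> z s)) t * b k * a l"
 have 1: "differential A Q (\<Psi> t) (P (\<Psi> t)) - ?H a b \<in> dimage K \<Psi> t"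
  unfolding ab(2) by (rule bracket_half[OF K A U \<Psi> W Q \<Psi>W R QT t ab(1,3,4)])
 have 2: "differential A P (\<Psi> t) (Q (\<Psi> t)) - ?H b a \<in> dimage K \<Psi> t"
  unfolding ab(4) by (rule bracket_half[OF K A U \<Psi> W P \<Psi>W R PT t ab(3,1,2)])
 have "?H a b s = ?H b a s" for s
 proof -
  have h: "holo K U (%z. \<Psi> z s)"
  proof (cases "s \<in> A")
   case False
   then show ?thesis using \<Psi> by (intro holo_cong[OF U _ holo_const[of K U 0]]) (auto simp: holom_def cspace_def)
  qed (use \<Psi> in \<open>auto simp: holom_def\<close>)
  have "?H a b s = (\<Sum>k\<in>K. \<Sum>l\<in>K. pd k (pd l (%z. \<Psi> z s)) t * b k * a l)"
   by (intro sum.cong refl) (simp add: holo_partial_commute[OF K U h _ _ t(1,2)])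
  also have "\<dots> = ?H b a s" by (subst sum.swap) (simp add: mult_ac)
  finally show ?thesis .
 qed
 then have "hbr A P Q (\<Psi> t) = (differential A Q (\<Psi> t) (P (\<Psi> t)) - ?H a b) - (differential A P (\<Psi> t) (Q (\<Psi> t)) - ?H b a)"
  by (simp add: hbr_def fun_eq_iff)
 then show ?thesis using fvs.subspace_diff[OF subspace_dimage 1 2] by simp
qed

section \<open>Smooth functions on complex coordinate space\<close>

abbreviation dirs :: "nat => (nat \<times> complex) set" where
 "dirs N \<equiv> {..<N} \<times> {1, \<i>}"

definition shift :: "nat => complex => nat cpoint => real => nat cpoint" where
 "shift j e Z t = Z(j := Z j + of_real t * e)"

lemma real_partial_shift: "real_partial j e f Z = vector_derivative (%t. f (shift j e Z t)) (at 0)"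
 by (simp add: real_partial_def shift_def)

lemma shift_0[simp]: "shift j e Z 0 = Z" by (simp add: shift_def)

lemma shift_Cn: "Z \<in> Cn N ==> j < N ==> shift j e Z t \<in> Cn N"
 by (auto simp: shift_def intro!: cspace_upd)

lemma continuous_shift: "continuous_on UNIV (shift j e Z)"
proof (rule continuous_on_coordinatewise_then_product)
 fix i show "continuous_on UNIV (%t. shift j e Z t i)"
  by (cases "i = j") (auto simp: shift_def intro!: continuous_intros)
qed

lemma eventually_shift: assumes "open U" "Z \<in> U" shows "\<forall>\<^sub>F t in nhds 0. shift j e Z t \<in> U"
proof -
 have "open (shift j e Z -` U)" by (rule open_vimage[OF assms(1) continuous_shift])
 moreover have "0 \<in> shift j e Z -` U" using assms by simp
 ultimately have "\<forall>\<^sub>F t in nhds 0. t \<in> shift j e Z -` U" by (intro eventually_nhds_in_open)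
 then show ?thesis by simp
qed

definition linediff :: "nat => nat cpoint set => (nat cpoint => complex) => bool" where
 "linediff N U f \<longleftrightarrow> continuous_on (U \<inter> Cn N) f &
   (\<forall>Z\<in>U \<inter> Cn N. \<forall>(j,e)\<in>dirs N. ((%t. f (shift j e Z t)) has_vector_derivative real_partial j e f Z) (at 0))"

definition smooth_on :: "nat => nat cpoint set => (nat cpoint => complex) => bool" where
 "smooth_on N U f \<longleftrightarrow> (\<forall>ds. set ds \<subseteq> dirs N --> linediff N U (iterated_partial ds f))"

lemma differentiable_real_partial:
 "(%t. f (Z(j := Z j + of_real t * e))) differentiable at (0::real) \<longleftrightarrow>
  ((%t. f (shift j e Z t)) has_vector_derivative real_partial j e f Z) (at 0)"
 unfolding real_partial_shift shift_def by (rule vector_derivative_works)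

lemma smooth_germ_iff: "smooth_germ N f p \<longleftrightarrow> (\<exists>U. open U & p \<in> U & smooth_on N U f)"
 unfolding smooth_germ_def smooth_on_def linediff_def differentiable_real_partial by auto

lemma real_partial_cong:
 assumes U: "open U" and Z: "Z \<in> U" "Z \<in> Cn N" and j: "j < N" and eq: "\<And>W. W \<in> U ==> W \<in> Cn N ==> f W = g W"
 shows "real_partial j e f Z = real_partial j e g Z"
  and "((%t. f (shift j e Z t)) has_vector_derivative D) (at 0) \<longleftrightarrow> ((%t. g (shift j e Z t)) has_vector_derivative D) (at 0)"
proof -
 have ev: "\<forall>\<^sub>F t in nhds 0. f (shift j e Z t) = g (shift j e Z t)"
  using eventually_shift[OF U Z(1), of j e] by (auto elim!: eventually_mono intro!: eq shift_Cn Z j)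
 show "real_partial j e f Z = real_partial j e g Z" unfolding real_partial_shift
  by (rule vector_derivative_cong_eq) (use ev in auto)
 show "((%t. f (shift j e Z t)) has_vector_derivative D) (at 0) \<longleftrightarrow> ((%t. g (shift j e Z t)) has_vector_derivative D) (at 0)"
  by (rule has_vector_derivative_cong_ev) (use ev Z eq in auto)
qed

lemma linediff_cong:
 assumes U: "open U" and eq: "\<And>W. W \<in> U ==> W \<in> Cn N ==> f W = g W" and f: "linediff N U f"
 shows "linediff N U g"
proof -
 have "continuous_on (U \<inter> Cn N) g" using f eq continuous_on_cong[of "U \<inter> Cn N" "U \<inter> Cn N" f g] by (auto simp: linediff_def)
 moreover have "((%t. g (shift j e Z t)) has_vector_derivative real_partial j e g Z) (at 0)"
  if "Z \<in> U \<inter> Cn N" "(j,e) \<in> dirs N" for Z j e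
 proof -
  have Z: "Z \<in> U" "Z \<in> Cn N" "j < N" using that by auto
  have "((%t. f (shift j e Z t)) has_vector_derivative real_partial j e f Z) (at 0)"
   using f that unfolding linediff_def by blast
  then have "((%t. g (shift j e Z t)) has_vector_derivative real_partial j e f Z) (at 0)"
   using real_partial_cong(2)[where f=f and g=g, OF U Z eq] by simp
  then show ?thesis using real_partial_cong(1)[where f=f and g=g and e=e, OF U Z eq] by simp
 qed
 ultimately show ?thesis unfolding linediff_def by blast
qed

text \<open>
A class of functions closed under taking real partial derivatives consists of smooth functions; this avoids
formulas for iterated partial derivatives of sums, products and compositions.
\<close>

lemma smooth_on_coinduct:
 assumes U: "open U" and f: "f \<in> C"
  and ld: "\<And>g. g \<in> C ==> linediff N U g"
  and pd: "\<And>g j e. g \<in> C ==> (j,e) \<in> dirs N ==> \<exists>h\<in>C. \<forall>Z\<in>U \<inter> Cn N. real_partial j e g Z = h Z"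
 shows "smooth_on N U f"
proof -
 have "set ds \<subseteq> dirs N ==> \<exists>h\<in>C. \<forall>Z\<in>U \<inter> Cn N. iterated_partial ds f Z = h Z" for ds
 proof (induction ds)
  case Nil then show ?case using f by auto
 next
  case (Cons d ds)
  obtain j e where d: "d = (j, e)" by force
  obtain h where h: "h \<in> C" "\<forall>Z\<in>U \<inter> Cn N. iterated_partial ds f Z = h Z" using Cons by auto
  obtain h' where h': "h' \<in> C" "\<forall>Z\<in>U \<inter> Cn N. real_partial j e h Z = h' Z" using pd[OF h(1), of j e] Cons.prems d by auto
  have "iterated_partial (d # ds) f Z = h' Z" if Z: "Z \<in> U \<inter> Cn N" for Z
   using real_partial_cong(1)[OF U _ _ _, of Z N j "iterated_partial ds f" h e] h h' Z Cons.prems d by auto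
  then show ?case using h'(1) by blast
 qed
 then show ?thesis unfolding smooth_on_def using ld linediff_cong[OF U] by (metis IntI)
qed

lemma smooth_on_linediff: "smooth_on N U f ==> linediff N U f"
 unfolding smooth_on_def by (metis empty_subsetI iterated_partial.simps(1) set_empty)

lemma iterated_partial_snoc: "iterated_partial ds (real_partial j e f) = iterated_partial (ds @ [(j,e)]) f"
 by (induction ds) auto

lemma smooth_on_partial: "smooth_on N U f ==> (j,e) \<in> dirs N ==> smooth_on N U (real_partial j e f)"
 unfolding smooth_on_def iterated_partial_snoc by auto

inductive_set smooth_alg :: "nat => nat cpoint set => (nat cpoint => complex) set" for N U where
 base: "smooth_on N U f ==> f \<in> smooth_alg N U"
| const: "(%Z. c) \<in> smooth_alg N U"
| add: "f \<in> smooth_alg N U ==> g \<in> smooth_alg N U ==> (%Z. f Z + g Z) \<in> smooth_alg N U"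
| mult: "f \<in> smooth_alg N U ==> g \<in> smooth_alg N U ==> (%Z. f Z * g Z) \<in> smooth_alg N U"

lemma linediffD: "linediff N U f ==> Z \<in> U ==> Z \<in> Cn N ==> (j,e) \<in> dirs N ==>
  ((%t. f (shift j e Z t)) has_vector_derivative real_partial j e f Z) (at 0)"
 unfolding linediff_def by blast

lemma real_partial_eqI: "((%t. f (shift j e Z t)) has_vector_derivative D) (at 0) ==> real_partial j e f Z = D"
 unfolding real_partial_shift by (rule vector_derivative_at)

lemma real_partial_const[simp]: "real_partial j e (%Z. c) Z = 0"
 by (rule real_partial_eqI) simp

lemma linediff_combine:
 assumes f: "linediff N U f" and g: "linediff N U g"
 shows "linediff N U (%Z. f Z + g Z)" "linediff N U (%Z. f Z * g Z)"
  and "Z \<in> U ==> Z \<in> Cn N ==> (j,e) \<in> dirs N ==> real_partial j e (%Z. f Z + g Z) Z = real_partial j e f Z + real_partial j e g Z"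
  and "Z \<in> U ==> Z \<in> Cn N ==> (j,e) \<in> dirs N ==> real_partial j e (%Z. f Z * g Z) Z = f Z * real_partial j e g Z + real_partial j e f Z * g Z"
proof -
 have a: "((%t. f (shift j e Z t) + g (shift j e Z t)) has_vector_derivative real_partial j e f Z + real_partial j e g Z) (at 0)"
   and m: "((%t. f (shift j e Z t) * g (shift j e Z t)) has_vector_derivative f Z * real_partial j e g Z + real_partial j e f Z * g Z) (at 0)"
   if "Z \<in> U" "Z \<in> Cn N" "(j,e) \<in> dirs N" for Z j e
  using has_vector_derivative_add[OF linediffD[OF f that] linediffD[OF g that]]
   has_vector_derivative_mult[OF linediffD[OF f that] linediffD[OF g that]] by auto
 note ap = real_partial_eqI[OF a] and mp = real_partial_eqI[OF m]
 show "Z \<in> U ==> Z \<in> Cn N ==> (j,e) \<in> dirs N ==> real_partial j e (%Z. f Z + g Z) Z = real_partial j e f Z + real_partial j e g Z"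
  and "Z \<in> U ==> Z \<in> Cn N ==> (j,e) \<in> dirs N ==> real_partial j e (%Z. f Z * g Z) Z = f Z * real_partial j e g Z + real_partial j e f Z * g Z"
  by (rule ap mp; assumption)+
 show "linediff N U (%Z. f Z + g Z)" "linediff N U (%Z. f Z * g Z)"
  using f g a m ap mp by (auto simp: linediff_def intro!: continuous_intros)
qed

lemma smooth_alg_props:
 assumes "f \<in> smooth_alg N U"
 shows "linediff N U f & (\<forall>(j,e)\<in>dirs N. \<exists>h\<in>smooth_alg N U. \<forall>Z\<in>U \<inter> Cn N. real_partial j e f Z = h Z)"
 using assms
proof induction
 case (base f)
 have "\<exists>h\<in>smooth_alg N U. \<forall>Z\<in>U \<inter> Cn N. real_partial j e f Z = h Z" if "(j,e) \<in> dirs N" for j e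
  by (rule bexI[OF _ smooth_alg.base[OF smooth_on_partial[OF base that]]]) simp
 then show ?case using smooth_on_linediff[OF base] by blast
next
 case (const c)
 show ?case using smooth_alg.const[of 0 N U] by (auto simp: linediff_def)
next
 case (add f g)
 have "\<exists>h\<in>smooth_alg N U. \<forall>Z\<in>U \<inter> Cn N. real_partial j e (%Z. f Z + g Z) Z = h Z" if je: "(j,e) \<in> dirs N" for j e
 proof -
  obtain h1 h2 where "h1 \<in> smooth_alg N U" "h2 \<in> smooth_alg N U"
   "\<forall>Z\<in>U \<inter> Cn N. real_partial j e f Z = h1 Z" "\<forall>Z\<in>U \<inter> Cn N. real_partial j e g Z = h2 Z" using add je by blast
  then show ?thesis using linediff_combine(3)[of N U f g] add je
   by (intro bexI[OF _ smooth_alg.add[of h1 N U h2]]) auto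
 qed
 then show ?case using add linediff_combine(1) by blast
next
 case (mult f g)
 have "\<exists>h\<in>smooth_alg N U. \<forall>Z\<in>U \<inter> Cn N. real_partial j e (%Z. f Z * g Z) Z = h Z" if je: "(j,e) \<in> dirs N" for j e
 proof -
  obtain h1 h2 where "h1 \<in> smooth_alg N U" "h2 \<in> smooth_alg N U"
   "\<forall>Z\<in>U \<inter> Cn N. real_partial j e f Z = h1 Z" "\<forall>Z\<in>U \<inter> Cn N. real_partial j e g Z = h2 Z" using mult je by blast
  then show ?thesis using linediff_combine(4)[of N U f g] mult je
   by (intro bexI[OF _ smooth_alg.add[OF smooth_alg.mult[of f N U h2] smooth_alg.mult[of h1 N U g]]]) auto
 qed
 then show ?case using mult linediff_combine(2) by blast
qed

lemma smooth_alg_smooth: assumes "open U" "f \<in> smooth_alg N U" shows "smooth_on N U f"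
 by (rule smooth_on_coinduct[OF assms]) (use smooth_alg_props in blast)+

lemma smooth_on_subset: assumes "smooth_on N U f" "W \<subseteq> U" shows "smooth_on N W f"
proof -
 have "linediff N W g" if "linediff N U g" for g
  using that assms(2) unfolding linediff_def by (metis (no_types, lifting) Int_mono continuous_on_subset order_refl subset_iff)
 then show ?thesis using assms(1) unfolding smooth_on_def by blast
qed

lemma smooth_germ_combine:
 assumes "smooth_germ N f p" "smooth_germ N g p"
 shows "smooth_germ N (%Z. f Z + g Z) p" "smooth_germ N (%Z. f Z * g Z) p"
proof -
 obtain U V where UV: "open U" "p \<in> U" "smooth_on N U f" "open V" "p \<in> V" "smooth_on N V g"
  using assms unfolding smooth_germ_iff by blast
 then have o: "open (U \<inter> V)" and f: "f \<in> smooth_alg N (U \<inter> V)" and g: "g \<in> smooth_alg N (U \<inter> V)"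
  by (auto intro!: smooth_alg.base intro: smooth_on_subset)
 show "smooth_germ N (%Z. f Z + g Z) p" "smooth_germ N (%Z. f Z * g Z) p"
  unfolding smooth_germ_iff using UV smooth_alg_smooth[OF o smooth_alg.add[OF f g]] smooth_alg_smooth[OF o smooth_alg.mult[OF f g]] o
  by blast+
qed

lemma smooth_germ_const[simp]: "smooth_germ N (%Z. c) p"
 unfolding smooth_germ_iff using smooth_alg_smooth[OF open_UNIV smooth_alg.const] by blast

lemma smooth_germ_sum: "(\<And>a. a \<in> A ==> smooth_germ N (f a) p) ==> smooth_germ N (%Z. \<Sum>a\<in>A. f a Z) p"
 by (induction A rule: infinite_finite_induct) (auto intro: smooth_germ_combine)

lemma smooth_germ_diff: "smooth_germ N f p ==> smooth_germ N g p ==> smooth_germ N (%Z. f Z - g Z) p"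
 using smooth_germ_combine(1)[OF _ smooth_germ_combine(2)[OF smooth_germ_const[of N "-1"]]] by force

lemma smooth_germ_partial: "smooth_germ N f p ==> (j,e) \<in> dirs N ==> smooth_germ N (real_partial j e f) p"
 unfolding smooth_germ_iff using smooth_on_partial by blast

lemma smooth_germ_tangent_apply:
 assumes "\<And>s. smooth_germ N (%Z. X Z s) p" "smooth_germ N f p"
 shows "smooth_germ N (%Z. tangent_apply N (X Z) f Z) p"
 unfolding tangent_apply_def divide_inverse
 by (intro smooth_germ_sum smooth_germ_combine smooth_germ_diff smooth_germ_const smooth_germ_partial assms) auto

definition cc :: "nat cpoint => (nat + nat) cpoint" where
 "cc Z = case_sum Z (cconj Z)"

abbreviation dbl :: "nat => (nat + nat) set" where
 "dbl N \<equiv> {..<N} <+> {..<N}"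

lemma cc_simps[simp]: "cc Z (Inl i) = Z i" "cc Z (Inr i) = cnj (Z i)" "cc Z o Inl = Z" "cc Z o Inr = cconj Z" "cc 0 = 0"
 by (auto simp: cc_def fun_eq_iff split: sum.splits)

lemma cc_dbl[simp]: "cc Z \<in> cspace (dbl N) \<longleftrightarrow> Z \<in> Cn N" by (simp add: cc_def)

lemma continuous_cc: "continuous_on S cc"
proof (rule continuous_on_coordinatewise_then_product)
 fix i :: "nat + nat" show "continuous_on S (%Z. cc Z i)"
  by (cases i) (auto intro!: continuous_intros continuous_on_subset[OF continuous_on_product_coordinates])
qed

lemma open_vimage_cc: "open V ==> open (cc -` V)" by (rule open_vimage[OF _ continuous_cc])

lemma cc_real_partial:
 assumes V: "open V" and F: "holo (dbl N) V F" and Z: "cc Z \<in> V" "Z \<in> Cn N" and j: "j < N"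
 shows "((%t. F (cc (shift j e Z t))) has_vector_derivative
   (pd (Inl j) F (cc Z) * e + pd (Inr j) F (cc Z) * cnj e)) (at 0)"
proof -
 have fin: "finite (dbl N)" by simp
 define g :: "nat + nat => complex" where "g = case_sum (%i. if i = j then e else 0) (%i. if i = j then cnj e else 0)"
 have d: "((%t. cc (shift j e Z t) m) has_vector_derivative g m) (at 0)" for m
 proof (cases m)
  case (Inl i)
  then show ?thesis by (cases "i = j") (auto simp: shift_def g_def intro!: derivative_eq_intros)
 next
  case (Inr i)
  then show ?thesis by (cases "i = j") (auto simp: shift_def g_def intro!: derivative_eq_intros)
 qed
 have "((%t. F (cc (shift j e Z t))) has_derivative (%h. \<Sum>m\<in>dbl N. pd m F (cc (shift j e Z 0)) * (h *\<^sub>R g m))) (at 0)"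
  by (rule holo_chain[OF fin V F]) (use d shift_Cn[OF Z(2) j] Z in \<open>auto simp: has_vector_derivative_def\<close>)
 then have "((%t. F (cc (shift j e Z t))) has_vector_derivative (\<Sum>m\<in>dbl N. pd m F (cc Z) * g m)) (at 0)"
  unfolding has_vector_derivative_def by (rule has_derivative_eq_rhs) (simp add: fun_eq_iff scaleR_sum_right)
 moreover have "(\<Sum>m\<in>dbl N. pd m F (cc Z) * g m) = pd (Inl j) F (cc Z) * e + pd (Inr j) F (cc Z) * cnj e"
  using j by (simp add: sum.Plus g_def if_distrib[of "(*) _"] cong: if_cong)
 ultimately show ?thesis by simp
qed

lemma smooth_on_cc:
 assumes V: "open V" and F: "holo (dbl N) V F"
 shows "smooth_on N (cc -` V) (%Z. F (cc Z))"
proof (rule smooth_on_coinduct[where C="{%Z. F (cc Z) | F. holo (dbl N) V F}"])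
 have fin: "finite (dbl N)" by simp
 fix g assume "g \<in> {%Z. F (cc Z) | F. holo (dbl N) V F}"
 then obtain F where g: "g = (%Z. F (cc Z))" and F: "holo (dbl N) V F" by blast
 have rp: "real_partial j e g Z = pd (Inl j) F (cc Z) * e + pd (Inr j) F (cc Z) * cnj e"
  if "Z \<in> cc -` V \<inter> Cn N" "j < N" for Z j e
  unfolding g by (rule real_partial_eqI[OF cc_real_partial[OF V F]]) (use that in auto)
 show "linediff N (cc -` V) g" unfolding linediff_def
 proof (intro conjI ballI, goal_cases)
  case 1
  have "continuous_on (cc -` V \<inter> Cn N) (F o cc)"
   by (rule continuous_on_compose[OF continuous_cc], rule continuous_on_subset[of "V \<inter> cspace (dbl N)"])
     (use F in \<open>auto simp: holo_def\<close>)
  then show ?case by (simp add: g comp_def)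
 next
  case (2 Z je)
  then obtain j e where je: "je = (j,e)" "cc Z \<in> V" "Z \<in> Cn N" "j < N" by auto
  then show ?case
   using cc_real_partial[OF V F, of Z j e] rp[of Z j e] by (simp add: g)
 qed
 fix j e assume "(j, e) \<in> dirs N"
 then show "\<exists>h\<in>{%Z. F (cc Z) | F. holo (dbl N) V F}. \<forall>Z\<in>cc -` V \<inter> Cn N. real_partial j e g Z = h Z"
  using rp holo_partial[OF fin V F]
  by (intro bexI[of _ "%Z. pd (Inl j) F (cc Z) * e + pd (Inr j) F (cc Z) * cnj e"])
    (auto intro!: exI[of _ "%x. pd (Inl j) F x * e + pd (Inr j) F x * cnj e"] holo_intros)
qed (use assms open_vimage_cc in auto)

lemma smooth_germ_cc: "hgerm (dbl N) F (cc p) ==> smooth_germ N (%Z. F (cc Z)) p"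
 unfolding hgerm_def smooth_germ_iff using smooth_on_cc open_vimage_cc by (metis vimageI2)

lemma tangent_apply_cc:
 assumes V: "open V" and F: "holo (dbl N) V F" and Z: "cc Z \<in> V" "Z \<in> Cn N"
 shows "tangent_apply N v (%Z. F (cc Z)) Z = (\<Sum>a\<in>dbl N. pd a F (cc Z) * v a)"
proof -
 have rp: "real_partial j e (%Z. F (cc Z)) Z = pd (Inl j) F (cc Z) * e + pd (Inr j) F (cc Z) * cnj e"
  if "j < N" for j e
  by (rule real_partial_eqI[OF cc_real_partial[OF V F Z that]])
 have "tangent_apply N v (%Z. F (cc Z)) Z = (\<Sum>j<N. v (Inl j) * pd (Inl j) F (cc Z) + v (Inr j) * pd (Inr j) F (cc Z))"
  unfolding tangent_apply_def by (rule sum.cong) (auto simp: rp algebra_simps)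
 then show ?thesis by (simp add: sum.Plus sum.distrib mult.commute)
qed

lemma real_mvt:
 fixes \<phi> :: "real => complex"
 assumes d: "\<And>x. \<bar>x\<bar> \<le> \<bar>a\<bar> ==> (\<phi> has_vector_derivative \<phi>' x) (at x)" and b: "\<And>x. \<bar>x\<bar> \<le> \<bar>a\<bar> ==> cmod (\<phi>' x - c) \<le> e"
 shows "cmod (\<phi> a - \<phi> 0 - a *\<^sub>R c) \<le> e * \<bar>a\<bar>"
proof -
 let ?S = "{-\<bar>a\<bar>..\<bar>a\<bar>}"
 have d': "((%x. \<phi> x - x *\<^sub>R c) has_derivative (%h. h *\<^sub>R (\<phi>' x - c))) (at x within ?S)" if "x \<in> ?S" for x
 proof -
  have "\<bar>x\<bar> \<le> \<bar>a\<bar>" using that by (simp add: abs_le_iff)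
  note dx = d[OF this]
  have "((%x. \<phi> x - x *\<^sub>R c) has_vector_derivative (\<phi>' x - c)) (at x within ?S)"
  proof (rule has_vector_derivative_diff)
   show "(\<phi> has_vector_derivative \<phi>' x) (at x within ?S)"
    by (rule has_vector_derivative_at_within[OF dx])
   show "((%x. x *\<^sub>R c) has_vector_derivative c) (at x within ?S)"
    unfolding has_vector_derivative_def by (rule bounded_linear_imp_has_derivative[OF bounded_linear_scaleR_left])
  qed
  then show ?thesis by (simp add: has_vector_derivative_def)
 qed
 have "norm ((\<phi> a - a *\<^sub>R c) - (\<phi> 0 - 0 *\<^sub>R c)) \<le> e * norm (a - 0)"
 proof (rule differentiable_bound[OF _ d'])
  fix x assume "x \<in> ?S"
  then have "\<bar>x\<bar> \<le> \<bar>a\<bar>" by (simp add: abs_le_iff)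
  note bx = b[OF this]
  show "onorm (%h. h *\<^sub>R (\<phi>' x - c)) \<le> e"
  proof (rule onorm_le)
   fix h :: real
   have "\<bar>h\<bar> * cmod (\<phi>' x - c) \<le> \<bar>h\<bar> * e" by (rule mult_left_mono[OF bx]) simp
   then show "norm (h *\<^sub>R (\<phi>' x - c)) \<le> e * norm h" unfolding norm_scaleR real_norm_def by (simp only: mult.commute)
  qed
 qed auto
 then show ?thesis by (simp add: algebra_simps)
qed

lemma C1_step:
 assumes U: "open U" and f: "linediff N U f" and p: "p \<in> Cn N" and j: "j < N" and e: "e \<in> {1, \<i>}"
  and sub: "pdisc {..<N} p dl \<subseteq> U"
  and b: "\<And>w. w \<in> pdisc {..<N} p dl ==> cmod (real_partial j e f w - real_partial j e f p) \<le> ep"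
  and w: "\<And>x. \<bar>x\<bar> \<le> \<bar>h\<bar> ==> shift j e w x \<in> pdisc {..<N} p dl"
 shows "cmod (f (shift j e w h) - f w - h *\<^sub>R real_partial j e f p) \<le> ep * \<bar>h\<bar>"
proof -
 have "cmod (f (shift j e w h) - f (shift j e w 0) - h *\<^sub>R real_partial j e f p) \<le> ep * \<bar>h\<bar>"
 proof (rule real_mvt)
  fix x assume x: "\<bar>x\<bar> \<le> \<bar>h\<bar>"
  let ?w = "shift j e w x"
  have "?w \<in> U" "?w \<in> Cn N" using w[OF x] sub by (auto simp: pdisc_iff)
  from linediffD[OF f this, of j e] j e
  have "((%t. f (shift j e ?w t)) has_vector_derivative real_partial j e f ?w) (at 0)" by auto
  then have "((%t. f (shift j e ?w (t - x))) has_vector_derivative real_partial j e f ?w) (at x)"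
  proof -
   have "((%t. t - x) has_vector_derivative 1) (at x)"
    by (auto intro!: derivative_eq_intros simp: has_real_derivative_iff_has_vector_derivative[symmetric])
   moreover have "((%t. f (shift j e ?w t)) has_vector_derivative real_partial j e f ?w) (at (x - x))"
    using \<open>((%t. f (shift j e ?w t)) has_vector_derivative real_partial j e f ?w) (at 0)\<close> by simp
   ultimately have "((%t. f (shift j e ?w t)) o (%t. t - x) has_vector_derivative 1 *\<^sub>R real_partial j e f ?w) (at x)"
    by (rule vector_diff_chain_at)
   then show ?thesis by (simp add: comp_def)
  qed
  moreover have "shift j e ?w (t - x) = shift j e w t" for t by (auto simp: shift_def fun_eq_iff algebra_simps)
  ultimately show "((%t. f (shift j e w t)) has_vector_derivative real_partial j e f ?w) (at x)" by simp
  show "cmod (real_partial j e f ?w - real_partial j e f p) \<le> ep" by (rule b[OF w[OF x]])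
 qed
 then show ?thesis by simp
qed

text \<open>
The mean value theorem, applied to one real coordinate at a time.
\<close>

lemma C1_expansion_aux:
 assumes U: "open U" and f: "linediff N U f" and p: "p \<in> Cn N"
  and sub: "pdisc {..<N} p dl \<subseteq> U" and dl: "dl > 0"
  and b: "\<And>w j e. w \<in> pdisc {..<N} p dl ==> j < N ==> e \<in> {1,\<i>} ==> cmod (real_partial j e f w - real_partial j e f p) \<le> ep"
  and ep: "ep \<ge> 0"
  and S: "finite S" "S \<subseteq> {..<N}" and w: "w \<in> pdisc {..<N} p dl" "\<forall>i. i \<notin> S --> w i = p i"
 shows "cmod (f w - f p - (\<Sum>j\<in>S. Re (w j - p j) *\<^sub>R real_partial j 1 f p + Im (w j - p j) *\<^sub>R real_partial j \<i> f p)) \<le> 2 * ep * n1 S (w - p)"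
 using S w
proof (induction S arbitrary: w rule: finite_induct)
 case empty
 then have "w = p" by auto
 then show ?case by (simp add: n1_def)
next
 case (insert j S)
 have j: "j < N" using insert by auto
 let ?w = "w(j := p j)" and ?a = "Re (w j - p j)" and ?b = "Im (w j - p j)"
 let ?w1 = "shift j 1 ?w ?a"
 have w: "?w \<in> pdisc {..<N} p dl" using insert.prems p j dl by (auto simp: pdisc_iff cspace_upd)
 have wz: "\<forall>i. i \<notin> S --> ?w i = p i" using insert.prems by auto
 have eq: "n1 S (?w - p) = n1 S (w - p)" unfolding n1_def using insert.hyps by (intro sum.cong) auto
 have eq2: "(\<Sum>k\<in>S. Re (?w k - p k) *\<^sub>R real_partial k 1 f p + Im (?w k - p k) *\<^sub>R real_partial k \<i> f p) =
   (\<Sum>k\<in>S. Re (w k - p k) *\<^sub>R real_partial k 1 f p + Im (w k - p k) *\<^sub>R real_partial k \<i> f p)"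
  using insert.hyps by (intro sum.cong) auto
 have 0: "cmod (f ?w - f p - (\<Sum>k\<in>S. Re (w k - p k) *\<^sub>R real_partial k 1 f p + Im (w k - p k) *\<^sub>R real_partial k \<i> f p)) \<le> 2 * ep * n1 S (w - p)"
  using insert.IH[OF _ w wz] insert.prems unfolding eq eq2 by blast
 have wj: "cmod (w j - p j) < dl" using insert.prems j by (auto simp: pdisc_iff)
 have upd: "w(j:=t) \<in> pdisc {..<N} p dl" if "cmod (t - p j) < dl" for t
  using insert.prems j that by (auto simp: pdisc_iff cspace_upd)
 have s1: "shift j 1 ?w x = w(j := p j + of_real x)" for x by (auto simp: shift_def)
 have s2: "shift j \<i> ?w1 x = w(j := p j + of_real ?a + of_real x * \<i>)" for x by (auto simp: shift_def)
 have full: "shift j \<i> ?w1 ?b = w"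
 proof -
  have "p j + of_real ?a + of_real ?b * \<i> = w j" by (simp add: complex_eq_iff)
  then show ?thesis unfolding s2 by simp
 qed
 have 1: "cmod (f ?w1 - f ?w - ?a *\<^sub>R real_partial j 1 f p) \<le> ep * \<bar>?a\<bar>"
 proof (rule C1_step[OF U f p j _ sub b])
  fix x assume x: "\<bar>x\<bar> \<le> \<bar>?a\<bar>"
  have "\<bar>x\<bar> < dl" using x abs_Re_le_cmod[of "w j - p j"] wj by linarith
  then show "shift j 1 ?w x \<in> pdisc {..<N} p dl" unfolding s1 by (intro upd) simp
 qed (use j in auto)
 have 2: "cmod (f (shift j \<i> ?w1 ?b) - f ?w1 - ?b *\<^sub>R real_partial j \<i> f p) \<le> ep * \<bar>?b\<bar>"
 proof (rule C1_step[OF U f p j _ sub b])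
  fix x assume x: "\<bar>x\<bar> \<le> \<bar>?b\<bar>"
  have "cmod (of_real ?a + of_real x * \<i>) \<le> cmod (w j - p j)"
   using x abs_le_square_iff[of x ?b] by (simp add: cmod_def)
  then show "shift j \<i> ?w1 x \<in> pdisc {..<N} p dl" unfolding s2 using wj by (intro upd) (simp add: algebra_simps)
 qed (use j in auto)
 have "f w - f p - (\<Sum>k\<in>insert j S. Re (w k - p k) *\<^sub>R real_partial k 1 f p + Im (w k - p k) *\<^sub>R real_partial k \<i> f p) =
   (f ?w - f p - (\<Sum>k\<in>S. Re (w k - p k) *\<^sub>R real_partial k 1 f p + Im (w k - p k) *\<^sub>R real_partial k \<i> f p)) +
   (f ?w1 - f ?w - ?a *\<^sub>R real_partial j 1 f p) + (f w - f ?w1 - ?b *\<^sub>R real_partial j \<i> f p)"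
  using insert.hyps by simp
 then have "cmod (f w - f p - (\<Sum>k\<in>insert j S. Re (w k - p k) *\<^sub>R real_partial k 1 f p + Im (w k - p k) *\<^sub>R real_partial k \<i> f p))
  \<le> 2 * ep * n1 S (w - p) + ep * \<bar>?a\<bar> + ep * \<bar>?b\<bar>"
  using 0 1 2[unfolded full] by (smt (verit) norm_triangle_ineq)
 also have "\<dots> \<le> 2 * ep * n1 S (w - p) + ep * cmod (w j - p j) + ep * cmod (w j - p j)"
  by (intro add_mono order_refl mult_left_mono abs_Re_le_cmod abs_Im_le_cmod ep)
 also have "\<dots> = 2 * ep * n1 (insert j S) (w - p)" using insert.hyps by (simp add: n1_def algebra_simps)
 finally show ?case .
qed

lemma derivative_growth:
 fixes u :: "'a::real_normed_vector => 'b::real_normed_vector"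
 assumes u: "(u has_derivative g) (at x within S)"
 shows "\<exists>K\<ge>0. \<forall>\<^sub>F y in at x within S. norm (u y - u x) \<le> K * norm (y - x)"
proof -
 obtain B where B: "B > 0" "\<And>h. norm (g h) \<le> norm h * B"
  using bounded_linear.pos_bounded[OF has_derivative_bounded_linear[OF u]] by blast
 have "((%y. norm (u y - u x - g (y - x)) / norm (y - x)) \<longlongrightarrow> 0) (at x within S)"
  using u by (simp add: has_derivative_iff_norm)
 then have "\<forall>\<^sub>F y in at x within S. norm (u y - u x - g (y - x)) / norm (y - x) < 1"
  by (auto dest: order_tendstoD(2)[of _ _ _ 1])
 moreover have "\<forall>\<^sub>F y in at x within S. y \<noteq> x" by (simp add: eventually_at_filter)
 ultimately have "\<forall>\<^sub>F y in at x within S. norm (u y - u x) \<le> (1 + B) * norm (y - x)"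
 proof eventually_elim
  case (elim y)
  then have "norm (u y - u x - g (y - x)) \<le> norm (y - x)" by (simp add: divide_simps split: if_splits)
  with B(2)[of "y - x"] show ?case
   using norm_triangle_sub[of "u y - u x" "g (y - x)"] by (simp add: algebra_simps)
 qed
 then show ?thesis using B(1) by (intro exI[of _ "1 + B"]) auto
qed

lemma real_chain:
 assumes U: "open U" and f: "smooth_on N U f" and p: "gm 0 \<in> U" "\<And>t. gm t \<in> Cn N"
  and d: "\<And>j. j < N ==> ((%t. gm t j) has_vector_derivative g j) (at (0::real))"
 shows "((%t. f (gm t)) has_vector_derivative (\<Sum>j<N. Re (g j) *\<^sub>R real_partial j 1 f (gm 0) + Im (g j) *\<^sub>R real_partial j \<i> f (gm 0))) (at 0)"
proof -
 let ?p = "gm 0"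
 define L where "L h = (\<Sum>j<N. Re (h j) *\<^sub>R real_partial j 1 f ?p + Im (h j) *\<^sub>R real_partial j \<i> f ?p)" for h
 have ld: "linediff N U f" by (rule smooth_on_linediff[OF f])
 have "\<forall>j. \<exists>K. K \<ge> 0 & (j < N --> (\<forall>\<^sub>F t in at 0. norm (gm t j - gm 0 j) \<le> K * norm (t - 0)))"
 proof
  fix j show "\<exists>K. K \<ge> 0 & (j < N --> (\<forall>\<^sub>F t in at 0. norm (gm t j - gm 0 j) \<le> K * norm (t - 0)))"
   using derivative_growth[OF d[unfolded has_vector_derivative_def], of j] by (cases "j < N") auto
 qed
 from choice[OF this] obtain K where K: "\<And>j. K j \<ge> 0" "\<And>j. j < N ==> \<forall>\<^sub>F t in at 0. norm (gm t j - gm 0 j) \<le> K j * norm (t - 0)"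
  by blast
 define KK where "KK = (\<Sum>j<N. K j)"
 have KK: "KK \<ge> 0" using K by (auto simp: KK_def sum_nonneg)
 have grow: "\<forall>\<^sub>F t in at 0. n1 {..<N} (gm t - ?p) \<le> KK * \<bar>t\<bar>"
 proof -
  have "\<forall>\<^sub>F t in at 0. \<forall>j\<in>{..<N}. norm (gm t j - gm 0 j) \<le> K j * norm (t - 0)"
   by (intro eventually_ball_finite ballI) (use K in auto)
  then show ?thesis by eventually_elim (auto simp: n1_def KK_def sum_distrib_right intro!: sum_mono)
 qed
 have Rlim: "((%t. norm (f (gm t) - f ?p - L (gm t - ?p)) / norm (t - 0)) \<longlongrightarrow> 0) (at 0)"
 proof (rule tendstoI)
  fix ep :: real assume ep: "ep > 0"
  define \<eta> where "\<eta> = ep / (2 * KK + 1) / 2"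
  have \<eta>: "\<eta> > 0" "2 * \<eta> * KK < ep"
  proof -
   show "\<eta> > 0" using ep KK by (simp add: \<eta>_def)
   have nz: "2 * KK + 1 > 0" using KK by simp
   have "ep * KK < ep * (2 * KK + 1)" using ep KK by (intro mult_strict_left_mono) auto
   then have "ep * KK / (2 * KK + 1) < ep" using nz by (simp only: pos_divide_less_eq)
   moreover have "2 * \<eta> * KK = ep * KK / (2 * KK + 1)" unfolding \<eta>_def using nz by (simp add: divide_simps)
   ultimately show "2 * \<eta> * KK < ep" by simp
  qed
  have "\<forall>\<^sub>F w in at ?p within (U \<inter> Cn N). \<forall>je\<in>dirs N. cmod (real_partial (fst je) (snd je) f w - real_partial (fst je) (snd je) f ?p) < \<eta>"
  proof (rule eventually_ball_finite, simp, rule)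
   fix je assume "je \<in> dirs N"
   then have "linediff N U (real_partial (fst je) (snd je) f)"
    using smooth_on_linediff[OF smooth_on_partial[OF f, of "fst je" "snd je"]] by (metis prod.collapse)
   then have "(real_partial (fst je) (snd je) f \<longlongrightarrow> real_partial (fst je) (snd je) f ?p) (at ?p within (U \<inter> Cn N))"
    unfolding linediff_def continuous_on_def using p by blast
   from tendstoD[OF this \<eta>(1)] show "\<forall>\<^sub>F w in at ?p within (U \<inter> Cn N). cmod (real_partial (fst je) (snd je) f w - real_partial (fst je) (snd je) f ?p) < \<eta>"
    by (simp add: dist_norm)
  qed
  then obtain W where W: "open W" "?p \<in> W" "\<And>w j e. w \<in> W ==> w \<noteq> ?p ==> w \<in> U ==> w \<in> Cn N ==> j < N ==> e \<in> {1,\<i>} ==> cmod (real_partial j e f w - real_partial j e f ?p) < \<eta>"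
   unfolding eventually_at_topological by force
  obtain dl where dl: "dl > 0" "pdisc {..<N} ?p dl \<subseteq> U \<inter> W"
   using open_pdisc_subset[of "{..<N}" "U \<inter> W" ?p] U W p by auto
  have exp: "cmod (f w - f ?p - L (w - ?p)) \<le> 2 * \<eta> * n1 {..<N} (w - ?p)" if w: "w \<in> pdisc {..<N} ?p dl" for w
  proof -
   have "cmod (real_partial j e f v - real_partial j e f ?p) \<le> \<eta>" if "v \<in> pdisc {..<N} ?p dl" "j < N" "e \<in> {1,\<i>}" for v j e
    using W(3)[of v j e] dl(2) that \<eta>(1) by (cases "v = ?p") (auto simp: pdisc_iff less_imp_le subset_iff)
   from C1_expansion_aux[OF U ld p(2) _ dl(1) this, of "{..<N}" w] w dl(2) \<eta>(1) p(2)
   show ?thesis by (auto simp: L_def pdisc_iff cspace_def)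
  qed
  have near: "\<forall>\<^sub>F t in at 0. gm t \<in> pdisc {..<N} ?p dl"
  proof -
   have "\<forall>\<^sub>F t in at 0. \<forall>j\<in>{..<N}. cmod (gm t j - ?p j) < dl"
   proof (rule eventually_ball_finite, simp, rule)
    fix j assume "j \<in> {..<N}"
    then have "((%t. gm t j) \<longlongrightarrow> gm 0 j) (at 0)"
     using has_vector_derivative_continuous[OF d] by (auto simp: continuous_within)
    from tendstoD[OF this dl(1)] show "\<forall>\<^sub>F t in at 0. cmod (gm t j - ?p j) < dl" by (simp add: dist_norm)
   qed
   then show ?thesis by eventually_elim (use p in \<open>auto simp: pdisc_iff\<close>)
  qed
  show "\<forall>\<^sub>F t in at 0. dist (norm (f (gm t) - f ?p - L (gm t - ?p)) / norm (t - 0)) 0 < ep"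
   using near grow eventually_at_filter[of "%t. t \<noteq> 0" 0 UNIV, simplified]
  proof eventually_elim
   case (elim t)
   have "cmod (f (gm t) - f ?p - L (gm t - ?p)) \<le> 2 * \<eta> * (KK * \<bar>t\<bar>)"
    using exp[OF elim(1)] elim(2) \<eta>(1) by (smt (verit) mult_left_mono)
   also have "\<dots> < ep * \<bar>t\<bar>" using \<eta>(2) elim(3) by (simp add: mult.assoc[symmetric])
   finally show ?case using elim(3) by (simp add: divide_simps)
  qed
 qed
 have R: "((%t. f (gm t) - f ?p - L (gm t - ?p)) has_vector_derivative 0) (at 0)"
  unfolding has_vector_derivative_def has_derivative_iff_norm using Rlim by (simp add: L_def)
 have Ld: "((%t. L (gm t - ?p)) has_vector_derivative L g) (at 0)"
  unfolding L_def fun_diff_def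
 proof (rule has_vector_derivative_sum)
  fix j assume "j \<in> {..<N}"
  have bl: "bounded_linear (%h. Re h *\<^sub>R real_partial j 1 f ?p + Im h *\<^sub>R real_partial j \<i> f ?p)"
   by (intro bounded_linear_add bounded_linear_compose[OF bounded_linear_scaleR_left bounded_linear_Re]
     bounded_linear_compose[OF bounded_linear_scaleR_left bounded_linear_Im])
  have "((%t. gm t j - ?p j) has_vector_derivative g j - 0) (at 0)"
   by (rule has_vector_derivative_diff[OF d has_vector_derivative_const]) (use \<open>j \<in> {..<N}\<close> in simp)
  then have "((%t. gm t j - ?p j) has_vector_derivative g j) (at 0)" by simp
  from bounded_linear.has_vector_derivative[OF bl this]
  show "((%t. Re (gm t j - ?p j) *\<^sub>R real_partial j 1 f ?p + Im (gm t j - ?p j) *\<^sub>R real_partial j \<i> f ?p)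
    has_vector_derivative Re (g j) *\<^sub>R real_partial j 1 f ?p + Im (g j) *\<^sub>R real_partial j \<i> f ?p) (at 0)" .
 qed
 have "((%t. f ?p + (f (gm t) - f ?p - L (gm t - ?p)) + L (gm t - ?p)) has_vector_derivative 0 + 0 + L g) (at 0)"
  by (intro has_vector_derivative_add R Ld) simp
 then show ?thesis by (simp add: L_def)
qed

lemma tangent_apply_real:
 "tangent_apply N (cc u) f Z = (\<Sum>j<N. Re (u j) *\<^sub>R real_partial j 1 f Z + Im (u j) *\<^sub>R real_partial j \<i> f Z)"
proof -
 have "z * ((a - \<i> * b) / 2) + cnj z * ((a + \<i> * b) / 2) = Re z *\<^sub>R a + Im z *\<^sub>R b" for z a b
 proof -
  have "z * ((a - \<i> * b) / 2) + cnj z * ((a + \<i> * b) / 2) = (z + cnj z) / 2 * a - \<i> * ((z - cnj z) / 2) * b"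
   by (simp add: field_simps)
  also have "\<dots> = Re z *\<^sub>R a + Im z *\<^sub>R b" unfolding complex_add_cnj complex_diff_cnj
   by (simp add: scaleR_conv_of_real algebra_simps)
  finally show ?thesis .
 qed
 then show ?thesis unfolding tangent_apply_def by simp
qed

section \<open>Determinants and inverse matrices depending holomorphically on parameters\<close>

text \<open>
Determinants of matrices given by functions, so that entries depending on parameters need no
conversion; by the Leibniz formula they are polynomials in the entries.
\<close>

definition fdet :: "nat => (nat => nat => complex) => complex" where
 "fdet n f = Determinant.det (mat n n (%(i,j). f i j))"

text \<open>
The inverse through the adjugate matrix: its entries are quotients of polynomials in the entries of the
matrix, whence holomorphic dependence.
\<close>

definition minv :: "nat => (nat => nat => complex) => nat => nat => complex" where
 "minv n f i j = adj_mat (mat n n (%(i,j). f i j)) $$ (i,j) / fdet n f"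

lemma fdet_leibniz: "fdet n f = (\<Sum>p | p permutes {..<n}. of_int (sign p) * (\<Prod>i<n. f i (p i)))"
proof -
 have "fdet n f = (\<Sum>p | p permutes {0..<n}. of_int (sign p) * (\<Prod>i = 0..<n. mat n n (%(i,j). f i j) $$ (i, p i)))"
  unfolding fdet_def by (rule det_def') simp
 also have "\<dots> = (\<Sum>p | p permutes {..<n}. of_int (sign p) * (\<Prod>i<n. f i (p i)))"
  unfolding lessThan_atLeast0
  by (intro sum.cong refl arg_cong2[where f="(*)"] prod.cong) (auto dest: permutes_in_image)
 finally show ?thesis .
qed

lemma fdet_one: "(\<And>i j. i < n ==> j < n ==> f i j = (if i = j then 1 else 0)) ==> fdet n f = 1"
proof -
 assume f: "\<And>i j. i < n ==> j < n ==> f i j = (if i = j then 1 else 0)"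
 have "mat n n (%(i,j). f i j) = 1\<^sub>m n" by (rule eq_matI) (auto simp: f)
 then show ?thesis by (simp add: fdet_def)
qed

lemma minv_right:
 assumes "fdet n f \<noteq> 0" "k < n" "l < n"
 shows "(\<Sum>j<n. f k j * minv n f j l) = (if k = l then 1 else 0)"
  and "(\<Sum>j<n. minv n f k j * f j l) = (if k = l then 1 else 0)"
proof -
 let ?A = "mat n n (%(i,j). f i j)"
 have A: "?A \<in> carrier_mat n n" by simp
 have 1: "(?A * adj_mat ?A) $$ (k,l) = (fdet n f \<cdot>\<^sub>m 1\<^sub>m n) $$ (k,l)" "(adj_mat ?A * ?A) $$ (k,l) = (fdet n f \<cdot>\<^sub>m 1\<^sub>m n) $$ (k,l)"
  using adj_mat(2,3)[OF A] unfolding fdet_def by auto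
 have "(\<Sum>j<n. f k j * adj_mat ?A $$ (j,l)) = fdet n f * (if k = l then 1 else 0)"
  using 1(1) assms adj_mat(1)[OF A] by (simp add: scalar_prod_def lessThan_atLeast0)
 then show "(\<Sum>j<n. f k j * minv n f j l) = (if k = l then 1 else 0)"
  using assms(1) by (simp add: minv_def sum_divide_distrib[symmetric])
 have "(\<Sum>j<n. adj_mat ?A $$ (k,j) * f j l) = fdet n f * (if k = l then 1 else 0)"
  using 1(2) assms adj_mat(1)[OF A] by (simp add: scalar_prod_def lessThan_atLeast0)
 then show "(\<Sum>j<n. minv n f k j * f j l) = (if k = l then 1 else 0)"
  using assms(1) by (simp add: minv_def sum_divide_distrib[symmetric])
qed

lemma holo_fdet: "(\<And>i j. i < n ==> j < n ==> holo I V (%z. f z i j)) ==> holo I V (%z. fdet n (f z))"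
 unfolding fdet_leibniz
 by (intro holo_sum holo_mult holo_prod holo_const) (auto dest: permutes_in_image)

lemma holo_minv:
 assumes f: "\<And>i j. i < n ==> j < n ==> holo I V (%z. f z i j)"
  and nz: "\<And>z. z \<in> V ==> z \<in> cspace I ==> fdet n (f z) \<noteq> 0" and ij: "i < n" "j < n"
 shows "holo I V (%z. minv n (f z) i j)"
proof -
 let ?s = "%m a. if a < m then a else Suc a"
 have "adj_mat (mat n n (%(i,j). f z i j)) $$ (i,j) = (-1)^(j+i) * fdet (n-1) (%a b. f z (?s j a) (?s i b))" for z
 proof -
  have "mat_delete (mat n n (%(i,j). f z i j)) j i = mat (n-1) (n-1) (%(a,b). f z (?s j a) (?s i b))"
   unfolding mat_delete_def by (rule eq_matI) auto
  then show ?thesis using ij by (simp add: adj_mat_def cofactor_def fdet_def)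
 qed
 then have "minv n (f z) i j = ((-1)^(j+i) * fdet (n-1) (%a b. f z (?s j a) (?s i b))) / fdet n (f z)" for z
  by (simp add: minv_def)
 then show ?thesis using nz
  by (auto intro!: holo_divide holo_mult holo_fdet f)
qed

section \<open>The defining equations near the origin\<close>

text \<open>
The antiholomorphic involution \<open>(Z, \<zeta>) \<mapsto> (cconj \<zeta>, cconj Z)\<close>; its fixed points are the points \<open>cc Z\<close>.
\<close>

definition sc :: "(nat + nat) cpoint => (nat + nat) cpoint" where
 "sc x = case_sum (cconj (x o Inr)) (cconj (x o Inl))"

definition sw :: "nat + nat => nat + nat" where
 "sw a = (case a of Inl i => Inr i | Inr i => Inl i)"

lemma sw_simps[simp]: "sw (Inl i) = Inr i" "sw (Inr i) = Inl i" "sw (sw a) = a" "sw a \<in> dbl N \<longleftrightarrow> a \<in> dbl N"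
 by (auto simp: sw_def split: sum.splits)

lemma sc_apply: "sc x a = cnj (x (sw a))" by (cases a) (auto simp: sc_def)

lemma ball_sw: "(\<forall>a\<in>dbl N. P (sw a)) \<longleftrightarrow> (\<forall>a\<in>dbl N. P a)"
 unfolding ball_Plus by auto

lemma sc_simps[simp]: "sc (sc x) = x" "sc (cc Z) = cc Z" "sc 0 = 0" "sc x \<in> cspace (dbl N) \<longleftrightarrow> x \<in> cspace (dbl N)"
 "sc x \<in> pdisc (dbl N) 0 r \<longleftrightarrow> x \<in> pdisc (dbl N) 0 r"
proof -
 show c: "sc x \<in> cspace (dbl N) \<longleftrightarrow> x \<in> cspace (dbl N)" for x
  unfolding cspace_def by (auto simp: sc_apply) (metis sw_simps(3,4))
 show "sc x \<in> pdisc (dbl N) 0 r \<longleftrightarrow> x \<in> pdisc (dbl N) 0 r"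
  unfolding pdisc_iff c using ball_sw[of N "%a. cmod (x a) < r"] by (simp add: sc_apply)
qed (auto simp: fun_eq_iff sc_apply sw_def split: sum.splits)

lemma sc_fixed: "sc v = v ==> v = cc (v o Inl)"
proof
 fix a assume "sc v = v"
 then have "v (Inr i) = cnj (v (Inl i))" for i by (metis sc_apply sw_simps(2))
 then show "v a = cc (v o Inl) a" by (cases a) auto
qed

lemma upd_DERIV: "((%t. (z(i:=t)) m) has_field_derivative (if m = i then 1 else 0)) (at x)"
 by (cases "m = i") auto

lemma partial_deriv_eqI: "((%t. f (z(i:=t))) has_field_derivative D) (at (z i)) ==> pd i f z = D"
 unfolding partial_deriv_def by (rule DERIV_imp_deriv)

definition mapp :: "'a set => 'b set => ('a => 'b => complex) => 'b cpoint => 'a cpoint" where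
 "mapp A B C s = (%a. if a \<in> A then \<Sum>b\<in>B. C a b * s b else 0)"

lemma mapp_cspace[simp]: "mapp A B C s \<in> cspace A" by (simp add: mapp_def cspace_def)

lemma cspace_plus: "x \<in> cspace A ==> y \<in> cspace A ==> x + y \<in> cspace A" by (simp add: cspace_def)

lemma mapp_add: "mapp A B C (s + t) = mapp A B C s + mapp A B C t"
 by (simp add: mapp_def fun_eq_iff sum.distrib algebra_simps)

lemma mapp_0[simp]: "mapp A B C 0 = 0" by (simp add: mapp_def fun_eq_iff)

lemma sum_ind: "finite B ==> (\<Sum>b\<in>B. (if b = k then 1 else 0) * c b) = (if k \<in> B then c k else (0::complex))"
 by (simp add: if_distrib[of "%x. x * _"] cong: if_cong)

lemma zero_comp: "(0 :: 'a => complex) o f = 0" by (simp add: fun_eq_iff)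

text \<open>
The complexified defining functions \<open>rr k\<close> on a polydisc on which they are holomorphic and satisfy
the reality condition. Genericity enters as a right inverse \<open>Bs\<close> of the \<open>Z\<close>-derivative of the defining functions at \<open>0\<close>.
\<close>

locale chart =
 fixes N d :: nat and M :: "nat cpoint set" and rr :: "nat => (nat + nat) cpoint => complex"
  and r :: real and Bs :: "nat => nat => complex"
 assumes r: "r > 0"
  and rh: "\<And>k. k < d ==> holo (dbl N) (pbox (dbl N) 0 r) (rr k)"
  and rreal: "\<And>k x. x \<in> pdisc (dbl N) 0 r ==> k < d ==> rr k (sc x) = cnj (rr k x)"
  and Mr: "\<And>Z. Z \<in> Cn N ==> cc Z \<in> pdisc (dbl N) 0 r ==> Z \<in> M \<longleftrightarrow> (\<forall>k<d. rr k (cc Z) = 0)"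
  and MC: "M \<subseteq> Cn N" and M0: "0 \<in> M"
  and Bs: "\<And>k l. k < d ==> l < d ==> (\<Sum>i<N. pd (Inl i) (rr k) 0 * Bs i l) = (if k = l then 1 else 0)"
begin

abbreviation A where "A \<equiv> dbl N"
abbreviation \<Omega> where "\<Omega> \<equiv> pbox (dbl N) 0 r"
abbreviation DD where "DD \<equiv> pdisc (dbl N) 0 r"

lemma finA[simp]: "finite A" by simp
lemma open_Om[simp]: "open \<Omega>" by (rule open_pbox) simp
lemma zero_Om[simp]: "0 \<in> \<Omega>" "0 \<in> DD" using r by (auto simp: pdisc_iff)
lemma DD_iff: "x \<in> DD \<longleftrightarrow> x \<in> \<Omega> & x \<in> cspace A" by (auto simp: pdisc_def)

lemma rr0: "k < d ==> rr k 0 = 0"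
 using Mr[of 0] M0 zero_Om by simp

lemma rr_partial_sc:
 assumes x: "x \<in> DD" and k: "k < d" and a: "a \<in> A"
 shows "pd a (rr k) (sc x) = cnj (pd (sw a) (rr k) x)"
proof (rule partial_deriv_eqI)
 have "((%t. rr k (x(sw a := t))) has_field_derivative pd (sw a) (rr k) x) (at (x (sw a)))"
  by (rule holo_partial_DERIV[OF rh[OF k]]) (use x a in \<open>auto simp: pdisc_def simp del: sw_simps(1,2)\<close>)
 then have "((cnj o (%t. rr k (x(sw a := t))) o cnj) has_field_derivative cnj (pd (sw a) (rr k) x)) (at (sc x a))"
  by (intro has_field_derivative_cnj_cnj) (simp add: sc_apply)
 moreover have "\<forall>\<^sub>F t in nhds (sc x a). (cnj o (%t. rr k (x(sw a := t))) o cnj) t = rr k ((sc x)(a := t))"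
 proof -
  have "sc x \<in> DD" using x by simp
  then have "sc x \<in> \<Omega>" "sc x \<in> cspace A" by (auto simp: DD_iff)
  then have "\<forall>\<^sub>F t in nhds (sc x a). (sc x)(a:=t) \<in> \<Omega>" by (intro eventually_upd) auto
  then show ?thesis
  proof eventually_elim
   case (elim t)
   have eq: "x(sw a := cnj t) = sc ((sc x)(a:=t))"
    by (auto simp: fun_eq_iff sc_apply)
   have "(sc x)(a:=t) \<in> DD" using elim \<open>sc x \<in> cspace A\<close> a by (simp add: DD_iff cspace_upd)
   then show ?case unfolding comp_def eq using rreal[OF _ k] by simp
  qed
 qed
 ultimately show "((%t. rr k ((sc x)(a := t))) has_field_derivative cnj (pd (sw a) (rr k) x)) (at (sc x a))"
  by (subst (asm) DERIV_cong_ev[OF refl _ refl]) auto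
qed

text \<open>
Moving \<open>P x\<close> in the directions of the columns of \<open>C\<close>, which are transversal to the level set, until
it lies on the level set. Two choices of \<open>P\<close> and \<open>C\<close> are used: a real one
retracting onto \<open>M\<close>, and one that keeps the coordinates \<open>\<zeta>\<close>.
\<close>

definition gsol :: "(nat + nat => nat + nat => complex) => (nat + nat => nat => complex) => (nat + nat) cpoint => nat cpoint" where
 "gsol P C = fixsol (%x s k. if k < d then s k - rr k (mapp A A P x + mapp A {..<d} C s) else 0)"

lemma gsol:
 assumes C: "\<And>k l. k < d ==> l < d ==> (\<Sum>a\<in>A. pd a (rr k) 0 * C a l) = (if k = l then 1 else 0)"
 shows "\<exists>U ep. open U & 0 \<in> U & ep > 0 & holom A {..<d} U (gsol P C) & gsol P C 0 = 0 &
  (\<forall>x\<in>U \<inter> cspace A. mapp A A P x + mapp A {..<d} C (gsol P C x) \<in> DD &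
   (\<forall>k<d. rr k (mapp A A P x + mapp A {..<d} C (gsol P C x)) = 0) &
   (\<forall>s\<in>pdisc {..<d} 0 ep. (\<forall>k<d. rr k (mapp A A P x + mapp A {..<d} C s) = 0) --> s = gsol P C x))"
proof -
 let ?J = "{..<d}" and ?K = "A <+> {..<d}"
 let ?T = "%x s k. if k < d then s k - rr k (mapp A A P x + mapp A {..<d} C s) else 0"
 let ?G = "%w. mapp A A P (w o Inl) + mapp A {..<d} C (w o Inr)"
 have K: "finite ?K" by simp
 have G: "holom ?K A UNIV ?G" unfolding holom_def
 proof (intro conjI ballI)
  fix a assume "a \<in> A"
  then show "holo ?K UNIV (%w. ?G w a)" by (auto simp: mapp_def intro!: holo_intros)
 qed (intro cspace_plus mapp_cspace)
 have Gd: "pd (Inr k) (%w. ?G w a) z = C a k" if "a \<in> A" "k < d" for k a z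
  using that by (intro partial_deriv_eqI) (auto simp: mapp_def sum_ind simp del: fun_upd_apply
    intro!: derivative_eq_intros upd_DERIV)
 have G0: "?G (case_sum 0 0) = 0" by (simp add: zero_comp)
 have hT: "hmgerm ?K ?J (%w. ?T (w o Inl) (w o Inr)) (case_sum 0 0)"
 proof (rule hmgermI)
  show "\<forall>\<^sub>F z in nhds (case_sum 0 0). z \<in> cspace ?K --> ?T (z o Inl) (z o Inr) \<in> cspace ?J"
   by (intro always_eventually) (auto simp: cspace_def)
  fix j assume j: "j \<in> ?J"
  have "hgerm ?K (%w. rr j (?G w)) (case_sum 0 0)"
  proof (rule hgerm_compose[where F="rr j" and G="?G", OF finA])
   show "hgerm A (rr j) (?G (case_sum 0 0))" unfolding G0 hgerm_def using rh j by (intro exI[of _ \<Omega>]) auto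
   show "hmgerm ?K A ?G (case_sum 0 0)" unfolding hmgerm_def using G by blast
  qed simp
  then show "hgerm ?K (%w. ?T (w o Inl) (w o Inr) j) (case_sum 0 0)" using j by (auto intro!: hgerm_diff)
 qed simp
 have T0: "?T 0 0 = 0" using rr0 by (auto simp: fun_eq_iff)
 have dT: "pd (Inr k) (%w. ?T (w o Inl) (w o Inr) j) (case_sum 0 0) = 0" if jk: "j \<in> ?J" "k \<in> ?J" for j k
 proof -
  let ?z = "case_sum 0 0 :: (nat + nat) + nat => complex"
  have eq: "(%w. ?T (w o Inl) (w o Inr) j) = (%w. w (Inr j) - rr j (?G w))"
   using jk by (auto simp: fun_eq_iff)
  have D1: "((%t. (?z(Inr k := t)) (Inr j)) has_field_derivative (if j = k then 1 else 0)) (at (?z (Inr k)))"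
   by (cases "j = k") auto
  have "((%t. rr j (?G ((case_sum 0 0)(Inr k := t)))) has_field_derivative
    (\<Sum>a\<in>A. pd a (rr j) (?G (case_sum 0 0)) * pd (Inr k) (%z. ?G z a) (case_sum 0 0))) (at ((case_sum 0 0 :: (nat+nat)+nat => complex) (Inr k)))"
   by (rule holo_chain_upd[OF finA open_UNIV open_Om rh G]) (use jk G0 in \<open>auto simp del: case_sum_0 plus_fun_apply\<close>)
  moreover have "(\<Sum>a\<in>A. pd a (rr j) (?G (case_sum 0 0)) * pd (Inr k) (%z. ?G z a) (case_sum 0 0)) = (if j = k then 1 else 0)"
  proof -
   have "(\<Sum>a\<in>A. pd a (rr j) (?G (case_sum 0 0)) * pd (Inr k) (%z. ?G z a) (case_sum 0 0)) = (\<Sum>a\<in>A. pd a (rr j) 0 * C a k)"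
    unfolding G0 by (rule sum.cong[OF refl]) (subst Gd, use jk in auto)
   then show ?thesis using C jk by simp
  qed
  ultimately have "((%t. rr j (?G ((case_sum 0 0)(Inr k := t)))) has_field_derivative (if j = k then 1 else 0)) (at ((case_sum 0 0 :: (nat+nat)+nat => complex) (Inr k)))" by simp
  from DERIV_diff[OF D1 this] have "((%t. (?z(Inr k := t)) (Inr j) - rr j (?G (?z(Inr k := t)))) has_field_derivative 0) (at (?z (Inr k)))"
   by (rule DERIV_cong) simp
  then show ?thesis unfolding eq by (rule partial_deriv_eqI)
 qed
 obtain U ep where U: "open U" "0 \<in> U" "ep > 0" "holom A ?J U (fixsol ?T)" "fixsol ?T 0 = 0"
  and sol: "\<And>x. x \<in> U ==> x \<in> cspace A ==> ?T x (fixsol ?T x) = fixsol ?T x"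
  and uniq: "\<And>x y. x \<in> U ==> x \<in> cspace A ==> y \<in> pdisc ?J 0 ep ==> ?T x y = y ==> y = fixsol ?T x"
  using implicit_function[OF finA finite_lessThan cspace_0 hT T0 dT] by blast
 have H: "holom A A U (%x. mapp A A P x + mapp A {..<d} C (fixsol ?T x))"
  unfolding holom_def
 proof (intro conjI ballI)
  fix a assume "a \<in> A"
  then show "holo A U (%x. (mapp A A P x + mapp A {..<d} C (fixsol ?T x)) a)"
   using U(4) unfolding holom_def by (auto simp: mapp_def intro!: holo_intros)
 qed (intro cspace_plus mapp_cspace)
 obtain W where W: "open W" "0 \<in> W" "W \<subseteq> U" "\<forall>x\<in>W \<inter> cspace A. mapp A A P x + mapp A {..<d} C (fixsol ?T x) \<in> \<Omega>"
  using open_vimage_germ[OF H U(1) open_Om U(2)] U(5) by auto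
 show ?thesis
 proof (intro exI[of _ W] exI[of _ ep] conjI ballI)
  fix x assume x: "x \<in> W \<inter> cspace A"
  show "mapp A A P x + mapp A {..<d} C (gsol P C x) \<in> DD"
   using W x unfolding DD_iff gsol_def by (auto intro!: cspace_plus)
  have s: "?T x (gsol P C x) = gsol P C x" unfolding gsol_def using sol x W by blast
  show "\<forall>k<d. rr k (mapp A A P x + mapp A {..<d} C (gsol P C x)) = 0"
  proof safe
   fix k assume "k < d"
   then show "rr k (mapp A A P x + mapp A {..<d} C (gsol P C x)) = 0"
    using fun_cong[OF s, of k] by simp
  qed
  fix s assume s: "s \<in> pdisc ?J 0 ep"
  show "(\<forall>k<d. rr k (mapp A A P x + mapp A {..<d} C s) = 0) --> s = gsol P C x"
  proof
   assume z: "\<forall>k<d. rr k (mapp A A P x + mapp A {..<d} C s) = 0"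
   have "?T x s = s" using z s by (auto simp: fun_eq_iff pdisc_iff cspace_def)
   then show "s = gsol P C x" unfolding gsol_def using uniq x W s by blast
  qed
 qed (use U W holom_subset in \<open>auto simp: gsol_def\<close>)
qed

definition CT :: "nat cpoint => (nat + nat) cpoint set" where
 "CT Z = {v \<in> cspace A. \<forall>k<d. (\<Sum>a\<in>A. pd a (rr k) (cc Z) * v a) = 0}"

lemma CT_eq:
 assumes "\<And>k Z. rr k (cc Z) = \<rho> Z (cconj Z) k" "cc Z \<in> DD" "Z \<in> Cn N"
 shows "complex_tangent_space N d \<rho> Z = CT Z"
proof -
 have "tangent_apply N v (%Z. rr k (cc Z)) Z = (\<Sum>a\<in>A. pd a (rr k) (cc Z) * v a)" if "k < d" for v k
  by (rule tangent_apply_cc[OF open_Om rh[OF that]]) (use assms(2,3) in \<open>auto simp: DD_iff\<close>)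
 then show ?thesis unfolding complex_tangent_space_def CT_def assms(1)[symmetric] by auto
qed

lemma subspace_CT: "fvs.subspace (CT Z)"
 unfolding fvs.subspace_def CT_def
 by (auto simp: cspace_plus smul_def cspace_def algebra_simps sum.distrib sum_distrib_left[symmetric])

lemma sum_sw: "(\<Sum>a\<in>A. f (sw a)) = (\<Sum>a\<in>A. f a)"
 by (simp add: sum.Plus add.commute)

text \<open>
Reality of the defining functions makes the complexified tangent space of \<open>M\<close> closed under conjugation.
\<close>

lemma CT_sc:
 assumes Z: "cc Z \<in> DD" and v: "v \<in> CT Z" shows "sc v \<in> CT Z"
proof -
 have "(\<Sum>a\<in>A. pd a (rr k) (cc Z) * sc v a) = cnj (\<Sum>a\<in>A. pd a (rr k) (cc Z) * v a)" if k: "k < d" for k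
 proof -
  have "pd a (rr k) (cc Z) * sc v a = cnj (pd (sw a) (rr k) (cc Z) * v (sw a))" if "a \<in> A" for a
   using rr_partial_sc[OF Z k that] by (simp add: sc_apply)
  then have "(\<Sum>a\<in>A. pd a (rr k) (cc Z) * sc v a) = cnj (\<Sum>a\<in>A. pd (sw a) (rr k) (cc Z) * v (sw a))"
   unfolding cnj_sum by (intro sum.cong) auto
  then show ?thesis using sum_sw[of "%a. pd a (rr k) (cc Z) * v a"] by simp
 qed
 moreover have "(\<Sum>a\<in>A. pd a (rr k) (cc Z) * v a) = 0" if "k < d" for k using v that by (auto simp: CT_def)
 ultimately have "(\<Sum>a\<in>A. pd a (rr k) (cc Z) * sc v a) = 0" if "k < d" for k
  using that by (simp only: complex_cnj_zero)
 moreover have "sc v \<in> cspace A" using v by (auto simp: CT_def)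
 ultimately show ?thesis unfolding CT_def by blast
qed

text \<open>
The matrix of the derivatives of the defining functions in the directions of \<open>C\<close> is the identity at \<open>0\<close>, hence
injective nearby.
\<close>

lemma near_identity_germ:
 assumes C: "\<And>k l. k < d ==> l < d ==> (\<Sum>a\<in>A. pd a (rr k) 0 * C a l) = (if k = l then 1 else 0)"
 shows "\<exists>W. open W & 0 \<in> W & W \<subseteq> \<Omega> & (\<forall>x\<in>W \<inter> cspace A. \<forall>s. s \<in> Cn d -->
   (\<forall>k<d. (\<Sum>a\<in>A. pd a (rr k) x * mapp A {..<d} C s a) = 0) --> s = 0)"
proof -
 define \<eta> :: real where "\<eta> = 1 / (2 * (d + 1))"
 have \<eta>: "\<eta> > 0" "card {..<d} * \<eta> \<le> 1/2" by (auto simp: \<eta>_def field_simps)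
 define E where "E k l x = (\<Sum>a\<in>A. pd a (rr k) x * C a l)" for k l x
 have hE: "holo A \<Omega> (E k l)" if "k < d" for k l
  unfolding E_def using that by (intro holo_intros holo_partial rh) auto
 have "\<forall>\<^sub>F x in at 0 within \<Omega> \<inter> cspace A. \<forall>k\<in>{..<d}. \<forall>l\<in>{..<d}. cmod (E k l x - (if k = l then 1 else 0)) < \<eta>"
 proof (intro eventually_ball_finite ballI)
  fix k l assume kl: "k \<in> {..<d}" "l \<in> {..<d}"
  then have "(E k l \<longlongrightarrow> E k l 0) (at 0 within \<Omega> \<inter> cspace A)"
   using hE[of k l] unfolding holo_def continuous_on_def by auto
  from tendstoD[OF this \<eta>(1)] show "\<forall>\<^sub>F x in at 0 within \<Omega> \<inter> cspace A. cmod (E k l x - (if k = l then 1 else 0)) < \<eta>"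
   using C kl by (simp add: dist_norm E_def)
 qed auto
 then obtain V where V: "open V" "0 \<in> V" "\<And>x k l. x \<in> V ==> x \<noteq> 0 ==> x \<in> \<Omega> ==> x \<in> cspace A ==> k < d ==> l < d ==> cmod (E k l x - (if k = l then 1 else 0)) < \<eta>"
  unfolding eventually_at_topological by force
 have b: "cmod (E k l x - (if k = l then 1 else 0)) \<le> \<eta>" if "x \<in> V \<inter> \<Omega>" "x \<in> cspace A" "k < d" "l < d" for x k l
  using V(3)[of x k l] C that \<eta>(1) by (cases "x = 0") (auto simp: E_def less_imp_le)
 show ?thesis
 proof (intro exI[of _ "V \<inter> \<Omega>"] conjI ballI allI impI)
  fix x and s :: "nat cpoint" assume x: "x \<in> V \<inter> \<Omega> \<inter> cspace A" and s: "s \<in> Cn d"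
   and z: "\<forall>k<d. (\<Sum>a\<in>A. pd a (rr k) x * mapp A {..<d} C s a) = 0"
  have "(\<Sum>l<d. E k l x * s l) = 0" if "k < d" for k
  proof -
   have "(\<Sum>l<d. E k l x * s l) = (\<Sum>a\<in>A. pd a (rr k) x * mapp A {..<d} C s a)"
    unfolding E_def sum_distrib_right by (subst sum.swap) (simp add: mapp_def sum_distrib_left mult.assoc)
   then show ?thesis using z that by simp
  qed
  then have "(\<Sum>u<d. cmod (s u)) \<le> 0"
   using near_identity_bound(1)[of "{..<d}" "%k l. E k l x" \<eta> s] b x \<eta>(2) by simp
  then have "(\<Sum>u<d. cmod (s u)) = 0" by (simp add: sum_nonneg eq_iff)
  then have "\<forall>u<d. s u = 0" by (simp add: sum_nonneg_eq_0_iff)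
  then show "s = 0" using s by (auto simp: cspace_def fun_eq_iff)
 qed (use V in auto)
qed

section \<open>Functions vanishing on the submanifold\<close>

text \<open>
Half of the transversal directions in \<open>Z\<close> and half, conjugated, in \<open>\<zeta>\<close>: this choice commutes with the
involution \<open>sc\<close>, so the resulting projection maps real points to points of \<open>M\<close>.
\<close>

definition Cm :: "nat + nat => nat => complex" where
 "Cm a l = (case a of Inl i => Bs i l / 2 | Inr i => cnj (Bs i l) / 2)"

lemma sum_dbl: "(\<Sum>a\<in>A. f a) = (\<Sum>i<N. f (Inl i)) + (\<Sum>i<N. f (Inr i))"
 by (simp add: sum.Plus)

lemma Cm: assumes "k < d" "l < d"
 shows "(\<Sum>a\<in>A. pd a (rr k) 0 * Cm a l) = (if k = l then 1 else 0)"
proof -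
 have "pd (Inr i) (rr k) 0 = cnj (pd (Inl i) (rr k) 0)" if "i < N" for i
  using rr_partial_sc[of 0 k "Inr i"] assms that zero_Om by simp
 then have "(\<Sum>i<N. pd (Inr i) (rr k) 0 * Cm (Inr i) l) = cnj (\<Sum>i<N. pd (Inl i) (rr k) 0 * Bs i l) / 2"
  by (simp add: Cm_def sum_divide_distrib)
 then have e1: "(\<Sum>i<N. pd (Inr i) (rr k) 0 * Cm (Inr i) l) = cnj (if k = l then 1 else 0) / 2"
  unfolding Bs[OF assms] .
 have "(\<Sum>i<N. pd (Inl i) (rr k) 0 * Cm (Inl i) l) = (\<Sum>i<N. pd (Inl i) (rr k) 0 * Bs i l) / 2"
  by (simp add: Cm_def sum_divide_distrib)
 then have e2: "(\<Sum>i<N. pd (Inl i) (rr k) 0 * Cm (Inl i) l) = (if k = l then 1 else 0) / 2"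
  unfolding Bs[OF assms] .
 show ?thesis unfolding sum_dbl e1 e2 by simp
qed

abbreviation idm :: "nat + nat => nat + nat => complex" where "idm \<equiv> %a b. if a = b then 1 else 0"

lemma mapp_idm: "x \<in> cspace A ==> mapp A A idm x = x"
 by (auto simp: mapp_def fun_eq_iff cspace_def if_distrib[of "%c. c * _"] cong: if_cong)

lemma sc_Cm: "sc (mapp A {..<d} Cm s) = mapp A {..<d} Cm (cconj s)"
proof
 fix a show "sc (mapp A {..<d} Cm s) a = mapp A {..<d} Cm (cconj s) a"
  by (cases a) (auto simp: sc_apply mapp_def Cm_def)
qed

lemma sc_add: "sc (x + y) = sc x + sc y" by (simp add: fun_eq_iff sc_apply)

lemma tangent_apply_lin:
 "tangent_apply N (v + w) f Z = tangent_apply N v f Z + tangent_apply N w f Z"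
 "tangent_apply N (smul c v) f Z = c * tangent_apply N v f Z"
 unfolding tangent_apply_def sum.distrib[symmetric] sum_distrib_left
 by (intro sum.cong refl, simp add: smul_def field_simps)+

end

section \<open>Segre flows and their vector fields\<close>

lemma partial_deriv_shift: "pd b f x = deriv (%h. f (x(b := x b + h))) 0"
proof -
 have "(%D. ((%t. f (x(b := t))) has_field_derivative D) (at (0 + x b))) = (%D. ((%h. f (x(b := x b + h))) has_field_derivative D) (at 0))"
  by (rule ext, subst DERIV_shift) (simp add: add.commute)
 then show ?thesis unfolding partial_deriv_def deriv_def by simp
qed

lemma holo_subset': assumes f: "holo I V f" and W: "W \<inter> cspace I \<subseteq> V" shows "holo I W f"
proof -
 have s: "W \<inter> cspace I \<subseteq> V \<inter> cspace I" using W by blast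
 show ?thesis using f continuous_on_subset[OF _ s] s unfolding holo_def by blast
qed

lemma holo_swap:
 assumes V: "open V" and f: "holo (dbl N) V f"
 shows "holo (dbl N) (sc -` V) (%x. cnj (f (sc x)))" and "open (sc -` V)"
proof -
 define swp :: "(nat + nat) cpoint => (nat + nat) cpoint" where "swp x = (%a. x (sw a))" for x
 have sc_swp: "sc x = cconj (swp x)" for x by (auto simp: swp_def sc_apply fun_eq_iff)
 have hs: "holom (dbl N) (dbl N) UNIV swp" unfolding holom_def
 proof (intro conjI ballI)
  fix z assume "z \<in> UNIV \<inter> cspace (dbl N)"
  then have "sc z \<in> cspace (dbl N)" by simp
  then show "swp z \<in> cspace (dbl N)" by (simp add: sc_swp)
 qed (simp add: swp_def)
 have c: "continuous_on UNIV sc"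
  by (rule continuous_on_coordinatewise_then_product)
    (auto simp: sc_apply intro!: continuous_intros continuous_on_product_coordinates)
 show o: "open (sc -` V)" by (rule open_vimage[OF V c])
 show "holo (dbl N) (sc -` V) (%x. cnj (f (sc x)))"
  using holo_compose[OF _ o open_vimage_cconj[OF V] holo_cnj(1)[OF f V] holom_subset[OF hs subset_UNIV]]
  by (simp add: sc_swp)
qed

lemma differential_apply: "differential A Q x v s = (\<Sum>a\<in>A. pd a (%z. Q z s) x * v a)"
 by (simp add: differential_def)

context chart
begin

text \<open>
A real tangent vector is the velocity of the curve obtained by retracting a line onto \<open>M\<close>; the
correction made by the retraction has derivative zero in tangential directions. Complex tangent vectors are
combinations of two real ones by \<open>CT_sc\<close>.
\<close>

lemma tangential:
 assumes f: "smooth_germ N f 0" and fM: "\<forall>\<^sub>F Z in nhds 0. Z \<in> M --> f Z = 0"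
 shows "\<forall>\<^sub>F Z in nhds 0. Z \<in> M --> (\<forall>v\<in>CT Z. tangent_apply N v f Z = 0)"
proof -
 define S where "S = gsol idm Cm"
 obtain U ep where U: "open U" "0 \<in> U" "ep > 0" "holom A {..<d} U S" "S 0 = 0"
  and US: "\<And>x. x \<in> U ==> x \<in> cspace A ==> x + mapp A {..<d} Cm (S x) \<in> DD & (\<forall>k<d. rr k (x + mapp A {..<d} Cm (S x)) = 0)"
  and Uu: "\<And>x s. x \<in> U ==> x \<in> cspace A ==> s \<in> pdisc {..<d} 0 ep ==> (\<forall>k<d. rr k (x + mapp A {..<d} Cm s) = 0) ==> s = S x"
 proof -
  obtain U ep where "open U & 0 \<in> U & ep > 0 & holom A {..<d} U S & S 0 = 0 &
  (\<forall>x\<in>U \<inter> cspace A. mapp A A idm x + mapp A {..<d} Cm (S x) \<in> DD &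
   (\<forall>k<d. rr k (mapp A A idm x + mapp A {..<d} Cm (S x)) = 0) &
   (\<forall>s\<in>pdisc {..<d} 0 ep. (\<forall>k<d. rr k (mapp A A idm x + mapp A {..<d} Cm s) = 0) --> s = S x))"
   unfolding S_def using gsol[OF Cm, of idm] by blast
  then show ?thesis by (intro that[of U ep]) (auto simp: mapp_idm)
 qed
 obtain W where W: "open W" "0 \<in> W" "W \<subseteq> \<Omega>" and Wz: "\<And>x s. x \<in> W ==> x \<in> cspace A ==> s \<in> Cn d ==>
   (\<forall>k<d. (\<Sum>a\<in>A. pd a (rr k) x * mapp A {..<d} Cm s a) = 0) ==> s = 0"
  using near_identity_germ[OF Cm] by blast
 obtain Uf where Uf: "open Uf" "0 \<in> Uf" "smooth_on N Uf f" using f unfolding smooth_germ_iff by blast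
 obtain Vf where Vf: "open Vf" "0 \<in> Vf" "\<And>Z. Z \<in> Vf ==> Z \<in> M ==> f Z = 0" using fM unfolding eventually_nhds by blast
 \<comment> \<open>a neighbourhood on which the solution stays in the range of uniqueness\<close>
 obtain U1 where U1: "open U1" "0 \<in> U1" "U1 \<subseteq> U" "\<And>x. x \<in> U1 ==> x \<in> cspace A ==> S x \<in> pdisc {..<d} 0 ep"
 proof -
  have S0: "S 0 \<in> pbox {..<d} 0 ep" using U(3,5) by simp
  obtain Ua where Ua: "open Ua" "0 \<in> Ua" "Ua \<subseteq> U" "\<forall>z\<in>Ua \<inter> cspace A. S z \<in> pbox {..<d} 0 ep"
   using open_vimage_germ[OF U(4,1) open_pbox[OF finite_lessThan] U(2) cspace_0 S0] by blast
  have "S x \<in> pdisc {..<d} 0 ep" if "x \<in> Ua" "x \<in> cspace A" for x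
   using Ua that U(4) by (auto simp: pdisc_def holom_def)
  then show ?thesis using that[of Ua] Ua by blast
 qed
 have Sreal: "cconj (S (cc Z)) = S (cc Z)" if Z: "cc Z \<in> U1" "Z \<in> Cn N" for Z
 proof (rule Uu)
  show "cconj (S (cc Z)) \<in> pdisc {..<d} 0 ep" using U1(4)[of "cc Z"] Z by (auto simp: pdisc_iff)
  show "\<forall>k<d. rr k (cc Z + mapp A {..<d} Cm (cconj (S (cc Z)))) = 0"
  proof safe
   fix k assume k: "k < d"
   have x: "cc Z + mapp A {..<d} Cm (S (cc Z)) \<in> DD" "rr k (cc Z + mapp A {..<d} Cm (S (cc Z))) = 0"
    using US[of "cc Z"] Z U1(3) k by auto
   have "cc Z + mapp A {..<d} Cm (cconj (S (cc Z))) = sc (cc Z + mapp A {..<d} Cm (S (cc Z)))"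
    by (simp add: sc_add sc_Cm)
   then show "rr k (cc Z + mapp A {..<d} Cm (cconj (S (cc Z)))) = 0" using rreal[OF x(1) k] x(2) by simp
  qed
 qed (use Z U1 in auto)
 define ret where "ret Z = Z + (%i. mapp A {..<d} Cm (S (cc Z)) (Inl i))" for Z
 have cc_ret: "cc (ret Z) = cc Z + mapp A {..<d} Cm (S (cc Z))" if Z: "cc Z \<in> U1" "Z \<in> Cn N" for Z
 proof -
  let ?y = "cc Z + mapp A {..<d} Cm (S (cc Z))"
  have "sc ?y = ?y" using Sreal[OF Z] by (simp add: sc_add sc_Cm)
  from sc_fixed[OF this] show ?thesis by (simp add: ret_def comp_def plus_fun_def)
 qed
 have ret_Cn: "ret Z \<in> Cn N" if "Z \<in> Cn N" for Z
  using that by (auto simp: ret_def cspace_def mapp_def)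
 have ret_M: "ret Z \<in> M" if Z: "cc Z \<in> U1" "Z \<in> Cn N" for Z
 proof -
  have "cc Z \<in> U" "cc Z \<in> cspace A" using Z U1 by auto
  from US[OF this] show ?thesis using Mr[OF ret_Cn[OF Z(2)]] cc_ret[OF Z] by simp
 qed
 have ret_fix: "S (cc Z) = 0 & ret Z = Z" if Z: "cc Z \<in> U1" "cc Z \<in> \<Omega>" "Z \<in> M" for Z
 proof -
  have ZC: "Z \<in> Cn N" using Z MC by auto
  have "\<forall>k<d. rr k (cc Z + mapp A {..<d} Cm 0) = 0" using Mr[OF ZC] Z ZC by (simp add: DD_iff)
  then have "0 = S (cc Z)" by (intro Uu) (use Z ZC U1 U(3) in \<open>auto simp: pdisc_iff\<close>)
  then show ?thesis by (simp add: ret_def zero_fun_def[symmetric])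
 qed
 have hr: "holom A A U1 (%x. x + mapp A {..<d} Cm (S x))"
  unfolding holom_def
 proof (intro conjI ballI)
  fix a assume "a \<in> A"
  then show "holo A U1 (%x. (x + mapp A {..<d} Cm (S x)) a)"
   using holom_subset[OF U(4) U1(3)] unfolding holom_def by (auto simp: mapp_def intro!: holo_intros)
 qed (auto intro!: cspace_plus)
 obtain U2 where U2: "open U2" "0 \<in> U2" "U2 \<subseteq> U1" "\<And>x. x \<in> U2 ==> x \<in> cspace A ==> x + mapp A {..<d} Cm (S x) \<in> \<Omega> \<inter> W"
 proof -
  have 0: "0 + mapp A {..<d} Cm (S 0) \<in> \<Omega> \<inter> W" using U(5) W by auto
  have o: "open (\<Omega> \<inter> W)" using W by auto
  obtain Ub where Ub: "open Ub" "0 \<in> Ub" "Ub \<subseteq> U1" "\<forall>z\<in>Ub \<inter> cspace A. z + mapp A {..<d} Cm (S z) \<in> \<Omega> \<inter> W"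
   using open_vimage_germ[where G="%x. x + mapp A {..<d} Cm (S x)" and a=0, OF hr U1(1) o U1(2) cspace_0 0] by blast
  show ?thesis by (rule that[OF Ub(1,2,3)]) (rule bspec[OF Ub(4)], simp)
 qed
 define G where "G = cc -` (U2 \<inter> \<Omega> \<inter> W) \<inter> Uf \<inter> Vf"
 have G: "open G" "0 \<in> G"
 proof -
  have "open (U2 \<inter> \<Omega> \<inter> W)" using U2(1) W(1) open_Om by blast
  then show "open G" unfolding G_def using Uf(1) Vf(1) open_vimage_cc by blast
  show "0 \<in> G" using U2(2) W(2) Uf(2) Vf(2) by (simp add: G_def)
 qed
 have main: "tangent_apply N (cc u) f Z = 0" if Z: "Z \<in> G" "Z \<in> M" and u: "cc u \<in> CT Z" for Z u
 proof -
  have ZC: "Z \<in> Cn N" and uC: "u \<in> Cn N" using Z MC u by (auto simp: CT_def)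
  have Z2: "cc Z \<in> U2" "cc Z \<in> U1" "cc Z \<in> \<Omega>" "cc Z \<in> W" "Z \<in> Uf" using Z U2(3) by (auto simp: G_def)
  note S0 = ret_fix[OF Z2(2,3) Z(2)]
  define gm where "gm t = Z + (%i. of_real t * u i)" for t :: real
  have gm0: "gm 0 = Z" by (simp add: gm_def fun_eq_iff)
  have gmC: "gm t \<in> Cn N" for t using ZC uC by (auto simp: gm_def cspace_def)
  have gmd: "((%t. cc (gm t) a) has_vector_derivative cc u a) (at 0)" for a
   by (cases a) (auto simp: gm_def intro!: derivative_eq_intros)
  define s' where "s' = (%k. if k < d then \<Sum>a\<in>A. pd a (%x. S x k) (cc Z) * cc u a else 0)"
  have hS: "holo A U2 (%x. S x k)" if "k < d" for k
  proof (rule holo_subset)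
   show "holo A U (%x. S x k)" using U(4) that unfolding holom_def by simp
   show "U2 \<subseteq> U" using U2(3) U1(3) by blast
  qed
  have chain: "((%t. F (cc (gm t))) has_vector_derivative (\<Sum>a\<in>A. pd a F (cc Z) * cc u a)) (at 0)"
   if F: "holo A V F" "open V" "cc Z \<in> V" for F V
  proof -
   have "((%t. F (cc (gm t))) has_derivative (%h. \<Sum>a\<in>A. pd a F (cc (gm 0)) * (h *\<^sub>R cc u a))) (at 0)"
    by (rule holo_chain[OF finA F(2,1)]) (use gmC gmd F(3) gm0 in \<open>auto simp: has_vector_derivative_def\<close>)
   then show ?thesis unfolding has_vector_derivative_def gm0
    by (rule has_derivative_eq_rhs) (simp add: fun_eq_iff scaleR_sum_right)
  qed
  have Sd: "((%t. S (cc (gm t)) k) has_vector_derivative s' k) (at 0)" if "k < d" for k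
   using chain[OF hS[OF that] U2(1) Z2(1)] that by (simp add: s'_def)
  have s'0: "s' = 0"
  proof (rule Wz[OF Z2(4)])
   show "cc Z \<in> cspace A" using ZC by simp
   show "s' \<in> Cn d" by (auto simp: s'_def cspace_def)
   show "\<forall>k<d. (\<Sum>a\<in>A. pd a (rr k) (cc Z) * mapp A {..<d} Cm s' a) = 0"
   proof safe
    fix k assume k: "k < d"
    let ?H = "%x. x + mapp A {..<d} Cm (S x)"
    have hH: "holo A U2 (%x. rr k (?H x))"
     by (rule holo_compose[OF finA U2(1) open_Om rh[OF k] holom_subset[OF hr U2(3)]]) (use U2(4) in auto)
    have Hd: "((%t. ?H (cc (gm t)) a) has_vector_derivative (cc u a + mapp A {..<d} Cm s' a)) (at 0)" if "a \<in> A" for a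
    proof -
     have "((%t. cc (gm t) a + (\<Sum>l<d. Cm a l * S (cc (gm t)) l)) has_vector_derivative (cc u a + (\<Sum>l<d. Cm a l * s' l))) (at 0)"
      by (rule has_vector_derivative_add[OF gmd], rule has_vector_derivative_sum, rule has_vector_derivative_mult_right, rule Sd) simp
     then show ?thesis using that by (simp add: mapp_def)
    qed
    have H0: "?H (cc (gm 0)) = cc Z" using S0 by (simp add: gm0)
    have "((%t. rr k (?H (cc (gm t)))) has_derivative (%h. \<Sum>a\<in>A. pd a (rr k) (?H (cc (gm 0))) * (h *\<^sub>R (cc u a + mapp A {..<d} Cm s' a)))) (at 0)"
     by (rule holo_chain[OF finA open_Om rh[OF k]])
       (use gmC ZC Hd Z2 H0 in \<open>auto simp: has_vector_derivative_def intro!: cspace_plus\<close>)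
    then have "((%t. rr k (?H (cc (gm t)))) has_vector_derivative (\<Sum>a\<in>A. pd a (rr k) (cc Z) * (cc u a + mapp A {..<d} Cm s' a))) (at 0)"
     unfolding has_vector_derivative_def H0
     by (rule has_derivative_eq_rhs) (simp add: fun_eq_iff scaleR_sum_right)
    moreover have "((%t. rr k (?H (cc (gm t)))) has_vector_derivative 0) (at 0)"
    proof -
     have "\<forall>\<^sub>F t in nhds 0. cc (gm t) \<in> U2"
     proof -
      have "continuous_on UNIV (%t. cc (gm t))"
      proof (rule continuous_on_coordinatewise_then_product)
       fix i :: "nat + nat" show "continuous_on UNIV (%t. cc (gm t) i)"
        by (cases i) (auto simp: gm_def intro!: continuous_intros)
      qed
      then have "open ((%t. cc (gm t)) -` U2)" by (rule open_vimage[OF U2(1)])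
      then have "\<forall>\<^sub>F t in nhds 0. t \<in> ((%t. cc (gm t)) -` U2)" by (rule eventually_nhds_in_open) (use Z2 gm0 in auto)
      then show ?thesis by simp
     qed
     then have ev: "\<forall>\<^sub>F t in nhds 0. rr k (?H (cc (gm t))) = 0"
      by eventually_elim (use US U2 U1 k gmC in auto)
     show ?thesis
      by (subst has_vector_derivative_cong_ev[where g="%_. 0"]) (use ev eventually_nhds_x_imp_x[OF ev] in auto)
    qed
    ultimately have "(\<Sum>a\<in>A. pd a (rr k) (cc Z) * (cc u a + mapp A {..<d} Cm s' a)) = 0"
     by (rule vector_derivative_unique_at)
    moreover have "(\<Sum>a\<in>A. pd a (rr k) (cc Z) * cc u a) = 0" using u k by (auto simp: CT_def)
    ultimately show "(\<Sum>a\<in>A. pd a (rr k) (cc Z) * mapp A {..<d} Cm s' a) = 0"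
     by (simp add: algebra_simps sum.distrib)
   qed
  qed
  have rd: "((%t. ret (gm t) j) has_vector_derivative u j) (at 0)" if "j < N" for j
  proof -
   have "((%t. cc (gm t) (Inl j) + (\<Sum>l<d. Cm (Inl j) l * S (cc (gm t)) l)) has_vector_derivative (cc u (Inl j) + (\<Sum>l<d. Cm (Inl j) l * s' l))) (at 0)"
    by (rule has_vector_derivative_add[OF gmd], rule has_vector_derivative_sum, rule has_vector_derivative_mult_right, rule Sd) simp
   then show ?thesis using that s'0 by (simp add: ret_def mapp_def)
  qed
  have "((%t. f (ret (gm t))) has_vector_derivative (\<Sum>j<N. Re (u j) *\<^sub>R real_partial j 1 f (ret (gm 0)) + Im (u j) *\<^sub>R real_partial j \<i> f (ret (gm 0)))) (at 0)"
   by (rule real_chain[OF Uf(1,3)]) (use rd ret_Cn gmC S0 Z2 gm0 in auto)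
  then have 1: "((%t. f (ret (gm t))) has_vector_derivative tangent_apply N (cc u) f Z) (at 0)"
   using S0 by (simp add: tangent_apply_real gm0)
  have "\<forall>\<^sub>F t in at 0. ret (gm t) \<in> Vf & cc (gm t) \<in> U1"
  proof -
   have c1: "continuous_on UNIV (%t. cc (gm t))"
   proof (rule continuous_on_coordinatewise_then_product)
    fix i :: "nat + nat" show "continuous_on UNIV (%t. cc (gm t) i)"
     by (cases i) (auto simp: gm_def intro!: continuous_intros)
   qed
   have o1: "open ((%t. cc (gm t)) -` U2)" by (rule open_vimage[OF U2(1) c1])
   have c2: "continuous_on ((%t. cc (gm t)) -` U2) (%t. ret (gm t))"
   proof (rule continuous_on_coordinatewise_then_product)
    fix i
    have "continuous_on ((%t. cc (gm t)) -` U2) (%t. S (cc (gm t)) l)" if "l < d" for l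
     by (rule continuous_on_compose2[of "U2 \<inter> cspace A" "%x. S x l"])
       (use hS[OF that] gmC continuous_on_subset[OF c1] in \<open>auto simp: holo_def\<close>)
    then show "continuous_on ((%t. cc (gm t)) -` U2) (%t. ret (gm t) i)"
     by (cases "i < N") (auto simp: ret_def mapp_def gm_def intro!: continuous_intros)
   qed
   have "open ((%t. ret (gm t)) -` Vf \<inter> (%t. cc (gm t)) -` U2)"
    using iffD1[OF continuous_on_open_vimage[OF o1] c2, rule_format, OF Vf(1)] .
   then have "\<forall>\<^sub>F t in nhds 0. t \<in> ((%t. ret (gm t)) -` Vf \<inter> (%t. cc (gm t)) -` U2)"
    by (rule eventually_nhds_in_open) (use Z S0 Z2 gm0 in \<open>auto simp: G_def\<close>)
   then have "\<forall>\<^sub>F t in nhds 0. ret (gm t) \<in> Vf & cc (gm t) \<in> U1"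
    by eventually_elim (use U2 in auto)
   then show ?thesis by (auto simp: eventually_at_filter elim: eventually_mono)
  qed
  then have "\<forall>\<^sub>F t in at 0. f (ret (gm t)) = 0" by eventually_elim (use Vf(3) ret_M gmC in auto)
  moreover have "f (ret (gm 0)) = 0" using Vf(3)[of Z] Z S0 gm0 by (simp add: G_def)
  ultimately have ev: "\<forall>\<^sub>F t in nhds 0. f (ret (gm t)) = 0"
   unfolding eventually_nhds_conv_at by simp
  have "((%t. f (ret (gm t))) has_vector_derivative 0) (at 0)"
   by (subst has_vector_derivative_cong_ev[where g="%_. 0"]) (use ev eventually_nhds_x_imp_x[OF ev] in auto)
  with 1 show ?thesis by (rule vector_derivative_unique_at)
 qed
 show ?thesis unfolding eventually_nhds
 proof (intro exI[of _ G] conjI ballI impI)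
  fix Z v assume Z: "Z \<in> G" "Z \<in> M" and v: "v \<in> CT Z"
  have ZD: "cc Z \<in> DD" using Z MC by (auto simp: G_def DD_iff)
  define v1 where "v1 = smul (1/2) (v + sc v)"
  define v2 where "v2 = smul (-\<i>/2) (v - sc v)"
  have vs: "v = v1 + smul \<i> v2" by (simp add: v1_def v2_def smul_def fun_eq_iff field_simps)
  have "v1 \<in> CT Z" unfolding v1_def
   by (rule fvs.subspace_scale[OF subspace_CT fvs.subspace_add[OF subspace_CT v CT_sc[OF ZD v]]])
  moreover have "v2 \<in> CT Z" unfolding v2_def
   by (rule fvs.subspace_scale[OF subspace_CT fvs.subspace_diff[OF subspace_CT v CT_sc[OF ZD v]]])
  moreover have "sc v1 = v1" "sc v2 = v2"
   by (auto simp: v1_def v2_def smul_def fun_eq_iff sc_apply field_simps)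
  moreover note sc_fixed[of v1] sc_fixed[of v2]
  ultimately have "tangent_apply N v1 f Z = 0" "tangent_apply N v2 f Z = 0"
   using main[OF Z, of "v1 o Inl"] main[OF Z, of "v2 o Inl"] by simp_all
  then show "tangent_apply N v f Z = 0" by (subst vs) (simp add: tangent_apply_lin)
 qed (use G in auto)
qed

definition Bm :: "nat => nat => complex" where "Bm l j = pd (Inl j) (rr l) 0"

text \<open>
The linear projection whose kernel is spanned by the columns of \<open>Cq\<close> and whose image is annihilated by the \<open>Z\<close>-derivative of the
defining functions at \<open>0\<close>; it keeps \<open>\<zeta>\<close>.
\<close>

definition Pm :: "nat + nat => nat + nat => complex" where
 "Pm a b = (case a of Inl i => (case b of Inl j => (if i = j then 1 else 0) - (\<Sum>l<d. Bs i l * Bm l j) | Inr j => 0)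
   | Inr i => (case b of Inl j => 0 | Inr j => if i = j then 1 else 0))"

definition Cq :: "nat + nat => nat => complex" where
 "Cq a l = (case a of Inl i => Bs i l | Inr i => 0)"

lemma Cq: "k < d ==> l < d ==> (\<Sum>a\<in>A. pd a (rr k) 0 * Cq a l) = (if k = l then 1 else 0)"
 using Bs by (simp add: sum_dbl Cq_def)

definition bm :: "(nat + nat) cpoint => nat cpoint" where
 "bm x = (%l. if l < d then \<Sum>j<N. Bm l j * x (Inl j) else 0)"

lemma bm_Cn[simp]: "bm x \<in> Cn d" by (simp add: bm_def cspace_def)

lemma Pm_decomp: assumes "x \<in> cspace A" shows "x = mapp A A Pm x + mapp A {..<d} Cq (bm x)"
proof
 fix a show "x a = (mapp A A Pm x + mapp A {..<d} Cq (bm x)) a"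
 proof (cases a)
  case (Inl i)
  show ?thesis
  proof (cases "i < N")
   case True
   have "(\<Sum>j<N. ((if i = j then 1 else 0) - (\<Sum>l<d. Bs i l * Bm l j)) * x (Inl j)) = x (Inl i) - (\<Sum>j<N. \<Sum>l<d. Bs i l * Bm l j * x (Inl j))"
    using True by (simp add: left_diff_distrib sum_subtractf sum_distrib_right if_distrib[of "%c. c * _"] cong: if_cong)
   moreover have "(\<Sum>j<N. \<Sum>l<d. Bs i l * Bm l j * x (Inl j)) = (\<Sum>l<d. Bs i l * (\<Sum>j<N. Bm l j * x (Inl j)))"
    by (subst sum.swap) (simp add: sum_distrib_left mult.assoc)
   ultimately show ?thesis using True Inl by (simp add: mapp_def sum_dbl Pm_def Cq_def bm_def)
  qed (use assms Inl in \<open>simp add: mapp_def cspace_def\<close>)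
 next
  case (Inr i)
  then show ?thesis using assms
   by (cases "i < N") (auto simp: mapp_def sum_dbl Pm_def Cq_def cspace_def if_distrib[of "%c. c * _"] cong: if_cong)
 qed
qed

lemma bm_Cq: assumes "s \<in> Cn d" shows "bm (mapp A {..<d} Cq s) = s"
proof
 fix l show "bm (mapp A {..<d} Cq s) l = s l"
 proof (cases "l < d")
  case True
  have "bm (mapp A {..<d} Cq s) l = (\<Sum>j<N. Bm l j * (\<Sum>m<d. Bs j m * s m))"
   using True by (simp add: bm_def mapp_def Cq_def)
  also have "\<dots> = (\<Sum>m<d. (\<Sum>j<N. Bm l j * Bs j m) * s m)"
   unfolding sum_distrib_left sum_distrib_right by (subst sum.swap) (simp add: mult.assoc)
  also have "\<dots> = (\<Sum>m<d. (if m = l then 1 else 0) * s m)"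
   by (rule sum.cong) (use Bs[OF True] in \<open>auto simp: Bm_def\<close>)
  also have "\<dots> = s l" using True by (simp add: sum_ind)
  finally show ?thesis .
 qed (use assms in \<open>simp add: bm_def cspace_def\<close>)
qed

lemma Pm_Cq: assumes "s \<in> Cn d" shows "mapp A A Pm (mapp A {..<d} Cq s) = 0"
proof -
 have "mapp A {..<d} Cq s = mapp A A Pm (mapp A {..<d} Cq s) + mapp A {..<d} Cq s"
  using Pm_decomp[of "mapp A {..<d} Cq s"] bm_Cq[OF assms] by simp
 then show ?thesis by (metis add_cancel_right_left)
qed

lemma Pm_Pm: assumes "x \<in> cspace A" shows "mapp A A Pm (mapp A A Pm x) = mapp A A Pm x"
proof -
 have "mapp A A Pm x = mapp A A Pm (mapp A A Pm x + mapp A {..<d} Cq (bm x))"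
  using Pm_decomp[OF assms] by simp
 also have "\<dots> = mapp A A Pm (mapp A A Pm x) + 0" by (simp only: mapp_add Pm_Cq[OF bm_Cn])
 finally show ?thesis by simp
qed

definition gq :: "(nat + nat) cpoint => nat cpoint" where "gq = gsol Pm Cq"

text \<open>
The projection of a neighbourhood of \<open>0\<close> onto the complexification of \<open>M\<close> that keeps \<open>\<zeta>\<close> and moves \<open>Z\<close> along the
directions \<open>Cq\<close>. It depends on its argument through \<open>Pm\<close> only (\<open>kq_cong\<close>), with no smallness condition.
\<close>

definition kq :: "(nat + nat) cpoint => (nat + nat) cpoint" where
 "kq x = mapp A A Pm x + mapp A {..<d} Cq (gq x)"

lemma kq_cspace[simp]: "kq x \<in> cspace A" by (simp add: kq_def cspace_plus)

lemma kq_cong: "mapp A A Pm x = mapp A A Pm y ==> kq x = kq y"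
proof -
 define K where "K m = m + mapp A {..<d} Cq (%j. lim (%n. ((%s k. if k < d then s k - rr k (m + mapp A {..<d} Cq s) else 0) ^^ n) 0 j))" for m
 have K: "kq z = K (mapp A A Pm z)" for z by (simp only: kq_def gq_def gsol_def fixsol_def K_def)
 assume "mapp A A Pm x = mapp A A Pm y"
 then show "kq x = kq y" unfolding K by (rule arg_cong)
qed

lemma mapp_restrict: "mapp A {..<d} Cq s = mapp A {..<d} Cq (%l. if l < d then s l else 0)"
 by (simp add: mapp_def fun_eq_iff)

lemma Pm_kq: assumes "x \<in> cspace A" shows "mapp A A Pm (kq x) = mapp A A Pm x"
proof -
 have "mapp A A Pm (kq x) = mapp A A Pm (mapp A A Pm x) + mapp A A Pm (mapp A {..<d} Cq (%l. if l < d then gq x l else 0))"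
  unfolding kq_def by (simp only: mapp_add mapp_restrict[symmetric])
 moreover have "mapp A A Pm (mapp A {..<d} Cq (%l. if l < d then gq x l else 0)) = 0"
  by (rule Pm_Cq) (simp add: cspace_def)
 ultimately show ?thesis using Pm_Pm[OF assms] by simp
qed

lemma kq_Inr: "x \<in> cspace A ==> kq x (Inr i) = x (Inr i)"
 by (cases "i < N") (auto simp: kq_def mapp_def sum_dbl Pm_def Cq_def cspace_def if_distrib[of "%c. c * _"] cong: if_cong)

definition inl :: "nat cpoint => (nat + nat) cpoint" where "inl t = case_sum t 0"

lemma inl_cspace[simp]: "inl t \<in> cspace A \<longleftrightarrow> t \<in> Cn N" by (simp add: inl_def)
lemma inl_add: "inl (s + t) = inl s + inl t" by (simp add: inl_def fun_eq_iff split: sum.splits)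
lemma inl_0[simp]: "inl 0 = 0" by (simp add: inl_def)
lemma inl_simps[simp]: "inl t (Inl i) = t i" "inl t (Inr i) = 0" by (simp_all add: inl_def)

text \<open>
Moving inside a Segre variety: \<open>\<zeta>\<close> stays fixed and \<open>Z\<close> moves. As \<open>kq\<close> depends on \<open>Pm\<close> only, this is an
action of the additive group (\<open>mvE_add\<close>), which makes it possible to undo a step exactly. The map \<open>mvO\<close> is the
conjugate motion, which fixes \<open>Z\<close>.
\<close>

definition mvE :: "nat cpoint => (nat + nat) cpoint => (nat + nat) cpoint" where
 "mvE t x = kq (x + inl t)"

definition mvO :: "nat cpoint => (nat + nat) cpoint => (nat + nat) cpoint" where
 "mvO t x = sc (mvE (cconj t) (sc x))"

lemma mvE_add: assumes "x \<in> cspace A" "b \<in> Cn N" shows "mvE a (mvE b x) = mvE (b + a) x"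
proof -
 have "mapp A A Pm (kq (x + inl b) + inl a) = mapp A A Pm (x + inl (b + a))"
  using assms by (simp only: mapp_add Pm_kq cspace_plus inl_cspace inl_add) (simp add: add.assoc)
 then show ?thesis unfolding mvE_def by (rule kq_cong)
qed

lemma mv_cspace[simp]: "mvE t x \<in> cspace A" "mvO t x \<in> cspace A"
 by (simp_all add: mvE_def mvO_def)

lemma mvO_add: assumes "x \<in> cspace A" "b \<in> Cn N" shows "mvO a (mvO b x) = mvO (b + a) x"
proof -
 have "cconj (b + a) = cconj b + cconj a" by (simp add: fun_eq_iff)
 then show ?thesis unfolding mvO_def using mvE_add[of "sc x" "cconj b" "cconj a"] assms by simp
qed

text \<open>
The velocity of \<open>mvE\<close> in the \<open>i\<close>-th parameter. On \<open>M\<close> these vectors span the \<open>(1,0)\<close> tangent vectors, and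
those of \<open>LO\<close> the \<open>(0,1)\<close> ones.
\<close>

definition LE :: "nat => (nat + nat) cpoint => (nat + nat) cpoint" where
 "LE i x = (%a. if a \<in> A then pd (Inl i) (%x. kq x a) x else 0)"

definition LO :: "nat => (nat + nat) cpoint => (nat + nat) cpoint" where
 "LO i x = sc (LE i (sc x))"

lemma LE_cspace[simp]: "LE i x \<in> cspace A" by (simp add: LE_def cspace_def)
lemma LO_cspace[simp]: "LO i x \<in> cspace A" by (simp add: LO_def)

lemma LE_cong: assumes "mapp A A Pm x = mapp A A Pm y" "i < N" shows "LE i x = LE i y"
proof -
 have "kq (x(Inl i := x (Inl i) + h)) = kq (y(Inl i := y (Inl i) + h))" for h
 proof (rule kq_cong)
  have e: "z(Inl i := z (Inl i) + h) = z + (%b. if b = Inl i then h else 0)" for z :: "(nat + nat) cpoint"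
   by (auto simp: fun_eq_iff)
  show "mapp A A Pm (x(Inl i := x (Inl i) + h)) = mapp A A Pm (y(Inl i := y (Inl i) + h))"
   unfolding e mapp_add assms(1) ..
 qed
 then have "(%h. kq (x(Inl i := x (Inl i) + h)) a) = (%h. kq (y(Inl i := y (Inl i) + h)) a)" for a
  by (intro ext) (rule fun_cong)
 then show ?thesis unfolding LE_def partial_deriv_shift by (simp only:)
qed

text \<open>
The iterated brackets of the velocities of the two flows. Linear combinations are formed only after evaluation at a point.
\<close>

inductive_set LL :: "((nat + nat) cpoint => (nat + nat) cpoint) set" where
 LE: "i < N ==> LE i \<in> LL"
| LO: "i < N ==> LO i \<in> LL"
| br: "P \<in> LL ==> Q \<in> LL ==> hbr A P Q \<in> LL"

lemma LL_cspace: "P \<in> LL ==> P x \<in> cspace A"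
proof (induction arbitrary: x rule: LL.induct)
 case (br P Q)
 have "differential A P' x v s = 0" if "\<And>x. P' x \<in> cspace A" "s \<notin> A" for P' :: "(nat + nat) cpoint => (nat + nat) cpoint" and v s
 proof -
  have "(%z. P' z s) = (%z. 0)" using that by (auto simp: cspace_def)
  then show ?thesis by (simp add: differential_apply partial_deriv_def)
 qed
 then show ?case using br by (simp add: hbr_def cspace_def)
qed auto

lemma kq_germ: "\<exists>r1>0. r1 \<le> r & holom A A (pbox A 0 r1) kq & kq 0 = 0 &
  (\<forall>x\<in>pdisc A 0 r1. kq x \<in> DD & (\<forall>k<d. rr k (kq x) = 0) & ((\<forall>k<d. rr k x = 0) --> kq x = x) &
   (\<forall>s. s \<in> Cn d --> (\<forall>k<d. (\<Sum>a\<in>A. pd a (rr k) x * mapp A {..<d} Cq s a) = 0) --> s = 0))"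
proof -
 obtain U ep where U: "open U" "0 \<in> U" "ep > 0" "holom A {..<d} U gq" "gq 0 = 0"
  and US: "\<And>x. x \<in> U ==> x \<in> cspace A ==> kq x \<in> DD & (\<forall>k<d. rr k (kq x) = 0)"
  and Uu: "\<And>x s. x \<in> U ==> x \<in> cspace A ==> s \<in> pdisc {..<d} 0 ep ==> (\<forall>k<d. rr k (mapp A A Pm x + mapp A {..<d} Cq s) = 0) ==> s = gq x"
  using gsol[OF Cq, of Pm] unfolding gq_def[symmetric] kq_def[symmetric] by blast
 obtain W where W: "open W" "0 \<in> W" "W \<subseteq> \<Omega>" and Wz: "\<And>x s. x \<in> W ==> x \<in> cspace A ==> s \<in> Cn d ==>
   (\<forall>k<d. (\<Sum>a\<in>A. pd a (rr k) x * mapp A {..<d} Cq s a) = 0) ==> s = 0"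
  using near_identity_germ[OF Cq] by blast
 define V where "V = {x. \<forall>l\<in>{..<d}. cmod (bm x l) < ep}"
 have "V = (\<Inter>l\<in>{..<d}. (%x. cmod (bm x l)) -` {..<ep})" by (auto simp: V_def)
 moreover have "open ((%x. cmod (bm x l)) -` {..<ep})" for l
  by (rule open_vimage, simp, cases "l < d")
    (auto simp: bm_def intro!: continuous_intros continuous_on_product_coordinates)
 ultimately have V: "open V" by auto
 have V0: "0 \<in> V" using U(3) by (simp add: V_def bm_def)
 have o: "open (U \<inter> W \<inter> V \<inter> \<Omega>)" by (intro open_Int U(1) W(1) V open_Om)
 obtain r1 where r1: "r1 > 0" "pdisc A 0 r1 \<subseteq> U \<inter> W \<inter> V \<inter> \<Omega>"
  using open_pdisc_subset[OF finA o, of 0] U W V0 by auto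
 define r2 where "r2 = min r1 r"
 have r2: "r2 > 0" "r2 \<le> r" "pdisc A 0 r2 \<subseteq> U \<inter> W \<inter> V \<inter> \<Omega>"
  using r1 r pdisc_mono[of r2 r1 A 0] by (auto simp: r2_def)
 have hg: "holo A (pbox A 0 r2) (%x. gq x l)" if "l < d" for l
  by (rule holo_subset'[of A U]) (use U(4) that r2(3) in \<open>auto simp: holom_def pdisc_def\<close>)
 have "holom A A (pbox A 0 r2) kq" unfolding holom_def kq_def
 proof (intro conjI ballI)
  fix a assume "a \<in> A"
  then show "holo A (pbox A 0 r2) (%x. (mapp A A Pm x + mapp A {..<d} Cq (gq x)) a)"
   by (auto simp: mapp_def intro!: holo_intros hg)
 qed (intro cspace_plus mapp_cspace)
 moreover have "kq 0 = 0" unfolding kq_def U(5) by simp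
 moreover have "kq x = x" if x: "x \<in> pdisc A 0 r2" "\<forall>k<d. rr k x = 0" for x
 proof -
  have xU: "x \<in> U" "x \<in> V" "x \<in> cspace A" using x r2(3) by (auto simp: pdisc_iff)
  have e: "mapp A A Pm x + mapp A {..<d} Cq (bm x) = x" using Pm_decomp[OF xU(3)] by simp
  have "bm x = gq x"
  proof (rule Uu[OF xU(1,3)])
   show "bm x \<in> pdisc {..<d} 0 ep" using xU(2) by (auto simp: pdisc_iff V_def)
   show "\<forall>k<d. rr k (mapp A A Pm x + mapp A {..<d} Cq (bm x)) = 0" unfolding e by (rule x(2))
  qed
  then show ?thesis using e by (simp add: kq_def)
 qed
 moreover have "kq x \<in> DD & (\<forall>k<d. rr k (kq x) = 0)" if "x \<in> pdisc A 0 r2" for x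
  by (rule US) (use r2(3) that in \<open>auto simp: pdisc_iff\<close>)
 moreover have "s = 0" if "x \<in> pdisc A 0 r2" "s \<in> Cn d" "\<forall>k<d. (\<Sum>a\<in>A. pd a (rr k) x * mapp A {..<d} Cq s a) = 0" for x s
 proof (rule Wz)
  show "x \<in> W" "x \<in> cspace A" using r2(3) that(1) by (auto simp: pdisc_iff)
 qed (use that in auto)
 ultimately show ?thesis using r2(1,2) by blast
qed

end

locale flow = chart +
 fixes r1 :: real
 assumes r1: "r1 > 0" "r1 \<le> r" and kh: "holom A A (pbox A 0 r1) kq" and k0: "kq 0 = 0"
  and kD: "\<And>x. x \<in> pdisc A 0 r1 ==> kq x \<in> DD" "\<And>x k. x \<in> pdisc A 0 r1 ==> k < d ==> rr k (kq x) = 0"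
  and kfix: "\<And>x. x \<in> pdisc A 0 r1 ==> (\<And>k. k < d ==> rr k x = 0) ==> kq x = x"
  and knear: "\<And>x s. x \<in> pdisc A 0 r1 ==> s \<in> Cn d ==> (\<And>k. k < d ==> (\<Sum>a\<in>A. pd a (rr k) x * mapp A {..<d} Cq s a) = 0) ==> s = 0"
begin

abbreviation \<Omega>1 where "\<Omega>1 \<equiv> pbox (dbl N) 0 r1"
abbreviation D1 where "D1 \<equiv> pdisc (dbl N) 0 r1"

lemma open_Om1[simp]: "open \<Omega>1" by (rule open_pbox) simp
lemma D1_iff: "x \<in> D1 \<longleftrightarrow> x \<in> \<Omega>1 & x \<in> cspace A" by (auto simp: pdisc_def)
lemma D1_DD: "x \<in> D1 ==> x \<in> DD" using pdisc_mono[OF r1(2), of A 0] by blast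
lemma Om1_Om: "\<Omega>1 \<subseteq> \<Omega>"
proof
 fix x assume "x \<in> \<Omega>1"
 then show "x \<in> \<Omega>" unfolding pbox_def mem_Collect_eq using r1(2) less_le_trans by blast
qed
lemma zero_D1[simp]: "0 \<in> D1" "0 \<in> \<Omega>1" using r1 by (auto simp: pdisc_iff)

lemma hkq: "a \<in> A ==> holo A \<Omega>1 (%x. kq x a)" using kh by (simp add: holom_def)

lemma sc_vimage: "sc -` \<Omega>1 = \<Omega>1"
proof -
 have "sc x \<in> \<Omega>1 \<longleftrightarrow> x \<in> \<Omega>1" for x
  using ball_sw[of N "%a. cmod (x a) < r1"] by (simp add: pbox_def sc_apply)
 then show ?thesis by blast
qed

lemma LE_holo: assumes "i < N" "a \<in> A" shows "holo A \<Omega>1 (%x. LE i x a)"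
proof -
 have "holo A \<Omega>1 (pd (Inl i) (%x. kq x a))"
  by (rule holo_partial[OF finA open_Om1 hkq]) (use assms in auto)
 then show ?thesis using assms by (simp add: LE_def)
qed

lemma LO_holo: assumes "i < N" "a \<in> A" shows "holo A \<Omega>1 (%x. LO i x a)"
proof -
 have "sw a \<in> A" using assms(2) by simp
 from holo_swap(1)[OF open_Om1 LE_holo[OF assms(1) this]] show ?thesis
  unfolding LO_def sc_apply sc_vimage .
qed

lemma LL_holo: "P \<in> LL ==> holom A A \<Omega>1 P"
proof (induction rule: LL.induct)
 case (br P Q)
 have h: "holo A \<Omega>1 (%x. \<Sum>b\<in>A. pd b (%z. Q' z a) x * P' x b)"
  if "a \<in> A" "holom A A \<Omega>1 P'" "holom A A \<Omega>1 Q'" for a P' Q'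
 proof (intro holo_sum holo_mult)
  fix b assume b: "b \<in> A"
  have "holo A \<Omega>1 (%z. Q' z a)" using that(1,3) unfolding holom_def by blast
  then show "holo A \<Omega>1 (%x. pd b (%z. Q' z a) x)" by (rule holo_partial[OF finA open_Om1 _ b])
  show "holo A \<Omega>1 (%x. P' x b)" using that(2) b unfolding holom_def by blast
 qed
 have "holo A \<Omega>1 (%x. hbr A P Q x a)" if "a \<in> A" for a
  unfolding hbr_def fun_diff_def differential_apply by (rule holo_diff[OF h[OF that br(3,4)] h[OF that br(4,3)]])
 then show ?case using LL_cspace[OF LL.br[OF br(1,2)]] unfolding holom_def by blast
next
 case (LE i)
 show ?case unfolding holom_def using LE_holo[OF LE] LE_cspace by blast
next
 case (LO i)
 show ?case unfolding holom_def using LO_holo[OF LO] LO_cspace by blast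
qed

lemma M_D1: assumes "Z \<in> M" "cc Z \<in> D1" shows "kq (cc Z) = cc Z" "k < d ==> rr k (cc Z) = 0"
proof -
 have "Z \<in> Cn N" using assms MC by auto
 then have z: "\<forall>k<d. rr k (cc Z) = 0" using Mr[of Z] D1_DD[OF assms(2)] assms(1) by blast
 then show "kq (cc Z) = cc Z" by (intro kfix[OF assms(2)]) auto
 show "k < d ==> rr k (cc Z) = 0" using z by blast
qed

lemma eventually_cc: "\<forall>\<^sub>F Z in nhds 0. Z \<in> M --> cc Z \<in> D1"
proof -
 have "open (cc -` \<Omega>1)" by (rule open_vimage_cc) simp
 then have "\<forall>\<^sub>F Z in nhds 0. Z \<in> cc -` \<Omega>1" by (rule eventually_nhds_in_open) simp
 then show ?thesis by eventually_elim (use MC in \<open>auto simp: D1_iff\<close>)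
qed

lemma dkq_tangent:
 assumes x: "x \<in> D1" and k: "k < d" and b: "b \<in> A"
 shows "(\<Sum>a\<in>A. pd a (rr k) (kq x) * pd b (%x. kq x a) x) = 0"
proof -
 have "pd b (%x. rr k (kq x)) x = (\<Sum>a\<in>A. pd a (rr k) (kq x) * pd b (%x. kq x a) x)"
  by (rule partial_deriv_compose[OF finA open_Om1 open_Om rh[OF k] kh]) (use x kD(1)[OF x] b in \<open>auto simp: D1_iff DD_iff\<close>)
 moreover have "pd b (%x. rr k (kq x)) x = pd b (%x. 0) x"
  by (rule partial_deriv_cong[OF open_Om1 _ _ b]) (use x kD(2)[OF _ k] in \<open>auto simp: D1_iff\<close>)
 ultimately show ?thesis by (simp add: partial_deriv_def)
qed

lemma dkq_Pm:
 assumes x: "x \<in> D1" and v: "v \<in> cspace A"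
 shows "mapp A A Pm (differential A kq x v) = mapp A A Pm v"
proof
 fix a show "mapp A A Pm (differential A kq x v) a = mapp A A Pm v a"
 proof (cases "a \<in> A")
  case True
  have "(\<Sum>c\<in>A. Pm a c * pd b (%z. kq z c) x) = Pm a b" if b: "b \<in> A" for b
  proof -
   have xc: "x \<in> \<Omega>1" "x \<in> cspace A" using x by (auto simp: D1_iff)
   have "((%t. \<Sum>c\<in>A. Pm a c * kq (x(b:=t)) c) has_field_derivative (\<Sum>c\<in>A. Pm a c * pd b (%z. kq z c) x)) (at (x b))"
    by (intro DERIV_sum DERIV_cmult holo_partial_DERIV[OF hkq] b xc)
   moreover have "(\<Sum>c\<in>A. Pm a c * kq (x(b:=t)) c) = (\<Sum>c\<in>A. Pm a c * (x(b:=t)) c)" for t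
    using fun_cong[OF Pm_kq[OF cspace_upd[OF xc(2) b, of t]], of a] True by (simp only: mapp_def if_True)
   moreover have "((%t. \<Sum>c\<in>A. Pm a c * (x(b:=t)) c) has_field_derivative (\<Sum>c\<in>A. Pm a c * (if c = b then 1 else 0))) (at (x b))"
    by (intro DERIV_sum DERIV_cmult upd_DERIV)
   ultimately have "(\<Sum>c\<in>A. Pm a c * pd b (%z. kq z c) x) = (\<Sum>c\<in>A. Pm a c * (if c = b then 1 else 0))"
    using DERIV_unique by simp
   also have "\<dots> = Pm a b" using sum_ind[OF finA, of b "Pm a"] b by (simp only: mult.commute if_True)
   finally show ?thesis .
  qed
  then have "(\<Sum>b\<in>A. (\<Sum>c\<in>A. Pm a c * pd b (%z. kq z c) x) * v b) = (\<Sum>b\<in>A. Pm a b * v b)"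
   by (intro sum.cong) auto
  moreover have "(\<Sum>c\<in>A. Pm a c * (\<Sum>b\<in>A. pd b (%z. kq z c) x * v b)) = (\<Sum>b\<in>A. (\<Sum>c\<in>A. Pm a c * pd b (%z. kq z c) x) * v b)"
   unfolding sum_distrib_left sum_distrib_right by (subst sum.swap) (simp only: mult.assoc)
  ultimately show ?thesis using True by (simp only: mapp_def if_True differential_apply)
 qed (simp add: mapp_def)
qed

text \<open>
The projection \<open>kq\<close> restricts to the identity on the complexification of \<open>M\<close>. The second claim follows without
derivatives along it: \<open>Dkq v - v\<close> is tangent, and \<open>Pm\<close> annihilates it, so it is a combination of the
transversal directions \<open>Cq\<close>.
\<close>

lemma dkq_CT:
 assumes Z: "Z \<in> M" "cc Z \<in> D1"
 shows "v \<in> cspace A ==> differential A kq (cc Z) v \<in> CT Z" and "v \<in> CT Z ==> differential A kq (cc Z) v = v"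
proof -
 let ?w = "%v. differential A kq (cc Z) v"
 have fx: "kq (cc Z) = cc Z" by (rule M_D1(1)[OF Z])
 show 1: "?w v \<in> CT Z" if v: "v \<in> cspace A" for v
 proof -
  have "(\<Sum>a\<in>A. pd a (rr k) (cc Z) * ?w v a) = 0" if k: "k < d" for k
  proof -
   have "(\<Sum>a\<in>A. pd a (rr k) (cc Z) * ?w v a) = (\<Sum>b\<in>A. (\<Sum>a\<in>A. pd a (rr k) (cc Z) * pd b (%x. kq x a) (cc Z)) * v b)"
    unfolding differential_apply sum_distrib_left sum_distrib_right by (subst sum.swap) (simp only: mult.assoc)
   also have "\<dots> = 0" using dkq_tangent[OF Z(2) k] unfolding fx by (intro sum.neutral) simp
   finally show ?thesis .
  qed
  moreover have "?w v \<in> cspace A" by (rule differential_cspace[OF open_Om1 kh]) (use Z in \<open>auto simp: D1_iff\<close>)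
  ultimately show ?thesis by (simp add: CT_def)
 qed
 show "?w v = v" if v: "v \<in> CT Z"
 proof -
  have vA: "v \<in> cspace A" using v by (simp add: CT_def)
  define u where "u = ?w v - v"
  have u: "u \<in> CT Z" unfolding u_def by (rule fvs.subspace_diff[OF subspace_CT 1[OF vA] v])
  have "mapp A A Pm (u + v) = mapp A A Pm v" using dkq_Pm[OF Z(2) vA] by (simp add: u_def)
  then have "mapp A A Pm u = 0" by (simp only: mapp_add add_0_left[symmetric] add_right_cancel) simp
  then have uC: "u = mapp A {..<d} Cq (bm u)" using Pm_decomp[of u] u by (simp add: CT_def)
  have "bm u = 0"
  proof (rule knear[OF Z(2) bm_Cn])
   fix k assume "k < d"
   then show "(\<Sum>a\<in>A. pd a (rr k) (cc Z) * mapp A {..<d} Cq (bm u) a) = 0"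
    using u unfolding uC[symmetric] by (simp add: CT_def)
  qed
  then have "u = 0" using uC by simp
  then show ?thesis by (simp add: u_def)
 qed
qed

lemma LE_eq: "i < N ==> differential A kq x (inl (unit_at i)) a = (\<Sum>j<N. pd (Inl j) (%z. kq z a) x * unit_at i j)"
 by (simp add: differential_apply sum_dbl)

lemma CT_LE:
 assumes Z: "Z \<in> M" "cc Z \<in> D1" and v: "v \<in> CT Z" "\<And>j. v (Inr j) = 0"
 shows "v = (\<Sum>i<N. smul (v (Inl i)) (LE i (cc Z)))"
proof
 fix a
 have "v a = differential A kq (cc Z) v a" using dkq_CT(2)[OF Z v(1)] by simp
 also have "\<dots> = (\<Sum>i<N. pd (Inl i) (%z. kq z a) (cc Z) * v (Inl i))"
  by (simp add: differential_apply sum_dbl v(2))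
 finally have 1: "v a = (\<Sum>i<N. pd (Inl i) (%z. kq z a) (cc Z) * v (Inl i))" .
 show "v a = (\<Sum>i<N. smul (v (Inl i)) (LE i (cc Z))) a"
 proof (cases "a \<in> A")
  case True
  then show ?thesis using 1 by (simp add: sum_fun_apply smul_def LE_def mult.commute)
 next
  case False
  then show ?thesis using v(1) by (simp add: sum_fun_apply smul_def LE_def CT_def cspace_def)
 qed
qed

lemma CT_LO:
 assumes Z: "Z \<in> M" "cc Z \<in> D1" and v: "v \<in> CT Z" "\<And>j. v (Inl j) = 0"
 shows "v = (\<Sum>i<N. smul (v (Inr i)) (LO i (cc Z)))"
proof -
 have "sc v \<in> CT Z" by (rule CT_sc[OF D1_DD[OF Z(2)] v(1)])
 then have "sc v = (\<Sum>i<N. smul (sc v (Inl i)) (LE i (cc Z)))" by (rule CT_LE[OF Z]) (simp add: sc_apply v(2))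
 then have "sc (sc v) = sc (\<Sum>i<N. smul (sc v (Inl i)) (LE i (cc Z)))" by simp
 also have "\<dots> = (\<Sum>i<N. smul (v (Inr i)) (LO i (cc Z)))"
  by (simp add: fun_eq_iff sc_apply sum_fun_apply smul_def LO_def)
 finally show ?thesis by simp
qed

lemma LE_CT: assumes Z: "Z \<in> M" "cc Z \<in> D1" and i: "i < N" shows "LE i (cc Z) \<in> CT Z"
proof -
 have "LE i (cc Z) = differential A kq (cc Z) (inl (unit_at i))"
 proof
  fix a
  have s: "(\<Sum>j<N. pd (Inl j) (%z. kq z a) (cc Z) * unit_at i j) = pd (Inl i) (%z. kq z a) (cc Z)"
   using i by (simp add: unit_at_def if_distrib[of "(*) _"] cong: if_cong)
  show "LE i (cc Z) a = differential A kq (cc Z) (inl (unit_at i)) a"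
  proof (cases "a \<in> A")
   case True
   then show ?thesis unfolding LE_eq[OF i] s by (simp only: LE_def if_True)
  next
   case False
   then have z: "(%z. kq z a) = (%z. 0)" using kq_cspace unfolding cspace_def by blast
   show ?thesis using False unfolding LE_eq[OF i] s z by (simp only: LE_def if_False) (simp add: partial_deriv_def)
  qed
 qed
 moreover have "unit_at i \<in> Cn N" using i by (simp add: unit_at_def cspace_def)
 then have "inl (unit_at i) \<in> cspace A" by simp
 ultimately show ?thesis using dkq_CT(1)[OF Z] by simp
qed

lemma LO_CT: assumes Z: "Z \<in> M" "cc Z \<in> D1" and i: "i < N" shows "LO i (cc Z) \<in> CT Z"
 using CT_sc[OF D1_DD[OF Z(2)] LE_CT[OF assms]] by (simp add: LO_def)

lemma rr_partial_holo: "k < d ==> a \<in> A ==> holo A \<Omega>1 (pd a (rr k))"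
 by (rule holo_subset[OF holo_partial[OF finA open_Om rh] Om1_Om])

text \<open>
Brackets of fields tangent to \<open>M\<close> along \<open>M\<close> are tangent to it: the defining functions applied to such a field vanish on \<open>M\<close>, so
tangential derivatives of these expressions vanish, and the second derivatives of the defining functions cancel by symmetry.
\<close>

lemma LL_CT: "P \<in> LL ==> \<forall>\<^sub>F Z in nhds 0. Z \<in> M --> P (cc Z) \<in> CT Z"
proof (induction rule: LL.induct)
 case (LE i)
 show ?case using eventually_cc by eventually_elim (use LE_CT LE in blast)
next
 case (LO i)
 show ?case using eventually_cc by eventually_elim (use LO_CT LO in blast)
next
 case (br P Q)
 define Pr where "Pr P k x = (\<Sum>a\<in>A. pd a (rr k) x * P x a)" for P k x
 have hP: "holo A \<Omega>1 (%x. P x a)" "holo A \<Omega>1 (%x. Q x a)" if "a \<in> A" for a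
  using LL_holo[OF br(1)] LL_holo[OF br(2)] that by (auto simp: holom_def)
 have hPr: "holo A \<Omega>1 (Pr P k)" "holo A \<Omega>1 (Pr Q k)" if "k < d" for k
  unfolding Pr_def using that by (intro holo_sum holo_mult rr_partial_holo hP; simp)+
 have tang: "\<forall>\<^sub>F Z in nhds 0. Z \<in> M --> (\<forall>v\<in>CT Z. (\<Sum>b\<in>A. pd b (Pr P' k) (cc Z) * v b) = 0)"
  if k: "k < d" and h: "holo A \<Omega>1 (Pr P' k)" and ev: "\<forall>\<^sub>F Z in nhds 0. Z \<in> M --> P' (cc Z) \<in> CT Z" for P' k
 proof -
  have "hgerm A (Pr P' k) (cc 0)" unfolding hgerm_def using h by (intro exI[of _ \<Omega>1]) simp
  then have sg: "smooth_germ N (%Z. Pr P' k (cc Z)) 0" by (rule smooth_germ_cc)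
  have "\<forall>\<^sub>F Z in nhds 0. Z \<in> M --> Pr P' k (cc Z) = 0"
   using ev by eventually_elim (use k in \<open>auto simp: CT_def Pr_def\<close>)
  from tangential[OF sg this] eventually_cc show ?thesis
  proof eventually_elim
   case (elim Z)
   then show ?case using tangent_apply_cc[OF open_Om1 h, of Z] MC by (auto simp: D1_iff)
  qed
 qed
 have "\<forall>\<^sub>F Z in nhds 0. \<forall>k\<in>{..<d}. Z \<in> M --> (\<forall>v\<in>CT Z. (\<Sum>b\<in>A. pd b (Pr P k) (cc Z) * v b) = 0) &
   (\<forall>v\<in>CT Z. (\<Sum>b\<in>A. pd b (Pr Q k) (cc Z) * v b) = 0)"
 proof (rule eventually_ball_finite, simp, rule)
  fix k assume "k \<in> {..<d}"
  then have k: "k < d" by simp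
  show "\<forall>\<^sub>F Z in nhds 0. Z \<in> M --> (\<forall>v\<in>CT Z. (\<Sum>b\<in>A. pd b (Pr P k) (cc Z) * v b) = 0) &
   (\<forall>v\<in>CT Z. (\<Sum>b\<in>A. pd b (Pr Q k) (cc Z) * v b) = 0)"
   using tang[OF k hPr(1)[OF k] br(3)] tang[OF k hPr(2)[OF k] br(4)] by eventually_elim blast
 qed
 then show ?case using br(3,4) eventually_cc
 proof eventually_elim
  case (elim Z)
  show ?case
  proof
   assume Z: "Z \<in> M"
   let ?x = "cc Z"
   have x: "?x \<in> \<Omega>1" "?x \<in> cspace A" using elim Z by (auto simp: D1_iff)
   have PQ: "P ?x \<in> CT Z" "Q ?x \<in> CT Z" using elim Z by auto
   have "(\<Sum>a\<in>A. pd a (rr k) ?x * hbr A P Q ?x a) = 0" if k: "k < d" for k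
   proof -
    have D: "pd b (Pr P' k) ?x = (\<Sum>a\<in>A. pd b (pd a (rr k)) ?x * P' ?x a + pd a (rr k) ?x * pd b (%z. P' z a) ?x)"
     if b: "b \<in> A" and P': "\<And>a. a \<in> A ==> holo A \<Omega>1 (%x. P' x a)" for b P'
    proof (rule partial_deriv_eqI)
     have "((%t. pd a (rr k) (?x(b:=t)) * P' (?x(b:=t)) a) has_field_derivative
       (pd b (pd a (rr k)) ?x * P' ?x a + pd a (rr k) ?x * pd b (%z. P' z a) ?x)) (at (?x b))" if a: "a \<in> A" for a
      using DERIV_mult[OF holo_partial_DERIV[OF rr_partial_holo[OF k a] b x] holo_partial_DERIV[OF P'[OF a] b x]]
      by (simp add: mult.commute add.commute)
     then show "((%t. Pr P' k (?x(b:=t))) has_field_derivative (\<Sum>a\<in>A. pd b (pd a (rr k)) ?x * P' ?x a + pd a (rr k) ?x * pd b (%z. P' z a) ?x)) (at (?x b))"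
      unfolding Pr_def by (rule DERIV_sum)
    qed
    let ?S = "%u v. \<Sum>b\<in>A. \<Sum>a\<in>A. pd b (pd a (rr k)) ?x * u a * v b"
    let ?T = "%P' v. \<Sum>a\<in>A. pd a (rr k) ?x * differential A P' ?x v a"
    have E: "(\<Sum>b\<in>A. pd b (Pr P' k) ?x * v b) = ?S (P' ?x) v + ?T P' v"
     if P': "\<And>a. a \<in> A ==> holo A \<Omega>1 (%x. P' x a)" for P' v
    proof -
     have "(\<Sum>b\<in>A. pd b (Pr P' k) ?x * v b) = ?S (P' ?x) v + (\<Sum>b\<in>A. \<Sum>a\<in>A. pd a (rr k) ?x * pd b (%z. P' z a) ?x * v b)"
      unfolding sum.distrib[symmetric]
      by (intro sum.cong refl) (simp add: D P' sum_distrib_right distrib_right sum.distrib)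
     also have "(\<Sum>b\<in>A. \<Sum>a\<in>A. pd a (rr k) ?x * pd b (%z. P' z a) ?x * v b) = ?T P' v"
      unfolding differential_apply sum_distrib_left by (subst sum.swap) (simp only: mult.assoc)
     finally show ?thesis .
    qed
    have z1: "(\<Sum>b\<in>A. pd b (Pr Q k) ?x * P ?x b) = 0" using elim(1) Z k PQ(1) by simp
    have z2: "(\<Sum>b\<in>A. pd b (Pr P k) ?x * Q ?x b) = 0" using elim(1) Z k PQ(2) by simp
    have 1: "?S (Q ?x) (P ?x) + ?T Q (P ?x) = 0" by (rule trans[OF E[of Q "P ?x", OF hP(2), symmetric] z1])
    have 2: "?S (P ?x) (Q ?x) + ?T P (Q ?x) = 0" by (rule trans[OF E[of P "Q ?x", OF hP(1), symmetric] z2])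
    have xO: "?x \<in> \<Omega>" using x Om1_Om by blast
    have "?S (Q ?x) (P ?x) = (\<Sum>b\<in>A. \<Sum>a\<in>A. pd a (pd b (rr k)) ?x * Q ?x a * P ?x b)"
     by (intro sum.cong refl) (simp add: holo_partial_commute[OF finA open_Om rh[OF k] _ _ xO x(2)])
    also have "\<dots> = ?S (P ?x) (Q ?x)"
    proof (subst sum.swap, intro sum.cong refl)
     fix a b
     show "pd b (pd a (rr k)) ?x * Q ?x b * P ?x a = pd b (pd a (rr k)) ?x * P ?x a * Q ?x b"
      by (rule semiring_normalization_rules(16))
    qed
    finally have 3: "?S (Q ?x) (P ?x) = ?S (P ?x) (Q ?x)" .
    have "(\<Sum>a\<in>A. pd a (rr k) ?x * hbr A P Q ?x a) = ?T Q (P ?x) - ?T P (Q ?x)"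
     unfolding hbr_def fun_diff_def by (simp only: right_diff_distrib sum_subtractf)
    also have "\<dots> = 0" using 1 2 unfolding 3 by (simp add: add_eq_0_iff)
    finally show ?thesis .
   qed
   then show "hbr A P Q ?x \<in> CT Z" using LL_cspace[OF LL.br[OF br(1,2)]] by (simp add: CT_def)
  qed
 qed
qed

section \<open>The module of smooth CR brackets\<close>

definition sfield :: "vfield => bool" where
 "sfield X \<longleftrightarrow> (\<forall>s. smooth_germ N (%Z. X Z s) 0) & (\<forall>Z. X Z \<in> cspace A)"

text \<open>
The module over smooth functions generated by \<open>LL\<close>, where only the values on \<open>M\<close> matter.
It serves to bound the algebra of smooth CR fields, whose elements are not holomorphic, from above.
\<close>

inductive_set MM :: "vfield set" where
 gen: "P \<in> LL ==> (%Z. P (cc Z)) \<in> MM"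
| zero: "(%Z. 0) \<in> MM"
| add: "X \<in> MM ==> Y \<in> MM ==> (%Z. X Z + Y Z) \<in> MM"
| smul: "X \<in> MM ==> smooth_germ N c 0 ==> (%Z. smul (c Z) (X Z)) \<in> MM"
| eqM: "X \<in> MM ==> sfield Y ==> \<forall>\<^sub>F Z in nhds 0. Z \<in> M --> Y Z = X Z ==> Y \<in> MM"

lemma sfield_gen: assumes "P \<in> LL" shows "sfield (%Z. P (cc Z))"
proof -
 have "smooth_germ N (%Z. P (cc Z) s) 0" for s
 proof (cases "s \<in> A")
  case True
  have "hgerm A (%x. P x s) (cc 0)" unfolding hgerm_def using LL_holo[OF assms] True
   by (intro exI[of _ \<Omega>1]) (simp add: holom_def)
  then show ?thesis by (rule smooth_germ_cc)
 next
  case False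
  then have "(%Z. P (cc Z) s) = (%Z. 0)" using LL_cspace[OF assms] unfolding cspace_def by blast
  then show ?thesis by simp
 qed
 then show ?thesis using LL_cspace[OF assms] by (simp add: sfield_def)
qed

lemma MM_props: "X \<in> MM ==> sfield X & (\<forall>\<^sub>F Z in nhds 0. Z \<in> M --> X Z \<in> CT Z)"
proof (induction rule: MM.induct)
 case (gen P)
 then show ?case using sfield_gen LL_CT by blast
next
 case zero
 have z: "0 \<in> CT Z" for Z by (rule fvs.subspace_0[OF subspace_CT])
 show ?case unfolding sfield_def
  by (intro conjI allI smooth_germ_const cspace_0 always_eventually impI z)
next
 case (add X Y)
 have e: "\<forall>\<^sub>F Z in nhds 0. Z \<in> M --> X Z + Y Z \<in> CT Z"
  using add(3)[THEN conjunct2] add(4)[THEN conjunct2] by eventually_elim (blast intro: fvs.subspace_add[OF subspace_CT])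
 have s: "smooth_germ N (%Z. X Z s) 0" "smooth_germ N (%Z. Y Z s) 0" for s using add(3,4) unfolding sfield_def by blast+
 have c: "X Z \<in> cspace A" "Y Z \<in> cspace A" for Z using add(3,4) unfolding sfield_def by blast+
 have s2: "smooth_germ N (%Z. (X Z + Y Z) s) 0" for s
  unfolding plus_fun_apply by (rule smooth_germ_combine(1)[OF s])
 show ?case unfolding sfield_def by (intro conjI allI s2 cspace_plus c e)
next
 case (smul X c)
 have e: "\<forall>\<^sub>F Z in nhds 0. Z \<in> M --> smul (c Z) (X Z) \<in> CT Z"
  using smul(3)[THEN conjunct2] by eventually_elim (blast intro: fvs.subspace_scale[OF subspace_CT])
 have s: "smooth_germ N (%Z. X Z s) 0" for s using smul(3) unfolding sfield_def by blast
 have c: "X Z \<in> cspace A" for Z using smul(3) unfolding sfield_def by blast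
 have s2: "smooth_germ N (%Z. smul (c Z) (X Z) s) 0" for s
  unfolding smul_def by (rule smooth_germ_combine(2)[OF smul(2) s])
 show ?case unfolding sfield_def
  by (intro conjI allI s2 fvs.subspace_scale[OF subspace_cspace] c e)
next
 case (eqM X Y)
 have "\<forall>\<^sub>F Z in nhds 0. Z \<in> M --> Y Z \<in> CT Z"
  using eqM(3) eqM(4)[THEN conjunct2] by eventually_elim simp
 then show ?case using eqM(2) by blast
qed

lemma sfield_bracket: assumes "sfield X" "sfield Y" shows "sfield (bracket N X Y)"
proof -
 have z: "tangent_apply N v (%W. Y' W s) Z = 0" if "sfield Y'" "s \<notin> A" for v Y' s Z
 proof -
  have "(%W. Y' W s) = (%W. 0)" using that unfolding sfield_def cspace_def by blast
  then show ?thesis by (simp add: tangent_apply_def)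
 qed
 have "bracket N X Y Z \<in> cspace A" for Z
  unfolding bracket_def cspace_def using z[OF assms(1)] z[OF assms(2)] by simp
 moreover have "smooth_germ N (%Z. bracket N X Y Z s) 0" for s
  unfolding bracket_def using assms
  by (intro smooth_germ_diff smooth_germ_tangent_apply) (simp_all add: sfield_def)
 ultimately show ?thesis by (simp add: sfield_def)
qed

lemma smooth_nhd:
 assumes "smooth_germ N f 0"
 shows "\<exists>U. open U & 0 \<in> U & linediff N U f"
 using assms smooth_on_linediff unfolding smooth_germ_iff by blast

lemma tangent_apply_add:
 assumes "smooth_germ N f 0" "smooth_germ N g 0"
 shows "\<forall>\<^sub>F Z in nhds 0. Z \<in> Cn N --> (\<forall>v. tangent_apply N v (%W. f W + g W) Z = tangent_apply N v f Z + tangent_apply N v g Z)"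
  and "\<forall>\<^sub>F Z in nhds 0. Z \<in> Cn N --> (\<forall>v. tangent_apply N v (%W. f W * g W) Z = f Z * tangent_apply N v g Z + g Z * tangent_apply N v f Z)"
proof -
 obtain U V where U: "open U" "0 \<in> U" "linediff N U f" and V: "open V" "0 \<in> V" "linediff N V g"
  using smooth_nhd[OF assms(1)] smooth_nhd[OF assms(2)] by blast
 have sub: "linediff N (U \<inter> V) h" if "linediff N W h" "U \<inter> V \<subseteq> W" for W h
  using that continuous_on_subset[of "W \<inter> Cn N" h "U \<inter> V \<inter> Cn N"] unfolding linediff_def by blast
 have fg: "linediff N (U \<inter> V) f" "linediff N (U \<inter> V) g" by (rule sub[OF U(3)], simp, rule sub[OF V(3)], simp)
 note c = linediff_combine(3,4)[OF fg]
 have e: "\<forall>\<^sub>F Z in nhds 0. Z \<in> U \<inter> V" by (rule eventually_nhds_in_open) (use U V in auto)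
 show "\<forall>\<^sub>F Z in nhds 0. Z \<in> Cn N --> (\<forall>v. tangent_apply N v (%W. f W + g W) Z = tangent_apply N v f Z + tangent_apply N v g Z)"
  using e
 proof eventually_elim
  case (elim Z)
  show ?case
  proof safe
   fix v assume Z: "Z \<in> Cn N"
   show "tangent_apply N v (%W. f W + g W) Z = tangent_apply N v f Z + tangent_apply N v g Z"
    unfolding tangent_apply_def sum.distrib[symmetric]
    by (intro sum.cong refl) (use c(1)[OF _ Z] elim in \<open>simp add: field_simps\<close>)
  qed
 qed
 show "\<forall>\<^sub>F Z in nhds 0. Z \<in> Cn N --> (\<forall>v. tangent_apply N v (%W. f W * g W) Z = f Z * tangent_apply N v g Z + g Z * tangent_apply N v f Z)"
  using e
 proof eventually_elim
  case (elim Z)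
  show ?case
  proof safe
   fix v assume Z: "Z \<in> Cn N"
   show "tangent_apply N v (%W. f W * g W) Z = f Z * tangent_apply N v g Z + g Z * tangent_apply N v f Z"
    unfolding tangent_apply_def sum_distrib_left sum.distrib[symmetric]
    by (intro sum.cong refl) (use c(2)[OF _ Z] elim in \<open>simp add: field_simps\<close>)
  qed
 qed
qed

lemma eventually_comp:
 assumes "\<And>s. s \<in> A ==> \<forall>\<^sub>F Z in nhds 0. Z \<in> M --> X Z s = Y Z s" and "\<And>Z. X Z \<in> cspace A" "\<And>Z. Y Z \<in> cspace A"
 shows "\<forall>\<^sub>F Z in nhds (0::nat cpoint). Z \<in> M --> X Z = (Y Z :: (nat + nat) cpoint)"
proof -
 have "\<forall>\<^sub>F Z in nhds 0. \<forall>s\<in>A. Z \<in> M --> X Z s = Y Z s" using assms(1) by (intro eventually_ball_finite) auto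
 then show ?thesis
 proof eventually_elim
  case (elim Z)
  have "X Z s = Y Z s" if "s \<notin> A" for s using assms(2,3)[of Z] that by (simp add: cspace_def)
  with elim show ?case by (auto simp: fun_eq_iff)
 qed
qed

text \<open>
Brackets are derivations in the coefficients, and by \<open>tangential\<close> a bracket of fields tangent to \<open>M\<close> depends on their
values on \<open>M\<close> only. So closure under bracketing with a fixed field need only be known for generators.
\<close>

lemma MM_bracket_left:
 assumes Y: "Y \<in> MM" and g: "\<And>P. P \<in> LL ==> bracket N (%Z. P (cc Z)) Y \<in> MM" and X: "X \<in> MM"
 shows "bracket N X Y \<in> MM"
 using X
proof (induction rule: MM.induct)
 case (gen P)
 then show ?case by (rule g)
next
 case zero
 have "bracket N (%Z. 0) Y = (%Z. 0)" by (simp add: bracket_def fun_eq_iff tangent_apply_def)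
 then show ?case by (rule ssubst) (rule MM.zero)
next
 case (add X1 X2)
 have sf: "sfield X1" "sfield X2" "sfield Y" "sfield (%Z. X1 Z + X2 Z)"
  using MM_props add(1,2) Y MM.add[OF add(1,2)] by blast+
 show ?case
 proof (rule MM.eqM[OF MM.add[OF add(3,4)] sfield_bracket[OF sf(4,3)]], rule eventually_comp)
  fix s assume s: "s \<in> A"
  have "\<forall>\<^sub>F Z in nhds 0. Z \<in> Cn N --> (\<forall>v. tangent_apply N v (%W. X1 W s + X2 W s) Z = tangent_apply N v (%W. X1 W s) Z + tangent_apply N v (%W. X2 W s) Z)"
   by (rule tangent_apply_add(1)) (use sf in \<open>simp_all add: sfield_def\<close>)
  then show "\<forall>\<^sub>F Z in nhds 0. Z \<in> M --> bracket N (%Z. X1 Z + X2 Z) Y Z s = (bracket N X1 Y Z + bracket N X2 Y Z) s"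
   by eventually_elim (use MC in \<open>auto simp: bracket_def tangent_apply_lin(1)\<close>)
 qed (use sf sfield_bracket in \<open>auto simp: sfield_def cspace_plus\<close>)
next
 case (smul X1 c)
 have sf: "sfield X1" "sfield Y" "sfield (%Z. smul (c Z) (X1 Z))"
  using MM_props smul(1) Y MM.smul[OF smul(1,2)] by blast+
 let ?e = "%Z. - tangent_apply N (Y Z) c Z"
 have e: "smooth_germ N ?e 0"
 proof -
  have "smooth_germ N (%Z. tangent_apply N (Y Z) c Z) 0"
   by (rule smooth_germ_tangent_apply) (use sf smul(2) in \<open>simp_all add: sfield_def\<close>)
  from smooth_germ_combine(2)[OF smooth_germ_const[of N "-1"] this] show ?thesis by simp
 qed
 have m: "(%Z. smul (c Z) (bracket N X1 Y Z) + smul (?e Z) (X1 Z)) \<in> MM"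
  by (rule MM.add[OF MM.smul[OF smul(3,2)] MM.smul[OF smul(1) e]])
 show ?case
 proof (rule MM.eqM[OF m sfield_bracket[OF sf(3,2)]], rule eventually_comp)
  fix s assume s: "s \<in> A"
  have "\<forall>\<^sub>F Z in nhds 0. Z \<in> Cn N --> (\<forall>v. tangent_apply N v (%W. c W * X1 W s) Z = c Z * tangent_apply N v (%W. X1 W s) Z + X1 Z s * tangent_apply N v c Z)"
   by (rule tangent_apply_add(2)) (use sf smul(2) in \<open>simp_all add: sfield_def\<close>)
  then show "\<forall>\<^sub>F Z in nhds 0. Z \<in> M --> bracket N (%Z. smul (c Z) (X1 Z)) Y Z s = (smul (c Z) (bracket N X1 Y Z) + smul (?e Z) (X1 Z)) s"
  proof eventually_elim
   case (elim Z)
   show ?case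
   proof
    assume "Z \<in> M"
    then have "tangent_apply N (Y Z) (%W. smul (c W) (X1 W) s) Z = c Z * tangent_apply N (Y Z) (%W. X1 W s) Z + X1 Z s * tangent_apply N (Y Z) c Z"
     using elim MC by (auto simp: smul_def)
    then show "bracket N (%Z. smul (c Z) (X1 Z)) Y Z s = (smul (c Z) (bracket N X1 Y Z) + smul (?e Z) (X1 Z)) s"
     unfolding bracket_def tangent_apply_lin(2) by (simp add: smul_def algebra_simps)
   qed
  qed
 qed (use sf sfield_bracket MM_props[OF m] in \<open>auto simp: sfield_def\<close>)
next
 case (eqM X1 X2)
 have sf: "sfield X1" "sfield X2" "sfield Y" using MM_props eqM(1,2) Y by blast+
 show ?case
 proof (rule MM.eqM[OF eqM(4) sfield_bracket[OF sf(2,3)]], rule eventually_comp)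
  fix s assume s: "s \<in> A"
  have sm: "smooth_germ N (%W. X1 W s) 0" "smooth_germ N (%W. X2 W s) 0" using sf by (simp_all add: sfield_def)
  have df: "smooth_germ N (%W. X2 W s - X1 W s) 0" by (rule smooth_germ_diff[OF sm(2,1)])
  have "\<forall>\<^sub>F Z in nhds 0. Z \<in> M --> X2 Z s - X1 Z s = 0" using eqM(3) by eventually_elim simp
  from tangential[OF df this] have t: "\<forall>\<^sub>F Z in nhds 0. Z \<in> M --> (\<forall>v\<in>CT Z. tangent_apply N v (%W. X2 W s - X1 W s) Z = 0)" .
  have a: "\<forall>\<^sub>F Z in nhds 0. Z \<in> Cn N --> (\<forall>v. tangent_apply N v (%W. (X2 W s - X1 W s) + X1 W s) Z = tangent_apply N v (%W. X2 W s - X1 W s) Z + tangent_apply N v (%W. X1 W s) Z)"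
   by (rule tangent_apply_add(1)[OF df sm(1)])
  show "\<forall>\<^sub>F Z in nhds 0. Z \<in> M --> bracket N X2 Y Z s = bracket N X1 Y Z s"
   using t a eqM(3) MM_props[OF Y, THEN conjunct2]
  proof eventually_elim
   case (elim Z)
   show ?case
   proof
    assume Z: "Z \<in> M"
    then have "tangent_apply N (Y Z) (%W. X2 W s) Z = tangent_apply N (Y Z) (%W. X1 W s) Z"
     using elim MC by auto
    then show "bracket N X2 Y Z s = bracket N X1 Y Z s" using elim Z by (simp add: bracket_def)
   qed
  qed
 qed (use sf sfield_bracket in \<open>auto simp: sfield_def\<close>)
qed

lemma MM_bracket: assumes X: "X \<in> MM" and Y: "Y \<in> MM" shows "bracket N X Y \<in> MM"
proof (rule MM_bracket_left[OF Y _ X])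
 fix P assume P: "P \<in> LL"
 let ?P = "%Z. P (cc Z)"
 have "bracket N Y ?P \<in> MM"
 proof (rule MM_bracket_left[OF MM.gen[OF P] _ Y])
  fix Q assume Q: "Q \<in> LL"
  show "bracket N (%Z. Q (cc Z)) ?P \<in> MM"
  proof (rule MM.eqM[OF MM.gen[OF LL.br[OF Q P]] sfield_bracket[OF sfield_gen[OF Q] sfield_gen[OF P]]], rule eventually_comp)
   fix s assume s: "s \<in> A"
   have h: "holo A \<Omega>1 (%x. P x s)" "holo A \<Omega>1 (%x. Q x s)" using LL_holo[OF P] LL_holo[OF Q] s by (auto simp: holom_def)
   show "\<forall>\<^sub>F Z in nhds 0. Z \<in> M --> bracket N (%Z. Q (cc Z)) ?P Z s = hbr A Q P (cc Z) s"
    using eventually_cc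
   proof eventually_elim
    case (elim Z)
    show ?case
    proof
     assume Z: "Z \<in> M"
     then have x: "cc Z \<in> \<Omega>1" "Z \<in> Cn N" using elim MC by (auto simp: D1_iff)
     show "bracket N (%Z. Q (cc Z)) ?P Z s = hbr A Q P (cc Z) s"
      unfolding bracket_def hbr_def fun_diff_def differential_apply
       tangent_apply_cc[OF open_Om1 h(1) x] tangent_apply_cc[OF open_Om1 h(2) x] ..
    qed
   qed
  qed (use LL_cspace[OF LL.br[OF Q P]] sfield_bracket[OF sfield_gen[OF Q] sfield_gen[OF P]] in \<open>auto simp: sfield_def\<close>)
 qed
 then have "(%Z. smul (-1) (bracket N Y ?P Z)) \<in> MM" by (rule MM.smul) simp
 moreover have "(%Z. smul (-1) (bracket N Y ?P Z)) = bracket N ?P Y"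
  by (simp add: bracket_def smul_def fun_eq_iff)
 ultimately show "bracket N ?P Y \<in> MM" by simp
qed

lemma MM_sum: "(\<And>i. i \<in> I ==> X i \<in> MM) ==> (%Z. \<Sum>i\<in>I. X i Z) \<in> MM"
proof (induction I rule: infinite_finite_induct)
 case (insert i I)
 show ?case unfolding sum.insert[OF insert(1,2)] by (rule MM.add) (use insert in auto)
qed (simp_all add: MM.zero)

lemma MM_0: "X \<in> MM ==> X 0 \<in> fvs.span ((%P. P 0) ` LL)"
proof (induction rule: MM.induct)
 case (gen P)
 show ?case unfolding cc_simps(5) by (rule fvs.span_base) (rule imageI[where f="%P. P 0", OF gen])
next
 case zero
 show ?case by (rule fvs.span_zero)
next
 case (add X Y)
 show ?case by (rule fvs.span_add[OF add(3,4)])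
next
 case (smul X c)
 show ?case by (rule fvs.span_scale[OF smul(3)])
next
 case (eqM X Y)
 have e: "Y 0 = X 0" using eventually_nhds_x_imp_x[OF eqM(3)] M0 by blast
 show ?case unfolding e by (rule eqM(4))
qed

text \<open>
A \<open>(1,0)\<close> field tangent to \<open>M\<close> is, on \<open>M\<close>, the combination of the \<open>LE i\<close> with its own \<open>Z\<close>-components as smooth coefficients.
\<close>

lemma CR_subset_MM:
 assumes rho: "\<And>k Z. rr k (cc Z) = \<rho> Z (cconj Z) k" and X: "X \<in> CR_lie_algebra N d M \<rho> 0"
 shows "X \<in> MM"
 using X
proof (induction rule: CR_lie_algebra.induct)
 case (type10 X)
 have sf: "sfield X" using type10(1) by (simp add: smooth_tangent_field_def sfield_def)
 have "(%Z. \<Sum>i<N. smul (X Z (Inl i)) (LE i (cc Z))) \<in> MM"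
  by (rule MM_sum, rule MM.smul, rule MM.gen, rule LL.LE) (use sf in \<open>auto simp: sfield_def\<close>)
 moreover have "\<forall>\<^sub>F Z in nhds 0. Z \<in> M --> X Z \<in> complex_tangent_space N d \<rho> Z"
  using type10(1) by (simp add: smooth_tangent_field_def)
 then have "\<forall>\<^sub>F Z in nhds 0. Z \<in> M --> X Z = (\<Sum>i<N. smul (X Z (Inl i)) (LE i (cc Z)))"
  using eventually_cc
 proof eventually_elim
  case (elim Z)
  show ?case
  proof
   assume Z: "Z \<in> M"
   have x: "cc Z \<in> D1" "Z \<in> Cn N" using elim(2) Z MC by blast+
   have "complex_tangent_space N d \<rho> Z = CT Z" by (rule CT_eq[where \<rho>=\<rho>, OF rho D1_DD[OF x(1)] x(2)])
   then have vC: "X Z \<in> CT Z" using elim(1) Z by simp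
   show "X Z = (\<Sum>i<N. smul (X Z (Inl i)) (LE i (cc Z)))"
    by (rule CT_LE[where v="X Z", OF Z x(1) vC]) (rule type10(2))
  qed
 qed
 ultimately show ?case by (rule MM.eqM[OF _ sf])
next
 case (type01 X)
 have sf: "sfield X" using type01(1) by (simp add: smooth_tangent_field_def sfield_def)
 have "(%Z. \<Sum>i<N. smul (X Z (Inr i)) (LO i (cc Z))) \<in> MM"
  by (rule MM_sum, rule MM.smul, rule MM.gen, rule LL.LO) (use sf in \<open>auto simp: sfield_def\<close>)
 moreover have "\<forall>\<^sub>F Z in nhds 0. Z \<in> M --> X Z \<in> complex_tangent_space N d \<rho> Z"
  using type01(1) by (simp add: smooth_tangent_field_def)
 then have "\<forall>\<^sub>F Z in nhds 0. Z \<in> M --> X Z = (\<Sum>i<N. smul (X Z (Inr i)) (LO i (cc Z)))"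
  using eventually_cc
 proof eventually_elim
  case (elim Z)
  show ?case
  proof
   assume Z: "Z \<in> M"
   have x: "cc Z \<in> D1" "Z \<in> Cn N" using elim(2) Z MC by blast+
   have "complex_tangent_space N d \<rho> Z = CT Z" by (rule CT_eq[where \<rho>=\<rho>, OF rho D1_DD[OF x(1)] x(2)])
   then have vC: "X Z \<in> CT Z" using elim(1) Z by simp
   show "X Z = (\<Sum>i<N. smul (X Z (Inr i)) (LO i (cc Z)))"
    by (rule CT_LO[where v="X Z", OF Z x(1) vC]) (rule type01(2))
  qed
 qed
 ultimately show ?case by (rule MM.eqM[OF _ sf])
next
 case (add X Y)
 have "(%Z s. X Z s + Y Z s) = (%Z. X Z + Y Z)" by (simp add: fun_eq_iff)
 then show ?case using MM.add[OF add(3,4)] by simp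
next
 case (scale X c)
 have "(%Z s. c * X Z s) = (%Z. smul c (X Z))" by (simp add: smul_def)
 then show ?case using MM.smul[OF scale(2), of "%Z. c"] by simp
next
 case (bracket X Y)
 show ?case by (rule MM_bracket[OF bracket(3,4)])
qed

text \<open>
At the point \<open>0\<close> the coefficients of elements of \<open>MM\<close> become numbers.
\<close>

lemma finite_type_span:
 assumes rho: "\<And>k Z. rr k (cc Z) = \<rho> Z (cconj Z) k" and ft: "finite_type N d M \<rho> 0"
 shows "CT 0 \<subseteq> fvs.span ((%P. P 0) ` LL)"
proof -
 have "complex_tangent_space N d \<rho> 0 = CT 0" by (rule CT_eq[where \<rho>=\<rho>, OF rho]) simp_all
 then have "CT 0 = (%X. X 0) ` CR_lie_algebra N d M \<rho> 0" using ft unfolding finite_type_def by simp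
 then show ?thesis using MM_0[OF CR_subset_MM[where \<rho>=\<rho>, OF rho]] by (simp add: image_subset_iff)
qed

end

section \<open>Chains of Segre flows\<close>

definition pcol :: "('k cpoint => 'a cpoint) => 'k cpoint => 'k => 'a cpoint" where
 "pcol \<Psi> t k = (%a. pd k (%z. \<Psi> z a) t)"

lemma differential_pcol: "differential K \<Psi> t c = (\<Sum>k\<in>K. smul (c k) (pcol \<Psi> t k))"
 by (simp add: differential_def pcol_def fun_eq_iff sum_fun_apply smul_def mult.commute)

lemma differential_unit: "finite K ==> k \<in> K ==> differential K \<Psi> t (unit_at k) = pcol \<Psi> t k"
 by (simp add: fun_eq_iff differential_def pcol_def unit_at_def if_distrib[of "(*) _"] cong: if_cong)

lemma unit_at_cspace: "k \<in> K ==> unit_at k \<in> cspace K"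
 by (auto simp: unit_at_def cspace_def)

lemma pcol_in_dimage: assumes "finite K" "k \<in> K" shows "pcol \<Psi> t k \<in> dimage K \<Psi> t"
 unfolding dimage_def differential_unit[OF assms, symmetric] by (rule imageI[OF unit_at_cspace[OF assms(2)]])

lemma dimage_subsetI:
 assumes W: "fvs.subspace W" and c: "\<And>k. k \<in> K ==> pcol \<Psi> t k \<in> W"
 shows "dimage K \<Psi> t \<subseteq> W"
proof
 fix v assume "v \<in> dimage K \<Psi> t"
 then obtain a where v: "v = (\<Sum>k\<in>K. smul (a k) (pcol \<Psi> t k))" unfolding dimage_def differential_pcol by blast
 show "v \<in> W" unfolding v by (rule fvs.subspace_sum[OF W], rule fvs.subspace_scale[OF W], rule c)
qed

lemma hmgerm_neighbourhood:
 assumes G: "hmgerm I J G a" and W: "open W" "G a \<in> W" and a: "a \<in> cspace I"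
 shows "\<exists>V. open V & a \<in> V & holom I J V G & (\<forall>z\<in>V \<inter> cspace I. G z \<in> W)"
proof -
 obtain V where V: "open V" "a \<in> V" "holom I J V G" using G unfolding hmgerm_def by blast
 obtain U where U: "open U" "a \<in> U" "U \<subseteq> V" "\<forall>z\<in>U \<inter> cspace I. G z \<in> W"
  using open_vimage_germ[OF V(3,1) W(1) V(2) a W(2)] by blast
 show ?thesis using U holom_subset[OF V(3) U(3)] by blast
qed

lemma holom_subset': "holom I J V G ==> W \<inter> cspace I \<subseteq> V ==> holom I J W G"
 unfolding holom_def using holo_subset'[of I V _ W] by auto

lemma partial_deriv_sc:
 assumes "((%t. f ((sc x)(sw a := t))) has_field_derivative D) (at (sc x (sw a)))"
 shows "pd a (%x. cnj (f (sc x))) x = cnj D"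
proof (rule partial_deriv_eqI)
 have "((cnj o (%t. f ((sc x)(sw a := t))) o cnj) has_field_derivative cnj D) (at (x a))"
  by (rule has_field_derivative_cnj_cnj) (use assms in \<open>simp add: sc_apply\<close>)
 moreover have "(sc x)(sw a := cnj t) = sc (x(a := t))" for t
  by (auto simp: fun_eq_iff sc_apply)
 ultimately show "((%t. cnj (f (sc (x(a:=t))))) has_field_derivative cnj D) (at (x a))"
  by (simp add: comp_def)
qed

context flow
begin

definition kO :: "(nat + nat) cpoint => (nat + nat) cpoint" where "kO x = sc (kq (sc x))"

text \<open>
Steps with even number move \<open>Z\<close>, steps with odd number move \<open>\<zeta>\<close>; \<open>dir\<close>, \<open>emb\<close>, \<open>LV\<close> and \<open>mv\<close> follow the same convention, so that
both kinds of steps can be treated together.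
\<close>

definition kl :: "nat => (nat + nat) cpoint => (nat + nat) cpoint" where
 "kl l = (if even l then kq else kO)"

definition dir :: "nat => nat => nat + nat" where "dir l i = (if even l then Inl i else Inr i)"

definition emb :: "nat => nat cpoint => (nat + nat) cpoint" where
 "emb l t = (if even l then case_sum t 0 else case_sum 0 t)"

definition LV :: "nat => nat => (nat + nat) cpoint => (nat + nat) cpoint" where
 "LV l i = (if even l then LE i else LO i)"

definition mv :: "nat => nat cpoint => (nat + nat) cpoint => (nat + nat) cpoint" where
 "mv l t = (if even l then mvE t else mvO t)"

lemma sc_emb_odd: "sc (case_sum 0 t) = inl (cconj t)"
 by (auto simp: fun_eq_iff sc_apply inl_def sw_def split: sum.splits)

lemma mv_kl: "mv l t x = kl l (x + emb l t)"
 by (simp add: mv_def kl_def emb_def kO_def mvE_def mvO_def sc_add sc_emb_odd) (simp add: inl_def)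

lemma mv_add: "x \<in> cspace A ==> b \<in> Cn N ==> mv l a (mv l b x) = mv l (b + a) x"
 by (simp add: mv_def mvE_add mvO_add)

lemma mv_in_cspace[simp]: "mv l t x \<in> cspace A" by (simp add: mv_def)

lemma mv_parity: "even l = even m ==> mv l = mv m" by (simp add: mv_def fun_eq_iff)

lemma emb_cspace[simp]: "emb l t \<in> cspace A \<longleftrightarrow> t \<in> Cn N" by (simp add: emb_def)
lemma emb_0[simp]: "emb l 0 = 0" by (simp add: emb_def)

lemma kl_cspace[simp]: "kl l x \<in> cspace A" by (simp add: kl_def kO_def)

lemma sc_D1[simp]: "sc x \<in> D1 \<longleftrightarrow> x \<in> D1" by simp

lemma kl_holom: "holom A A \<Omega>1 (kl l)"
proof -
 have "holo A \<Omega>1 (%x. kO x a)" if "a \<in> A" for a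
 proof -
  have "sw a \<in> A" using that by simp
  from holo_swap(1)[OF open_Om1 hkq[OF this]] show ?thesis unfolding kO_def sc_apply sc_vimage .
 qed
 then have "holom A A \<Omega>1 kO" by (simp add: holom_def kO_def)
 then show ?thesis using kh by (simp add: kl_def)
qed

lemma kl_segre: assumes x: "x \<in> D1" shows "kl l x \<in> DD" "k < d ==> rr k (kl l x) = 0"
proof -
 have "kq x \<in> DD" "kq (sc x) \<in> DD" using kD(1) x by simp_all
 then show "kl l x \<in> DD" by (simp add: kl_def kO_def)
 assume k: "k < d"
 have "rr k (kq x) = 0" "rr k (kq (sc x)) = 0" using kD(2)[OF _ k] x by simp_all
 then show "rr k (kl l x) = 0" using rreal[OF \<open>kq (sc x) \<in> DD\<close> k] by (simp add: kl_def kO_def)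
qed

lemma kl_fixed: assumes x: "x \<in> D1" and z: "\<And>k. k < d ==> rr k x = 0" shows "kl l x = x"
proof -
 have "kq x = x" by (rule kfix[OF x z])
 moreover have "kq (sc x) = sc x"
 proof (rule kfix)
  fix k assume "k < d"
  then show "rr k (sc x) = 0" using rreal[OF D1_DD[OF x]] z by simp
 qed (use x in simp)
 ultimately show ?thesis by (simp add: kl_def kO_def)
qed

lemma kl_0: "kl l 0 = 0" by (simp add: kl_def kO_def k0)

lemma kl_other: assumes "x \<in> cspace A" shows "kl l x (dir (Suc l) i) = x (dir (Suc l) i)"
proof -
 have "kq (sc x) (Inr i) = sc x (Inr i)" using kq_Inr assms by simp
 then show ?thesis using kq_Inr[OF assms] by (simp add: kl_def dir_def kO_def sc_apply)
qed

lemma LV_kl: assumes x: "x \<in> cspace A" and i: "i < N" shows "LV l i (kl l x) = LV l i x"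
proof -
 have "LE i (kq y) = LE i y" if "y \<in> cspace A" for y by (rule LE_cong[OF Pm_kq[OF that] i])
 then show ?thesis using x by (simp add: LV_def kl_def LO_def kO_def)
qed

lemma LV_partial:
 assumes x: "x \<in> D1" and i: "i < N" and a: "a \<in> A"
 shows "LV l i x a = pd (dir l i) (%x. kl l x a) x"
proof (cases "even l")
 case True
 then show ?thesis using a by (simp add: LV_def LE_def dir_def kl_def)
next
 case False
 have s: "sc x \<in> \<Omega>1" "sc x \<in> cspace A" using x sc_D1[of x] unfolding D1_iff by blast+
 have sa: "sw a \<in> A" and iA: "Inl i \<in> A" using a i by simp_all
 have "pd (Inr i) (%x. cnj (kq (sc x) (sw a))) x = cnj (pd (Inl i) (%z. kq z (sw a)) (sc x))"
  by (rule partial_deriv_sc) (use holo_partial_DERIV[OF hkq[OF sa] iA s] in \<open>simp only: sw_simps(2)\<close>)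
 then show ?thesis using False sa by (simp add: LV_def LO_def LE_def dir_def kl_def kO_def sc_apply)
qed

lemma LV_LL: "i < N ==> LV l i \<in> LL" by (simp add: LV_def LL.LE LL.LO)

text \<open>
The parameters of all steps are collected in one point \<open>c\<close>, the \<open>l\<close>-th step using the coordinates
\<open>(l, i)\<close>.
\<close>

primrec chain :: "nat => (nat \<times> nat) cpoint => (nat + nat) cpoint => (nat + nat) cpoint" where
 "chain 0 c x = x"
| "chain (Suc l) c x = mv (Suc l) (%i. c (Suc l, i)) (chain l c x)"

abbreviation KK :: "(nat \<times> nat) set" where "KK \<equiv> {Suc 0..2*d+3} \<times> {..<N}"

lemma finKK: "finite KK" "finite (KK <+> A)" by auto

lemma slice_Cn: "c \<in> cspace KK ==> (%i. c (l,i)) \<in> Cn N" by (simp add: cspace_def)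

lemma chain_cspace: "x \<in> cspace A ==> chain l c x \<in> cspace A" by (cases l) auto

lemma chain_cong: "(\<And>l' i. l' \<le> l ==> c (l',i) = c' (l',i)) ==> chain l c x = chain l c' x"
 by (induction l) auto

definition pre :: "nat => (nat \<times> nat) cpoint => (nat + nat) cpoint => (nat + nat) cpoint" where
 "pre l c x = chain l c x + emb (Suc l) (%i. c (Suc l, i))"

lemma chain_Suc_pre: "chain (Suc l) c x = kl (Suc l) (pre l c x)" by (simp add: pre_def mv_kl)

lemma pre_germ:
 assumes "hmgerm (KK <+> A) A (%w. chain l (w o Inl) (w o Inr)) 0"
 shows "hmgerm (KK <+> A) A (%w. pre l (w o Inl) (w o Inr)) 0"
proof (rule hmgermI[OF finA])
 have "pre l (w o Inl) (w o Inr) \<in> cspace A" if "w \<in> cspace (KK <+> A)" for w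
  unfolding pre_def using slice_Cn[OF cspace_comp_sum(1)[OF that], of "Suc l"]
  by (intro cspace_plus chain_cspace cspace_comp_sum(2)[OF that]) (simp only: emb_cspace)
 then show "\<forall>\<^sub>F w in nhds 0. w \<in> cspace (KK <+> A) --> pre l (w o Inl) (w o Inr) \<in> cspace A" by simp
 fix a assume a: "a \<in> A"
 have "hgerm (KK <+> A) (%w. emb (Suc l) (%i. (w o Inl) (Suc l, i)) a) 0"
  by (cases a; cases "even l") (simp_all add: emb_def)
 from hgerm_add[OF hmgermD[OF assms a] this]
 show "hgerm (KK <+> A) (%w. pre l (w o Inl) (w o Inr) a) 0" by (simp add: pre_def)
qed

lemma pre_0: "chain l 0 0 = 0 ==> pre l 0 0 = 0"
 by (simp add: pre_def) (simp add: zero_fun_def[symmetric])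

lemma chain_germ: "hmgerm (KK <+> A) A (%w. chain l (w o Inl) (w o Inr)) 0 & chain l 0 0 = 0"
proof (induction l)
 case 0
 have "hmgerm (KK <+> A) A (%w. w o Inr) 0"
 proof (rule hmgermI[OF finA])
  show "\<forall>\<^sub>F w in nhds 0. w \<in> cspace (KK <+> A) --> w o Inr \<in> cspace A"
   using cspace_comp_sum(2) by (intro always_eventually) blast
 qed simp
 then show ?case unfolding chain.simps(1) by (rule conjI[OF _ refl])
next
 case (Suc l)
 have p0: "pre l 0 0 = 0" using Suc pre_0 by blast
 have "hmgerm (KK <+> A) A (%w. kl (Suc l) (pre l (w o Inl) (w o Inr))) 0"
 proof (rule hmgerm_compose[OF finA finA _ pre_germ[OF conjunct1[OF Suc]] cspace_0])
  have "hmgerm A A (kl (Suc l)) 0" unfolding hmgerm_def using kl_holom by (intro exI[of _ \<Omega>1]) simp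
  then show "hmgerm A A (kl (Suc l)) (pre l (0 o Inl) (0 o Inr))" by (simp only: zero_comp p0)
 qed
 moreover have "chain (Suc l) 0 0 = 0" unfolding chain_Suc_pre p0 by (rule kl_0)
 ultimately show ?case by (simp only: chain_Suc_pre)
qed

lemma chain_domain:
 assumes W: "open W" "0 \<in> W"
 shows "\<exists>dl>0. (\<forall>l. holom (KK <+> A) A (pbox (KK <+> A) 0 dl) (%w. chain l (w o Inl) (w o Inr)) \<or> l > 2*d+3) &
  (\<forall>l\<le>2*d+3. \<forall>c\<in>pdisc KK 0 dl. \<forall>x\<in>pdisc A 0 dl. chain l c x \<in> D1 \<inter> W & pre l c x \<in> D1)"
proof -
 let ?C = "%l w. chain l (w o Inl) (w o Inr)" and ?P = "%l w. pre l (w o Inl) (w o Inr)" and ?J = "KK <+> A"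
 have "\<forall>l\<in>{..2*d+3}. \<exists>V. open V & 0 \<in> V & holom ?J A V (?C l) & (\<forall>z\<in>V \<inter> cspace ?J. ?C l z \<in> \<Omega>1 \<inter> W & ?P l z \<in> \<Omega>1)"
 proof
  fix l
  have 0: "?C l 0 \<in> \<Omega>1 \<inter> W" "?P l 0 \<in> \<Omega>1" using chain_germ[of l] pre_0[of l] W by (simp_all only: zero_comp) auto
  obtain V1 where V1: "open V1" "0 \<in> V1" "holom ?J A V1 (?C l)" "\<forall>z\<in>V1 \<inter> cspace ?J. ?C l z \<in> \<Omega>1 \<inter> W"
   using hmgerm_neighbourhood[OF conjunct1[OF chain_germ] open_Int[OF open_Om1 W(1)] 0(1) cspace_0] by blast
  obtain V2 where V2: "open V2" "0 \<in> V2" "\<forall>z\<in>V2 \<inter> cspace ?J. ?P l z \<in> \<Omega>1"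
   using hmgerm_neighbourhood[OF pre_germ[OF conjunct1[OF chain_germ]] open_Om1 0(2) cspace_0] by blast
  have "holom ?J A (V1 \<inter> V2) (?C l)" by (rule holom_subset[OF V1(3)]) simp
  then show "\<exists>V. open V & 0 \<in> V & holom ?J A V (?C l) & (\<forall>z\<in>V \<inter> cspace ?J. ?C l z \<in> \<Omega>1 \<inter> W & ?P l z \<in> \<Omega>1)"
   using V1 V2 by (intro exI[of _ "V1 \<inter> V2"]) auto
 qed
 then obtain V where V: "\<And>l. l \<le> 2*d+3 ==> open (V l) & 0 \<in> V l & holom ?J A (V l) (?C l) & (\<forall>z\<in>V l \<inter> cspace ?J. ?C l z \<in> \<Omega>1 \<inter> W & ?P l z \<in> \<Omega>1)"
  unfolding bchoice_iff by auto
 have o: "open (\<Inter>l\<in>{..2*d+3}. V l)" "0 \<in> (\<Inter>l\<in>{..2*d+3}. V l)" using V by auto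
 obtain dl where dl: "dl > 0" "pdisc ?J 0 dl \<subseteq> (\<Inter>l\<in>{..2*d+3}. V l)"
  using open_pdisc_subset[OF finKK(2) o cspace_0] by blast
 have "holom ?J A (pbox ?J 0 dl) (?C l)" if "l \<le> 2*d+3" for l
  by (rule holom_subset'[of _ _ "V l"]) (use V[OF that] dl(2) that in \<open>auto simp: pdisc_def\<close>)
 moreover have "chain l c x \<in> D1 \<inter> W & pre l c x \<in> D1" if l: "l \<le> 2*d+3" and c: "c \<in> pdisc KK 0 dl" and x: "x \<in> pdisc A 0 dl" for l c x
 proof -
  have mem: "case_sum c x \<in> pdisc ?J 0 dl" using pdisc_case_sum[of c x KK A 0 0 dl] c x by simp
  then have mV: "case_sum c x \<in> V l" using dl(2) l by blast
  have mC: "case_sum c x \<in> cspace ?J" using mem unfolding pdisc_iff by blast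
  have "\<forall>z\<in>V l \<inter> cspace ?J. ?C l z \<in> \<Omega>1 \<inter> W & ?P l z \<in> \<Omega>1" using V[OF l] by blast
  from bspec[OF this IntI[OF mV mC]] have "chain l c x \<in> \<Omega>1 \<inter> W & pre l c x \<in> \<Omega>1" by (simp only: case_sum_comp)
  moreover have "c \<in> cspace KK" "x \<in> cspace A" using c x by (simp_all add: pdisc_iff)
  ultimately show ?thesis using chain_cspace slice_Cn by (auto simp: D1_iff pre_def intro!: cspace_plus)
 qed
 ultimately show ?thesis using dl(1) by (intro exI[of _ dl]) (auto simp: not_le)
qed

end

section \<open>Growth of the rank along chains\<close>

text \<open>
The polydisc of radius \<open>dl\<close> is so small that all chains of \<open>2d + 3\<close> steps stay where the flows are defined,
and that fields \<open>Pv v\<close> of \<open>LL\<close>, which form a basis of the tangent space at \<open>0\<close>, stay independent along them.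
\<close>

locale chains = flow +
 fixes dl :: real and S :: "(nat + nat) cpoint set" and Pv :: "(nat + nat) cpoint => (nat + nat) cpoint => (nat + nat) cpoint"
 assumes dl: "dl > 0"
  and ch: "\<And>l. l \<le> 2*d+3 ==> holom (KK <+> A) A (pbox (KK <+> A) 0 dl) (%w. chain l (w o Inl) (w o Inr))"
  and chD: "\<And>l c x. l \<le> 2*d+3 ==> c \<in> pdisc KK 0 dl ==> x \<in> pdisc A 0 dl ==> chain l c x \<in> D1 & pre l c x \<in> D1"
  and S: "finite S" "CT 0 \<subseteq> fvs.span S" "S \<subseteq> CT 0" "fvs.independent S" and PvLL: "\<And>v. v \<in> S ==> Pv v \<in> LL"
  and Pvi: "\<And>l c. l \<le> 2*d+3 ==> c \<in> pdisc KK 0 dl ==>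
   inj_on (%v. Pv v (chain l c 0)) S & fvs.independent ((%v. Pv v (chain l c 0)) ` S)"
begin

abbreviation "psi l c \<equiv> chain l c 0"
abbreviation "Dl \<equiv> pdisc KK 0 dl"
abbreviation "Bl \<equiv> pbox KK 0 dl"

lemma open_Bl[simp]: "open Bl" by (rule open_pbox) simp
lemma Dl_iff: "c \<in> Dl \<longleftrightarrow> c \<in> Bl & c \<in> cspace KK" by (auto simp: pdisc_def)
lemma zero_Dl[simp]: "0 \<in> Dl" "(0 :: (nat + nat) cpoint) \<in> pdisc A 0 dl" using dl by (auto simp: pdisc_iff)

lemma psi_D1: "l \<le> 2*d+3 ==> c \<in> Dl ==> psi l c \<in> D1" "l \<le> 2*d+3 ==> c \<in> Dl ==> pre l c 0 \<in> D1"
 using chD zero_Dl(2) by blast+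

lemma psi_rr: assumes c: "c \<in> Dl" and k: "k < d" shows "l \<le> 2*d+3 ==> rr k (psi l c) = 0"
proof (cases l)
 case (Suc m)
 assume "l \<le> 2*d+3"
 then show ?thesis unfolding Suc chain_Suc_pre by (intro kl_segre(2)[OF psi_D1(2)[OF _ c] k]) (use Suc in simp)
qed (simp add: rr0 k)

lemma mv_0_psi: assumes "l \<le> 2*d+3" "c \<in> Dl" shows "mv m 0 (psi l c) = psi l c"
 unfolding mv_kl emb_0 add_0_right
 by (rule kl_fixed[OF psi_D1(1)[OF assms]]) (rule psi_rr[OF assms(2) _ assms(1)])

lemma psi_zero_step: assumes "l < 2*d+3" "c \<in> Dl" "\<And>i. c (Suc l, i) = 0" shows "psi (Suc l) c = psi l c"
proof -
 have "(%i. c (Suc l, i)) = 0" using assms(3) by (simp add: fun_eq_iff)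
 then show ?thesis using mv_0_psi[of l c "Suc l"] assms by simp
qed

lemma psi_holom: assumes l: "l \<le> 2*d+3" shows "holom KK A Bl (psi l)"
proof -
 have z: "(0 :: (nat \<times> nat + (nat + nat)) cpoint) = case_sum 0 0" by simp
 have G: "holom KK (KK <+> A) Bl (%c. case_sum c 0)" unfolding holom_def ball_Plus by simp
 have m: "case_sum c 0 \<in> pbox (KK <+> A) 0 dl" if "c \<in> Bl" "c \<in> cspace KK" for c
  using pdisc_case_sum[of c 0 KK A 0 0 dl] that zero_Dl(2) unfolding z[symmetric] by (auto simp: pdisc_def)
 have "holo KK Bl (%c. psi l c a)" if a: "a \<in> A" for a
 proof -
  have h: "holo (KK <+> A) (pbox (KK <+> A) 0 dl) (%w. chain l (w o Inl) (w o Inr) a)" using ch[OF l] a by (simp add: holom_def)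
  have "holo KK Bl (%c. (%w :: (nat \<times> nat + (nat + nat)) cpoint. chain l (w o Inl) (w o Inr) a) (case_sum c 0))"
   by (rule holo_compose[where F="%w. chain l (w o Inl) (w o Inr) a" and G="%c. case_sum c 0", OF finKK(2) open_Bl open_pbox[OF finKK(2)] h G m])
  then show ?thesis by simp
 qed
 then show ?thesis by (simp add: holom_def chain_cspace)
qed

lemma chain_holom: assumes l: "l \<le> 2*d+3" and t: "t \<in> Dl" shows "holom A A (pbox A 0 dl) (chain l t)"
proof -
 have z: "(0 :: (nat \<times> nat + (nat + nat)) cpoint) = case_sum 0 0" by simp
 have G: "holom A (KK <+> A) (pbox A 0 dl) (%x. case_sum t x)"
  unfolding holom_def ball_Plus using t by (simp add: Dl_iff)
 have m: "case_sum t x \<in> pbox (KK <+> A) 0 dl" if "x \<in> pbox A 0 dl" "x \<in> cspace A" for x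
  using pdisc_case_sum[of t x KK A 0 0 dl] that t unfolding z[symmetric] by (auto simp: pdisc_def)
 have "holo A (pbox A 0 dl) (%x. chain l t x a)" if a: "a \<in> A" for a
 proof -
  have h: "holo (KK <+> A) (pbox (KK <+> A) 0 dl) (%w. chain l (w o Inl) (w o Inr) a)" using ch[OF l] a by (simp add: holom_def)
  have "holo A (pbox A 0 dl) (%x. chain l (case_sum t x o Inl) (case_sum t x o Inr) a)"
   by (rule holo_compose[OF finKK(2) open_pbox[OF finA] open_pbox[OF finKK(2)] h G m])
  then show ?thesis by simp
 qed
 then show ?thesis by (simp add: holom_def chain_cspace)
qed

lemma partial_deriv_cong_line:
 assumes "t \<in> Dl" "k \<in> KK" "\<And>u. t(k:=u) \<in> Dl ==> f (t(k:=u)) = g (t(k:=u))"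
 shows "pd k f t = pd k g t"
proof -
 have "\<forall>\<^sub>F u in nhds (t k). t(k:=u) \<in> Bl" by (rule eventually_upd) (use assms(1) in \<open>simp_all add: Dl_iff\<close>)
 then have "\<forall>\<^sub>F u in nhds (t k). f (t(k:=u)) = g (t(k:=u))"
 proof eventually_elim
  case (elim u)
  have "t(k:=u) \<in> cspace KK" by (rule cspace_upd[OF _ assms(2)]) (use assms(1) in \<open>simp add: Dl_iff\<close>)
  then show ?case by (intro assms(3)) (use elim in \<open>simp add: Dl_iff\<close>)
 qed
 then show ?thesis unfolding partial_deriv_def by (rule deriv_cong_ev) simp
qed

lemma pcol_psi_last:
 assumes m: "m < 2*d+3" and t: "t \<in> Dl" and i: "i < N"
 shows "pcol (psi (Suc m)) t (Suc m, i) = LV (Suc m) i (psi (Suc m) t)"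
proof
 fix a
 let ?l = "Suc m" let ?y = "pre m t 0" let ?b = "psi m t (dir ?l i)"
 have y: "?y \<in> D1" using psi_D1(2)[OF _ t] m by simp
 then have y': "?y \<in> \<Omega>1" "?y \<in> cspace A" by (auto simp: D1_iff)
 show "pcol (psi ?l) t (?l, i) a = LV ?l i (psi ?l t) a"
 proof (cases "a \<in> A")
  case True
  have dA: "dir ?l i \<in> A" using i by (simp add: dir_def)
  have up: "pre m (t((?l,i) := u)) 0 = ?y(dir ?l i := ?b + u)" for u
  proof -
   have "chain m (t((?l,i) := u)) 0 = psi m t" by (rule chain_cong) auto
   then show ?thesis
    by (auto simp: pre_def fun_eq_iff emb_def dir_def split: sum.splits)
  qed
  have yb: "?y (dir ?l i) = ?b + t (?l,i)" by (simp add: pre_def emb_def dir_def)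
  have "((%v. kl ?l (?y(dir ?l i := v)) a) has_field_derivative pd (dir ?l i) (%x. kl ?l x a) ?y) (at (?y (dir ?l i)))"
   by (rule holo_partial_DERIV[OF _ dA y']) (use kl_holom True in \<open>simp add: holom_def\<close>)
  then have "((%u. kl ?l (?y(dir ?l i := u + ?b)) a) has_field_derivative pd (dir ?l i) (%x. kl ?l x a) ?y) (at (t (?l,i)))"
   unfolding yb add.commute[of ?b] by (subst (asm) DERIV_shift)
  then have "((%u. psi ?l (t((?l,i):=u)) a) has_field_derivative LV ?l i ?y a) (at (t (?l,i)))"
   unfolding chain_Suc_pre up LV_partial[OF y i True] by (simp only: add.commute)
  then have "pcol (psi ?l) t (?l, i) a = LV ?l i ?y a" unfolding pcol_def by (rule partial_deriv_eqI)
  then show ?thesis unfolding chain_Suc_pre LV_kl[OF y'(2) i] .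
 next
  case False
  have "(%z. psi ?l z a) = (%z. 0)" using chain_cspace[OF cspace_0, of ?l] False unfolding cspace_def by blast
  then have "pcol (psi ?l) t (?l, i) a = 0" unfolding pcol_def by (simp only: partial_deriv_def) simp
  moreover have "LV ?l i x a = 0" for x using LL_cspace[OF LV_LL[OF i]] False unfolding cspace_def by blast
  ultimately show ?thesis by simp
 qed
qed

lemma pcol_psi_cong:
 assumes "\<And>l' i. l' \<le> m ==> t (l',i) = t' (l',i)" "fst k \<le> m"
 shows "pcol (psi m) t k = pcol (psi m) t' k"
proof -
 have "psi m (t(k:=u)) = psi m (t'(k:=u))" for u by (rule chain_cong) (use assms(1) in auto)
 moreover have "t k = t' k" using assms by (cases k) auto
 ultimately show ?thesis by (simp add: pcol_def partial_deriv_def)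
qed

lemma pcol_psi_later: assumes "m < fst k" shows "pcol (psi m) t k = 0"
proof -
 have "psi m (t(k:=u)) = psi m t" for u by (rule chain_cong) (use assms in auto)
 then show ?thesis by (simp add: pcol_def partial_deriv_def fun_eq_iff)
qed

lemma pcol_psi_zero_step:
 assumes m: "m < 2*d+3" and t: "t \<in> Dl" and z: "\<And>i. t (Suc m, i) = 0" and k: "k \<in> KK" "fst k \<le> m"
 shows "pcol (psi (Suc m)) t k = pcol (psi m) t k"
proof
 fix a show "pcol (psi (Suc m)) t k a = pcol (psi m) t k a"
  unfolding pcol_def
 proof (rule partial_deriv_cong_line[OF t k(1)])
  fix u assume u: "t(k:=u) \<in> Dl"
  have "psi (Suc m) (t(k:=u)) = psi m (t(k:=u))" by (rule psi_zero_step[OF m u]) (use z k in auto)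
  then show "psi (Suc m) (t(k:=u)) a = psi m (t(k:=u)) a" by simp
 qed
qed

definition TT :: "nat => (nat \<times> nat) cpoint => (nat + nat) cpoint set" where
 "TT l t = dimage KK (psi l) t"

lemma TT_cspace: assumes "l \<le> 2*d+3" "t \<in> Dl" shows "TT l t \<subseteq> cspace A"
 unfolding TT_def dimage_def using differential_cspace[OF open_Bl psi_holom[OF assms(1)]] assms(2) by (auto simp: Dl_iff)

lemma subspace_TT: "fvs.subspace (TT l t)" unfolding TT_def by (rule subspace_dimage)

text \<open>
Appending a step with parameter zero does not change the end point, but adds the velocity of the new
step to the image of the differential.
\<close>

lemma TT_step:
 assumes m: "m < 2*d+3" and t: "t \<in> Dl"
 shows "\<exists>t'\<in>Dl. TT m t \<subseteq> TT (Suc m) t' & (\<forall>i<N. LV (Suc m) i (psi m t) \<in> TT (Suc m) t')"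
proof -
 define t' where "t' = (%(l,i). if l = Suc m then 0 else t (l,i))"
 have t': "t' \<in> Dl" using t dl by (auto simp: pdisc_iff t'_def cspace_def)
 have z: "t' (Suc m, i) = 0" for i by (simp add: t'_def)
 have agree: "l' \<le> m ==> t (l',i) = t' (l',i)" for l' i by (simp add: t'_def)
 have p: "psi (Suc m) t' = psi m t"
  using psi_zero_step[OF m t' z] chain_cong[of m t t' 0] agree by simp
 have "TT m t \<subseteq> TT (Suc m) t'" unfolding TT_def[of m]
 proof (rule dimage_subsetI[OF subspace_TT])
  fix k assume k: "k \<in> KK"
  show "pcol (psi m) t k \<in> TT (Suc m) t'"
  proof (cases "fst k \<le> m")
   case True
   have "pcol (psi m) t k = pcol (psi (Suc m)) t' k"
    using pcol_psi_cong[of m t t' k] pcol_psi_zero_step[OF m t' z k True] agree True by simp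
   then show ?thesis unfolding TT_def using pcol_in_dimage[OF finKK(1) k] by simp
  next
   case False
   then show ?thesis using pcol_psi_later[of m k t] fvs.subspace_0[OF subspace_TT] by simp
  qed
 qed
 moreover have "LV (Suc m) i (psi m t) \<in> TT (Suc m) t'" if i: "i < N" for i
 proof -
  have "(Suc m, i) \<in> KK" using i m by simp
  from pcol_in_dimage[OF finKK(1) this, of "psi (Suc m)" t'] show ?thesis
   unfolding TT_def p[symmetric] pcol_psi_last[OF m t' i, symmetric] .
 qed
 ultimately show ?thesis using t' by blast
qed

definition RR :: "nat => nat" where "RR l = Max ((%t. fvs.dim (TT l t)) ` Dl)"

lemma RR: assumes "l \<le> 2*d+3"
 shows "t \<in> Dl ==> fvs.dim (TT l t) \<le> RR l" and "\<exists>t\<in>Dl. fvs.dim (TT l t) = RR l"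
proof -
 have "(%t. fvs.dim (TT l t)) ` Dl \<subseteq> {..card A}"
  using dim_le_dim_cspace[OF finA TT_cspace[OF assms]] by blast
 then have f: "finite ((%t. fvs.dim (TT l t)) ` Dl)" by (rule finite_subset) simp
 show "t \<in> Dl ==> fvs.dim (TT l t) \<le> RR l" unfolding RR_def by (rule Max_ge[OF f]) simp
 have "RR l \<in> (%t. fvs.dim (TT l t)) ` Dl" unfolding RR_def by (rule Max_in[OF f]) (use zero_Dl(1) in blast)
 then show "\<exists>t\<in>Dl. fvs.dim (TT l t) = RR l" by auto
qed

lemma RR_mono: assumes "l < 2*d+3" shows "RR l \<le> RR (Suc l)"
proof -
 have l: "l \<le> 2*d+3" "Suc l \<le> 2*d+3" using assms by auto
 obtain t where t: "t \<in> Dl" "fvs.dim (TT l t) = RR l" using RR(2)[OF l(1)] by blast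
 obtain t' where t': "t' \<in> Dl" "TT l t \<subseteq> TT (Suc l) t'" using TT_step[OF assms t(1)] by blast
 have "fvs.dim (TT l t) \<le> fvs.dim (TT (Suc l) t')" by (rule dim_subset_cspace[OF finA TT_cspace[OF l(2) t'(1)] t'(2)])
 also have "\<dots> \<le> RR (Suc l)" by (rule RR(1)[OF l(2) t'(1)])
 finally show ?thesis using t(2) by simp
qed

text \<open>
If the maximal rank does not grow, then at points of maximal rank the image of the differential contains the velocities of
steps of both kinds: of the last one already made and of the one that could be appended. By \<open>bracket_in_dimage\<close> it
then contains all of \<open>LL\<close>.
\<close>

lemma rank_growth:
 assumes l: "Suc m < 2*d+3" and eq: "RR (Suc (Suc m)) = RR (Suc m)"
 shows "card S \<le> RR (Suc m)"
proof -
 let ?l = "Suc m"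
 have ll: "?l \<le> 2*d+3" "Suc ?l \<le> 2*d+3" "m < 2*d+3" using l by auto
 have gen: "LV j i (psi ?l t) \<in> TT ?l t" if t: "t \<in> Dl" "fvs.dim (TT ?l t) = RR ?l" and i: "i < N" for t i j
 proof -
  have 1: "LV ?l i (psi ?l t) \<in> TT ?l t"
  proof -
   have "(?l, i) \<in> KK" using i ll by simp
   from pcol_in_dimage[OF finKK(1) this] show ?thesis
    unfolding TT_def pcol_psi_last[OF ll(3) t(1) i, symmetric] .
  qed
  obtain t' where t': "t' \<in> Dl" "TT ?l t \<subseteq> TT (Suc ?l) t'" "\<forall>i<N. LV (Suc ?l) i (psi ?l t) \<in> TT (Suc ?l) t'"
   using TT_step[OF l t(1)] by blast
  obtain B where B: "B \<subseteq> TT ?l t" "fvs.independent B" "TT ?l t \<subseteq> fvs.span B" "card B = fvs.dim (TT ?l t)"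
   using fvs.basis_exists by blast
  have "TT (Suc ?l) t' \<subseteq> fvs.span B"
  proof (rule span_if_dim_le[OF finA TT_cspace[OF ll(2) t'(1)] _ B(2)])
   show "B \<subseteq> TT (Suc ?l) t'" using B(1) t'(2) by blast
   show "fvs.dim (TT (Suc ?l) t') \<le> card B" using RR(1)[OF ll(2) t'(1)] eq t(2) B(4) by simp
  qed
  also have "fvs.span B \<subseteq> TT ?l t" by (rule fvs.span_minimal[OF B(1) subspace_TT])
  finally have 2: "LV (Suc ?l) i (psi ?l t) \<in> TT ?l t" using t'(3) i by blast
  show ?thesis
  proof (cases "even j = even ?l")
   case True
   then have "LV j = LV ?l" by (intro ext) (simp add: LV_def)
   then show ?thesis using 1 by (simp only:)
  next
   case False
   then have "LV j = LV (Suc ?l)" by (intro ext) (auto simp: LV_def)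
   then show ?thesis using 2 by (simp only:)
  qed
 qed
 have all: "\<forall>t\<in>Dl. fvs.dim (TT ?l t) = RR ?l --> P (psi ?l t) \<in> TT ?l t" if "P \<in> LL" for P
  using that
 proof (induction rule: LL.induct)
  case (LE i)
  have eq: "LE i = LV 0 i" by (simp add: LV_def)
  show ?case unfolding eq by (intro ballI impI gen LE)
 next
  case (LO i)
  have eq: "LO i = LV 1 i" by (simp add: LV_def)
  show ?case unfolding eq by (intro ballI impI gen LO)
 next
  case (br P Q)
  show ?case unfolding TT_def
  proof (intro ballI impI)
   fix t assume t: "t \<in> Dl" "fvs.dim (dimage KK (psi ?l) t) = RR ?l"
   show "hbr A P Q (psi ?l t) \<in> dimage KK (psi ?l) t"
   proof (rule bracket_in_dimage[OF finKK(1) finA open_Bl psi_holom[OF ll(1)] open_Om1 LL_holo[OF br(1)] LL_holo[OF br(2)], where R="RR ?l"])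
    fix t assume t: "t \<in> Bl" "t \<in> cspace KK"
    then have tD: "t \<in> Dl" by (simp add: Dl_iff)
    show "psi ?l t \<in> \<Omega>1" using psi_D1(1)[OF ll(1) tD] by (simp add: D1_iff)
    show "fvs.dim (dimage KK (psi ?l) t) \<le> RR ?l" using RR(1)[OF ll(1) tD] unfolding TT_def .
    assume e: "fvs.dim (dimage KK (psi ?l) t) = RR ?l"
    show "P (psi ?l t) \<in> dimage KK (psi ?l) t" using bspec[OF br(3) tD] e unfolding TT_def by (rule mp)
    show "Q (psi ?l t) \<in> dimage KK (psi ?l) t" using bspec[OF br(4) tD] e unfolding TT_def by (rule mp)
   qed (use t in \<open>simp_all add: Dl_iff\<close>)
  qed
 qed
 obtain t where t: "t \<in> Dl" "fvs.dim (TT ?l t) = RR ?l" using RR(2)[OF ll(1)] by blast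
 have i: "inj_on (%v. Pv v (psi ?l t)) S" "fvs.independent ((%v. Pv v (psi ?l t)) ` S)" using Pvi[OF ll(1) t(1)] by auto
 have "(%v. Pv v (psi ?l t)) ` S \<subseteq> TT ?l t" using all[OF PvLL] t by blast
 from indep_card_le_dim[OF finA TT_cspace[OF ll(1) t(1)] this i(2)] show ?thesis
  using card_image[OF i(1)] t(2) by simp
qed

lemma CT_0_iff: "v \<in> CT 0 \<longleftrightarrow> v \<in> cspace A & (\<forall>k<d. (\<Sum>j<N. Bm k j * v (Inl j)) + (\<Sum>j<N. cnj (Bm k j) * v (Inr j)) = 0)"
proof -
 have "pd (Inr j) (rr k) 0 = cnj (Bm k j)" if "k < d" "j < N" for k j
  using rr_partial_sc[of 0 k "Inr j"] that zero_Om by (simp add: Bm_def)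
 then have "(\<Sum>a\<in>A. pd a (rr k) 0 * v a) = (\<Sum>j<N. Bm k j * v (Inl j)) + (\<Sum>j<N. cnj (Bm k j) * v (Inr j))" if "k < d" for k
  using that by (simp add: sum_dbl Bm_def[symmetric])
 then show ?thesis by (auto simp: CT_def)
qed

lemma Bm_Bs: assumes "k < d" shows "(\<Sum>j<N. Bm k j * (\<Sum>l<d. Bs j l * \<mu> l)) = \<mu> k"
 and "(\<Sum>j<N. cnj (Bm k j) * (\<Sum>l<d. cnj (Bs j l) * \<mu> l)) = \<mu> k"
proof -
 have 1: "(\<Sum>j<N. Bm k j * (\<Sum>l<d. Bs j l * \<mu> l)) = \<mu> k" for \<mu> :: "nat => complex"
 proof -
  have "(\<Sum>j<N. Bm k j * (\<Sum>l<d. Bs j l * \<mu> l)) = (\<Sum>l<d. (\<Sum>j<N. Bm k j * Bs j l) * \<mu> l)"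
   unfolding sum_distrib_left sum_distrib_right by (subst sum.swap) (simp add: mult.assoc)
  also have "\<dots> = (\<Sum>l<d. (if l = k then 1 else 0) * \<mu> l)"
   by (rule sum.cong) (use Bs[OF assms] in \<open>auto simp: Bm_def\<close>)
  also have "\<dots> = \<mu> k" using assms by (simp add: sum_ind)
  finally show ?thesis .
 qed
 show "(\<Sum>j<N. Bm k j * (\<Sum>l<d. Bs j l * \<mu> l)) = \<mu> k" by (rule 1)
 have "cnj (\<Sum>j<N. Bm k j * (\<Sum>l<d. Bs j l * cnj (\<mu> l))) = cnj (cnj (\<mu> k))" unfolding 1 ..
 then show "(\<Sum>j<N. cnj (Bm k j) * (\<Sum>l<d. cnj (Bs j l) * \<mu> l)) = \<mu> k" by simp
qed

text \<open>
Subtracting multiples of \<open>d\<close> fixed vectors makes the two halves of a tangent vector tangent separately, and then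
\<open>CT_LE\<close> and \<open>CT_LO\<close> apply.
\<close>

lemma CT_0_decomp:
 assumes v: "v \<in> CT 0" and W: "fvs.subspace W" and LW: "\<And>i. i < N ==> LE i 0 \<in> W" "\<And>i. i < N ==> LO i 0 \<in> W"
  and w: "\<And>l. l < d ==> (%a. if a \<in> A then case_sum (%i. Bs i l) (%i. - cnj (Bs i l)) a else 0) \<in> W"
 shows "v \<in> W"
proof -
 have ccz: "cc 0 = 0" "cc 0 \<in> D1" by simp_all
 define \<mu> where "\<mu> k = (\<Sum>j<N. Bm k j * v (Inl j))" for k
 have \<mu>': "(\<Sum>j<N. cnj (Bm k j) * v (Inr j)) = - \<mu> k" if "k < d" for k
  using v that unfolding CT_0_iff \<mu>_def by (simp add: eq_neg_iff_add_eq_0 add.commute)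
 define va where "va = (%a. if a \<in> A then case_sum (%i. v (Inl i) - (\<Sum>l<d. Bs i l * \<mu> l)) (%i. 0) a else 0)"
 define vb where "vb = (%a. if a \<in> A then case_sum (%i. 0) (%i. v (Inr i) + (\<Sum>l<d. cnj (Bs i l) * \<mu> l)) a else 0)"
 have va: "va \<in> CT 0" unfolding CT_0_iff
  using Bm_Bs(1)[of _ \<mu>] by (auto simp: va_def cspace_def right_diff_distrib sum_subtractf \<mu>_def[symmetric])
 have vb: "vb \<in> CT 0" unfolding CT_0_iff
  using Bm_Bs(2)[of _ \<mu>] by (auto simp: vb_def cspace_def distrib_left sum.distrib \<mu>')
 have "va = (\<Sum>i<N. smul (va (Inl i)) (LE i (cc 0)))" by (rule CT_LE[OF M0 ccz(2) va]) (simp add: va_def)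
 then have vaW: "va \<in> W"
 proof (rule ssubst)
  show "(\<Sum>i<N. smul (va (Inl i)) (LE i (cc 0))) \<in> W"
   unfolding ccz(1) by (rule fvs.subspace_sum[OF W], rule fvs.subspace_scale[OF W], rule LW(1)) simp
 qed
 have "vb = (\<Sum>i<N. smul (vb (Inr i)) (LO i (cc 0)))" by (rule CT_LO[OF M0 ccz(2) vb]) (simp add: vb_def)
 then have vbW: "vb \<in> W"
 proof (rule ssubst)
  show "(\<Sum>i<N. smul (vb (Inr i)) (LO i (cc 0))) \<in> W"
   unfolding ccz(1) by (rule fvs.subspace_sum[OF W], rule fvs.subspace_scale[OF W], rule LW(2)) simp
 qed
 let ?w = "%l a. if a \<in> A then case_sum (%i. Bs i l) (%i. - cnj (Bs i l)) a else 0"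
 have wW: "(\<Sum>l<d. smul (\<mu> l) (?w l)) \<in> W"
  by (rule fvs.subspace_sum[OF W], rule fvs.subspace_scale[OF W], rule w) simp
 have "v a = (va + vb + (\<Sum>l<d. smul (\<mu> l) (?w l))) a" for a
 proof (cases a)
  case (Inl i)
  then show ?thesis using v by (cases "i < N") (auto simp: va_def vb_def sum_fun_apply smul_def CT_def cspace_def mult.commute)
 next
  case (Inr i)
  then show ?thesis using v by (cases "i < N") (auto simp: va_def vb_def sum_fun_apply smul_def CT_def cspace_def mult.commute sum_negf)
 qed
 then have "v = va + vb + (\<Sum>l<d. smul (\<mu> l) (?w l))" by (rule ext)
 then show ?thesis
 proof (rule ssubst)
  show "va + vb + (\<Sum>l<d. smul (\<mu> l) (?w l)) \<in> W"
   by (rule fvs.subspace_add[OF W fvs.subspace_add[OF W vaW vbW] wW])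
 qed
qed

lemma rank_two: "card S \<le> RR 2 + d"
proof -
 have l: "(1::nat) < 2*d+3" "(2::nat) \<le> 2*d+3" "Suc 1 = 2" by simp_all
 have LO0: "LV 1 i 0 \<in> TT 1 0" if i: "i < N" for i
 proof -
  have k: "(Suc 0, i) \<in> KK" using i by simp
  have p0: "psi (Suc 0) 0 = 0" by (rule conjunct2[OF chain_germ])
  have p: "pcol (psi (Suc 0)) 0 (Suc 0, i) = LV (Suc 0) i (psi (Suc 0) 0)"
   by (rule pcol_psi_last[OF _ zero_Dl(1) i]) simp
  show ?thesis using pcol_in_dimage[OF finKK(1) k, of "psi (Suc 0)" 0] unfolding p p0 TT_def One_nat_def .
 qed
 obtain t where t: "t \<in> Dl" "TT 1 0 \<subseteq> TT 2 t" "\<forall>i<N. LV 2 i (psi 1 0) \<in> TT 2 t"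
  using TT_step[OF l(1) zero_Dl(1)] unfolding l(3) by blast
 have p1: "psi 1 0 = 0" using chain_germ[of 1] by simp
 obtain B where B: "B \<subseteq> TT 2 t" "fvs.independent B" "TT 2 t \<subseteq> fvs.span B" "card B = fvs.dim (TT 2 t)"
  using fvs.basis_exists by blast
 have finB: "finite B" by (rule indep_cspace_finite[OF finA _ B(2)]) (use B(1) TT_cspace[OF l(2) t(1)] in blast)
 let ?w = "%l a. if a \<in> A then case_sum (%i. Bs i l) (%i. - cnj (Bs i l)) a else 0"
 let ?B = "B \<union> ?w ` {..<d}"
 have TB: "TT 2 t \<subseteq> fvs.span ?B" using B(3) fvs.span_mono[of B ?B] by blast
 have "CT 0 \<subseteq> fvs.span ?B"
 proof
  fix v assume v: "v \<in> CT 0"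
  show "v \<in> fvs.span ?B"
  proof (rule CT_0_decomp[OF v fvs.subspace_span])
   fix i assume i: "i < N"
   have "LV 2 i 0 \<in> TT 2 t" using t(3) i unfolding p1 by blast
   then show "LE i 0 \<in> fvs.span ?B" using TB by (auto simp: LV_def)
   have "LV 1 i 0 \<in> TT 2 t" using LO0[OF i] t(2) by blast
   then show "LO i 0 \<in> fvs.span ?B" using TB by (auto simp: LV_def)
  next
   fix l assume "l < d"
   then show "?w l \<in> fvs.span ?B" by (intro fvs.span_base) blast
  qed
 qed
 then have "S \<subseteq> fvs.span ?B" using S(3) by blast
 then have "card S \<le> card ?B" using fvs.independent_span_bound[of ?B S] finB S(4) by simp
 also have "\<dots> \<le> card B + card (?w ` {..<d})" by (rule card_Un_le)
 also have "\<dots> \<le> RR 2 + d" using B(4) RR(1)[OF l(2) t(1)] card_image_le[of "{..<d}" ?w] by simp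
 finally show ?thesis .
qed

lemma full_rank: "\<exists>t\<in>Dl. card S \<le> fvs.dim (TT (d+2) t)"
proof -
 have "j \<le> d ==> card S \<le> RR (j+2) + (d-j)" for j
 proof (induction j)
  case 0
  then show ?case using rank_two by (simp add: numeral_2_eq_2)
 next
  case (Suc j)
  have m: "RR (j+2) \<le> RR (Suc (j+2))" by (rule RR_mono) (use Suc in simp)
  have g: "RR (Suc (j+2)) = RR (j+2) ==> card S \<le> RR (j+2)" using rank_growth[of "j+1"] Suc by simp
  show ?case
  proof (cases "RR (Suc (j+2)) = RR (j+2)")
   case True
   then show ?thesis using g by simp
  next
   case False
   then have "RR (Suc (j+2)) \<ge> RR (j+2) + 1" using m by linarith
   moreover have "card S \<le> RR (j+2) + (d-j)" using Suc by simp
   ultimately show ?thesis using Suc.prems by simp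
  qed
 qed
 from this[of d] have "card S \<le> RR (d+2)" by simp
 then show ?thesis using RR(2)[of "d+2"] by force
qed

section \<open>Closing the chain\<close>

text \<open>
The first \<open>d + 1\<close> steps follow \<open>t\<close>, step \<open>d + 2\<close> does nothing, and the remaining steps undo the first ones in reverse
order; \<open>l\<close> and \<open>2d + 4 - l\<close> have the same parity, so each undoing step is of the right kind.
\<close>

definition closing :: "(nat \<times> nat) cpoint => (nat \<times> nat) cpoint" where
 "closing t = (%(l,i). if l < d+2 then t (l,i) else if l = d+2 then 0 else - t (2*d+4-l, i))"

definition first :: "(nat \<times> nat) cpoint => (nat \<times> nat) cpoint" where
 "first s = (%(l,i). if l \<le> d+2 then s (l,i) else 0)"

lemma closing_Dl: assumes "t \<in> Dl" shows "closing t \<in> Dl"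
proof -
 have a: "t \<in> cspace KK & (\<forall>k\<in>KK. cmod (t k - 0 k) < dl)" using assms unfolding pdisc_iff .
 have tC: "t k = 0" if "k \<notin> KK" for k using a that unfolding cspace_def by blast
 have tb: "cmod (t k) < dl" if "k \<in> KK" for k
 proof -
  have "cmod (t k - 0 k) < dl" using a that by blast
  then show ?thesis by (simp only: zero_fun_apply diff_zero)
 qed
 have b: "cmod (t k) < dl" for k using tC[of k] tb[of k] dl by (cases "k \<in> KK") auto
 have "closing t k = 0" if k: "k \<notin> KK" for k
 proof -
  obtain l i where k': "k = (l,i)" by (cases k)
  have "(l,i) \<notin> KK" "(2*d+4-l,i) \<notin> KK \<or> l \<le> d+2" using k unfolding k' by auto
  then show ?thesis using tC by (auto simp: closing_def k')
 qed
 moreover have "cmod (closing t k) < dl" for k using b dl by (auto simp: closing_def split: prod.splits)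
 ultimately show ?thesis by (auto simp: pdisc_iff cspace_def)
qed

lemma chain_backtrack:
 assumes c: "c \<in> Dl" and t: "t \<in> cspace KK" and ct: "\<And>l i. d+2 < l ==> l \<le> 2*d+3 ==> c (l,i) = - t (2*d+4-l, i)"
 shows "j \<le> d+1 ==> chain j t (psi (2*d+3) c) = psi (2*d+3-j) c"
proof (induction j)
 case (Suc j)
 obtain n where n: "2*d+3-j = Suc n" "n \<le> 2*d+3" "n = 2*d+3 - Suc j" using Suc by (intro that[of "2*d+2-j"]) auto
 have s: "(%i. t (Suc j, i)) + (%i. c (Suc n, i)) = 0"
 proof -
  have "c (Suc n, i) = - t (2*d+4 - Suc n, i)" for i by (rule ct) (use Suc n in auto)
  moreover have "2*d+4 - Suc n = Suc j" using n Suc by auto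
  ultimately show ?thesis by (simp add: fun_eq_iff)
 qed
 have par: "mv (Suc j) = mv (Suc n)" by (rule mv_parity) (use n Suc in presburger)
 have IH: "chain j t (psi (2*d+3) c) = psi (Suc n) c" unfolding n(1)[symmetric] by (rule Suc.IH) (use Suc.prems in simp)
 have "chain (Suc j) t (psi (2*d+3) c) = mv (Suc j) (%i. t (Suc j, i)) (psi (Suc n) c)" unfolding chain.simps(2)[of j] IH ..
 also have "\<dots> = mv (Suc n) (%i. t (Suc j, i)) (mv (Suc n) (%i. c (Suc n, i)) (psi n c))" unfolding par chain.simps(2) ..
 also have "\<dots> = mv (Suc n) ((%i. c (Suc n, i)) + (%i. t (Suc j, i))) (psi n c)"
  by (rule mv_add[OF chain_cspace[OF cspace_0] slice_Cn]) (use c in \<open>simp add: Dl_iff\<close>)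
 also have "\<dots> = psi n c" unfolding add.commute[of "%i. c (Suc n, i)"] s by (rule mv_0_psi[OF n(2) c])
 finally show ?case unfolding n(3)[symmetric] .
qed simp

lemma chain_return:
 assumes c: "c \<in> Dl" and t: "t \<in> cspace KK" and ct: "\<And>l i. d+2 < l ==> l \<le> 2*d+3 ==> c (l,i) = - t (2*d+4-l, i)"
  and ce: "\<And>l i. l < d+2 ==> c (l,i) = t (l,i)" and c0: "\<And>i. c (d+2,i) = 0"
 shows "m \<le> d+1 ==> psi (d+2+m) c = psi (d+1-m) c"
proof (induction m)
 case 0
 have e: "d+2+0 = Suc (d+1)" "d+1-0 = d+1" by simp_all
 show ?case unfolding e by (rule psi_zero_step[OF _ c]) (use c0 in simp_all)
next
 case (Suc m)
 obtain n where n: "d+1-m = Suc n" "n \<le> 2*d+3" "n = d+1 - Suc m" using Suc by (intro that[of "d - m"]) auto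
 have s: "(%i. c (Suc n, i)) + (%i. c (d+2+Suc m, i)) = 0"
 proof -
  have "c (d+2+Suc m, i) = - t (2*d+4 - (d+2+Suc m), i)" for i by (rule ct) (use Suc in auto)
  moreover have "2*d+4 - (d+2+Suc m) = Suc n" using n Suc by auto
  moreover have "c (Suc n, i) = t (Suc n, i)" for i by (rule ce) (use n Suc in auto)
  ultimately show ?thesis by (simp add: fun_eq_iff)
 qed
 have par: "mv (d+2+Suc m) = mv (Suc n)" by (rule mv_parity) (use n Suc in presburger)
 have IH: "psi (d+2+m) c = psi (Suc n) c" unfolding n(1)[symmetric] by (rule Suc.IH) (use Suc.prems in simp)
 have e: "d+2+Suc m = Suc (d+2+m)" by simp
 have "psi (d+2+Suc m) c = mv (d+2+Suc m) (%i. c (d+2+Suc m, i)) (psi (Suc n) c)" unfolding e chain.simps(2)[of "d+2+m"] IH ..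
 also have "\<dots> = mv (Suc n) (%i. c (d+2+Suc m, i)) (mv (Suc n) (%i. c (Suc n, i)) (psi n c))" unfolding par chain.simps(2)[of n] ..
 also have "\<dots> = mv (Suc n) ((%i. c (Suc n, i)) + (%i. c (d+2+Suc m, i))) (psi n c)"
  by (rule mv_add[OF chain_cspace[OF cspace_0] slice_Cn]) (use c in \<open>simp add: Dl_iff\<close>)
 also have "\<dots> = psi n c" unfolding s by (rule mv_0_psi[OF n(2) c])
 finally show ?case unfolding n(3)[symmetric] .
qed

lemma smul_Dl: assumes "t \<in> Dl" "cmod lam \<le> 1" shows "smul lam t \<in> Dl"
proof -
 have "cmod (lam * t k) < dl" if "cmod (t k) < dl" for k
 proof -
  have "cmod (lam * t k) \<le> 1 * cmod (t k)" unfolding norm_mult by (rule mult_right_mono[OF assms(2)]) simp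
  then show ?thesis using that by simp
 qed
 then show ?thesis using assms(1) by (auto simp: pdisc_iff smul_def cspace_def)
qed

lemma closed_chain: assumes t: "t \<in> Dl" and lam: "cmod lam \<le> 1" shows "psi (2*d+3) (smul lam (closing t)) = 0"
proof -
 have "psi (d+2+(d+1)) (smul lam (closing t)) = psi (d+1-(d+1)) (smul lam (closing t))"
 proof (rule chain_return[OF smul_Dl[OF closing_Dl[OF t] lam], where t = "smul lam t"])
  show "smul lam t \<in> cspace KK" using smul_Dl[OF t lam] by (simp add: Dl_iff)
 qed (auto simp: smul_def closing_def)
 then show ?thesis by (simp add: mult_2 numeral_3_eq_3)
qed

text \<open>
Perturb the first \<open>d + 2\<close> steps of the closed chain by \<open>s\<close>. Running forward along \<open>t\<close> from its end
point cancels the undoing steps, and the point reached is the end of the chain of \<open>d + 2\<close> steps with parameter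
\<open>t + s\<close>. Thus the differential of full rank factors through that of the closed chain.
\<close>

lemma closing_rank:
 assumes t: "t \<in> Dl" and r: "card S \<le> fvs.dim (TT (d+2) t)" and v: "v \<in> CT 0"
 shows "\<exists>s\<in>cspace KK. v = differential KK (psi (2*d+3)) (closing t) (first s)"
proof -
 let ?L = "2*d+3" and ?\<tau> = "closing t"
 let ?I = "%s. differential KK (psi ?L) ?\<tau> (first s)"
 have le: "?L \<le> 2*d+3" "d+2 \<le> 2*d+3" by simp_all
 have \<tau>: "?\<tau> \<in> Bl" "?\<tau> \<in> cspace KK" using closing_Dl[OF t] by (simp_all add: Dl_iff)
 have t': "t \<in> Bl" "t \<in> cspace KK" using t by (simp_all add: Dl_iff)
 have fC: "first s \<in> cspace KK" if "s \<in> cspace KK" for s using that by (auto simp: first_def cspace_def)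
 have \<tau>0: "psi ?L ?\<tau> = 0" using closed_chain[OF t, of 1] by (simp add: smul_def)
 have hL: "holo KK Bl (%c. psi ?L c a)" if "a \<in> A" for a using psi_holom[OF le(1)] that by (simp add: holom_def)
 have line: "((%u. psi ?L (?\<tau> + smul u (first s)) a) has_field_derivative ?I s a) (at 0)" if "s \<in> cspace KK" "a \<in> A" for s a
  unfolding differential_def by (rule holo_line_DERIV[OF finKK(1) open_Bl hL[OF that(2)] \<tau> fC[OF that(1)]])
 have IC: "?I s \<in> CT 0" if s: "s \<in> cspace KK" for s
 proof -
  have "(\<Sum>a\<in>A. pd a (rr k) 0 * ?I s a) = 0" if k: "k < d" for k
  proof -
   have pc: "(\<Sum>a\<in>A. pd a (rr k) 0 * pd j (%c. psi ?L c a) ?\<tau>) = 0" if j: "j \<in> KK" for j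
   proof -
    have "pd j (%c. rr k (psi ?L c)) ?\<tau> = (\<Sum>a\<in>A. pd a (rr k) (psi ?L ?\<tau>) * pd j (%c. psi ?L c a) ?\<tau>)"
     by (rule partial_deriv_compose[OF finA open_Bl open_Om rh[OF k] psi_holom[OF le(1)] \<tau> _ j]) (simp add: \<tau>0)
    moreover have "pd j (%c. rr k (psi ?L c)) ?\<tau> = pd j (%c. 0) ?\<tau>"
     by (rule partial_deriv_cong_line[OF closing_Dl[OF t] j]) (rule psi_rr[OF _ k le(1)])
    ultimately show ?thesis unfolding \<tau>0 by (simp add: partial_deriv_def)
   qed
   have "(\<Sum>a\<in>A. pd a (rr k) 0 * ?I s a) = (\<Sum>j\<in>KK. (\<Sum>a\<in>A. pd a (rr k) 0 * pd j (%c. psi ?L c a) ?\<tau>) * first s j)"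
    unfolding differential_apply sum_distrib_left sum_distrib_right by (subst sum.swap) (simp only: mult.assoc)
   also have "\<dots> = 0" by (rule sum.neutral) (simp add: pc)
   finally show ?thesis .
  qed
  moreover have "?I s \<in> cspace A" by (rule differential_cspace[OF open_Bl psi_holom[OF le(1)] \<tau>])
  ultimately show ?thesis by (simp add: CT_def)
 qed
 \<comment> \<open>Running forward along \<open>t\<close> from the end of the closed chain recovers the first half.\<close>
 define G where "G = chain (d+2) t"
 have hG: "holom A A (pbox A 0 dl) G" unfolding G_def by (rule chain_holom[OF le(2) t])
 have push: "differential KK (psi (d+2)) t s = differential A G 0 (?I s)" if s: "s \<in> cspace KK" for s
 proof
  fix a show "differential KK (psi (d+2)) t s a = differential A G 0 (?I s) a"
  proof (cases "a \<in> A")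
   case True
   have hGa: "holo A (pbox A 0 dl) (%x. G x a)" using hG True by (simp add: holom_def)
   have "((%u. G (psi ?L (?\<tau> + smul u (first s))) a) has_field_derivative (\<Sum>b\<in>A. pd b (%x. G x a) (psi ?L (?\<tau> + smul 0 (first s))) * ?I s b)) (at 0)"
   proof (rule holo_chain_DERIV[OF finA open_pbox[OF finA] hGa])
    show "psi ?L (?\<tau> + smul 0 (first s)) \<in> pbox A 0 dl" using \<tau>0 dl by (simp add: smul_def zero_fun_def[symmetric])
   qed (use line[OF s] chain_cspace in auto)
   then have 1: "((%u. G (psi ?L (?\<tau> + smul u (first s))) a) has_field_derivative differential A G 0 (?I s) a) (at 0)"
    using \<tau>0 by (simp add: differential_apply smul_def zero_fun_def[symmetric])
   have h2: "holo KK Bl (%c. psi (d+2) c a)" using psi_holom[OF le(2)] True by (simp add: holom_def)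
   have 2: "((%u. psi (d+2) (t + smul u s) a) has_field_derivative differential KK (psi (d+2)) t s a) (at 0)"
    unfolding differential_def by (rule holo_line_DERIV[OF finKK(1) open_Bl h2 t' s])
   have "\<forall>\<^sub>F u in at 0. ?\<tau> + smul u (first s) \<in> Bl" by (rule eventually_line[OF open_Bl \<tau>(1)])
   then have ev: "\<forall>\<^sub>F u in at 0. G (psi ?L (?\<tau> + smul u (first s))) a = psi (d+2) (t + smul u s) a"
   proof eventually_elim
    case (elim u)
    let ?c = "?\<tau> + smul u (first s)"
    have "smul u (first s) \<in> cspace KK" using fC[OF s] by (simp add: cspace_def smul_def)
    then have c: "?c \<in> Dl" using elim \<tau>(2) by (simp add: Dl_iff cspace_plus)
    have b: "chain (d+1) t (psi ?L ?c) = psi (?L-(d+1)) ?c"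
     by (rule chain_backtrack[OF c t'(2)]) (auto simp: closing_def first_def smul_def)
    have e: "?L - (d+1) = Suc (d+1)" by simp
    have "G (psi ?L ?c) = mv (Suc (d+1)) (%i. t (Suc (d+1), i)) (chain (d+1) t (psi ?L ?c))"
     by (simp add: G_def)
    also have "\<dots> = mv (Suc (d+1)) (%i. t (Suc (d+1), i)) (mv (Suc (d+1)) (%i. ?c (Suc (d+1), i)) (psi (d+1) ?c))"
     unfolding b e by simp
    also have "\<dots> = mv (Suc (d+1)) ((%i. ?c (Suc (d+1), i)) + (%i. t (Suc (d+1), i))) (psi (d+1) ?c)"
     by (rule mv_add[OF chain_cspace[OF cspace_0] slice_Cn]) (rule conjunct2[OF c[unfolded Dl_iff]])
    also have "(%i. ?c (Suc (d+1), i)) + (%i. t (Suc (d+1), i)) = (%i. (t + smul u s) (Suc (d+1), i))"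
     by (simp add: fun_eq_iff closing_def first_def smul_def)
    also have "psi (d+1) ?c = psi (d+1) (t + smul u s)"
     by (rule chain_cong) (simp add: closing_def first_def smul_def)
    finally have "G (psi ?L ?c) = psi (Suc (d+1)) (t + smul u s)" unfolding chain.simps(2)[of "d+1"] .
    moreover have "d + 2 = Suc (d+1)" by simp
    ultimately show ?case by (simp only:)
   qed
   have at0: "G (psi ?L (?\<tau> + smul 0 (first s))) a = psi (d+2) (t + smul 0 s) a"
   proof -
    have c1: "((%u. G (psi ?L (?\<tau> + smul u (first s))) a) \<longlongrightarrow> G (psi ?L (?\<tau> + smul 0 (first s))) a) (at 0)"
     using DERIV_isCont[OF 1] by (simp add: isCont_def)
    have c2: "((%u. psi (d+2) (t + smul u s) a) \<longlongrightarrow> psi (d+2) (t + smul 0 s) a) (at 0)"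
     using DERIV_isCont[OF 2] by (simp add: isCont_def)
    have "((%u. psi (d+2) (t + smul u s) a) \<longlongrightarrow> G (psi ?L (?\<tau> + smul 0 (first s))) a) (at 0)"
     using c1 by (rule Lim_transform_eventually[OF _ ev])
    then show ?thesis by (rule tendsto_unique[OF _ _ c2, rotated]) simp
   qed
   have "\<forall>\<^sub>F u in nhds 0. G (psi ?L (?\<tau> + smul u (first s))) a = psi (d+2) (t + smul u s) a"
    unfolding eventually_nhds_conv_at using ev at0 by blast
   then have "((%u. psi (d+2) (t + smul u s) a) has_field_derivative differential A G 0 (?I s) a) (at 0)"
    using 1 by (subst (asm) DERIV_cong_ev[OF refl _ refl]) auto
   with 2 show ?thesis by (rule DERIV_unique)
  next
   case False
   have z: "(%z. psi (d+2) z a) = (%z. 0)" using chain_cspace[OF cspace_0, of "d+2"] False unfolding cspace_def by blast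
   have "differential A G 0 (?I s) \<in> cspace A"
    by (rule differential_cspace[OF open_pbox[OF finA] hG]) (use dl in simp_all)
   then have "differential A G 0 (?I s) a = 0" using False by (simp add: cspace_def)
   moreover have "differential KK (psi (d+2)) t s a = 0" unfolding differential_def z by (simp add: partial_deriv_def)
   ultimately show ?thesis by simp
  qed
 qed
 obtain B where B: "B \<subseteq> TT (d+2) t" "fvs.independent B" "TT (d+2) t \<subseteq> fvs.span B" "card B = fvs.dim (TT (d+2) t)"
  by (rule fvs.basis_exists)
 have finB: "finite B" by (rule indep_cspace_finite[OF finA _ B(2)]) (rule subset_trans[OF B(1) TT_cspace[OF le(2) t]])
 have "\<forall>b\<in>B. \<exists>s. s \<in> cspace KK & b = differential A G 0 (?I s)"
 proof
  fix b assume "b \<in> B"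
  then have "b \<in> differential KK (psi (d+2)) t ` cspace KK" using B(1) unfolding TT_def dimage_def by blast
  then obtain s where s: "b = differential KK (psi (d+2)) t s" "s \<in> cspace KK" by (rule imageE)
  show "\<exists>s. s \<in> cspace KK & b = differential A G 0 (?I s)"
   by (rule exI[of _ s], rule conjI[OF s(2)], rule trans[OF s(1) push[OF s(2)]])
 qed
 then obtain \<sigma> where \<sigma>: "\<And>b. b \<in> B ==> \<sigma> b \<in> cspace KK & b = differential A G 0 (?I (\<sigma> b))"
  unfolding bchoice_iff by blast
 let ?e = "%b. ?I (\<sigma> b)"
 have lin: "differential A G 0 (\<Sum>b\<in>F. smul (gm b) (?e b)) = (\<Sum>b\<in>F. smul (gm b) (differential A G 0 (?e b)))" if "finite F" for F gm
  using that
 proof (induction F)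
  case empty
  show ?case by (simp add: differential_def fun_eq_iff)
 next
  case (insert x F)
  show ?case unfolding sum.insert[OF insert(1,2)] differential_add differential_smul insert(3) by (rule refl)
 qed
 have indep: "inj_on ?e B" "fvs.independent (?e ` B)"
 proof -
  have "\<forall>b\<in>B. gm b = 0" if "(\<Sum>b\<in>B. smul (gm b) (?e b)) = 0" for gm
  proof -
   have "(\<Sum>b\<in>B. smul (gm b) (differential A G 0 (?e b))) = 0"
    using lin[OF finB, of gm] unfolding that by (simp add: differential_def fun_eq_iff)
   moreover have "(\<Sum>b\<in>B. smul (gm b) (differential A G 0 (?e b))) = (\<Sum>b\<in>B. smul (gm b) b)"
   proof (rule sum.cong[OF refl])
    fix b assume "b \<in> B"
    from \<sigma>[OF this] have "differential A G 0 (?e b) = b" by (elim conjE) (rule sym)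
    then show "smul (gm b) (differential A G 0 (?e b)) = smul (gm b) b" by (rule arg_cong)
   qed
   ultimately have "(\<Sum>b\<in>B. smul (gm b) b) = 0" by simp
   then show ?thesis using fvs.independentD[OF B(2) finB subset_refl] by blast
  qed
  note * = this
  show "inj_on ?e B" "fvs.independent (?e ` B)" using family_independent[OF finB, of ?e] * by blast+
 qed
 have CA: "CT 0 \<subseteq> cspace A" by (auto simp: CT_def)
 have "CT 0 \<subseteq> fvs.span (?e ` B)"
 proof (rule span_if_dim_le[OF finA CA _ indep(2)])
  show "?e ` B \<subseteq> CT 0" using IC \<sigma> by blast
  have "fvs.dim (CT 0) = card S" by (rule fvs.dim_unique[OF S(3,2,4) refl])
  then show "fvs.dim (CT 0) \<le> card (?e ` B)" using r B(4) card_image[OF indep(1)] by simp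
 qed
 then have "v \<in> fvs.span (?e ` B)" using v by blast
 also have "fvs.span (?e ` B) \<subseteq> ?I ` cspace KK"
 proof (rule fvs.span_minimal)
  show "?e ` B \<subseteq> ?I ` cspace KK" using \<sigma> by blast
  have fl: "first (a + b) = first a + first b" "first (smul c a) = smul c (first a)" for a b c
   by (auto simp: first_def fun_eq_iff smul_def)
  show "fvs.subspace (?I ` cspace KK)"
  proof (rule fvs.subspaceI)
   have f0: "first 0 = 0" by (auto simp: first_def fun_eq_iff)
   have I0: "?I 0 = 0" unfolding f0 by (simp add: differential_def fun_eq_iff)
   have "?I 0 \<in> ?I ` cspace KK" by (rule imageI[where f="?I", OF cspace_0])
   then show "0 \<in> ?I ` cspace KK" unfolding I0 .
  next
   fix x y assume "x \<in> ?I ` cspace KK" "y \<in> ?I ` cspace KK"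
   then obtain a b where ab: "a \<in> cspace KK" "b \<in> cspace KK" "x = ?I a" "y = ?I b" by blast
   have "?I (a + b) = x + y" unfolding ab(3,4) fl differential_add ..
   with imageI[where f="?I", OF cspace_plus[OF ab(1,2)]] show "x + y \<in> ?I ` cspace KK" by (simp only:)
  next
   fix c x assume "x \<in> ?I ` cspace KK"
   then obtain a where a: "a \<in> cspace KK" "x = ?I a" by blast
   have "?I (smul c a) = smul c x" unfolding a(2) fl differential_smul ..
   with imageI[where f="?I", OF fvs.subspace_scale[OF subspace_cspace a(1), of c]] show "smul c x \<in> ?I ` cspace KK" by (simp only:)
  qed
 qed
 finally show ?thesis by blast
qed

text \<open>
Every vector of \<open>\<complex>\<^sup>N\<close> is the \<open>Z\<close>-part of a vector tangent to the complexification, by genericity.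
\<close>

lemma closing_directions:
 "\<exists>\<tau> e. \<tau> \<in> Dl & (\<forall>lam. cmod lam \<le> 1 --> psi (2*d+3) (smul lam \<tau>) = 0) & (\<forall>j<N. e j \<in> cspace KK) &
   (\<forall>i<N. \<forall>j<N. differential KK (psi (2*d+3)) \<tau> (e j) (Inl i) = (if i = j then 1 else 0))"
proof -
 obtain t where t: "t \<in> Dl" "card S \<le> fvs.dim (TT (d+2) t)" using full_rank by blast
 have "\<exists>e. e \<in> cspace KK & (\<forall>i<N. differential KK (psi (2*d+3)) (closing t) e (Inl i) = (if i = j then 1 else 0))" if j: "j < N" for j
 proof -
  define v where "v = (%a. if a \<in> A then case_sum (%i. if i = j then 1 else 0) (%i. - (\<Sum>l<d. cnj (Bs i l) * Bm l j)) a else 0)"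
  have "v \<in> CT 0" unfolding CT_0_iff
  proof (intro conjI allI impI)
   show "v \<in> cspace A" by (simp add: v_def cspace_def)
   fix k assume k: "k < d"
   have "(\<Sum>i<N. cnj (Bm k i) * (\<Sum>l<d. cnj (Bs i l) * Bm l j)) = Bm k j" by (rule Bm_Bs(2)[OF k])
   moreover have "(\<Sum>i<N. Bm k i * (if i = j then 1 else 0)) = Bm k j"
    using j by (simp add: if_distrib[of "(*) _"] cong: if_cong)
   ultimately show "(\<Sum>i<N. Bm k i * v (Inl i)) + (\<Sum>i<N. cnj (Bm k i) * v (Inr i)) = 0"
    by (simp add: v_def sum_negf)
  qed
  then obtain s where s: "s \<in> cspace KK" "v = differential KK (psi (2*d+3)) (closing t) (first s)"
   using closing_rank[OF t] by blast
  have "first s \<in> cspace KK" using s(1) by (auto simp: first_def cspace_def)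
  moreover have "v (Inl i) = (if i = j then 1 else 0)" if "i < N" for i using that by (simp add: v_def)
  ultimately show ?thesis unfolding s(2) by blast
 qed
 then have "\<forall>j\<in>{..<N}. \<exists>e. e \<in> cspace KK & (\<forall>i<N. differential KK (psi (2*d+3)) (closing t) e (Inl i) = (if i = j then 1 else 0))" by simp
 then obtain e where "\<forall>j\<in>{..<N}. e j \<in> cspace KK & (\<forall>i<N. differential KK (psi (2*d+3)) (closing t) (e j) (Inl i) = (if i = j then 1 else 0))"
  unfolding bchoice_iff by blast
 then show ?thesis using closing_Dl[OF t(1)] closed_chain[OF t(1)]
  by (intro exI[of _ "closing t"] exI[of _ e]) auto
qed

end

section \<open>Holomorphic families of chains ending at a prescribed point\<close>

lemma minv_solve:
 assumes "fdet n f \<noteq> 0" and z: "\<And>i. i < n ==> (\<Sum>j<n. minv n f i j * X j) = 0" and l: "l < n"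
 shows "X l = 0"
proof -
 have "X l = (\<Sum>j<n. (if j = l then 1 else 0) * X j)" using l by (simp add: sum_ind)
 also have "\<dots> = (\<Sum>j<n. (\<Sum>i<n. f l i * minv n f i j) * X j)"
  by (rule sum.cong[OF refl]) (use minv_right(1)[OF assms(1) l] in auto)
 also have "\<dots> = (\<Sum>i<n. f l i * (\<Sum>j<n. minv n f i j * X j))"
  unfolding sum_distrib_left sum_distrib_right by (subst sum.swap) (simp only: mult.assoc)
 also have "\<dots> = 0" by (rule sum.neutral) (simp add: z)
 finally show ?thesis .
qed

lemma case_option_eta: "case_option (w None) (w o Some) = w"
 by (auto simp: fun_eq_iff split: option.splits)

lemma eventually_family:
 assumes "\<forall>\<^sub>F w in nhds (case_option lam 0). P w"
 shows "\<forall>\<^sub>F Z in nhds (0 :: nat cpoint). P (case_option lam Z)"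
proof -
 obtain V where V: "open V" "case_option lam 0 \<in> V" "\<forall>w\<in>V. P w" using assms unfolding eventually_nhds by blast
 have "continuous_on UNIV (%Z :: nat cpoint. case_option lam Z :: nat option cpoint)"
 proof (rule continuous_on_coordinatewise_then_product)
  fix i :: "nat option" show "continuous_on UNIV (%Z :: nat cpoint. case_option lam Z i)"
   by (cases i) (auto intro!: continuous_intros continuous_on_product_coordinates)
 qed
 then have "open ((%Z :: nat cpoint. case_option lam Z :: nat option cpoint) -` V)" by (rule open_vimage[OF V(1)])
 then have "\<forall>\<^sub>F Z in nhds 0. Z \<in> (%Z :: nat cpoint. case_option lam Z :: nat option cpoint) -` V"
  by (rule eventually_nhds_in_open) (use V(2) in simp)
 then show ?thesis by eventually_elim (use V(3) in simp)
qed

abbreviation fam :: "nat => nat option set" where "fam N \<equiv> insert None (Some ` {..<N})"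

context chains
begin

abbreviation chain_len :: nat where "chain_len \<equiv> 2*d+3"

definition Am :: "(nat \<times> nat) cpoint => (nat => (nat \<times> nat) cpoint) => complex => nat => nat => complex" where
 "Am \<tau> e \<mu> i j = differential KK (psi chain_len) (smul \<mu> \<tau>) (e j) (Inl i)"

lemma Am_holo:
 assumes \<tau>: "\<tau> \<in> cspace KK" and i: "i < N" and J: "open V" "\<And>w. w \<in> V ==> w \<in> cspace J ==> smul (c * w j0) \<tau> \<in> Bl"
 shows "holo J V (%w. Am \<tau> e (c * w j0) i j)"
proof -
 have "holo J V (%w. \<Sum>k\<in>KK. pd k (%z. psi chain_len z (Inl i)) (smul (c * w j0) \<tau>) * e j k)"
 proof (intro holo_sum holo_mult holo_const)
  fix k assume k: "k \<in> KK"
  have h: "holo KK Bl (%z. psi chain_len z (Inl i))" using psi_holom[of chain_len] i by (simp add: holom_def)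
  have G: "holom J KK V (%w. smul (c * w j0) \<tau>)" unfolding holom_def
  proof (intro conjI ballI)
   fix z show "smul (c * z j0) \<tau> \<in> cspace KK" by (rule fvs.subspace_scale[OF subspace_cspace \<tau>])
  qed (simp add: smul_def holo_mult)
  show "holo J V (%w. pd k (%z. psi chain_len z (Inl i)) (smul (c * w j0) \<tau>))"
   by (rule holo_compose[where F="pd k (%z. psi chain_len z (Inl i))" and G="%w. smul (c * w j0) \<tau>",
      OF finKK(1) J(1) open_Bl holo_partial[OF finKK(1) open_Bl h k] G]) (rule J(2))
 qed
 then show ?thesis by (simp add: Am_def differential_def)
qed

text \<open>
The parameters \<open>\<mu>\<close> for which the scaled chain stays in the polydisc form a starlike open set containing \<open>0\<close> and \<open>1\<close>; a
holomorphic function on it with value \<open>1\<close> at \<open>1\<close> has isolated zeros.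
\<close>

lemma determinant_nonzero:
 assumes \<tau>: "\<tau> \<in> Dl" and e1: "\<And>i j. i < N ==> j < N ==> Am \<tau> e 1 i j = (if i = j then 1 else 0)"
 shows "\<exists>ep0>0. ep0 \<le> 1 & (\<forall>\<mu>. 0 < cmod \<mu> & cmod \<mu> < ep0 --> fdet N (Am \<tau> e \<mu>) \<noteq> 0)"
proof -
 define L where "L = {\<mu>. smul \<mu> \<tau> \<in> Bl}"
 have \<tau>': "\<tau> \<in> Bl" "\<tau> \<in> cspace KK" using \<tau> by (auto simp: Dl_iff)
 have L: "open L"
 proof -
  have "continuous_on UNIV (%\<mu>. smul \<mu> \<tau>)"
   by (rule continuous_on_coordinatewise_then_product) (auto simp: smul_def intro!: continuous_intros)
  then have "open ((%\<mu>. smul \<mu> \<tau>) -` Bl)" by (rule open_vimage[OF open_Bl])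
  then show ?thesis by (simp add: L_def vimage_def)
 qed
 have L01: "0 \<in> L" "1 \<in> L" using \<tau>' dl by (auto simp: L_def smul_def zero_fun_def[symmetric])
 have "starlike L" unfolding starlike_def
 proof (intro bexI[OF _ L01(1)] ballI subsetI)
  fix x y assume x: "x \<in> L" and "y \<in> closed_segment 0 x"
  then obtain u where u: "0 \<le> u" "u \<le> 1" "y = u *\<^sub>R x" by (auto simp: in_segment)
  have "cmod (y * \<tau> k) < dl" if "k \<in> KK" for k
  proof -
   have "cmod (y * \<tau> k) = u * cmod (x * \<tau> k)" using u by (simp add: norm_mult)
   also have "\<dots> \<le> 1 * cmod (x * \<tau> k)" by (rule mult_right_mono[OF u(2)]) simp
   also have "\<dots> < dl" using x that unfolding L_def pbox_def smul_def by auto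
   finally show ?thesis .
  qed
  then show "y \<in> L" by (auto simp: L_def pbox_def smul_def)
 qed
 then have Lc: "connected L" by (rule starlike_imp_connected)
 have hol: "(%\<mu>. fdet N (Am \<tau> e \<mu>)) holomorphic_on L"
  unfolding holomorphic_on_def
 proof
  fix \<mu> assume \<mu>: "\<mu> \<in> L"
  let ?V = "{w :: unit cpoint. w () \<in> L}"
  have V: "open ?V"
  proof -
   have "open ((%w :: unit cpoint. w ()) -` L)" by (rule open_vimage[OF L]) (rule continuous_on_product_coordinates)
   then show ?thesis by (simp add: vimage_def)
  qed
  have "holo {()} ?V (%w. fdet N (Am \<tau> e (1 * w ())))"
   by (intro holo_fdet Am_holo[OF \<tau>'(2) _ V]) (auto simp: L_def)
  moreover have "(%_. \<mu>) \<in> ?V \<inter> cspace {()}" using \<mu> by (simp add: cspace_def)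
  ultimately have "(%t. fdet N (Am \<tau> e (1 * ((%_. \<mu>)(() := t)) ()))) field_differentiable at ((%_. \<mu>) ())"
   unfolding holo_def by blast
  then have "(%t. fdet N (Am \<tau> e t)) field_differentiable at \<mu>" by simp
  then show "(%t. fdet N (Am \<tau> e t)) field_differentiable at \<mu> within L" by (rule field_differentiable_at_within)
 qed
 have f1: "fdet N (Am \<tau> e 1) \<noteq> 0" using fdet_one[of N "Am \<tau> e 1"] e1 by simp
 have "\<forall>\<^sub>F w in at 0. fdet N (Am \<tau> e w) \<noteq> 0 & w \<in> L"
  by (rule non_zero_neighbour_alt[OF hol L Lc L01 f1])
 then obtain ep where ep: "ep > 0" "\<And>w. w \<noteq> 0 ==> dist w 0 < ep ==> fdet N (Am \<tau> e w) \<noteq> 0"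
  unfolding eventually_at by auto
 show ?thesis by (intro exI[of _ "min ep 1"]) (use ep in auto)
qed

lemma psi_keep: "psi (Suc l) c (dir l i) = psi l c (dir l i)" if "c \<in> cspace KK"
proof -
 have p: "pre l c 0 \<in> cspace A" unfolding pre_def by (intro cspace_plus chain_cspace) (use slice_Cn[OF that] in simp_all)
 have d: "dir (Suc (Suc l)) i = dir l i" by (simp add: dir_def)
 have "psi (Suc l) c (dir l i) = pre l c 0 (dir l i)"
  using kl_other[OF p, of "Suc l" i] unfolding d chain_Suc_pre .
 also have "\<dots> = psi l c (dir l i)" by (simp add: pre_def emb_def dir_def)
 finally show ?thesis .
qed

definition ctrl :: "real => (nat \<times> nat) cpoint => (nat => (nat \<times> nat) cpoint) => nat option cpoint => nat cpoint => (nat \<times> nat) cpoint" where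
 "ctrl ep0 \<tau> e x s = smul (of_real ep0 * x None) \<tau> + (\<Sum>j<N. smul (s j) (e j))"

text \<open>
A Newton step with the derivative at \<open>s = 0\<close> frozen turns the equation for the chain parameters \<open>s\<close> into a fixed point problem for \<open>T\<close>
whose derivative in \<open>s\<close> vanishes at \<open>s = 0\<close>.
The scaling by \<open>ep0\<close> makes every \<open>\<lambda>\<close> with \<open>0 < \<bar>\<lambda>\<bar> < 1\<close> admissible.
\<close>

lemma segre_family:
 "\<exists>p. (\<forall>l\<le>2*d+2. \<forall>lam. 0 < cmod lam & cmod lam < 1 --> hmgerm (fam N) A (%w. p l (w None) (w o Some)) (case_option lam 0)) &
  (\<forall>l\<le>2*d+2. \<forall>a\<in>A. ((%lam. p l lam 0 a) \<longlongrightarrow> 0) (at 0)) &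
  (\<forall>lam. 0 < cmod lam & cmod lam < 1 --> (\<forall>\<^sub>F Z in nhds 0. Z \<in> Cn N -->
   p 0 lam Z = 0 & (\<forall>l\<le>2*d+2. p l lam Z \<in> cspace A & (\<forall>k<d. rr k (p l lam Z) = 0)) &
   (\<forall>l<2*d+2. \<forall>i. p (Suc l) lam Z (dir l i) = p l lam Z (dir l i)) & (\<forall>i<N. p (2*d+2) lam Z (Inl i) = Z i)))"
proof -
 obtain \<tau> e where \<tau>: "\<tau> \<in> Dl" and closed: "\<And>\<mu>. cmod \<mu> \<le> 1 ==> psi chain_len (smul \<mu> \<tau>) = 0" and e: "\<And>j. j < N ==> e j \<in> cspace KK"
  and e1: "\<And>i j. i < N ==> j < N ==> differential KK (psi chain_len) \<tau> (e j) (Inl i) = (if i = j then 1 else 0)"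
  using closing_directions by blast
 have \<tau>C: "\<tau> \<in> cspace KK" using \<tau> by (simp add: Dl_iff)
 have Am1: "Am \<tau> e 1 i j = (if i = j then 1 else 0)" if "i < N" "j < N" for i j
  using e1[OF that] by (simp add: Am_def smul_def)
 have "\<exists>ep0>0. ep0 \<le> 1 & (\<forall>\<mu>. 0 < cmod \<mu> & cmod \<mu> < ep0 --> fdet N (Am \<tau> e \<mu>) \<noteq> 0)"
  by (rule determinant_nonzero[OF \<tau>]) (rule Am1)
 then obtain ep0 where E: "0 < ep0 & ep0 \<le> 1 & (\<forall>\<mu>. 0 < cmod \<mu> & cmod \<mu> < ep0 --> fdet N (Am \<tau> e \<mu>) \<noteq> 0)"
  by (elim exE)
 have ep0: "ep0 > 0" "ep0 \<le> 1" by (rule conjunct1[OF E], rule conjunct1[OF conjunct2[OF E]])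
 have nz: "fdet N (Am \<tau> e \<mu>) \<noteq> 0" if "0 < cmod \<mu>" "cmod \<mu> < ep0" for \<mu>
  by (rule mp[OF spec[OF conjunct2[OF conjunct2[OF E]]] conjI[OF that]])
 let ?m = "%x :: nat option cpoint. of_real ep0 * x None"
 let ?arg = "ctrl ep0 \<tau> e" and ?I = "fam N" and ?J = "{..<N}"
 define T where "T x s = (%i. if i < N then s i - (\<Sum>j<N. minv N (Am \<tau> e (?m x)) i j * (psi chain_len (?arg x s) (Inl j) - x (Some j))) else 0)"
  for x :: "nat option cpoint" and s :: "nat cpoint"
 have finI: "finite ?I" by simp
 have argC: "?arg x s \<in> cspace KK" for x s
  unfolding ctrl_def by (intro cspace_plus fvs.subspace_scale[OF subspace_cspace \<tau>C] fvs.subspace_sum[OF subspace_cspace] fvs.subspace_scale[OF subspace_cspace] e) simp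
 have arg0: "?arg x 0 = smul (?m x) \<tau>" for x by (simp add: ctrl_def smul_def zero_fun_def[symmetric])
 have small: "smul \<mu> \<tau> \<in> Bl" if "cmod \<mu> \<le> 1" for \<mu> using smul_Dl[OF \<tau> that] by (simp add: Dl_iff)
 have argh: "hgerm (?I <+> ?J) (%w. ?arg (w o Inl) (w o Inr) k) b" for k b
  unfolding ctrl_def by (simp add: smul_def sum_fun_apply) (intro hgerm_add hgerm_mult hgerm_sum hgerm_const hgerm_coord)
 have argm: "hmgerm (?I <+> ?J) KK (%w. ?arg (w o Inl) (w o Inr)) b" for b
  by (rule hmgermI[OF finKK(1)]) (use argC argh in simp_all)
 have psig: "hmgerm KK A (psi l) c" if "c \<in> Bl" "l \<le> chain_len" for l c
  unfolding hmgerm_def using psi_holom[OF that(2)] that(1) by (intro exI[of _ Bl]) simp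
 define s where "s = fixsol T"
 define p where "p l lam Z = psi l (?arg (case_option lam Z) (s (case_option lam Z)))" for l lam Z
 have main: "\<exists>U. open U & case_option lam 0 \<in> U & holom ?I ?J U s & s (case_option lam 0) = 0 & (\<forall>x\<in>U \<inter> cspace ?I. T x (s x) = s x)"
  if lam: "0 < cmod lam" "cmod lam < 1" for lam
 proof -
  let ?a = "case_option lam 0 :: nat option cpoint" let ?\<mu> = "of_real ep0 * lam"
  let ?z = "case_sum ?a 0 :: nat option + nat => complex"
  have aC: "?a \<in> cspace ?I" by (auto simp: cspace_def split: option.splits)
  have \<mu>: "0 < cmod ?\<mu>" "cmod ?\<mu> < ep0" using lam ep0 by (simp_all add: norm_mult)
  have \<mu>1: "cmod ?\<mu> \<le> 1" using \<mu> ep0 by simp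
  let ?V = "(%w :: nat option + nat => complex. of_real ep0 * w (Inl None)) -` (ball 0 ep0 - {0})"
  have V: "open ?V"
   by (rule open_vimage) (auto intro!: continuous_intros continuous_on_product_coordinates open_Diff)
  have zV: "?z \<in> ?V" using \<mu> by auto
  have hmi: "hgerm (?I <+> ?J) (%w. minv N (Am \<tau> e (?m (w o Inl))) i j) ?z" if "i < N" "j < N" for i j
  proof -
   have "holo (?I <+> ?J) ?V (%w. minv N (Am \<tau> e (of_real ep0 * w (Inl None))) i j)"
   proof (rule holo_minv[OF _ _ that])
    fix i j assume ij: "i < N" "j < N"
    show "holo (?I <+> ?J) ?V (%w. Am \<tau> e (of_real ep0 * w (Inl None)) i j)"
     by (rule Am_holo[OF \<tau>C ij(1) V], rule small) (use ep0 in auto)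
   qed (use nz in auto)
   then show ?thesis unfolding hgerm_def using V zV by (intro exI[of _ ?V]) simp
  qed
  have argz: "?arg (?z o Inl) (?z o Inr) = smul ?\<mu> \<tau>" using arg0 by simp
  have hpsi: "hgerm (?I <+> ?J) (%w. psi chain_len (?arg (w o Inl) (w o Inr)) (Inl j)) ?z" if "j < N" for j
  proof (rule hgerm_compose[where F="%c. psi chain_len c (Inl j)" and G="%w. ?arg (w o Inl) (w o Inr)", OF finKK(1) _ argm])
   have "hmgerm KK A (psi chain_len) (smul ?\<mu> \<tau>)" by (rule psig[OF small[OF \<mu>1]]) simp
   then show "hgerm KK (%c. psi chain_len c (Inl j)) (?arg (?z o Inl) (?z o Inr))"
    unfolding argz by (rule hmgermD) (use that in simp)
   show "?z \<in> cspace (?I <+> ?J)" using aC by simp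
  qed
  have hT: "hmgerm (?I <+> ?J) ?J (%w. T (w o Inl) (w o Inr)) ?z"
  proof (rule hmgermI)
   show "\<forall>\<^sub>F w in nhds ?z. w \<in> cspace (?I <+> ?J) --> T (w o Inl) (w o Inr) \<in> cspace ?J"
    by (intro always_eventually) (auto simp: T_def cspace_def)
   fix i assume i: "i \<in> ?J"
   have "hgerm (?I <+> ?J) (%w. w (Inr i) - (\<Sum>j<N. minv N (Am \<tau> e (?m (w o Inl))) i j * (psi chain_len (?arg (w o Inl) (w o Inr)) (Inl j) - w (Inl (Some j))))) ?z"
    by (intro hgerm_diff hgerm_coord hgerm_sum hgerm_mult hmi hpsi) (use i in auto)
   then show "hgerm (?I <+> ?J) (%w. T (w o Inl) (w o Inr) i) ?z" using i by (simp add: T_def)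
  qed simp
  have T0: "T ?a 0 = 0" using closed[OF \<mu>1] by (simp add: T_def fun_eq_iff arg0)
  have dT: "pd (Inr k) (%w. T (w o Inl) (w o Inr) i) ?z = 0" if ik: "i \<in> ?J" "k \<in> ?J" for i k
  proof (rule partial_deriv_eqI)
   have ik': "i < N" "k < N" using ik by auto
   let ?M = "minv N (Am \<tau> e ?\<mu>)"
   have up: "T (?z(Inr k := u) o Inl) (?z(Inr k := u) o Inr) i = (if k = i then u else 0) - (\<Sum>j<N. ?M i j * psi chain_len (smul ?\<mu> \<tau> + smul u (e k)) (Inl j))" for u
   proof -
    have "?z(Inr k := u) o Inl = ?a" "?z(Inr k := u) o Inr = 0(k := u)" by (auto simp: fun_eq_iff)
    moreover have "?arg ?a (0(k := u)) = smul ?\<mu> \<tau> + smul u (e k)"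
    proof -
     have "(\<Sum>j<N. smul ((0(k := u)) j) (e j)) = (\<Sum>j<N. if j = k then smul u (e k) else 0)"
      by (rule sum.cong) (auto simp: smul_def fun_eq_iff)
     then show ?thesis using ik'(2) by (simp add: ctrl_def)
    qed
    ultimately show ?thesis using ik'(1) by (simp add: T_def)
   qed
   have d1: "((%u. if k = i then u else 0) has_field_derivative (if k = i then 1 else 0)) (at (?z (Inr k)))"
    by (cases "k = i") auto
   have d2: "((%u. psi chain_len (smul ?\<mu> \<tau> + smul u (e k)) (Inl j)) has_field_derivative Am \<tau> e ?\<mu> j k) (at 0)" if j: "j < N" for j
   proof -
    have h: "holo KK Bl (%z. psi chain_len z (Inl j))" using psi_holom[of chain_len] j by (simp add: holom_def)
    show ?thesis unfolding Am_def differential_def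
     by (rule holo_line_DERIV[OF finKK(1) open_Bl h small[OF \<mu>1] fvs.subspace_scale[OF subspace_cspace \<tau>C] e[OF ik'(2)]])
   qed
   have "((%u. (if k = i then u else 0) - (\<Sum>j<N. ?M i j * psi chain_len (smul ?\<mu> \<tau> + smul u (e k)) (Inl j))) has_field_derivative
     (if k = i then 1 else 0) - (\<Sum>j<N. ?M i j * Am \<tau> e ?\<mu> j k)) (at (?z (Inr k)))"
    by (intro DERIV_diff[OF d1] DERIV_sum DERIV_cmult) (use d2 in simp)
   moreover have "(\<Sum>j<N. ?M i j * Am \<tau> e ?\<mu> j k) = (if i = k then 1 else 0)"
    by (rule minv_right(2)[OF nz[OF \<mu>] ik'])
   ultimately show "((%u. T (?z(Inr k := u) o Inl) (?z(Inr k := u) o Inr) i) has_field_derivative 0) (at (?z (Inr k)))"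
    unfolding up by (auto split: if_splits)
  qed
  have "\<exists>U ep. open U & ?a \<in> U & ep > 0 & holom ?I ?J U (fixsol T) & fixsol T ?a = 0 &
    (\<forall>x\<in>U \<inter> cspace ?I. T x (fixsol T x) = fixsol T x & (\<forall>y\<in>pdisc ?J 0 ep. T x y = y --> y = fixsol T x))"
   by (rule implicit_function[where T=T and a="?a", OF finI finite_lessThan aC hT T0]) (rule dT)
  then obtain U ep where U: "open U" "?a \<in> U" "ep > 0" "holom ?I ?J U (fixsol T)" "fixsol T ?a = 0"
   "\<forall>x\<in>U \<inter> cspace ?I. T x (fixsol T x) = fixsol T x & (\<forall>y\<in>pdisc ?J 0 ep. T x y = y --> y = fixsol T x)"
   by (elim exE conjE) (rule that)
  show ?thesis unfolding s_def
   by (rule exI[of _ U], rule conjI[OF U(1)], rule conjI[OF U(2)], rule conjI[OF U(4)], rule conjI[OF U(5)],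
     rule ballI, rule conjunct1, rule bspec[OF U(6)])
 qed
 have sgerm: "hmgerm ?I KK (%w. ?arg w (s w)) (case_option lam 0)" if lam: "0 < cmod lam" "cmod lam < 1" for lam
 proof (rule hmgermI[OF finKK(1)])
  obtain U where U: "open U" "case_option lam 0 \<in> U" "holom ?I ?J U s" using main[OF lam] by (elim exE conjE) (rule that)
  have sj: "hgerm ?I (%w. s w j) (case_option lam 0)" if "j < N" for j
   unfolding hgerm_def using U that by (intro exI[of _ U]) (simp add: holom_def)
  fix k show "hgerm ?I (%w. ?arg w (s w) k) (case_option lam 0)"
   unfolding ctrl_def by (simp add: smul_def sum_fun_apply) (intro hgerm_add hgerm_mult hgerm_sum hgerm_const hgerm_coord sj; simp)
 qed (use argC in simp)
 have s0: "s (case_option lam 0) = 0" if lam: "0 < cmod lam" "cmod lam < 1" for lam using main[OF lam] by (elim exE conjE)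
 have arglam: "?arg (case_option lam 0) (s (case_option lam 0)) = smul (of_real ep0 * lam) \<tau>" if lam: "0 < cmod lam" "cmod lam < 1" for lam
  unfolding s0[OF lam] arg0 by simp
 have lam1: "cmod (of_real ep0 * lam) \<le> 1" if "cmod lam < 1" for lam
  using mult_mono[of ep0 1 "cmod lam" 1] ep0 that by (simp add: norm_mult)
 have A1: "hmgerm ?I A (%w. p l (w None) (w o Some)) (case_option lam 0)" if l: "l \<le> 2*d+2" and lam: "0 < cmod lam" "cmod lam < 1" for l lam
  unfolding p_def case_option_eta
 proof (rule hmgerm_compose[where F="psi l" and G="%w. ?arg w (s w)", OF finKK(1) finA _ sgerm[OF lam]])
  show "hmgerm KK A (psi l) (?arg (case_option lam 0) (s (case_option lam 0)))"
   unfolding arglam[OF lam] by (rule psig[OF small[OF lam1[OF lam(2)]]]) (use l in simp)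
  show "case_option lam 0 \<in> cspace ?I" by (auto simp: cspace_def split: option.splits)
 qed
 have A2: "((%lam. p l lam 0 a) \<longlongrightarrow> 0) (at 0)" if l: "l \<le> 2*d+2" and a: "a \<in> A" for l a
 proof -
  have h: "holo KK Bl (%z. psi l z a)" using psi_holom[of l] l a by (simp add: holom_def)
  have "((%\<mu>. psi l (0 + smul \<mu> \<tau>) a) has_field_derivative (\<Sum>k\<in>KK. pd k (%z. psi l z a) 0 * \<tau> k)) (at 0)"
   by (rule holo_line_DERIV[OF finKK(1) open_Bl h _ cspace_0 \<tau>C]) (use dl in simp)
  from DERIV_isCont[OF this] have c: "isCont (%\<mu>. psi l (0 + smul \<mu> \<tau>) a) (of_real ep0 * 0)"
   by (simp only: mult_zero_right)
  have "isCont (%lam :: complex. of_real ep0 * lam) 0" by (intro continuous_intros)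
  from isCont_o2[where g="%\<mu>. psi l (0 + smul \<mu> \<tau>) a", OF this c]
  have "((%lam. psi l (0 + smul (of_real ep0 * lam) \<tau>) a) \<longlongrightarrow> psi l (0 + smul (of_real ep0 * 0) \<tau>) a) (at 0)"
   unfolding isCont_def .
  moreover have "0 + smul (of_real ep0 * 0) \<tau> = 0" by (simp add: smul_def fun_eq_iff)
  moreover have "psi l 0 a = 0" using fun_cong[OF conjunct2[OF chain_germ[of l]], of a] by (simp only: zero_fun_apply)
  ultimately have lim: "((%lam. psi l (smul (of_real ep0 * lam) \<tau>) a) \<longlongrightarrow> 0) (at 0)"
   by (simp only: add_0_left)
  have "\<forall>\<^sub>F lam :: complex in at 0. 0 < cmod lam & cmod lam < 1"
   unfolding eventually_at by (intro exI[of _ 1]) simp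
  then have "\<forall>\<^sub>F lam in at 0. psi l (smul (of_real ep0 * lam) \<tau>) a = p l lam 0 a"
  proof eventually_elim
   case (elim lam)
   show ?case unfolding p_def arglam[OF conjunct1[OF elim] conjunct2[OF elim]] by (rule refl)
  qed
  then show ?thesis by (rule Lim_transform_eventually[OF lim])
 qed
 have A3: "\<forall>\<^sub>F Z in nhds 0. Z \<in> Cn N -->
   p 0 lam Z = 0 & (\<forall>l\<le>2*d+2. p l lam Z \<in> cspace A & (\<forall>k<d. rr k (p l lam Z) = 0)) &
   (\<forall>l<2*d+2. \<forall>i. p (Suc l) lam Z (dir l i) = p l lam Z (dir l i)) & (\<forall>i<N. p (2*d+2) lam Z (Inl i) = Z i)"
  if lam: "0 < cmod lam" "cmod lam < 1" for lam
 proof -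
  let ?a = "case_option lam 0 :: nat option cpoint" let ?\<mu> = "of_real ep0 * lam"
  have aC: "?a \<in> cspace ?I" by (auto simp: cspace_def split: option.splits)
  obtain U where U: "open U" "?a \<in> U" "\<forall>x\<in>U \<inter> cspace ?I. T x (s x) = s x" using main[OF lam] by (elim exE conjE) (rule that)
  have m0: "?arg ?a (s ?a) \<in> Bl" unfolding arglam[OF lam] by (rule small[OF lam1[OF lam(2)]])
  obtain V where V: "open V" "?a \<in> V" "\<forall>z\<in>V \<inter> cspace ?I. ?arg z (s z) \<in> Bl"
   using hmgerm_neighbourhood[where G="%w. ?arg w (s w)" and a="?a", OF sgerm[OF lam] open_Bl m0 aC] by (elim exE conjE) (rule that)
  have "\<forall>\<^sub>F w in nhds ?a. w \<in> U \<inter> V" by (rule eventually_nhds_in_open) (use U V in auto)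
  then have "\<forall>\<^sub>F Z in nhds (0 :: nat cpoint). case_option lam Z \<in> U \<inter> V" by (rule eventually_family)
  then show ?thesis
  proof eventually_elim
   case (elim Z)
   show ?case
   proof
    assume Z: "Z \<in> Cn N"
    let ?x = "case_option lam Z :: nat option cpoint"
    have xC: "?x \<in> cspace ?I" using Z by (auto simp: cspace_def split: option.splits)
    let ?c = "?arg ?x (s ?x)"
    have c: "?c \<in> Dl" using V(3) elim xC argC by (simp add: Dl_iff)
    have fx: "T ?x (s ?x) = s ?x" using U(3) elim xC by blast
    have keep: "psi (Suc l) ?c (dir l i) = psi l ?c (dir l i)" for l i by (rule psi_keep[OF argC])
    have endp: "psi (2*d+2) ?c (Inl i) = Z i" if i: "i < N" for i
    proof -
     have nzm: "fdet N (Am \<tau> e ?\<mu>) \<noteq> 0" by (rule nz) (use lam ep0 in \<open>simp_all add: norm_mult\<close>)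
     have "psi chain_len ?c (Inl i) - Z i = 0"
     proof (rule minv_solve[OF nzm _ i, where X="%j. psi chain_len ?c (Inl j) - Z j"])
      fix m assume m: "m < N"
      show "(\<Sum>j<N. minv N (Am \<tau> e ?\<mu>) m j * (psi chain_len ?c (Inl j) - Z j)) = 0"
       using fun_cong[OF fx, of m] m by (simp add: T_def)
     qed
     moreover have "psi chain_len ?c (Inl i) = psi (2*d+2) ?c (Inl i)"
     proof -
      have e: "chain_len = Suc (2*d+2)" "dir (2*d+2) i = Inl i" by (simp_all add: dir_def)
      show ?thesis unfolding e(1) using keep[of "2*d+2" i] unfolding e(2) .
     qed
     ultimately show ?thesis by simp
    qed
    have rz: "rr k (psi l ?c) = 0" if "l \<le> 2*d+2" "k < d" for k l
     by (rule psi_rr[OF c that(2)]) (use that(1) in simp)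
    have k0: "p 0 lam Z = 0" unfolding p_def chain.simps(1) by (rule refl)
    have k1: "\<forall>l\<le>2*d+2. p l lam Z \<in> cspace A & (\<forall>k<d. rr k (p l lam Z) = 0)"
     unfolding p_def by (intro allI impI conjI chain_cspace[OF cspace_0] rz)
    have k2: "\<forall>l<2*d+2. \<forall>i. p (Suc l) lam Z (dir l i) = p l lam Z (dir l i)"
     unfolding p_def by (intro allI impI keep)
    have k3: "\<forall>i<N. p (2*d+2) lam Z (Inl i) = Z i" unfolding p_def by (intro allI impI endp)
    show "p 0 lam Z = 0 & (\<forall>l\<le>2*d+2. p l lam Z \<in> cspace A & (\<forall>k<d. rr k (p l lam Z) = 0)) &
     (\<forall>l<2*d+2. \<forall>i. p (Suc l) lam Z (dir l i) = p l lam Z (dir l i)) & (\<forall>i<N. p (2*d+2) lam Z (Inl i) = Z i)"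
     by (rule conjI[OF k0 conjI[OF k1 conjI[OF k2 k3]]])
   qed
  qed
 qed
 show ?thesis
  by (rule exI[of _ p], rule conjI, intro allI impI, elim conjE, rule A1, assumption+,
    rule conjI, intro allI impI ballI, rule A2, assumption+, intro allI impI, elim conjE, rule A3, assumption+)
qed

end

section \<open>Existence of the Segre flow and of the chains\<close>

lemma (in chart) flow_exists: "\<exists>r1. flow N d M rr r Bs r1"
proof -
 obtain r1 where r1: "r1 > 0" "r1 \<le> r" "holom A A (pbox A 0 r1) kq" "kq 0 = 0"
  and k: "\<forall>x\<in>pdisc A 0 r1. kq x \<in> DD & (\<forall>k<d. rr k (kq x) = 0) & ((\<forall>k<d. rr k x = 0) --> kq x = x) &
   (\<forall>s. s \<in> Cn d --> (\<forall>k<d. (\<Sum>a\<in>A. pd a (rr k) x * mapp A {..<d} Cq s a) = 0) --> s = 0)"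
  using kq_germ by (elim exE conjE) (rule that)
 have "flow N d M rr r Bs r1"
 proof (unfold_locales)
  fix x assume x: "x \<in> pdisc A 0 r1"
  note kx = bspec[OF k x]
  note kx2 = conjunct2[OF kx] and kx3 = conjunct2[OF conjunct2[OF kx]]
  show "kq x \<in> DD" by (rule conjunct1[OF kx])
  show "rr k (kq x) = 0" if "k < d" for k by (rule mp[OF spec[OF conjunct1[OF kx2]] that])
  show "kq x = x" if "\<And>k. k < d ==> rr k x = 0" by (rule mp[OF conjunct1[OF kx3]]) (intro allI impI that)
  show "s = 0" if "s \<in> Cn d" "\<And>k. k < d ==> (\<Sum>a\<in>A. pd a (rr k) x * mapp A {..<d} Cq s a) = 0" for s
   by (rule mp[OF mp[OF spec[OF conjunct2[OF kx3]] that(1)]]) (intro allI impI that(2))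
 qed (fact r1)+
 then show ?thesis ..
qed

lemma (in flow) chains_exist:
 assumes ft: "CT 0 \<subseteq> fvs.span ((%P. P 0) ` LL)"
 shows "\<exists>dl S Pv. chains N d M rr r Bs r1 dl S Pv"
proof -
 obtain S where S: "S \<subseteq> (%P. P 0) ` LL" "fvs.independent S" "(%P. P 0) ` LL \<subseteq> fvs.span S"
  by (rule fvs.maximal_independent_subset)
 have P0: "P 0 \<in> CT 0" if "P \<in> LL" for P
  using eventually_nhds_x_imp_x[OF LL_CT[OF that]] M0 by simp
 have SC: "S \<subseteq> CT 0" using S(1) P0 by blast
 have SA: "S \<subseteq> cspace A" using SC by (auto simp: CT_def)
 have finS: "finite S" by (rule indep_cspace_finite[OF finA SA S(2)])
 have CS: "CT 0 \<subseteq> fvs.span S"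
  using ft fvs.span_minimal[OF S(3) fvs.subspace_span] by (rule subset_trans)
 have "\<forall>v\<in>S. \<exists>P. P \<in> LL & P 0 = v" using S(1) by blast
 then obtain Pv where Pv: "\<And>v. v \<in> S ==> Pv v \<in> LL" "\<And>v. v \<in> S ==> Pv v 0 = v" unfolding bchoice_iff by blast
 from independent_perturb[OF finA S(2) SA] obtain \<kappa> where K: "\<kappa> > 0 & (\<exists>\<phi>. (\<forall>u\<in>S. \<forall>v\<in>S. (\<Sum>a\<in>A. \<phi> u a * v a) = (if u = v then 1 else (0::complex))) &
  (\<forall>e. (\<forall>v\<in>S. \<forall>a\<in>A. cmod (e v a - v a) < \<kappa>) -->
   inj_on e S & fvs.independent (e ` S) &
   (\<forall>gm. (\<Sum>u\<in>S. cmod (gm u)) \<le> 2 * (\<Sum>u\<in>S. cmod (\<Sum>v\<in>S. (\<Sum>a\<in>A. \<phi> u a * e v a) * gm v)))))"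
  by (elim exE)
 have \<kappa>: "\<kappa> > 0" by (rule conjunct1[OF K])
 have \<kappa>2: "inj_on e S & fvs.independent (e ` S)" if e: "\<forall>v\<in>S. \<forall>a\<in>A. cmod (e v a - v a) < \<kappa>" for e
 proof -
  from conjunct2[OF K] obtain \<phi> where "\<forall>e. (\<forall>v\<in>S. \<forall>a\<in>A. cmod (e v a - v a) < \<kappa>) -->
   inj_on e S & fvs.independent (e ` S) &
   (\<forall>gm. (\<Sum>u\<in>S. cmod (gm u)) \<le> 2 * (\<Sum>u\<in>S. cmod (\<Sum>v\<in>S. (\<Sum>a\<in>A. \<phi> u a * e v a) * gm v)))"
   by (elim exE conjE) (rule that)
  from mp[OF spec[OF this] e] show ?thesis by (elim conjE) (rule conjI)
 qed
 have "\<forall>v\<in>S. \<exists>V. open V & 0 \<in> V & (\<forall>z\<in>V \<inter> cspace A. Pv v z \<in> pbox A v \<kappa>)"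
 proof
  fix v assume v: "v \<in> S"
  have g: "hmgerm A A (Pv v) 0" unfolding hmgerm_def using LL_holo[OF Pv(1)[OF v]] by (intro exI[of _ \<Omega>1]) simp
  have 0: "Pv v 0 \<in> pbox A v \<kappa>" unfolding Pv(2)[OF v] using \<kappa> by simp
  obtain V where "open V & 0 \<in> V & holom A A V (Pv v) & (\<forall>z\<in>V \<inter> cspace A. Pv v z \<in> pbox A v \<kappa>)"
   using hmgerm_neighbourhood[where G="Pv v" and a=0, OF g open_pbox[OF finA] 0 cspace_0] ..
  then show "\<exists>V. open V & 0 \<in> V & (\<forall>z\<in>V \<inter> cspace A. Pv v z \<in> pbox A v \<kappa>)" by blast
 qed
 then obtain V where V: "\<And>v. v \<in> S ==> open (V v) & 0 \<in> V v & (\<forall>z\<in>V v \<inter> cspace A. Pv v z \<in> pbox A v \<kappa>)"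
  unfolding bchoice_iff by blast
 define W where "W = (\<Inter>v\<in>S. V v)"
 have W: "open W" "0 \<in> W" unfolding W_def using V finS by auto
 obtain dl where dl: "dl > 0" "\<forall>l. holom (KK <+> A) A (pbox (KK <+> A) 0 dl) (%w. chain l (w o Inl) (w o Inr)) \<or> l > 2*d+3"
  and c: "\<forall>l\<le>2*d+3. \<forall>c\<in>pdisc KK 0 dl. \<forall>x\<in>pdisc A 0 dl. chain l c x \<in> D1 \<inter> W & pre l c x \<in> D1"
  using chain_domain[OF W] by (elim exE conjE)
 have "chains N d M rr r Bs r1 dl S Pv"
 proof (unfold_locales)
  show "0 < dl" by (fact dl(1))
  show "holom (KK <+> A) A (pbox (KK <+> A) 0 dl) (%w. chain l (w o Inl) (w o Inr))" if "l \<le> 2*d+3" for l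
   using spec[OF dl(2), of l] that by simp
  show "chain l c x \<in> D1 & pre l c x \<in> D1" if "l \<le> 2*d+3" "c \<in> pdisc KK 0 dl" "x \<in> pdisc A 0 dl" for l c x
   using \<open>\<forall>l\<le>2*d+3. _\<close> that by blast
  show "inj_on (%v. Pv v (chain l c 0)) S & fvs.independent ((%v. Pv v (chain l c 0)) ` S)"
   if l: "l \<le> 2*d+3" and cc: "c \<in> pdisc KK 0 dl" for l c
  proof (rule \<kappa>2, intro ballI)
   fix v a assume v: "v \<in> S" and a: "a \<in> A"
   have z: "(0 :: (nat + nat) cpoint) \<in> pdisc A 0 dl" using dl(1) by (simp add: pdisc_iff)
   have "chain l c 0 \<in> W" using c l cc z by blast
   then have "chain l c 0 \<in> V v" "chain l c 0 \<in> cspace A" using v chain_cspace[OF cspace_0] by (auto simp: W_def)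
   then have "Pv v (chain l c 0) \<in> pbox A v \<kappa>" using V[OF v] by blast
   then show "cmod (Pv v (chain l c 0) a - v a) < \<kappa>" using a by (simp only: pbox_def mem_Collect_eq)
  qed
 qed (fact finS CS SC S(2) | rule Pv(1); assumption)+
 then show ?thesis by (intro exI)
qed

section \<open>Functions vanishing on the submanifold, complexified\<close>

context flow
begin

text \<open>
Functions vanishing on \<open>M\<close> that are constant along the directions transversal to the complexification. Composition with
\<open>kq\<close> yields such functions, and the class is closed under partial derivatives.
\<close>

definition flat :: "real => ((nat + nat) cpoint => complex) => bool" where
 "flat r' g \<longleftrightarrow> holo A (pbox A 0 r') g & (\<forall>x y. mapp A A Pm x = mapp A A Pm y --> g x = g y) &
   (\<forall>\<^sub>F Z in nhds 0. Z \<in> M --> g (cc Z) = 0)"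

text \<open>
Such a function satisfies \<open>g = g \<circ> kq\<close>, so on \<open>M\<close> its derivative in any direction is a derivative in a direction tangent to \<open>M\<close>.
\<close>

lemma flat_partial:
 assumes g: "flat r' g" and r': "r' > 0" and b: "b \<in> A"
 shows "flat r' (pd b g)"
proof -
 have h: "holo A (pbox A 0 r') g" and inv: "\<And>x y. mapp A A Pm x = mapp A A Pm y ==> g x = g y"
  and z: "\<forall>\<^sub>F Z in nhds 0. Z \<in> M --> g (cc Z) = 0" using g unfolding flat_def by blast+
 have o: "open (pbox A 0 r')" by (rule open_pbox) simp
 have h': "holo A (pbox A 0 r') (pd b g)" by (rule holo_partial[OF finA o h b])
 have inv': "pd b g x = pd b g y" if "mapp A A Pm x = mapp A A Pm y" for x y
 proof -
  have e: "w(b := w b + u) = w + (%c. if c = b then u else 0)" for u and w :: "(nat + nat) cpoint" by (auto simp: fun_eq_iff)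
  have "g (x(b := x b + u)) = g (y(b := y b + u))" for u
   by (rule inv) (simp only: e mapp_add that)
  then have "(%u. g (x(b := x b + u))) = (%u. g (y(b := y b + u)))" by (intro ext)
  then show ?thesis unfolding partial_deriv_shift by (simp only:)
 qed
 have "hgerm A g (cc 0)" unfolding hgerm_def using h o r' by (intro exI[of _ "pbox A 0 r'"]) simp
 then have sg: "smooth_germ N (%Z. g (cc Z)) 0" by (rule smooth_germ_cc)
 have "open (cc -` pbox A 0 r')" by (rule open_vimage_cc[OF o])
 then have near: "\<forall>\<^sub>F Z in nhds 0. Z \<in> cc -` pbox A 0 r'" by (rule eventually_nhds_in_open) (use r' in simp)
 have "\<forall>\<^sub>F Z in nhds 0. Z \<in> M --> pd b g (cc Z) = 0"
  using tangential[OF sg z] eventually_cc near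
 proof eventually_elim
  case (elim Z)
  show ?case
  proof
   assume Z: "Z \<in> M"
   have x1: "cc Z \<in> D1" using elim(2) Z by blast
   have x: "cc Z \<in> pbox A 0 r'" "Z \<in> Cn N" "cc Z \<in> \<Omega>1" "cc Z \<in> cspace A" using elim(3) Z MC x1 by (auto simp: D1_iff)
   have fx: "kq (cc Z) = cc Z" by (rule M_D1(1)[OF Z x1])
   let ?v = "%a. pd b (%x. kq x a) (cc Z)"
   have gk: "g (kq y) = g y" if "y \<in> cspace A" for y by (rule inv[OF Pm_kq[OF that]])
   have "pd b g (cc Z) = pd b (%y. g (kq y)) (cc Z)"
    by (rule partial_deriv_cong[OF open_Om1 x(3,4) b]) (simp add: gk)
   also have "\<dots> = (\<Sum>a\<in>A. pd a g (kq (cc Z)) * ?v a)"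
    by (rule partial_deriv_compose[OF finA open_Om1 o h kh x(3,4) _ b]) (simp only: fx x(1))
   also have "\<dots> = (\<Sum>a\<in>A. pd a g (cc Z) * differential A kq (cc Z) (unit_at b) a)"
    unfolding fx differential_unit[OF finA b] pcol_def ..
   also have "\<dots> = tangent_apply N (differential A kq (cc Z) (unit_at b)) (%Z. g (cc Z)) Z"
    by (rule tangent_apply_cc[OF o h x(1,2), symmetric])
   also have "\<dots> = 0" using elim(1) Z dkq_CT(1)[OF Z x1 unit_at_cspace[OF b]] by blast
   finally show "pd b g (cc Z) = 0" .
  qed
 qed
 then show ?thesis unfolding flat_def by (intro conjI allI impI h' inv')
qed

lemma flat_sum_mult:
 assumes "\<And>k. k \<in> B ==> flat r' (f k)" "finite B"
 shows "flat r' (%x. \<Sum>k\<in>B. f k x * c k)"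
proof -
 have f: "holo A (pbox A 0 r') (f k)" "\<And>x y. mapp A A Pm x = mapp A A Pm y ==> f k x = f k y"
  "\<forall>\<^sub>F Z in nhds 0. Z \<in> M --> f k (cc Z) = 0" if "k \<in> B" for k using assms(1)[OF that] unfolding flat_def by blast+
 have 1: "holo A (pbox A 0 r') (%x. \<Sum>k\<in>B. f k x * c k)" by (intro holo_sum holo_mult holo_const f(1))
 have 2: "(\<Sum>k\<in>B. f k x * c k) = (\<Sum>k\<in>B. f k y * c k)" if xy: "mapp A A Pm x = mapp A A Pm y" for x y
  by (rule sum.cong[OF refl]) (simp only: f(2)[OF _ xy])
 have "\<forall>\<^sub>F Z in nhds 0. \<forall>k\<in>B. Z \<in> M --> f k (cc Z) = 0"
  by (rule eventually_ball_finite[OF assms(2)]) (use f(3) in blast)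
 then have 3: "\<forall>\<^sub>F Z in nhds 0. Z \<in> M --> (\<Sum>k\<in>B. f k (cc Z) * c k) = 0"
  by eventually_elim (auto intro!: sum.neutral)
 show ?thesis unfolding flat_def by (intro conjI allI impI 1 2 3)
qed

text \<open>
All derivatives along the line through \<open>x\<close> belong to the same class, so they vanish at \<open>0\<close>, and the identity theorem applies
on the line.
\<close>

lemma flat_zero:
 assumes g: "flat r' g" and r': "r' > 0" and x: "x \<in> pdisc A 0 (r'/2)"
 shows "g x = 0"
proof -
 define Dx where "Dx f = (%y. \<Sum>k\<in>A. pd k f y * x k)" for f :: "(nat + nat) cpoint => complex"
 define G where "G n = (Dx ^^ n) g" for n
 have G: "flat r' (G n)" for n
 proof (induction n)
  case (Suc n)
  have "G (Suc n) = (%y. \<Sum>k\<in>A. pd k (G n) y * x k)" by (simp add: G_def Dx_def)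
  then show ?case using flat_sum_mult[of A r' "%k. pd k (G n)" x] flat_partial[OF Suc r'] finA by simp
 qed (simp add: G_def g)
 define \<phi> where "\<phi> n s = G n (smul s x)" for n s
 have o: "open (pbox A 0 r')" by (rule open_pbox) simp
 have xC: "x \<in> cspace A" using x by (simp add: pdisc_iff)
 have in_box: "smul s x \<in> pbox A 0 r'" if s: "s \<in> ball 0 2" for s
 proof -
  have "cmod (s * x a) < r'" if a: "a \<in> A" for a
  proof -
   have "cmod (x a) < r'/2" using x a by (simp add: pdisc_iff)
   moreover have "cmod s < 2" using s by simp
   ultimately have "cmod s * cmod (x a) < 2 * (r'/2)" using r' by (intro mult_strict_mono) auto
   then show ?thesis by (simp add: norm_mult)
  qed
  then show ?thesis by (auto simp: pbox_def smul_def)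
 qed
 have sC: "smul s x \<in> cspace A" for s by (rule fvs.subspace_scale[OF subspace_cspace xC])
 have D: "(\<phi> n has_field_derivative \<phi> (Suc n) s) (at s)" if s: "s \<in> ball 0 2" for n s
 proof -
  have h: "holo A (pbox A 0 r') (G n)" using G unfolding flat_def by blast
  have "((%u. G n (smul s x + smul u x)) has_field_derivative (\<Sum>k\<in>A. pd k (G n) (smul s x) * x k)) (at 0)"
   by (rule holo_line_DERIV[OF finA o h in_box[OF s] sC xC])
  moreover have "smul s x + smul u x = smul (u + s) x" for u by (simp add: smul_def fun_eq_iff algebra_simps)
  ultimately have "((%u. \<phi> n (u + s)) has_field_derivative \<phi> (Suc n) s) (at 0)"
   by (simp add: \<phi>_def G_def Dx_def)
  then show ?thesis using DERIV_shift[of "\<phi> n" "\<phi> (Suc n) s" 0 s] by simp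
 qed
 have dn: "s \<in> ball 0 2 ==> (deriv ^^ n) (\<phi> 0) s = \<phi> n s" for n s
 proof (induction n arbitrary: s)
  case (Suc n)
  have "\<forall>\<^sub>F u in nhds s. u \<in> ball 0 2" by (rule eventually_nhds_in_open) (use Suc.prems in auto)
  then have "\<forall>\<^sub>F u in nhds s. (deriv ^^ n) (\<phi> 0) u = \<phi> n u" by eventually_elim (rule Suc.IH)
  then have "deriv ((deriv ^^ n) (\<phi> 0)) s = deriv (\<phi> n) s" by (rule deriv_cong_ev) simp
  then show ?case using DERIV_imp_deriv[OF D[OF Suc.prems]] by simp
 qed simp
 have hol: "\<phi> 0 holomorphic_on ball 0 2" unfolding holomorphic_on_def field_differentiable_def
 proof
  fix s :: complex assume "s \<in> ball 0 2"
  then have "(\<phi> 0 has_field_derivative \<phi> (Suc 0) s) (at s within ball 0 2)" by (rule has_field_derivative_at_within[OF D])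
  then show "\<exists>f'. (\<phi> 0 has_field_derivative f') (at s within ball 0 2)" ..
 qed
 have zero: "(deriv ^^ n) (\<phi> 0) 0 = 0" for n
 proof -
  have "\<forall>\<^sub>F Z in nhds 0. Z \<in> M --> G n (cc Z) = 0" using G unfolding flat_def by blast
  from eventually_nhds_x_imp_x[OF this] M0 have "G n 0 = 0" by simp
  moreover have "smul 0 x = 0" by (simp add: smul_def fun_eq_iff)
  ultimately show ?thesis using dn[of 0 n] by (simp add: \<phi>_def)
 qed
 have "\<phi> 0 1 = 0" by (rule holomorphic_fun_eq_0_on_ball[OF hol _ zero]) simp
 moreover have "smul 1 x = x" by (simp add: smul_def)
 ultimately show ?thesis by (simp add: \<phi>_def G_def)
qed

lemma vanishing_complexified:
 assumes f: "hgerm A f 0" and fM: "\<forall>\<^sub>F Z in nhds 0. Z \<in> M --> f (cc Z) = 0"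
 shows "\<exists>V. open V & 0 \<in> V & (\<forall>x\<in>V \<inter> cspace A. (\<forall>k<d. rr k x = 0) --> f x = 0)"
proof -
 have "hmgerm A A kq 0" unfolding hmgerm_def using kh by (intro exI[of _ \<Omega>1]) simp
 then have "hgerm A (%x. f (kq x)) 0"
  by (rule hgerm_compose[where F=f and G=kq, OF finA _ _ cspace_0, rotated]) (simp only: k0 f)
 then obtain V where V: "open V" "0 \<in> V" "holo A V (%x. f (kq x))" unfolding hgerm_def by blast
 obtain r' where r': "r' > 0" "pdisc A 0 r' \<subseteq> V" using open_pdisc_subset[OF finA V(1,2) cspace_0] by blast
 have 1: "holo A (pbox A 0 r') (%x. f (kq x))"
  by (rule holo_subset'[OF V(3)]) (use r'(2) in \<open>simp add: pdisc_def\<close>)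
 have 2: "f (kq x) = f (kq y)" if "mapp A A Pm x = mapp A A Pm y" for x y using kq_cong[OF that] by simp
 have 3: "\<forall>\<^sub>F Z in nhds 0. Z \<in> M --> f (kq (cc Z)) = 0"
  using fM eventually_cc by eventually_elim (use M_D1(1) in auto)
 have fl: "flat r' (%x. f (kq x))" unfolding flat_def by (intro conjI allI impI 1 2 3)
 have "f x = 0" if x: "x \<in> pbox A 0 (r'/2) \<inter> \<Omega>1" "x \<in> cspace A" "\<forall>k<d. rr k x = 0" for x
 proof -
  have "kq x = x" by (rule kfix) (use x in \<open>simp_all add: D1_iff\<close>)
  then show ?thesis using flat_zero[OF fl r'(1), of x] x by (simp add: pdisc_def)
 qed
 then show ?thesis using r'(1) by (intro exI[of _ "pbox A 0 (r'/2) \<inter> \<Omega>1"]) (auto intro!: open_Int open_pbox)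
qed

end

section \<open>Generic submanifolds and finite type\<close>

lemma continuous_comp_fun: "continuous_on UNIV (%x :: 'a => complex. x o f)"
 by (rule continuous_on_coordinatewise_then_product) (simp add: continuous_on_product_coordinates)

lemma eventually_comp_nhds:
 assumes "continuous_on UNIV F" "F a = b" "eventually P (nhds b)"
 shows "\<forall>\<^sub>F x in nhds a. P (F x)"
proof -
 obtain S where S: "open S" "b \<in> S" "\<forall>y\<in>S. P y" using assms(3) unfolding eventually_nhds by blast
 have "\<forall>\<^sub>F x in nhds a. x \<in> F -` S" by (rule eventually_nhds_in_open[OF open_vimage[OF S(1) assms(1)]]) (use S assms(2) in simp)
 then show ?thesis by eventually_elim (use S in simp)
qed

lemma generic_chart:
 assumes gen: "generic_submanifold N d M \<rho>"
 shows "\<exists>r Bs. chart N d M (%k x. \<rho> (x o Inl) (x o Inr) k) r Bs & (\<forall>x\<in>pdisc (dbl N) 0 r. \<rho> (x o Inl) (x o Inr) \<in> Cn d)"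
proof -
 let ?A = "dbl N" and ?R = "%x :: (nat + nat) cpoint. \<rho> (x o Inl) (x o Inr)"
 have finA: "finite ?A" by simp
 have MC: "M \<subseteq> Cn N" and M0: "0 \<in> M" and hg: "holomorphic_germ ?A {..<d} ?R 0"
  and ev: "\<forall>\<^sub>F (Z, \<zeta>) in nhds (0, 0). Z \<in> Cn N & \<zeta> \<in> Cn N --> \<rho> Z \<zeta> = cconj (\<rho> (cconj \<zeta>) (cconj Z)) &
    (\<exists>v. (\<forall>l<d. v l \<in> Cn N) & wedge d (%k u. differential {..<N} (%Y. \<rho> Y \<zeta>) Z u k) v \<noteq> 0)"
  and evM: "\<forall>\<^sub>F Z in nhds 0. Z \<in> Cn N --> (Z \<in> M \<longleftrightarrow> \<rho> Z (cconj Z) = 0)"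
  using gen unfolding generic_submanifold_def by blast+
 have "hmgerm ?A {..<d} ?R 0" using hg holomorphic_germ_iff[OF finA finite_lessThan] by blast
 then obtain V where V: "open V" "0 \<in> V" "holom ?A {..<d} V ?R" unfolding hmgerm_def by blast
 have c2: "continuous_on UNIV (%x :: (nat + nat) cpoint. (x o Inl, x o Inr))"
  by (intro continuous_on_Pair continuous_comp_fun)
 have z: "(0 :: (nat + nat) cpoint) o Inl = 0" "(0 :: (nat + nat) cpoint) o Inr = 0" by (simp_all add: zero_comp)
 have e1: "\<forall>\<^sub>F x in nhds (0 :: (nat + nat) cpoint). x o Inl \<in> Cn N & x o Inr \<in> Cn N --> ?R x = cconj (\<rho> (cconj (x o Inr)) (cconj (x o Inl)))"
  using eventually_comp_nhds[OF c2 _ ev, of 0] unfolding z by (simp add: eventually_mono)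
 have e2: "\<forall>\<^sub>F x in nhds (0 :: (nat + nat) cpoint). x o Inl \<in> Cn N --> (x o Inl \<in> M \<longleftrightarrow> \<rho> (x o Inl) (cconj (x o Inl)) = 0)"
  using eventually_comp_nhds[where F="%x. x o Inl" and a=0, OF continuous_comp_fun z(1) evM] .
 have e3: "\<forall>\<^sub>F x in nhds 0. x \<in> V" by (rule eventually_nhds_in_open[OF V(1,2)])
 have "\<forall>\<^sub>F x in nhds (0 :: (nat + nat) cpoint). x \<in> cspace ?A --> x \<in> V &
   ?R x = cconj (\<rho> (cconj (x o Inr)) (cconj (x o Inl))) & (x o Inl \<in> M \<longleftrightarrow> \<rho> (x o Inl) (cconj (x o Inl)) = 0)"
  using e1 e2 e3
 proof eventually_elim
  case (elim x)
  show ?case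
  proof
   assume "x \<in> cspace ?A"
   note c = cspace_comp_sum[OF this]
   show "x \<in> V & ?R x = cconj (\<rho> (cconj (x o Inr)) (cconj (x o Inl))) & (x o Inl \<in> M \<longleftrightarrow> \<rho> (x o Inl) (cconj (x o Inl)) = 0)"
    by (rule conjI[OF elim(3) conjI[OF mp[OF elim(1) conjI[OF c]] mp[OF elim(2) c(1)]]])
  qed
 qed
 then obtain r where r: "r > 0" "\<And>x. x \<in> pdisc ?A 0 r ==> x \<in> V &
   ?R x = cconj (\<rho> (cconj (x o Inr)) (cconj (x o Inl))) & (x o Inl \<in> M \<longleftrightarrow> \<rho> (x o Inl) (cconj (x o Inl)) = 0)"
  unfolding eventually_nhds_pdisc[OF finA cspace_0] by blast
 have RC: "?R x \<in> Cn d" if "x \<in> pdisc ?A 0 r" for x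
 proof -
  have xC: "x \<in> cspace ?A" using that by (simp only: pdisc_iff)
  show ?thesis by (rule bspec[OF conjunct1[OF V(3)[unfolded holom_def]] IntI[OF conjunct1[OF r(2)[OF that]] xC]])
 qed
 note ev0 = eventually_nhds_x_imp_x[OF ev, unfolded prod.case]
 have "\<exists>v. (\<forall>l<d. v l \<in> Cn N) & wedge d (%k u. differential {..<N} (%Y. \<rho> Y 0) 0 u k) v \<noteq> 0"
  by (rule conjunct2[OF mp[OF ev0 conjI[OF cspace_0 cspace_0]]])
 then obtain v where v: "\<forall>l<d. v l \<in> Cn N" "wedge d (%k u. differential {..<N} (%Y. \<rho> Y 0) 0 u k) v \<noteq> 0"
  by (elim exE conjE) (rule that)
 define f where "f k l = differential {..<N} (%Y. \<rho> Y 0) 0 (v l) k" for k l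
 have fd: "fdet d f \<noteq> 0" using v(2) by (simp add: wedge_def fdet_leibniz f_def)
 define Bs where "Bs i l = (\<Sum>j<d. v j i * minv d f j l)" for i l
 have pd: "pd (Inl i) (%x. ?R x k) 0 = pd i (%Y. \<rho> Y 0 k) 0" for i k
 proof -
  have "((0 :: (nat + nat) cpoint)(Inl i := t)) o Inl = 0(i := t)" "((0 :: (nat + nat) cpoint)(Inl i := t)) o Inr = 0" for t
   by (auto simp: fun_eq_iff)
  then show ?thesis by (simp add: partial_deriv_def)
 qed
 have "chart N d M (%k x. ?R x k) r Bs"
 proof
  show "0 < r" by (rule r(1))
  show "holo ?A (pbox ?A 0 r) (%x. ?R x k)" if "k < d" for k
  proof (rule holo_subset')
   show "holo ?A V (%x. ?R x k)" using V(3) that by (simp add: holom_def)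
   show "pbox ?A 0 r \<inter> cspace ?A \<subseteq> V" using r(2) by (auto simp: pdisc_def)
  qed
  show "?R (sc x) k = cnj (?R x k)" if x: "x \<in> pdisc ?A 0 r" and "k < d" for k x
  proof -
   have s: "sc x o Inl = cconj (x o Inr)" "sc x o Inr = cconj (x o Inl)" by (simp_all add: sc_def)
   have "?R x = cconj (\<rho> (cconj (x o Inr)) (cconj (x o Inl)))" using r(2)[OF x] by blast
   from fun_cong[OF this, of k] show ?thesis unfolding s by simp
  qed
  show "Z \<in> M \<longleftrightarrow> (\<forall>k<d. ?R (cc Z) k = 0)" if Z: "Z \<in> Cn N" "cc Z \<in> pdisc ?A 0 r" for Z
  proof -
   have "Z \<in> M \<longleftrightarrow> \<rho> Z (cconj Z) = 0" using r(2)[OF Z(2)] by simp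
   moreover have "\<rho> Z (cconj Z) \<in> Cn d" using RC[OF Z(2)] by simp
   then have "\<rho> Z (cconj Z) = 0 \<longleftrightarrow> (\<forall>k<d. \<rho> Z (cconj Z) k = 0)"
    by (auto simp: cspace_def fun_eq_iff)
   ultimately show ?thesis by simp
  qed
  show "M \<subseteq> Cn N" "0 \<in> M" by (fact MC M0)+
  show "(\<Sum>i<N. pd (Inl i) (%x. ?R x k) 0 * Bs i l) = (if k = l then 1 else 0)" if kl: "k < d" "l < d" for k l
  proof -
   have "(\<Sum>i<N. pd (Inl i) (%x. ?R x k) 0 * Bs i l) = (\<Sum>j<d. f k j * minv d f j l)"
    unfolding pd Bs_def f_def differential_def sum_distrib_left sum_distrib_right
    by (subst sum.swap) (simp only: mult.assoc)
   then show ?thesis using minv_right(1)[OF fd kl] by simp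
  qed
 qed
 then show ?thesis using RC by blast
qed

text \<open>
The points \<open>p 0, \<dots>, p (2d + 2)\<close> form a chain from \<open>0\<close> to a point over \<open>Z\<close>, consecutive points sharing
alternately the part \<open>Z\<close> and the part \<open>\<zeta>\<close>.
\<close>

definition segre_chain_family ::
 "nat => nat => (nat cpoint => nat cpoint => nat cpoint) => (nat => complex => nat cpoint => (nat + nat) cpoint) => bool" where
 "segre_chain_family N d \<rho> p \<longleftrightarrow>
  (\<forall>l\<le>2*d+2. \<forall>lam. 0 < cmod lam & cmod lam < 1 --> hmgerm (fam N) (dbl N) (%w. p l (w None) (w o Some)) (case_option lam 0)) &
  (\<forall>l\<le>2*d+2. \<forall>a\<in>dbl N. ((%lam. p l lam 0 a) \<longlongrightarrow> 0) (at 0)) &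
  (\<forall>lam. 0 < cmod lam & cmod lam < 1 --> (\<forall>\<^sub>F Z in nhds 0. Z \<in> Cn N -->
   p 0 lam Z = 0 & (\<forall>l\<le>2*d+2. p l lam Z \<in> cspace (dbl N) & (\<forall>k<d. \<rho> (p l lam Z o Inl) (p l lam Z o Inr) k = 0)) &
   (\<forall>j\<le>d. p (2*j+1) lam Z o Inl = p (2*j) lam Z o Inl & p (2*j+2) lam Z o Inr = p (2*j+1) lam Z o Inr) &
   p (2*d+2) lam Z o Inl = Z))"

lemma segre_chains:
 assumes gen: "generic_submanifold N d M \<rho>" and ft: "finite_type N d M \<rho> 0"
 shows "\<exists>p. segre_chain_family N d \<rho> p"
proof -
 let ?rr = "%k (x :: (nat + nat) cpoint). \<rho> (x o Inl) (x o Inr) k"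
 obtain r Bs where ch: "chart N d M ?rr r Bs" using generic_chart[OF gen] by (elim exE conjE) (rule that)
 obtain r1 where fl: "flow N d M ?rr r Bs r1" using chart.flow_exists[OF ch] ..
 interpret flow N d M ?rr r Bs r1 by (rule fl)
 have "CT 0 \<subseteq> fvs.span ((%P. P 0) ` LL)"
  by (rule finite_type_span[where \<rho>=\<rho>, OF _ ft]) simp
 from chains_exist[OF this] obtain dl S Pv where cs: "chains N d M ?rr r Bs r1 dl S Pv" by (elim exE)
 interpret chains N d M ?rr r Bs r1 dl S Pv by (rule cs)
 from segre_family obtain p where P: "(\<forall>l\<le>2*d+2. \<forall>lam. 0 < cmod lam & cmod lam < 1 --> hmgerm (fam N) A (%w. p l (w None) (w o Some)) (case_option lam 0)) &
  (\<forall>l\<le>2*d+2. \<forall>a\<in>A. ((%lam. p l lam 0 a) \<longlongrightarrow> 0) (at 0)) &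
  (\<forall>lam. 0 < cmod lam & cmod lam < 1 --> (\<forall>\<^sub>F Z in nhds 0. Z \<in> Cn N -->
   p 0 lam Z = 0 & (\<forall>l\<le>2*d+2. p l lam Z \<in> cspace A & (\<forall>k<d. ?rr k (p l lam Z) = 0)) &
   (\<forall>l<2*d+2. \<forall>i. p (Suc l) lam Z (dir l i) = p l lam Z (dir l i)) & (\<forall>i<N. p (2*d+2) lam Z (Inl i) = Z i)))"
  by (elim exE)
 have p4: "\<forall>\<^sub>F Z in nhds 0. Z \<in> Cn N -->
   p 0 lam Z = 0 & (\<forall>l\<le>2*d+2. p l lam Z \<in> cspace A & (\<forall>k<d. ?rr k (p l lam Z) = 0)) &
   (\<forall>j\<le>d. p (2*j+1) lam Z o Inl = p (2*j) lam Z o Inl & p (2*j+2) lam Z o Inr = p (2*j+1) lam Z o Inr) &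
   p (2*d+2) lam Z o Inl = Z"
  if lam: "0 < cmod lam & cmod lam < 1" for lam
  using mp[OF spec[OF conjunct2[OF conjunct2[OF P]]] lam]
 proof eventually_elim
  case (elim Z)
  show ?case
  proof
   assume Z: "Z \<in> Cn N"
   note e = mp[OF elim Z]
   have pA: "p (2*d+2) lam Z \<in> cspace A" using e[THEN conjunct2, THEN conjunct1] by simp
   have keep: "p (Suc l) lam Z (dir l i) = p l lam Z (dir l i)" if "l < 2*d+2" for l i
    using e[THEN conjunct2, THEN conjunct2, THEN conjunct1] that by blast
   have last: "p (2*d+2) lam Z (Inl i) = Z i" if "i < N" for i
    using e[THEN conjunct2, THEN conjunct2, THEN conjunct2] that by blast
   have k1: "p (2*j+1) lam Z o Inl = p (2*j) lam Z o Inl" if "j \<le> d" for j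
   proof
    fix i show "(p (2*j+1) lam Z o Inl) i = (p (2*j) lam Z o Inl) i"
     using keep[of "2*j" i] that by (simp add: dir_def)
   qed
   have k2: "p (2*j+2) lam Z o Inr = p (2*j+1) lam Z o Inr" if "j \<le> d" for j
   proof
    fix i show "(p (2*j+2) lam Z o Inr) i = (p (2*j+1) lam Z o Inr) i"
     using keep[of "2*j+1" i] that by (simp add: dir_def)
   qed
   have k3: "p (2*d+2) lam Z o Inl = Z"
   proof
    fix i show "(p (2*d+2) lam Z o Inl) i = Z i"
     using pA Z last[of i] by (cases "i < N") (simp_all add: cspace_def)
   qed
   have k12: "\<forall>j\<le>d. p (2*j+1) lam Z o Inl = p (2*j) lam Z o Inl & p (2*j+2) lam Z o Inr = p (2*j+1) lam Z o Inr"
    by (intro allI impI conjI k1 k2)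
   show "p 0 lam Z = 0 & (\<forall>l\<le>2*d+2. p l lam Z \<in> cspace A & (\<forall>k<d. ?rr k (p l lam Z) = 0)) &
   (\<forall>j\<le>d. p (2*j+1) lam Z o Inl = p (2*j) lam Z o Inl & p (2*j+2) lam Z o Inr = p (2*j+1) lam Z o Inr) &
   p (2*d+2) lam Z o Inl = Z"
    by (rule conjI[OF conjunct1[OF e] conjI[OF e[THEN conjunct2, THEN conjunct1] conjI[OF k12 k3]]])
  qed
 qed
 show ?thesis unfolding segre_chain_family_def
  by (rule exI[of _ p], rule conjI[OF conjunct1[OF P]], rule conjI[OF conjunct1[OF conjunct2[OF P]]],
    rule allI, rule impI, rule p4)
qed

lemma vanishing_on_complexification:
 assumes gen: "generic_submanifold N d M \<rho>"
  and f: "hgerm (dbl N) f 0" "\<forall>\<^sub>F Z in nhds 0. Z \<in> M --> f (cc Z) = 0"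
 shows "\<exists>V. open V & 0 \<in> V & (\<forall>x\<in>V \<inter> cspace (dbl N). (\<forall>k<d. \<rho> (x o Inl) (x o Inr) k = 0) --> f x = 0)"
proof -
 obtain r Bs where ch: "chart N d M (%k x. \<rho> (x o Inl) (x o Inr) k) r Bs" using generic_chart[OF gen] by (elim exE conjE) (rule that)
 obtain r1 where "flow N d M (%k x. \<rho> (x o Inl) (x o Inr) k) r Bs r1" using chart.flow_exists[OF ch] ..
 from flow.vanishing_complexified[OF this f] show ?thesis .
qed

section \<open>Recovering a point of the target from its projection\<close>

lemma hgerm_DERIV:
 assumes "hgerm I f a" "i \<in> I" "a \<in> cspace I"
 shows "((%t. f (a(i:=t))) has_field_derivative pd i f a) (at (a i))"
proof -
 obtain V where V: "a \<in> V" "holo I V f" using assms(1) unfolding hgerm_def by blast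
 show ?thesis by (rule holo_partial_DERIV[OF V(2) assms(2) V(1) assms(3)])
qed

lemma hmgerm_case_sum:
 assumes "hmgerm I J G a" "hmgerm I K F a"
 shows "hmgerm I (J <+> K) (%w. case_sum (G w) (F w)) a"
proof -
 obtain V W where V: "open V" "a \<in> V" "holom I J V G" and W: "open W" "a \<in> W" "holom I K W F"
  using assms unfolding hmgerm_def by blast
 have "holom I J (V \<inter> W) G" "holom I K (V \<inter> W) F" using holom_subset[OF V(3)] holom_subset[OF W(3)] by simp_all
 then have "holom I (J <+> K) (V \<inter> W) (%w. case_sum (G w) (F w))" unfolding holom_def ball_Plus by simp
 then show ?thesis unfolding hmgerm_def using V W by (intro exI[of _ "V \<inter> W"]) (simp add: open_Int)
qed

lemma hmgerm_cnj:
 assumes "hmgerm I J G 0" shows "hmgerm I J (%z. cconj (G (cconj z))) 0"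
proof -
 obtain V where V: "open V" "0 \<in> V" "holom I J V G" using assms unfolding hmgerm_def by blast
 have "holom I J (cconj -` V) (%z. cconj (G (cconj z)))" unfolding holom_def
 proof (intro conjI ballI)
  fix z assume "z \<in> cconj -` V \<inter> cspace I"
  then show "cconj (G (cconj z)) \<in> cspace J" using V(3) by (simp add: holom_def)
 next
  fix j assume "j \<in> J"
  then have "holo I V (%z. G z j)" using V(3) by (simp add: holom_def)
  from holo_cnj(1)[OF this V(1)] show "holo I (cconj -` V) (%z. cconj (G (cconj z)) j)" by simp
 qed
 then show ?thesis unfolding hmgerm_def using V open_vimage_cconj by (intro exI[of _ "cconj -` V"]) simp
qed

lemma hmgerm_comp_sum:
 "hmgerm (I <+> J) I (%w. w o Inl) a" "hmgerm (I <+> J) J (%w. w o Inr) a"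
proof -
 have "holom (I <+> J) I UNIV (%w. w o Inl)"
  unfolding holom_def by (intro conjI ballI cspace_comp_sum(1)[of _ I J]) simp_all
 then show "hmgerm (I <+> J) I (%w. w o Inl) a" unfolding hmgerm_def by (intro exI[of _ UNIV]) simp_all
 have "holom (I <+> J) J UNIV (%w. w o Inr)"
  unfolding holom_def by (intro conjI ballI cspace_comp_sum(2)[of _ I J]) simp_all
 then show "hmgerm (I <+> J) J (%w. w o Inr) a" unfolding hmgerm_def by (intro exI[of _ UNIV]) simp_all
qed

lemma smul_apply: "smul c f i = c * f i" by (simp add: smul_def)

text \<open>
The differential \<open>A\<close> of \<open>zt\<close> maps the tangent space of the Segre variety onto itself, because the kernel of \<open>A\<close> and that space
span everything; being finite-dimensional, that space meets the kernel of \<open>A\<close> in \<open>0\<close> only.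
\<close>

lemma transversal_injective:
 assumes ts: "transversal_submersion n \<rho>' zt"
  and v: "v \<in> Cn n" "differential {..<n} (%Z. \<rho>' Z 0) 0 v = 0" "differential {..<n} zt 0 v = 0"
 shows "v = 0"
proof -
 let ?I = "{..<n}" let ?A = "differential ?I zt 0"
 define TS where "TS = level_tangent_space ?I (%Z. \<rho>' Z 0) 0"
 define TF where "TF = level_tangent_space ?I zt 0"
 have im: "?A ` Cn n = TS" and sp: "{u + v | u v. u \<in> TF & v \<in> TS} = Cn n"
  using ts unfolding transversal_submersion_def Let_def TS_def TF_def by simp_all
 have TSC: "TS \<subseteq> Cn n" by (auto simp: TS_def level_tangent_space_def)
 have sub: "fvs.subspace TS" unfolding TS_def level_tangent_space_def
 proof (rule fvs.subspaceI)
  show "0 \<in> {v \<in> Cn n. differential ?I (%Z. \<rho>' Z 0) 0 v = 0}" by (simp add: differential_def fun_eq_iff)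
 next
  fix x y assume "x \<in> {v \<in> Cn n. differential ?I (%Z. \<rho>' Z 0) 0 v = 0}" "y \<in> {v \<in> Cn n. differential ?I (%Z. \<rho>' Z 0) 0 v = 0}"
  then show "x + y \<in> {v \<in> Cn n. differential ?I (%Z. \<rho>' Z 0) 0 v = 0}" by (simp add: differential_add cspace_plus)
 next
  fix c x assume "x \<in> {v \<in> Cn n. differential ?I (%Z. \<rho>' Z 0) 0 v = 0}"
  then show "smul c x \<in> {v \<in> Cn n. differential ?I (%Z. \<rho>' Z 0) 0 v = 0}"
   using fvs.subspace_scale[OF subspace_cspace, of x ?I c] by (simp add: differential_smul)
 qed
 have onto: "\<exists>v. v \<in> TS & ?A v = w" if w: "w \<in> TS" for w
 proof -
  obtain c where c: "c \<in> Cn n" "?A c = w" using w unfolding im[symmetric] by blast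
  obtain u v where uv: "c = u + v" "u \<in> TF" "v \<in> TS" using c(1) unfolding sp[symmetric] by blast
  have "?A u = 0" using uv(2) by (simp add: TF_def level_tangent_space_def)
  then have "?A v = w" using c(2) unfolding uv(1) differential_add by simp
  then show ?thesis using uv(3) by blast
 qed
 obtain B where B: "B \<subseteq> TS" "fvs.independent B" "TS \<subseteq> fvs.span B" "card B = fvs.dim TS" by (rule fvs.basis_exists)
 have finB: "finite B" by (rule indep_cspace_finite[OF finite_lessThan subset_trans[OF B(1) TSC] B(2)])
 have "\<forall>b\<in>B. \<exists>v. v \<in> TS & ?A v = b" using onto B(1) by blast
 then obtain e where e: "\<And>b. b \<in> B ==> e b \<in> TS" "\<And>b. b \<in> B ==> ?A (e b) = b" unfolding bchoice_iff by blast
 have lin: "?A (\<Sum>b\<in>F. smul (gm b) (e b)) = (\<Sum>b\<in>F. smul (gm b) (?A (e b)))" if "finite F" for F gm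
  using that
 proof (induction F)
  case empty
  show ?case by (simp add: differential_def fun_eq_iff)
 next
  case (insert x F)
  show ?case unfolding sum.insert[OF insert(1,2)] differential_add differential_smul insert(3) by (rule refl)
 qed
 have coeff: "\<forall>b\<in>B. gm b = 0" if "?A (\<Sum>b\<in>B. smul (gm b) (e b)) = 0" for gm
 proof -
  have "(\<Sum>b\<in>B. smul (gm b) (?A (e b))) = (\<Sum>b\<in>B. smul (gm b) b)"
   by (rule sum.cong[OF refl]) (simp only: e(2))
  then have "(\<Sum>b\<in>B. smul (gm b) b) = 0" using lin[OF finB, of gm] that by simp
  then show ?thesis using fvs.independentD[OF B(2) finB subset_refl] by blast
 qed
 have i: "inj_on e B" "fvs.independent (e ` B)"
 proof -
  have "\<forall>b\<in>B. gm b = 0" if "(\<Sum>b\<in>B. smul (gm b) (e b)) = 0" for gm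
   by (rule coeff) (unfold that, simp add: differential_def fun_eq_iff)
  note * = this
  show "inj_on e B" "fvs.independent (e ` B)" using family_independent[OF finB, of e] * by blast+
 qed
 have "TS \<subseteq> fvs.span (e ` B)"
  by (rule span_if_dim_le[OF _ TSC _ i(2)]) (use e(1) B(4) card_image[OF i(1)] in auto)
 moreover have "v \<in> TS" using v(1,2) by (simp add: TS_def level_tangent_space_def)
 ultimately have "v \<in> fvs.span (e ` B)" by blast
 then obtain u where u: "v = (\<Sum>x\<in>e ` B. smul (u x) x)"
  unfolding fvs.span_finite[OF finite_imageI[OF finB]] by blast
 then have v2: "v = (\<Sum>b\<in>B. smul (u (e b)) (e b))" using sum.reindex[OF i(1), of "%x. smul (u x) x"] by (simp add: comp_def)
 have "\<forall>b\<in>B. u (e b) = 0" by (rule coeff) (unfold v2[symmetric], rule v(3))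
 then show "v = 0" unfolding v2 by (intro sum.neutral) (simp add: smul_def fun_eq_iff)
qed

text \<open>
The map \<open>Z' \<mapsto> (\<rho>' Z' 0, zt Z')\<close> is an immersion at \<open>0\<close> by transversality. A left inverse \<open>L\<close> of its derivative turns
the two conditions on \<open>Z'\<close> into a fixed point equation to which \<open>implicit_function\<close> applies.
\<close>

lemma target_recovery:
 assumes gen: "generic_submanifold n d' M' \<rho>'" and ts: "transversal_submersion n \<rho>' zt"
 shows "\<exists>Y Q. hmgerm (dbl n) {..<n} Y 0 & Y 0 = 0 & open Q & 0 \<in> Q &
  (\<forall>q\<in>Q \<inter> cspace (dbl n). \<rho>' (q o Inl) (q o Inr) = 0 --> q o Inl = Y (case_sum (zt (q o Inl)) (q o Inr)))"
proof -
 let ?I = "{..<n}" and ?A = "dbl n" and ?Q = "{..<d'} <+> {..<n}"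
 have finA: "finite ?A" by simp
 have zt: "hmgerm ?I ?I zt 0" "zt 0 = 0"
  using ts holomorphic_germ_iff[of ?I ?I zt 0] unfolding transversal_submersion_def Let_def by auto
 have rh: "hmgerm ?A {..<d'} (%w. \<rho>' (w o Inl) (w o Inr)) 0"
  using gen holomorphic_germ_iff[OF finA finite_lessThan] unfolding generic_submanifold_def by blast
 have r0: "\<rho>' 0 0 = 0"
 proof -
  have "\<forall>\<^sub>F Z in nhds 0. Z \<in> Cn n --> (Z \<in> M' \<longleftrightarrow> \<rho>' Z (cconj Z) = 0)" "0 \<in> M'"
   using gen unfolding generic_submanifold_def by blast+
  from eventually_nhds_x_imp_x[OF this(1)] this(2) show ?thesis by simp
 qed
 define D where "D v = (case_sum (%k. if k < d' then differential ?I (%Z. \<rho>' Z 0) 0 v k else 0) (%i. if i < n then differential ?I zt 0 v i else 0) :: (nat + nat) cpoint)" for v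
 have rh0: "hgerm ?I (%Z. \<rho>' Z 0 k) 0" if k: "k < d'" for k
 proof -
  have g: "hmgerm ?I ?A (%Z. case_sum Z 0) 0" unfolding hmgerm_def holom_def ball_Plus
   by (intro exI[of _ UNIV]) simp
  have "hgerm ?I (%Z. (%w :: (nat + nat) cpoint. \<rho>' (w o Inl) (w o Inr) k) (case_sum Z 0)) 0"
  proof (rule hgerm_compose[where F="%w. \<rho>' (w o Inl) (w o Inr) k" and G="%Z. case_sum Z 0", OF finA _ g cspace_0])
   show "hgerm ?A (%w. \<rho>' (w o Inl) (w o Inr) k) (case_sum 0 0)"
    unfolding case_sum_0 by (rule hmgermD[OF rh]) (use k in simp)
  qed
  then show ?thesis by simp
 qed
 have D0: "v = 0" if v: "v \<in> Cn n" "D v = 0" for v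
 proof (rule transversal_injective[OF ts v(1)])
  have k: "differential ?I (%Z. \<rho>' Z 0) 0 v k = 0" if "k < d'" for k
   using fun_cong[OF v(2), of "Inl k"] that by (simp add: D_def)
  have i: "differential ?I zt 0 v i = 0" if "i < n" for i
   using fun_cong[OF v(2), of "Inr i"] that by (simp add: D_def)
  obtain V where V: "open V" "0 \<in> V" "holom ?I ?I V zt" using zt(1) unfolding hmgerm_def by blast
  have "differential ?I zt 0 v \<in> Cn n" by (rule differential_cspace[OF V(1,3,2) cspace_0])
  then show "differential ?I zt 0 v = 0" using i by (auto simp: cspace_def fun_eq_iff)
  have g: "hmgerm ?I ?A (%Z. case_sum Z 0) 0" unfolding hmgerm_def holom_def ball_Plus
   by (intro exI[of _ UNIV]) simp
  have "hmgerm ?I {..<d'} (%Z. (%w :: (nat + nat) cpoint. \<rho>' (w o Inl) (w o Inr)) (case_sum Z 0)) 0"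
   by (rule hmgerm_compose[where F="%w. \<rho>' (w o Inl) (w o Inr)" and G="%Z. case_sum Z 0", OF finA finite_lessThan _ g cspace_0]) (unfold case_sum_0, rule rh)
  then have "hmgerm ?I {..<d'} (%Z. \<rho>' Z 0) 0" by simp
  then obtain V' where V': "open V'" "0 \<in> V'" "holom ?I {..<d'} V' (%Z. \<rho>' Z 0)" unfolding hmgerm_def by blast
  have "differential ?I (%Z. \<rho>' Z 0) 0 v \<in> Cn d'" by (rule differential_cspace[OF V'(1,3,2) cspace_0])
  then show "differential ?I (%Z. \<rho>' Z 0) 0 v = 0" using k by (auto simp: cspace_def fun_eq_iff)
 qed
 have Dlin: "D (\<Sum>j\<in>F. smul (gm j) (unit_at j)) = (\<Sum>j\<in>F. smul (gm j) (D (unit_at j)))" if "finite F" for F :: "nat set" and gm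
  using that
 proof (induction F)
  case empty
  show ?case by (auto simp: D_def differential_def fun_eq_iff split: sum.splits)
 next
  case (insert x F)
  have Da: "D (a + b) = D a + D b" for a b
   by (rule ext, rename_tac x, case_tac x) (simp_all add: D_def differential_add)
  have Ds: "D (smul c a) = smul c (D a)" for a c
   by (rule ext, rename_tac x, case_tac x) (simp_all add: D_def differential_smul smul_apply)
  show ?case unfolding sum.insert[OF insert(1,2)] Da Ds insert(3) by (rule refl)
 qed
 have ind: "inj_on (%j. D (unit_at j)) ?I" "fvs.independent ((%j. D (unit_at j)) ` ?I)"
 proof -
  have "\<forall>j\<in>?I. gm j = 0" if g: "(\<Sum>j\<in>?I. smul (gm j) (D (unit_at j))) = 0" for gm
  proof -
   have "(\<Sum>j\<in>?I. smul (gm j) (unit_at j)) = 0"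
   proof (rule D0)
    show "(\<Sum>j\<in>?I. smul (gm j) (unit_at j)) \<in> Cn n"
     by (rule fvs.subspace_sum[OF subspace_cspace], rule fvs.subspace_scale[OF subspace_cspace], rule unit_at_cspace)
    show "D (\<Sum>j\<in>?I. smul (gm j) (unit_at j)) = 0" using Dlin[of ?I gm] g by simp
   qed
   then have z: "(\<Sum>j\<in>?I. smul (gm j) (unit_at j)) i = 0" for i by simp
   show ?thesis
   proof
    fix j assume "j \<in> ?I"
    with z[of j] show "gm j = 0"
     by (simp add: sum_fun_apply smul_def unit_at_def if_distrib[of "(*) _"] cong: if_cong)
   qed
  qed
  note * = this
  show "inj_on (%j. D (unit_at j)) ?I" "fvs.independent ((%j. D (unit_at j)) ` ?I)"
   using family_independent[OF finite_lessThan, of "%j. D (unit_at j)" n] * by blast+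
 qed
 have DQ: "(%j. D (unit_at j)) ` ?I \<subseteq> cspace ?Q" by (auto simp: D_def cspace_def split: sum.splits)
 obtain \<phi> where \<phi>: "\<forall>u\<in>(%j. D (unit_at j)) ` ?I. \<forall>v\<in>(%j. D (unit_at j)) ` ?I. (\<Sum>a\<in>?Q. \<phi> u a * v a) = (if u = v then 1 else (0::complex))"
  using dual_family[OF _ ind(2) DQ] by auto
 define L where "L j m = \<phi> (D (unit_at j)) m" for j m
 have L: "(\<Sum>m\<in>?Q. L j m * D (unit_at k) m) = (if j = k then 1 else 0)" if "j < n" "k < n" for j k
  using \<phi> that ind(1) unfolding L_def inj_on_def by auto
 have Dk: "D (unit_at k) (Inl l) = pd k (%Z. \<rho>' Z 0 l) 0" if "k < n" "l < d'" for k l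
  using fun_cong[OF differential_unit[of ?I k "%Z. \<rho>' Z 0" 0], of l] that by (simp add: D_def pcol_def)
 have Dz: "D (unit_at k) (Inr i) = pd k (%Z. zt Z i) 0" if "k < n" "i < n" for k i
  using fun_cong[OF differential_unit[of ?I k zt 0], of i] that by (simp add: D_def pcol_def)
 define T where "T x y = (%j. if j < n then y j - ((\<Sum>l<d'. L j (Inl l) * \<rho>' y (x o Inr) l) + (\<Sum>i<n. L j (Inr i) * (zt y i - x (Inl i)))) else 0)"
  for x :: "(nat + nat) cpoint" and y :: "nat cpoint"
 have g1: "hmgerm (?A <+> ?I) ?A (%w. case_sum (w o Inr) ((w o Inl) o Inr)) (case_sum 0 0)"
 proof (rule hmgerm_case_sum[OF hmgerm_comp_sum(2)])
  have "hmgerm (?A <+> ?I) ?I (%w. (%v. v o Inr) (w o Inl)) (case_sum 0 0)"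
   by (rule hmgerm_compose[where F="%v. v o Inr" and G="%w. w o Inl", OF finA finite_lessThan hmgerm_comp_sum(2) hmgerm_comp_sum(1)]) simp
  then show "hmgerm (?A <+> ?I) ?I (%w. (w o Inl) o Inr) (case_sum 0 0)" .
 qed
 have z: "(0 :: (nat + nat) cpoint) o Inr = 0" "(0 :: (nat + nat) cpoint) o Inl = 0" by (simp_all add: zero_comp)
 have hT: "hmgerm (?A <+> ?I) ?I (%w. T (w o Inl) (w o Inr)) (case_sum 0 0)"
 proof (rule hmgermI)
  show "\<forall>\<^sub>F w in nhds (case_sum 0 0). w \<in> cspace (?A <+> ?I) --> T (w o Inl) (w o Inr) \<in> Cn n"
   by (intro always_eventually) (auto simp: T_def cspace_def)
  fix j assume j: "j \<in> ?I"
  have hr: "hgerm (?A <+> ?I) (%w. \<rho>' (w o Inr) ((w o Inl) o Inr) l) (case_sum 0 0)" if "l < d'" for l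
  proof -
   have "hgerm (?A <+> ?I) (%w. \<rho>' (case_sum (w o Inr) ((w o Inl) o Inr) o Inl) (case_sum (w o Inr) ((w o Inl) o Inr) o Inr) l) (case_sum 0 0)"
   proof (rule hgerm_compose[where F="%w. \<rho>' (w o Inl) (w o Inr) l" and G="%w. case_sum (w o Inr) ((w o Inl) o Inr)", OF finA _ g1])
    show "hgerm ?A (%w. \<rho>' (w o Inl) (w o Inr) l) (case_sum (case_sum 0 0 o Inr) ((case_sum 0 0 o Inl) o Inr))"
     unfolding case_sum_0 zero_comp by (rule hmgermD[OF rh]) (use that in simp)
   qed simp
   then show ?thesis by simp
  qed
  have hz: "hgerm (?A <+> ?I) (%w. zt (w o Inr) i) (case_sum 0 0)" if "i < n" for i
  proof (rule hgerm_compose[where F="%y. zt y i" and G="%w. w o Inr", OF finite_lessThan _ hmgerm_comp_sum(2)])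
   show "hgerm ?I (%y. zt y i) (case_sum 0 0 o Inr)" unfolding case_sum_comp by (rule hmgermD[OF zt(1)]) (use that in simp)
  qed simp
  have "hgerm (?A <+> ?I) (%w. w (Inr j) - ((\<Sum>l<d'. L j (Inl l) * \<rho>' (w o Inr) ((w o Inl) o Inr) l) + (\<Sum>i<n. L j (Inr i) * (zt (w o Inr) i - w (Inl (Inl i)))))) (case_sum 0 0)"
   by (intro hgerm_diff hgerm_add hgerm_coord hgerm_sum hgerm_mult hgerm_const hr hz) simp_all
  then show "hgerm (?A <+> ?I) (%w. T (w o Inl) (w o Inr) j) (case_sum 0 0)" using j by (simp add: T_def)
 qed simp
 have T0: "T 0 0 = 0" by (simp add: T_def z r0 zt(2) fun_eq_iff)
 have dT: "pd (Inr k) (%w. T (w o Inl) (w o Inr) j) (case_sum 0 0) = 0" if jk: "j \<in> ?I" "k \<in> ?I" for j k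
 proof (rule partial_deriv_eqI)
  have jk': "j < n" "k < n" using jk by auto
  let ?z = "case_sum 0 0 :: (nat + nat) + nat => complex"
  have up: "T (?z(Inr k := t) o Inl) (?z(Inr k := t) o Inr) j = (0(k := t)) j - ((\<Sum>l<d'. L j (Inl l) * \<rho>' (0(k := t)) 0 l) + (\<Sum>i<n. L j (Inr i) * zt (0(k := t)) i))" for t
  proof -
   have "?z(Inr k := t) o Inl = 0" "?z(Inr k := t) o Inr = 0(k := t)" by (auto simp: fun_eq_iff)
   then show ?thesis using jk' by (simp add: T_def z)
  qed
  have d1: "((%t. ((0 :: nat cpoint)(k := t)) j) has_field_derivative (if j = k then 1 else 0)) (at (?z (Inr k)))" by (rule upd_DERIV)
  have d2: "((%t. \<rho>' (0(k := t)) 0 l) has_field_derivative D (unit_at k) (Inl l)) (at (?z (Inr k)))" if "l < d'" for l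
   using hgerm_DERIV[OF rh0[OF that] jk(2) cspace_0] Dk[OF jk'(2) that] by simp
  have d3: "((%t. zt (0(k := t)) i) has_field_derivative D (unit_at k) (Inr i)) (at (?z (Inr k)))" if i: "i < n" for i
  proof -
   have "i \<in> ?I" using i by simp
   from hgerm_DERIV[OF hmgermD[OF zt(1) this] jk(2) cspace_0] show ?thesis using Dz[OF jk'(2) i] by simp
  qed
  have "((%t. (0(k := t)) j - ((\<Sum>l<d'. L j (Inl l) * \<rho>' (0(k := t)) 0 l) + (\<Sum>i<n. L j (Inr i) * zt (0(k := t)) i))) has_field_derivative
    (if j = k then 1 else 0) - ((\<Sum>l<d'. L j (Inl l) * D (unit_at k) (Inl l)) + (\<Sum>i<n. L j (Inr i) * D (unit_at k) (Inr i)))) (at (?z (Inr k)))"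
   by (intro DERIV_diff[OF d1] DERIV_add DERIV_sum DERIV_cmult) (use d2 d3 in simp_all)
  moreover have "(\<Sum>l<d'. L j (Inl l) * D (unit_at k) (Inl l)) + (\<Sum>i<n. L j (Inr i) * D (unit_at k) (Inr i)) = (if j = k then 1 else 0)"
   using L[OF jk'] by (simp add: sum.Plus)
  ultimately show "((%t. T (?z(Inr k := t) o Inl) (?z(Inr k := t) o Inr) j) has_field_derivative 0) (at (?z (Inr k)))"
   unfolding up by simp
 qed
 have "\<exists>U ep. open U & 0 \<in> U & ep > 0 & holom ?A ?I U (fixsol T) & fixsol T 0 = 0 &
   (\<forall>x\<in>U \<inter> cspace ?A. T x (fixsol T x) = fixsol T x & (\<forall>y\<in>pdisc ?I 0 ep. T x y = y --> y = fixsol T x))"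
  by (rule implicit_function[where T=T and a=0, OF finA finite_lessThan cspace_0 hT T0]) (rule dT)
 then obtain U ep where U: "open U" "0 \<in> U" "ep > 0" "holom ?A ?I U (fixsol T)" "fixsol T 0 = 0"
  and uniq: "\<forall>x\<in>U \<inter> cspace ?A. T x (fixsol T x) = fixsol T x & (\<forall>y\<in>pdisc ?I 0 ep. T x y = y --> y = fixsol T x)"
  by (elim exE conjE) (rule that)
 have Yg: "hmgerm ?A ?I (fixsol T) 0" unfolding hmgerm_def using U by blast
 have Kg: "hmgerm ?A ?A (%q. case_sum (zt (q o Inl)) (q o Inr)) 0"
 proof (rule hmgerm_case_sum[OF _ hmgerm_comp_sum(2)])
  show "hmgerm ?A ?I (%q. zt (q o Inl)) 0"
   by (rule hmgerm_compose[where F=zt and G="%q. q o Inl", OF finite_lessThan finite_lessThan _ hmgerm_comp_sum(1) cspace_0]) (unfold z, rule zt(1))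
 qed
 have K0: "case_sum (zt ((0 :: (nat + nat) cpoint) o Inl)) ((0 :: (nat + nat) cpoint) o Inr) \<in> U"
  unfolding zero_comp zt(2) case_sum_0 by (rule U(2))
 obtain V where V: "open V" "0 \<in> V" "holom ?A ?A V (%q. case_sum (zt (q o Inl)) (q o Inr))" "\<forall>q\<in>V \<inter> cspace ?A. case_sum (zt (q o Inl)) (q o Inr) \<in> U"
  using hmgerm_neighbourhood[where G="%q. case_sum (zt (q o Inl)) (q o Inr)" and a=0, OF Kg U(1) K0 cspace_0] by (elim exE conjE) (rule that)
 have "q o Inl = fixsol T (case_sum (zt (q o Inl)) (q o Inr))"
  if q: "q \<in> V \<inter> pbox ?A 0 ep" "q \<in> cspace ?A" and r: "\<rho>' (q o Inl) (q o Inr) = 0" for q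
 proof -
  let ?x = "case_sum (zt (q o Inl)) (q o Inr)"
  have x: "?x \<in> U" "?x \<in> cspace ?A" using V(3,4) q by (auto simp: holom_def)
  have y: "q o Inl \<in> pdisc ?I 0 ep" using q cspace_comp_sum(1)[OF q(2)] by (simp add: pdisc_iff pbox_def)
  have "T ?x (q o Inl) = q o Inl"
   using cspace_comp_sum(1)[OF q(2)] r by (auto simp: T_def fun_eq_iff cspace_def)
  then show ?thesis using uniq x y by blast
 qed
 then have "\<forall>q\<in>(V \<inter> pbox ?A 0 ep) \<inter> cspace ?A. \<rho>' (q o Inl) (q o Inr) = 0 --> q o Inl = fixsol T (case_sum (zt (q o Inl)) (q o Inr))" by blast
 moreover have "open (V \<inter> pbox ?A 0 ep)" "0 \<in> V \<inter> pbox ?A 0 ep" using V U(3) open_pbox[OF finA] by auto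
 ultimately show ?thesis using Yg U(5) by blast
qed

section \<open>Reconstruction along chains\<close>

text \<open>
With \<open>Z'\<^sub>0 = 0\<close>, the inner application of \<open>Y\<close> yields the conjugate of \<open>\<zeta>'\<^sub>l\<^sub>+\<^sub>1\<close> from \<open>Z'\<^sub>l\<close>, by the reality of the target
equation, and the outer one yields \<open>Z'\<^sub>l\<^sub>+\<^sub>1\<close> from \<open>\<zeta>'\<^sub>l\<^sub>+\<^sub>1\<close>.
\<close>

primrec segre_rec :: "((nat + nat) cpoint => nat cpoint) => (nat \<times> (nat + nat)) cpoint => nat => nat cpoint" where
 "segre_rec Y w 0 = 0"
| "segre_rec Y w (Suc l) = Y (case_sum (%i. w (Suc l, Inr i))
   (cconj (Y (case_sum (%i. cnj (w (Suc l, Inl i))) (cconj (segre_rec Y w l))))))"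

lemma segre_rec_germ:
 assumes Y: "hmgerm (dbl n) {..<n} Y 0" "Y 0 = 0"
 shows "hmgerm (tuple_index m n) {..<n} (%w. segre_rec Y w l) 0 & segre_rec Y 0 l = 0"
proof (induction l)
 case 0
 have z: "hmgerm (tuple_index m n) {..<n} (%w. 0) 0" unfolding hmgerm_def holom_def by (intro exI[of _ UNIV]) simp
 show ?case unfolding segre_rec.simps(1) by (rule conjI[OF z refl])
next
 case (Suc l)
 let ?I = "tuple_index m n"
 have finI: "finite ?I" by (simp add: tuple_index_def)
 have finA: "finite (dbl n)" by simp
 have sl: "hmgerm ?I {..<n} (%w i. w (Suc l, s i)) 0" if s: "\<And>i. s i \<in> dbl n \<longleftrightarrow> i < n" for s
 proof -
  have "(%i. w (Suc l, s i)) \<in> cspace {..<n}" if "w \<in> cspace ?I" for w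
   using that s unfolding cspace_def tuple_index_def by auto
  then show ?thesis unfolding hmgerm_def holom_def by (intro exI[of _ UNIV]) simp
 qed
 let ?G = "%v. cconj (segre_rec Y (cconj v) l)"
 let ?E = "%v. case_sum (%i. v (Suc l, Inl i)) (?G v)"
 have G: "hmgerm ?I {..<n} ?G 0" by (rule hmgerm_cnj[OF conjunct1[OF Suc]])
 have E: "hmgerm ?I (dbl n) ?E 0" by (rule hmgerm_case_sum[OF sl G]) simp
 have c0: "(%i. (0 :: (nat \<times> (nat + nat)) cpoint) (Suc l, t i)) = (0 :: nat cpoint)" for t by (simp add: fun_eq_iff)
 have s0: "segre_rec Y 0 l = 0" by (rule conjunct2[OF Suc])
 have E0: "?E 0 = 0" by (simp only: c0 cconj_simps(3) s0 case_sum_0)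
 have F: "hmgerm ?I {..<n} (%v. Y (?E v)) 0"
  by (rule hmgerm_compose[where F=Y and G="?E", OF finA finite_lessThan _ E cspace_0]) (unfold E0, rule Y(1))
 let ?F = "%w. cconj (Y (?E (cconj w)))"
 have F': "hmgerm ?I {..<n} ?F 0" by (rule hmgerm_cnj[OF F])
 let ?H = "%w. case_sum (%i. w (Suc l, Inr i)) (?F w)"
 have H: "hmgerm ?I (dbl n) ?H 0" by (rule hmgerm_case_sum[OF sl F']) simp
 have E0': "case_sum (%i. (0 :: (nat \<times> (nat + nat)) cpoint) (Suc l, Inl i)) (cconj (segre_rec Y 0 l)) = 0"
  using E0 unfolding cconj_simps(3) .
 have F0: "?F 0 = 0" unfolding cconj_simps(3) E0' Y(2) by (rule refl)
 have H0: "?H 0 = 0" unfolding c0 F0 by simp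
 have "hmgerm ?I {..<n} (%w. Y (?H w)) 0"
  by (rule hmgerm_compose[where F=Y and G="?H", OF finA finite_lessThan _ H cspace_0]) (unfold H0, rule Y(1))
 moreover have eq: "segre_rec Y w (Suc l) = Y (?H w)" for w by simp
 moreover have "segre_rec Y 0 (Suc l) = 0" unfolding eq H0 by (rule Y(2))
 ultimately show ?case by (simp only:)
qed

text \<open>
First \<open>\<lambda>\<close> is chosen small, to bring the chain over \<open>Z = 0\<close> close to \<open>0\<close>, and then \<open>Z\<close>, depending on \<open>\<lambda>\<close>.
\<close>

lemma family_close:
 assumes p1: "\<And>lam. 0 < cmod lam & cmod lam < 1 ==> hmgerm (fam N) (dbl N) (%w. p (w None) (w o Some)) (case_option lam 0)"
  and p2: "\<And>a. a \<in> dbl N ==> ((%lam. p lam 0 a) \<longlongrightarrow> 0) (at 0)" and W: "open W" "0 \<in> W"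
 shows "\<forall>\<^sub>F lam in at 0. \<forall>\<^sub>F Z in nhds 0. Z \<in> Cn N --> p lam Z \<in> W"
proof -
 have finA: "finite (dbl N)" by simp
 obtain ep where ep: "ep > 0" "pdisc (dbl N) 0 ep \<subseteq> W" using open_pdisc_subset[OF finA W cspace_0] by blast
 have "\<forall>\<^sub>F lam in at 0. \<forall>a\<in>dbl N. cmod (p lam 0 a) < ep"
 proof (rule eventually_ball_finite[OF finA], rule)
  fix a assume "a \<in> dbl N"
  from tendstoD[OF p2[OF this] ep(1)] show "\<forall>\<^sub>F lam in at 0. cmod (p lam 0 a) < ep" by simp
 qed
 moreover have "\<forall>\<^sub>F lam :: complex in at 0. 0 < cmod lam & cmod lam < 1"
  unfolding eventually_at by (intro exI[of _ 1]) simp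
 ultimately show ?thesis
 proof eventually_elim
  case (elim lam)
  let ?a = "case_option lam 0 :: nat option cpoint"
  have e: "?a None = lam" "?a o Some = 0" by (auto simp: fun_eq_iff)
  have aC: "?a \<in> cspace (fam N)" by (auto simp: cspace_def split: option.splits)
  have "p (?a None) (?a o Some) \<in> pbox (dbl N) 0 ep" unfolding e using elim(1) by (simp add: pbox_def)
  from hmgerm_neighbourhood[where G="%w. p (w None) (w o Some)" and a="?a", OF p1[OF elim(2)] open_pbox[OF finA] this aC]
  obtain V where V: "open V" "?a \<in> V" "holom (fam N) (dbl N) V (%w. p (w None) (w o Some))"
   "\<forall>z\<in>V \<inter> cspace (fam N). p (z None) (z o Some) \<in> pbox (dbl N) 0 ep" by (elim exE conjE)
  have "\<forall>\<^sub>F w in nhds ?a. w \<in> V" by (rule eventually_nhds_in_open[OF V(1,2)])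
  then have "\<forall>\<^sub>F Z in nhds (0 :: nat cpoint). case_option lam Z \<in> V" by (rule eventually_family)
  then show ?case
  proof eventually_elim
   case (elim Z)
   show ?case
   proof
    assume Z: "Z \<in> Cn N"
    let ?x = "case_option lam Z :: nat option cpoint"
    have x: "?x \<in> V" "?x \<in> cspace (fam N)" using elim Z by (auto simp: cspace_def split: option.splits)
    have e: "?x None = lam" "?x o Some = Z" by (auto simp: fun_eq_iff)
    have "p (?x None) (?x o Some) \<in> pbox (dbl N) 0 ep" using V(4) x by blast
    moreover have "p (?x None) (?x o Some) \<in> cspace (dbl N)" using V(3) x unfolding holom_def by blast
    ultimately show "p lam Z \<in> W" unfolding e using ep(2) by (auto simp: pdisc_def)
   qed
  qed
 qed
qed

text \<open>
The component functions of \<open>\<rho>' (H Z) (conj_map H \<zeta>)\<close> vanish on \<open>M\<close>, hence on the complexification; the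
open set \<open>Q\<close> only records that the image points can be taken as close to \<open>0\<close> as desired.
\<close>

lemma complexified_inclusion:
 assumes gen': "generic_submanifold n d' M' \<rho>'" and H: "hmgerm {..<N} {..<n} H 0" "H 0 = 0"
  and HM: "\<forall>\<^sub>F Z in nhds 0. Z \<in> M --> H Z \<in> M'" and gen: "generic_submanifold N d M \<rho>"
  and Q: "open Q" "0 \<in> Q"
 shows "\<exists>W. open W & 0 \<in> W & (\<forall>x\<in>W \<inter> cspace (dbl N). (\<forall>k<d. \<rho> (x o Inl) (x o Inr) k = 0) -->
  (let q = case_sum (H (x o Inl)) (conj_map H (x o Inr)) in
   q \<in> Q & sc q \<in> Q & q \<in> cspace (dbl n) & \<rho>' (q o Inl) (q o Inr) = 0 & \<rho>' (sc q o Inl) (sc q o Inr) = 0))"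
proof -
 let ?A = "dbl N" and ?B = "dbl n"
 let ?q = "%x. case_sum (H (x o Inl)) (conj_map H (x o Inr))"
 let ?r = "%k (x :: (nat + nat) cpoint). \<rho>' (x o Inl) (x o Inr) k"
 obtain r Bs where ch: "chart n d' M' ?r r Bs" and RC: "\<forall>x\<in>pdisc ?B 0 r. \<rho>' (x o Inl) (x o Inr) \<in> Cn d'"
  using generic_chart[OF gen'] by (elim exE conjE) (rule that)
 have MC: "M \<subseteq> Cn N" using gen unfolding generic_submanifold_def by blast
 have finB: "finite ?B" by simp
 have z: "(0 :: (nat + nat) cpoint) o Inr = 0" "(0 :: (nat + nat) cpoint) o Inl = 0" by (simp_all add: zero_comp)
 have Hc: "hmgerm {..<N} {..<n} (conj_map H) 0" unfolding conj_map_def by (rule hmgerm_cnj[OF H(1)])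
 have c0: "conj_map H 0 = 0" by (simp add: conj_map_def H(2))
 have q: "hmgerm ?A ?B ?q 0"
 proof (rule hmgerm_case_sum)
  show "hmgerm ?A {..<n} (%x. H (x o Inl)) 0"
   by (rule hmgerm_compose[where F=H and G="%x. x o Inl", OF finite_lessThan finite_lessThan _ hmgerm_comp_sum(1) cspace_0]) (unfold z, rule H(1))
  show "hmgerm ?A {..<n} (%x. conj_map H (x o Inr)) 0"
   by (rule hmgerm_compose[where F="conj_map H" and G="%x. x o Inr", OF finite_lessThan finite_lessThan _ hmgerm_comp_sum(2) cspace_0]) (unfold z, rule Hc)
 qed
 have q0: "?q 0 = 0" unfolding z H(2) c0 by simp
 have r: "r > 0" using ch by (simp add: chart_def)
 have rh: "hgerm ?B (?r k) 0" if "k < d'" for k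
 proof -
  have "holo ?B (pbox ?B 0 r) (?r k)" using chart.rh[OF ch that] .
  then show ?thesis unfolding hgerm_def using r open_pbox[OF finB] by (intro exI[of _ "pbox ?B 0 r"]) simp
 qed
 have swo: "open (sc -` Q)"
 proof -
  have "continuous_on UNIV sc"
   by (rule continuous_on_coordinatewise_then_product)
     (auto simp: sc_apply intro!: continuous_intros continuous_on_product_coordinates)
  then show ?thesis by (rule open_vimage[OF Q(1)])
 qed
 let ?O = "Q \<inter> (sc -` Q) \<inter> pbox ?B 0 r"
 have O: "open ?O" by (intro open_Int Q(1) swo open_pbox[OF finB])
 have O0: "?q 0 \<in> ?O" unfolding q0 using Q(2) r by simp
 obtain V where V: "open V" "0 \<in> V" "holom ?A ?B V ?q" "\<forall>x\<in>V \<inter> cspace ?A. ?q x \<in> ?O"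
  using hmgerm_neighbourhood[where G="?q" and a=0, OF q O O0 cspace_0] by (elim exE conjE) (rule that)
 have qcc: "?q (cc Z) = cc (H Z)" for Z by (simp add: cc_def conj_map_def)
 have "\<forall>k\<in>{..<d'}. \<exists>V. open V & 0 \<in> V & (\<forall>x\<in>V \<inter> cspace ?A. (\<forall>k<d. \<rho> (x o Inl) (x o Inr) k = 0) --> ?r k (?q x) = 0)"
 proof
  fix k assume "k \<in> {..<d'}"
  then have k: "k < d'" by simp
  have h: "hgerm ?A (%x. ?r k (?q x)) 0"
   by (rule hgerm_compose[where F="?r k" and G="?q", OF finB _ q cspace_0]) (unfold q0, rule rh[OF k])
  have "open (cc -` V)" by (rule open_vimage_cc[OF V(1)])
  then have "\<forall>\<^sub>F Z in nhds 0. Z \<in> cc -` V" by (rule eventually_nhds_in_open) (use V(2) in simp)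
  with HM have "\<forall>\<^sub>F Z in nhds 0. Z \<in> M --> ?r k (?q (cc Z)) = 0"
  proof eventually_elim
   case (elim Z)
   show ?case
   proof
    assume Z: "Z \<in> M"
    then have x: "cc Z \<in> V" "cc Z \<in> cspace ?A" using elim MC by auto
    have "?q (cc Z) \<in> pbox ?B 0 r" "?q (cc Z) \<in> cspace ?B" using V(3,4) x unfolding holom_def by blast+
    then have c: "cc (H Z) \<in> pdisc ?B 0 r" "cc (H Z) \<in> cspace ?B" unfolding qcc by (simp_all add: pdisc_def)
    then have "H Z \<in> Cn n" by simp
    from chart.Mr[OF ch this c(1)] elim(1) Z k show "?r k (?q (cc Z)) = 0" unfolding qcc by blast
   qed
  qed
  from vanishing_on_complexification[OF gen h this] show "\<exists>V. open V & 0 \<in> V & (\<forall>x\<in>V \<inter> cspace ?A. (\<forall>k<d. \<rho> (x o Inl) (x o Inr) k = 0) --> ?r k (?q x) = 0)" .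
 qed
 then obtain Vk where Vk: "\<And>k. k < d' ==> open (Vk k) & 0 \<in> Vk k & (\<forall>x\<in>Vk k \<inter> cspace ?A. (\<forall>k<d. \<rho> (x o Inl) (x o Inr) k = 0) --> ?r k (?q x) = 0)"
  unfolding bchoice_iff by auto
 let ?W = "V \<inter> (\<Inter>k\<in>{..<d'}. Vk k)"
 have W: "open ?W" "0 \<in> ?W" using V(1,2) Vk by auto
 have *: "?q x \<in> Q & sc (?q x) \<in> Q & ?q x \<in> cspace ?B & \<rho>' (?q x o Inl) (?q x o Inr) = 0 & \<rho>' (sc (?q x) o Inl) (sc (?q x) o Inr) = 0"
  if x: "x \<in> ?W" "x \<in> cspace ?A" and zx: "\<forall>k<d. \<rho> (x o Inl) (x o Inr) k = 0" for x
 proof -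
  have xV: "x \<in> V" using x by blast
  have "?q x \<in> ?O" using V(4) xV x(2) by blast
  then have a: "?q x \<in> Q" "sc (?q x) \<in> Q" "?q x \<in> pbox ?B 0 r" by auto
  have b: "?q x \<in> cspace ?B" using V(3) xV x(2) unfolding holom_def by blast
  have c: "?q x \<in> pdisc ?B 0 r" using a(3) b by (simp only: pdisc_def Int_iff)
  then have c': "sc (?q x) \<in> pdisc ?B 0 r" by (simp only: sc_simps)
  have k: "?r k (?q x) = 0" if "k < d'" for k using Vk[OF that] x zx that by blast
  have k': "?r k (sc (?q x)) = 0" if "k < d'" for k
   using chart.rreal[OF ch c that] k[OF that] by simp
  have "\<rho>' (?q x o Inl) (?q x o Inr) j = 0" for j
   using k[of j] bspec[OF RC c] by (cases "j < d'") (simp_all only: cspace_def mem_Collect_eq lessThan_iff simp_thms)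
  moreover have "\<rho>' (sc (?q x) o Inl) (sc (?q x) o Inr) j = 0" for j
   using k'[of j] bspec[OF RC c'] by (cases "j < d'") (simp_all only: cspace_def mem_Collect_eq lessThan_iff simp_thms)
  ultimately show ?thesis using a(1,2) b by (simp add: fun_eq_iff)
 qed
 show ?thesis unfolding Let_def
 proof (rule exI[of _ ?W], rule conjI[OF W(1)], rule conjI[OF W(2)], rule ballI, rule impI)
  fix x assume x: "x \<in> ?W \<inter> cspace ?A" and zx: "\<forall>k<d. \<rho> (x o Inl) (x o Inr) k = 0"
  show "?q x \<in> Q & sc (?q x) \<in> Q & ?q x \<in> cspace ?B & \<rho>' (?q x o Inl) (?q x o Inr) = 0 & \<rho>' (sc (?q x) o Inl) (sc (?q x) o Inr) = 0"
   by (rule *[OF IntD1[OF x] IntD2[OF x] zx])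
 qed
qed

theorem theorem1p1:
  fixes N d :: nat
    and M :: "nat cpoint set"
    and \<rho> :: "nat cpoint \<Rightarrow> nat cpoint \<Rightarrow> nat cpoint"
  assumes "generic_submanifold N d M \<rho>"
    and "finite_type N d M \<rho> 0"
  shows "\<exists>g h :: nat \<Rightarrow> complex \<Rightarrow> nat cpoint \<Rightarrow> nat cpoint.
    (\<forall>j\<in>{1..d}. holomorphic_family N (g j) \<and> ((\<lambda>lam. g j lam 0) \<longlongrightarrow> 0) (at 0)) \<and>
    (\<forall>j\<in>{1..d+1}. holomorphic_family N (h j) \<and> ((\<lambda>lam. h j lam 0) \<longlongrightarrow> 0) (at 0)) \<and>
    (\<forall>(N'::nat) (d'::nat) (M' :: nat cpoint set)
      (\<rho>' :: nat cpoint \<Rightarrow> nat cpoint \<Rightarrow> nat cpoint) (zt :: nat cpoint \<Rightarrow> nat cpoint).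
      generic_submanifold N' d' M' \<rho>' \<and> transversal_submersion N' \<rho>' zt \<longrightarrow>
      (\<exists>\<Phi> :: (nat \<times> (nat + nat)) cpoint \<Rightarrow> nat cpoint.
        holomorphic_germ_along (tuple_index (d+1) N') (conj_power (d+1) (segre_variety N' \<rho>' 0))
          {..<N'} \<Phi> 0 \<and>
        \<Phi> 0 = 0 \<and>
        (\<forall>H :: nat cpoint \<Rightarrow> nat cpoint.
          holomorphic_germ {..<N} {..<N'} H 0 \<and> H 0 = 0 \<and>
          (\<forall>\<^sub>F Z in nhds 0. Z \<in> M \<longrightarrow> H Z \<in> M') \<longrightarrow>
          (\<forall>\<^sub>F lam in at 0. \<forall>\<^sub>F Z in nhds 0. Z \<in> Cn N \<longrightarrow>
             H Z = \<Phi> (mk_tuple (d+1)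
                        (\<lambda>l. conj_map (zt \<circ> H) (h l lam Z))
                        (\<lambda>l. (zt \<circ> H) (if l = d+1 then Z else g l lam Z)))))))"
proof -
 obtain p where P: "segre_chain_family N d \<rho> p" using segre_chains[OF assms] ..
 have p1: "hmgerm (fam N) (dbl N) (%w. p l (w None) (w o Some)) (case_option lam 0)"
  if "l \<le> 2*d+2" "0 < cmod lam & cmod lam < 1" for l lam
  using P[unfolded segre_chain_family_def, THEN conjunct1] that by blast
 have p2: "((%lam. p l lam 0 a) \<longlongrightarrow> 0) (at 0)" if "l \<le> 2*d+2" "a \<in> dbl N" for l a
  using P[unfolded segre_chain_family_def, THEN conjunct2, THEN conjunct1] that by blast
 note p3 = P[unfolded segre_chain_family_def, THEN conjunct2, THEN conjunct2, THEN spec, THEN mp]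
 define g where "g j lam Z = p (2*j) lam Z o Inl" for j lam Z
 define h where "h j lam Z = p (2*j-1) lam Z o Inr" for j lam Z
 have part: "holomorphic_family N (%lam Z. p l lam Z o s) & ((%lam. p l lam 0 o s) \<longlongrightarrow> 0) (at 0)"
  if l: "l \<le> 2*d+2" and s: "s = Inl \<or> s = Inr" for l s
 proof
  have sI: "hmgerm (dbl N) {..<N} (%x. x o s) x" for x using s hmgerm_comp_sum by blast
  show "holomorphic_family N (%lam Z. p l lam Z o s)" unfolding holomorphic_family_def
  proof (intro allI impI)
   fix lam :: complex assume lam: "0 < cmod lam & cmod lam < 1"
   have aC: "case_option lam 0 \<in> cspace (fam N)" by (auto simp: cspace_def split: option.splits)
   have "hmgerm (fam N) {..<N} (%w. p l (w None) (w o Some) o s) (case_option lam 0)"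
    by (rule hmgerm_compose[where F="%x. x o s" and G="%w. p l (w None) (w o Some)", OF _ finite_lessThan sI p1[OF l lam] aC]) simp
   then show "holomorphic_germ (fam N) {..<N} (%w. p l (w None) (w o Some) o s) (case_option lam 0)"
    using holomorphic_germ_iff[of "fam N" "{..<N}"] by simp
  qed
  show "((%lam. p l lam 0 o s) \<longlongrightarrow> 0) (at 0)"
  proof (rule topological_tendstoI)
   fix U :: "nat cpoint set" assume U: "open U" "0 \<in> U"
   have o: "open ((%x. x o s) -` U)" by (rule open_vimage[OF U(1) continuous_comp_fun])
   have m: "0 \<in> (%x. x o s) -` U" using U(2) by (simp add: zero_comp)
   have "\<forall>\<^sub>F lam in at 0. \<forall>\<^sub>F Z in nhds 0. Z \<in> Cn N --> p l lam Z \<in> (%x. x o s) -` U"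
    by (rule family_close[OF p1[OF l] p2[OF l] o m])
   then show "\<forall>\<^sub>F lam in at 0. p l lam 0 o s \<in> U"
   proof eventually_elim
    case (elim lam)
    from eventually_nhds_x_imp_x[OF elim] show ?case by simp
   qed
  qed
 qed
 have G: "holomorphic_family N (g j) & ((%lam. g j lam 0) \<longlongrightarrow> 0) (at 0)" if "j \<in> {1..d}" for j
  using part[of "2*j" Inl] that unfolding g_def by simp
 have Hf: "holomorphic_family N (h j) & ((%lam. h j lam 0) \<longlongrightarrow> 0) (at 0)" if "j \<in> {1..d+1}" for j
 proof -
  have l: "2*j-1 \<le> 2*d+2" using that by auto
  show ?thesis unfolding h_def by (rule part[OF l]) simp
 qed
 have main: "\<exists>\<Phi> :: (nat \<times> (nat + nat)) cpoint => nat cpoint.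
    holomorphic_germ_along (tuple_index (d+1) N') (conj_power (d+1) (segre_variety N' \<rho>' 0)) {..<N'} \<Phi> 0 &
    \<Phi> 0 = 0 &
    (\<forall>H :: nat cpoint => nat cpoint.
     holomorphic_germ {..<N} {..<N'} H 0 & H 0 = 0 &
     (\<forall>\<^sub>F Z in nhds 0. Z \<in> M --> H Z \<in> M') -->
     (\<forall>\<^sub>F lam in at 0. \<forall>\<^sub>F Z in nhds 0. Z \<in> Cn N -->
       H Z = \<Phi> (mk_tuple (d+1)
            (%l. conj_map (zt o H) (h l lam Z))
            (%l. (zt o H) (if l = d+1 then Z else g l lam Z)))))"
  if gen': "generic_submanifold N' d' M' \<rho>'" and ts: "transversal_submersion N' \<rho>' zt" for N' d' M' \<rho>' zt
 proof -
  obtain Y Q where Y: "hmgerm (dbl N') {..<N'} Y 0" "Y 0 = 0" and Q: "open Q" "0 \<in> Q"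
   and YQ: "\<forall>q\<in>Q \<inter> cspace (dbl N'). \<rho>' (q o Inl) (q o Inr) = 0 --> q o Inl = Y (case_sum (zt (q o Inl)) (q o Inr))"
   using target_recovery[OF gen' ts] by (elim exE conjE) (rule that)
  define \<Phi> where "\<Phi> w = segre_rec Y w (d+1)" for w
  have "hmgerm (tuple_index (d+1) N') {..<N'} \<Phi> 0" and \<Phi>0: "\<Phi> 0 = 0"
   using segre_rec_germ[OF Y, of "d+1" "d+1"] unfolding \<Phi>_def by blast+
  then have "holomorphic_germ (tuple_index (d+1) N') {..<N'} \<Phi> 0"
   using holomorphic_germ_iff[of "tuple_index (d+1) N'" "{..<N'}" \<Phi> 0] by (simp add: tuple_index_def)
  then have along: "holomorphic_germ_along (tuple_index (d+1) N') (conj_power (d+1) (segre_variety N' \<rho>' 0)) {..<N'} \<Phi> 0"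
   unfolding holomorphic_germ_along_def by (intro exI[of _ \<Phi>]) simp
  have rec: "\<forall>\<^sub>F lam in at 0. \<forall>\<^sub>F Z in nhds 0. Z \<in> Cn N -->
       H Z = \<Phi> (mk_tuple (d+1)
            (%l. conj_map (zt o H) (h l lam Z))
            (%l. (zt o H) (if l = d+1 then Z else g l lam Z)))"
   if Hh: "holomorphic_germ {..<N} {..<N'} H 0" and H0: "H 0 = 0" and HM: "\<forall>\<^sub>F Z in nhds 0. Z \<in> M --> H Z \<in> M'" for H
  proof -
   have Hg: "hmgerm {..<N} {..<N'} H 0" using Hh holomorphic_germ_iff[of "{..<N}" "{..<N'}"] by simp
   let ?q = "%x. case_sum (H (x o Inl)) (conj_map H (x o Inr))"
   obtain W where W: "open W" "0 \<in> W" and WQ: "\<forall>x\<in>W \<inter> cspace (dbl N). (\<forall>k<d. \<rho> (x o Inl) (x o Inr) k = 0) -->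
    ?q x \<in> Q & sc (?q x) \<in> Q & ?q x \<in> cspace (dbl N') & \<rho>' (?q x o Inl) (?q x o Inr) = 0 & \<rho>' (sc (?q x) o Inl) (sc (?q x) o Inr) = 0"
    using complexified_inclusion[OF gen' Hg H0 HM assms(1) Q] unfolding Let_def by (elim exE conjE) (rule that)
   have Z1: "H (x o Inl) = Y (case_sum (zt (H (x o Inl))) (conj_map H (x o Inr)))"
    and Z2: "H (cconj (x o Inr)) = Y (case_sum (zt (H (cconj (x o Inr)))) (cconj (H (x o Inl))))"
    if "x \<in> W" "x \<in> cspace (dbl N)" "\<forall>k<d. \<rho> (x o Inl) (x o Inr) k = 0" for x
   proof -
    note q = mp[OF bspec[OF WQ IntI[OF that(1,2)]] that(3)]
    have "?q x o Inl = Y (case_sum (zt (?q x o Inl)) (?q x o Inr))" using YQ q by blast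
    then show "H (x o Inl) = Y (case_sum (zt (H (x o Inl))) (conj_map H (x o Inr)))" by simp
    have "sc (?q x) \<in> cspace (dbl N')" using q by simp
    then have "sc (?q x) o Inl = Y (case_sum (zt (sc (?q x) o Inl)) (sc (?q x) o Inr))" using YQ q by blast
    then show "H (cconj (x o Inr)) = Y (case_sum (zt (H (cconj (x o Inr)))) (cconj (H (x o Inl))))"
     by (simp add: sc_def conj_map_def)
   qed
   have "\<forall>\<^sub>F lam in at 0. \<forall>l\<in>{..2*d+2}. \<forall>\<^sub>F Z in nhds 0. Z \<in> Cn N --> p l lam Z \<in> W"
   proof (rule eventually_ball_finite, simp, rule)
    fix l assume "l \<in> {..2*d+2}"
    then have l: "l \<le> 2*d+2" by simp
    show "\<forall>\<^sub>F lam in at 0. \<forall>\<^sub>F Z in nhds 0. Z \<in> Cn N --> p l lam Z \<in> W"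
     by (rule family_close[OF p1[OF l] p2[OF l] W])
   qed
   moreover have "\<forall>\<^sub>F lam :: complex in at 0. 0 < cmod lam & cmod lam < 1"
    unfolding eventually_at by (intro exI[of _ 1]) simp
   ultimately show ?thesis
   proof eventually_elim
    case (elim lam)
    have "\<forall>\<^sub>F Z in nhds 0. \<forall>l\<in>{..2*d+2}. Z \<in> Cn N --> p l lam Z \<in> W"
     by (rule eventually_ball_finite[OF finite_atMost elim(1)])
    then show ?case using p3[OF elim(2)]
    proof eventually_elim
     case (elim Z)
     show ?case
     proof
      assume Z: "Z \<in> Cn N"
      let ?w = "mk_tuple (d+1) (%l. conj_map (zt o H) (h l lam Z)) (%l. (zt o H) (if l = d+1 then Z else g l lam Z))"
      let ?p = "%l. p l lam Z"
      have pp: "?p l \<in> W" "?p l \<in> cspace (dbl N)" "\<forall>k<d. \<rho> (?p l o Inl) (?p l o Inr) k = 0" if "l \<le> 2*d+2" for l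
       using elim Z that by auto
      have p0: "?p 0 = 0" and pend: "?p (2*d+2) o Inl = Z" using elim(2) Z by blast+
      have keep: "?p (2*j+1) o Inl = ?p (2*j) o Inl" "?p (2*j+2) o Inr = ?p (2*j+1) o Inr" if "j \<le> d" for j
       using elim(2) Z that by blast+
      have "l \<le> d+1 ==> segre_rec Y ?w l = H (?p (2*l) o Inl)" for l
      proof (induction l)
       case 0
       show ?case unfolding segre_rec.simps(1) mult_0_right p0 zero_comp H0 by (rule refl)
      next
       case (Suc l)
       then have l: "l \<le> d" "2*l+1 \<le> 2*d+2" "2*l+2 \<le> 2*d+2" by auto
       have IH: "segre_rec Y ?w l = H (?p (2*l+1) o Inl)" 
        unfolding keep(1)[OF l(1)] by (rule Suc.IH) (use l in simp)
       have e1: "(%i. cnj (?w (Suc l, Inl i))) = zt (H (cconj (?p (2*l+1) o Inr)))"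
        using l by (simp add: mk_tuple_def h_def conj_map_def fun_eq_iff)
       have e2: "(%i. ?w (Suc l, Inr i)) = zt (H (?p (2*l+2) o Inl))"
       proof (cases "l = d")
        case True
        then show ?thesis using pend by (simp add: mk_tuple_def)
       next
        case False
        then show ?thesis using l by (simp add: mk_tuple_def g_def)
       qed
       have "Y (case_sum (%i. cnj (?w (Suc l, Inl i))) (cconj (segre_rec Y ?w l))) = H (cconj (?p (2*l+1) o Inr))"
        unfolding e1 IH by (rule Z2[OF pp[OF l(2)], symmetric])
       then have "segre_rec Y ?w (Suc l) = Y (case_sum (zt (H (?p (2*l+2) o Inl))) (cconj (H (cconj (?p (2*l+1) o Inr)))))"
        unfolding segre_rec.simps e2 by (simp only:)
       also have "\<dots> = Y (case_sum (zt (H (?p (2*l+2) o Inl))) (conj_map H (?p (2*l+2) o Inr)))"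
        using keep(2)[OF l(1)] by (simp add: conj_map_def)
       also have "\<dots> = H (?p (2*l+2) o Inl)" by (rule Z1[OF pp[OF l(3)], symmetric])
       finally have r: "segre_rec Y ?w (Suc l) = H (?p (2*l+2) o Inl)" .
       have e: "2 * Suc l = 2*l+2" by simp
       show ?case unfolding e by (rule r)
      qed
      note ind = this
      have r: "segre_rec Y ?w (d+1) = H (?p (2*(d+1)) o Inl)" by (rule ind[OF order_refl])
      have e: "2*(d+1) = 2*d+2" by simp
      show "H Z = \<Phi> ?w" using r unfolding \<Phi>_def e pend by (rule sym)
     qed
    qed
   qed
  qed
  show ?thesis
   by (rule exI[of _ \<Phi>], rule conjI[OF along], rule conjI[OF \<Phi>0], rule allI, rule impI, elim conjE, rule rec)
 qed
 have c1: "\<forall>j\<in>{1..d}. holomorphic_family N (g j) & ((%lam. g j lam 0) \<longlongrightarrow> 0) (at 0)" by (rule ballI) (rule G)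
 have c2: "\<forall>j\<in>{1..d+1}. holomorphic_family N (h j) & ((%lam. h j lam 0) \<longlongrightarrow> 0) (at 0)" by (rule ballI) (rule Hf)
 show ?thesis
  by (rule exI[of _ g], rule exI[of _ h], rule conjI[OF c1], rule conjI[OF c2], intro allI impI, elim conjE, rule main)
qed

end
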